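(* Let $p\in(1,+\infty)$ and let $w\in L^1_{\rm loc}(\mathbb R^2)$ be a distributional solution of $$-\Delta w=[w]_+^p\ \text{ in }\mathbb R^2,\qquad \int_{\mathbb R^2}[w]_+^p\,dx\le C_0<+\infty.$$ Then $w\in C^2(\mathbb R^2)$ and $[w]_+\in L^\infty(\mathbb R^2)$. Moreover, denoting $$\beta_p\equiv\beta_p(w):=\frac1{2\pi}\int_{\mathbb R^2}[w]_+^p\,dx,$$ we have that: - either $\beta_p=0$, and then $w$ is a non-positive constant, - or $\beta_p>0$, and then $w$ is, up to a translation, radial and takes the form $$w(x)=\begin{cases}\dfrac{1}{R_p^{\frac{2}{p-1}}}\,\phi\Big(\dfrac{x}{R_p}\Big), & 0\le|x|\le R_p,\\[2mm] \dfrac{1}{R_p^{\frac{2}{p-1}}}\,\phi'(1)\log\Big(\dfrac{|x|}{R_p}\Big), & |x|>R_p,\end{cases}$$ where $R_p>0$ is uniquely defined in terms of $\beta_p$ by $$\beta_p=\frac1{2\pi}\frac{I_p}{R_p^{\frac{2}{p-1}}}=\frac{-\phi'(1)}{R_p^{\frac{2}{p-1}}}.$$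
   Context: $[t]_+=\max\{t,0\}$. $\phi$ is the unique solution of the Emden problem $-\Delta\phi=\phi^p$, $\phi>0$ in the unit disk $B_1(0)\subset\mathbb R^2$, $\phi=0$ on $\partial B_1(0)$; it is radial and radially decreasing, and $\phi'(1)<0$ denotes its radial derivative at $|x|=1$. $I_p=\int_{B_1(0)}\phi^p\,dx=-2\pi\phi'(1)$. *)

theory Defs
  imports "HOL-Analysis.Analysis"
begin

type_synonym plane = "real^2"

text \<open>Class \<open>C\<^sup>k\<close> on an \<^emph>\<open>open\<close> set: directional derivatives are taken in the ambient space.\<close>

primrec Ck_on :: "nat \<Rightarrow> (plane \<Rightarrow> real) \<Rightarrow> plane set \<Rightarrow> bool" where
  "Ck_on 0 f S \<longleftrightarrow> continuous_on S f"
| "Ck_on (Suc k) f S \<longleftrightarrow>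
     f differentiable_on S \<and> (\<forall>v. Ck_on k (\<lambda>x. frechet_derivative f (at x) v) S)"

definition laplacian :: "(plane \<Rightarrow> real) \<Rightarrow> plane \<Rightarrow> real" where
  "laplacian f x =
     (\<Sum>e\<in>Basis. frechet_derivative (\<lambda>y. frechet_derivative f (at y) e) (at x) e)"

definition test_function :: "(plane \<Rightarrow> real) \<Rightarrow> bool" where
  "test_function \<psi> \<longleftrightarrow> (\<forall>k. Ck_on k \<psi> UNIV) \<and> compact (closure {x. \<psi> x \<noteq> 0})"

definition locally_integrable :: "(plane \<Rightarrow> real) \<Rightarrow> bool" where
  "locally_integrable w \<longleftrightarrow> (\<forall>K. compact K \<longrightarrow> w absolutely_integrable_on K)"

definition pos_part :: "real \<Rightarrow> real" where
  "pos_part t = max t 0"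

definition distributional_solution :: "real \<Rightarrow> (plane \<Rightarrow> real) \<Rightarrow> bool" where
  "distributional_solution p w \<longleftrightarrow>
     (\<forall>\<psi>. test_function \<psi> \<longrightarrow>
        - (LINT x|lebesgue. w x * laplacian \<psi> x)
          = (LINT x|lebesgue. pos_part (w x) powr p * \<psi> x))"

definition essentially_bounded :: "(plane \<Rightarrow> real) \<Rightarrow> bool" where
  "essentially_bounded g \<longleftrightarrow>
     g \<in> borel_measurable lebesgue \<and> (\<exists>M. AE x in lebesgue. \<bar>g x\<bar> \<le> M)"

text \<open>Classical solutions of the Emden problem on the unit disk; values of \<open>\<phi>\<close> outside the
  closed disk play no role.\<close>

definition emden_solution :: "real \<Rightarrow> (plane \<Rightarrow> real) \<Rightarrow> bool" where
  "emden_solution p \<phi> \<longleftrightarrow>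
     Ck_on 2 \<phi> (ball 0 1) \<and> continuous_on (cball 0 1) \<phi> \<and>
     (\<forall>x\<in>ball 0 1. - laplacian \<phi> x = \<phi> x powr p) \<and>
     (\<forall>x\<in>ball 0 1. \<phi> x > 0) \<and>
     (\<forall>x\<in>sphere 0 1. \<phi> x = 0)"

text \<open>The radial derivative \<open>\<phi>'(1)\<close>, as the one-sided derivative at \<open>r = 1\<close> along the ray
  through the first unit vector; the choice of ray is immaterial since \<open>\<phi>\<close> is radial.\<close>

definition radial_deriv1 :: "(plane \<Rightarrow> real) \<Rightarrow> real" where
  "radial_deriv1 \<phi> = vector_derivative (\<lambda>r. \<phi> (r *\<^sub>R axis 1 1)) (at 1 within {0..1})"

definition emden_mass :: "real \<Rightarrow> (plane \<Rightarrow> real) \<Rightarrow> real" where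
  "emden_mass p \<phi> = (LINT x:ball 0 1|lebesgue. \<phi> x powr p)"

definition beta :: "real \<Rightarrow> (plane \<Rightarrow> real) \<Rightarrow> real" where
  "beta p w = 1 / (2 * pi) * (LINT x|lebesgue. pos_part (w x) powr p)"

definition emden_profile :: "real \<Rightarrow> (plane \<Rightarrow> real) \<Rightarrow> real \<Rightarrow> plane \<Rightarrow> real" where
  "emden_profile p \<phi> R x =
     (if norm x \<le> R
      then 1 / R powr (2 / (p - 1)) * \<phi> (x /\<^sub>R R)
      else 1 / R powr (2 / (p - 1)) * radial_deriv1 \<phi> * ln (norm x / R))"

end

theory Submission
  imports Defs "HOL-Computational_Algebra.Polynomial"
begin

text \<open>Fix a kernel \<open>k\<close> with compact support and \<open>-\<Delta>k = \<delta>\<^sub>0 - \<rho>\<close>, where \<open>\<rho> \<ge> 0\<close> is a bump of mass one.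
  Then \<open>w = w * \<rho> + k * f\<close> almost everywhere for \<open>f = [w]\<^sub>+\<^sup>p\<close>. As \<open>w \<le> 1 + f\<close> and \<open>f\<close> is integrable, the
  first summand is bounded above, and \<open>k * f\<close> has all powers uniformly integrable over unit balls; hence
  \<open>f\<close> is bounded, and \<open>w\<close> is \<open>C\<^sup>1\<close> and then \<open>C\<^sup>2\<close>. Letting the radius of the support of \<open>k\<close> tend to
  infinity turns the identity into the logarithmic potential of \<open>f\<close> up to a constant. So \<open>w\<close> is constant
  if \<open>f = 0\<close>, and otherwise tends to \<open>-\<infinity>\<close>, which is what moving planes need at infinity. Moving planes make
  \<open>w\<close> radial about a point, and also make \<open>\<phi>\<close> radial. The radial equation with given value at the origin
  has one solution, so \<open>w\<close> is a rescaling of \<open>\<phi>\<close> on the disk where it is positive, and it is a multiple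
  of the logarithm outside; the flux through the boundary of that disk is the mass.\<close>

section \<open>Functions of class C1 and C2\<close>

text \<open>No boundary integral occurs. Once its singularity is regularised, the kernel is
  \<open>C2\<close> on the whole plane and vanishes outside a disk, so integration by parts reduces
  to one fact: the gradient of a compactly supported \<open>C1\<close> function has integral zero.
  The averages of \<open>w\<close> over large disks have no a priori lower bound. What replaces one
  is the upper bound \<open>M\<close>: since \<open>M - u\<close> is nonnegative, the oscillation of
  its averages at scale \<open>R\<close> is controlled by an average at scale \<open>3 * R\<close>,
  which Green's formula expresses through \<open>f\<close> again. The obstacle to moving planes is
  that \<open>u\<close> itself does not vanish at infinity, so the difference between
  \<open>u\<close> and its reflection is not obviously small there. Decay makes the support of
  \<open>f\<close> bounded, and the logarithmic potential then bounds this difference below by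
  \<open>- \<epsilon>\<close> far away. Hence its quotient by a bounded barrier attains a negative
  minimum if it is negative anywhere. As the nonlinearity vanishes for \<open>u \<le> 0\<close>,
  planes can be moved by controlling only the bounded set where \<open>u > 0\<close>.\<close>

definition C1_on :: "plane set \<Rightarrow> (plane \<Rightarrow> real) \<Rightarrow> (plane \<Rightarrow> plane) \<Rightarrow> bool" where
  "C1_on S u G \<longleftrightarrow> (\<forall>x\<in>S. (u has_derivative (\<lambda>h. G x \<bullet> h)) (at x)) \<and> continuous_on S G"

text \<open>\<open>H e\<close> is the gradient of the partial derivative in direction
  \<open>e\<close>, so the Laplacian is the sum of the \<open>H e x \<bullet> e\<close>. The
  derivatives are explicit arguments so that those of a convolution can be named as
  convolutions.\<close>

definition C2_on ::
  "plane set \<Rightarrow> (plane \<Rightarrow> real) \<Rightarrow> (plane \<Rightarrow> plane) \<Rightarrow> (plane \<Rightarrow> plane \<Rightarrow> plane) \<Rightarrow> bool" where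
  "C2_on S u G H \<longleftrightarrow> C1_on S u G \<and> (\<forall>e\<in>Basis. C1_on S (\<lambda>x. G x \<bullet> e) (H e))"

abbreviation smooth :: "(plane \<Rightarrow> real) \<Rightarrow> bool" where
  "smooth f \<equiv> \<forall>k. Ck_on k f UNIV"

lemma C1_on_deriv: "C1_on S u G \<Longrightarrow> x \<in> S \<Longrightarrow> (u has_derivative (\<lambda>h. G x \<bullet> h)) (at x)"
  by (simp add: C1_on_def)

lemma C1_on_continuous_grad: "C1_on S u G \<Longrightarrow> continuous_on S G"
  by (simp add: C1_on_def)

lemma C1_on_continuous: "C1_on S u G \<Longrightarrow> continuous_on S u"
  unfolding C1_on_def
  by (meson continuous_at_imp_continuous_on has_derivative_continuous)

lemma C1_on_subset: "C1_on S u G \<Longrightarrow> T \<subseteq> S \<Longrightarrow> C1_on T u G"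
  unfolding C1_on_def by (meson continuous_on_subset subsetD)

lemma C2_on_subset: "C2_on S u G H \<Longrightarrow> T \<subseteq> S \<Longrightarrow> C2_on T u G H"
  unfolding C2_on_def by (meson C1_on_subset)

lemma C2_on_C1: "C2_on S u G H \<Longrightarrow> C1_on S u G"
  by (simp add: C2_on_def)

lemma C2_on_C1_grad: "C2_on S u G H \<Longrightarrow> e \<in> Basis \<Longrightarrow> C1_on S (\<lambda>x. G x \<bullet> e) (H e)"
  by (simp add: C2_on_def)

lemma C1_on_transform:
  assumes "C1_on S u G" "open S" "\<And>x. x \<in> S \<Longrightarrow> v x = u x"
  shows "C1_on S v G"
  unfolding C1_on_def
proof (intro conjI ballI)
  fix x assume "x \<in> S"
  with assms show "(v has_derivative (\<lambda>h. G x \<bullet> h)) (at x)"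
    by (intro has_derivative_transform_within_open[of u _ x UNIV S v])
       (auto simp: C1_on_def)
qed (use assms in \<open>auto simp: C1_on_def\<close>)

lemma C2_on_transform:
  assumes "C2_on S u G H" "open S" "\<And>x. x \<in> S \<Longrightarrow> v x = u x"
  shows "C2_on S v G H"
  using assms C1_on_transform unfolding C2_on_def by blast

lemma frechet_derivative_C1_on:
  assumes "C1_on S u G" "x \<in> S"
  shows "frechet_derivative u (at x) = (\<lambda>h. G x \<bullet> h)"
  using assms frechet_derivative_at unfolding C1_on_def by metis

lemma C1_on_of_frechet:
  assumes "open S" "u differentiable_on S"
    and "\<And>e. e \<in> Basis \<Longrightarrow> continuous_on S (\<lambda>x. frechet_derivative u (at x) e)"
  shows "C1_on S u (\<lambda>x. \<Sum>e\<in>Basis. frechet_derivative u (at x) e *\<^sub>R e)"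
proof -
  have "(u has_derivative (\<lambda>h. (\<Sum>e\<in>Basis. frechet_derivative u (at x) e *\<^sub>R e) \<bullet> h)) (at x)"
    if x: "x \<in> S" for x
  proof -
    have "u differentiable at x"
      using assms x by (metis at_within_open differentiable_on_def)
    then have d: "(u has_derivative frechet_derivative u (at x)) (at x)"
      using frechet_derivative_works by blast
    have "frechet_derivative u (at x) h = (\<Sum>e\<in>Basis. frechet_derivative u (at x) e *\<^sub>R e) \<bullet> h"
      for h
    proof -
      interpret linear "frechet_derivative u (at x)"
        using d has_derivative_linear by blast
      have "frechet_derivative u (at x) h = frechet_derivative u (at x) (\<Sum>e\<in>Basis. (h \<bullet> e) *\<^sub>R e)"
        by (simp add: euclidean_representation)
      also have "\<dots> = (\<Sum>e\<in>Basis. frechet_derivative u (at x) e *\<^sub>R e) \<bullet> h"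
        by (simp add: sum scale inner_sum_left inner_sum_right inner_commute mult.commute)
      finally show ?thesis .
    qed
    then have "frechet_derivative u (at x) = (\<lambda>h. (\<Sum>e\<in>Basis. frechet_derivative u (at x) e *\<^sub>R e) \<bullet> h)"
      by (rule ext)
    with d show ?thesis by metis
  qed
  moreover have "continuous_on S (\<lambda>x. \<Sum>e\<in>Basis. frechet_derivative u (at x) e *\<^sub>R e)"
    using assms(3) by (intro continuous_intros) auto
  ultimately show ?thesis by (simp add: C1_on_def)
qed

lemma Ck_on_cong:
  assumes "open S" "\<And>x. x \<in> S \<Longrightarrow> f x = g x"
  shows "Ck_on k f S \<longleftrightarrow> Ck_on k g S"
  using assms(2)
proof (induction k arbitrary: f g)
  case 0
  then show ?case by (simp cong: continuous_on_cong)
next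
  case (Suc k)
  have hd: "(f has_derivative D) (at x) \<longleftrightarrow> (g has_derivative D) (at x)" if "x \<in> S" for x D
    using Suc.prems assms(1) that has_derivative_transform_within_open[of f D x UNIV S g]
      has_derivative_transform_within_open[of g D x UNIV S f] by auto
  \<comment> \<open>\<open>frechet_derivative\<close> is a choice among all derivatives at the
    point, so it is transferred by showing that both functions have the same derivatives
    there.\<close>
  then have fd: "frechet_derivative f (at x) = frechet_derivative g (at x)" if "x \<in> S" for x
    using that by (simp add: frechet_derivative_def)
  have "f differentiable_on S \<longleftrightarrow> g differentiable_on S"
    using hd by (auto simp: differentiable_on_eq_differentiable_at[OF assms(1)] differentiable_def)
  moreover have "Ck_on k (\<lambda>x. frechet_derivative f (at x) v) S \<longleftrightarrow>
      Ck_on k (\<lambda>x. frechet_derivative g (at x) v) S" for v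
    by (rule Suc.IH) (simp add: fd)
  ultimately show ?case by simp
qed

lemma Ck_on_Suc_D: "Ck_on (Suc k) f S \<Longrightarrow> Ck_on k f S"
proof (induction k arbitrary: f)
  case 0
  then show ?case by (auto intro: differentiable_imp_continuous_on)
next
  case (Suc k)
  then show ?case by (metis Ck_on.simps(2))
qed

lemma Ck_on_Suc_derivI:
  assumes "open S" "\<And>x. x \<in> S \<Longrightarrow> (f has_derivative D x) (at x)"
    and "\<And>v. Ck_on k (\<lambda>x. D x v) S"
  shows "Ck_on (Suc k) f S"
proof -
  have "frechet_derivative f (at x) = D x" if "x \<in> S" for x
    using assms(2)[OF that] frechet_derivative_at by metis
  moreover have "f differentiable_on S"
    using assms(2) by (meson differentiable_at_imp_differentiable_on differentiable_def)
  ultimately show ?thesis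
    using assms(3) Ck_on_cong[OF assms(1), of "\<lambda>x. D x v" "\<lambda>x. frechet_derivative f (at x) v" for v]
    by simp
qed

lemma Ck_on_has_derivative:
  assumes "open S" "Ck_on (Suc k) f S" "x \<in> S"
  shows "(f has_derivative frechet_derivative f (at x)) (at x)"
  using assms by (metis Ck_on.simps(2) at_within_open differentiable_on_def frechet_derivative_works)

lemma Ck_on_const: "open S \<Longrightarrow> Ck_on k (\<lambda>x. c) S"
proof (induction k arbitrary: c)
  case (Suc k)
  then show ?case
    by (intro Ck_on_Suc_derivI[where D="\<lambda>x v. 0"]) auto
qed auto

lemma Ck_on_add:
  assumes "open S" "Ck_on k f S" "Ck_on k g S"
  shows "Ck_on k (\<lambda>x. f x + g x) S"
  using assms(2,3)
proof (induction k arbitrary: f g)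
  case 0
  then show ?case by (simp add: continuous_on_add continuous_on_mult)
next
  case (Suc k)
  show ?case
  proof (rule Ck_on_Suc_derivI[OF assms(1)])
    show "((\<lambda>x. f x + g x) has_derivative
       (\<lambda>v. frechet_derivative f (at x) v + frechet_derivative g (at x) v)) (at x)" if "x \<in> S" for x
      using Ck_on_has_derivative[OF assms(1)] Suc.prems that by (intro has_derivative_add) auto
  qed (use Suc in auto)
qed

lemma Ck_on_mult:
  assumes "open S" "Ck_on k f S" "Ck_on k g S"
  shows "Ck_on k (\<lambda>x. f x * g x) S"
  using assms(2,3)
proof (induction k arbitrary: f g)
  case 0
  then show ?case by (simp add: continuous_on_add continuous_on_mult)
next
  case (Suc k)
  show ?case
  proof (rule Ck_on_Suc_derivI[OF assms(1)])
    show "((\<lambda>x. f x * g x) has_derivative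
       (\<lambda>v. f x * frechet_derivative g (at x) v + frechet_derivative f (at x) v * g x)) (at x)"
      if "x \<in> S" for x
      using Ck_on_has_derivative[OF assms(1)] Suc.prems that by (intro has_derivative_mult) auto
    show "Ck_on k (\<lambda>x. f x * frechet_derivative g (at x) v + frechet_derivative f (at x) v * g x) S" for v
      using Suc Ck_on_Suc_D[OF Suc.prems(1)] Ck_on_Suc_D[OF Suc.prems(2)]
      by (intro Ck_on_add assms(1) Suc.IH) auto
  qed
qed

lemma Ck_on_prod:
  assumes "open S" "finite I" "\<And>i. i \<in> I \<Longrightarrow> Ck_on k (f i) S"
  shows "Ck_on k (\<lambda>x. \<Prod>i\<in>I. f i x) S"
  using assms(2,3)
  by (induction I) (auto intro: Ck_on_const Ck_on_mult assms(1))

lemma Ck_on_affine: "open S \<Longrightarrow> Ck_on k (\<lambda>x. a \<bullet> x + c) S"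
proof (cases k)
  case (Suc j)
  assume "open S"
  then show ?thesis unfolding Suc
    by (intro Ck_on_Suc_derivI[where D="\<lambda>x v. a \<bullet> v"] Ck_on_const) (auto intro!: derivative_eq_intros)
qed (auto intro!: continuous_intros)

text \<open>The whole sequence \<open>h\<close> of successive derivatives is the parameter, so that
  the induction on the order can pass from \<open>h n\<close> to \<open>h (Suc n)\<close>.\<close>

lemma Ck_on_compose_real:
  fixes h :: "nat \<Rightarrow> real \<Rightarrow> real"
  assumes "open S" "\<And>n t. (h n has_real_derivative h (Suc n) t) (at t)"
    and "\<And>k. Ck_on k q S"
  shows "Ck_on k (\<lambda>x. h n (q x)) S"
proof (induction k arbitrary: n)
  case 0
  have "continuous_on UNIV (h n)"
    using assms(2) by (meson DERIV_continuous continuous_at_imp_continuous_on)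
  moreover have "continuous_on S q" using assms(3)[of 0] by simp
  ultimately show ?case by (simp add: continuous_on_compose2[of UNIV])
next
  case (Suc k)
  show ?case
  proof (rule Ck_on_Suc_derivI[OF assms(1)])
    show "((\<lambda>x. h n (q x)) has_derivative (\<lambda>v. h (Suc n) (q x) * frechet_derivative q (at x) v)) (at x)"
      if "x \<in> S" for x
      by (rule has_derivative_compose[OF Ck_on_has_derivative[OF assms(1) assms(3)[of "Suc 0"] that]
          has_field_derivative_imp_has_derivative[OF assms(2)]])
    show "Ck_on k (\<lambda>x. h (Suc n) (q x) * frechet_derivative q (at x) v) S" for v
      using assms(3)[of "Suc k"] by (intro Ck_on_mult assms(1) Suc.IH) auto
  qed
qed

lemma Ck_on_2_imp_C2_on:
  assumes "open S" "Ck_on 2 u S"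
  obtains G H where "C2_on S u G H"
proof -
  let ?d = "\<lambda>f e x. frechet_derivative f (at x) e"
  have k: "u differentiable_on S" "?d u e differentiable_on S" "continuous_on S (?d (?d u e) v)" for e v
    using assms(2) by (auto simp: numeral_2_eq_2)
  have 1: "C1_on S u (\<lambda>x. \<Sum>e\<in>Basis. ?d u e x *\<^sub>R e)"
    by (intro C1_on_of_frechet assms k differentiable_imp_continuous_on)
  have 2: "C1_on S (?d u e) (\<lambda>x. \<Sum>b\<in>Basis. ?d (?d u e) b x *\<^sub>R b)" for e
    by (intro C1_on_of_frechet assms k differentiable_imp_continuous_on)
  have "(\<Sum>b\<in>Basis. ?d u b x *\<^sub>R b) \<bullet> e = ?d u e x" if "e \<in> Basis" for e x
    using that by (simp add: inner_sum_left inner_Basis if_distrib if_distribR sum.delta cong: if_cong)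
  then have "C1_on S (\<lambda>x. (\<Sum>b\<in>Basis. ?d u b x *\<^sub>R b) \<bullet> e) (\<lambda>x. \<Sum>b\<in>Basis. ?d (?d u e) b x *\<^sub>R b)"
    if "e \<in> Basis" for e
    using that by (intro C1_on_transform[OF 2[of e] assms(1)])
  with 1 show ?thesis
    by (intro that[of "\<lambda>x. \<Sum>e\<in>Basis. ?d u e x *\<^sub>R e" "\<lambda>e x. \<Sum>b\<in>Basis. ?d (?d u e) b x *\<^sub>R b"])
       (auto simp: C2_on_def)
qed

text \<open>Passes from basis directions to arbitrary ones by linearity; an affine change of
  variables produces derivatives in the directions \<open>A e\<close>.\<close>

lemma C1_on_grad_inner:
  assumes "\<forall>e\<in>Basis. C1_on S (\<lambda>x. G x \<bullet> e) (H e)"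
  shows "C1_on S (\<lambda>x. G x \<bullet> v) (\<lambda>x. \<Sum>e\<in>Basis. (v \<bullet> e) *\<^sub>R H e x)"
proof -
  have "C1_on S (\<lambda>x. \<Sum>e\<in>Basis. (v \<bullet> e) * (G x \<bullet> e)) (\<lambda>x. \<Sum>e\<in>Basis. (v \<bullet> e) *\<^sub>R H e x)"
    unfolding C1_on_def inner_sum_left inner_scaleR_left using assms
    by (auto simp: C1_on_def
          intro!: continuous_on_sum continuous_on_scaleR continuous_on_const has_derivative_sum has_derivative_mult_right)
  moreover have "(\<Sum>e\<in>Basis. (v \<bullet> e) * (G x \<bullet> e)) = G x \<bullet> v" for x
    by (subst (3) euclidean_inner) (simp add: mult.commute)
  ultimately show ?thesis by simp
qed

lemma C2_on_imp_Ck_on: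
  assumes "open S" "C2_on S u G H"
  shows "Ck_on 2 u S"
proof -
  have "Ck_on 1 (\<lambda>x. G x \<bullet> v) S" for v
    unfolding One_nat_def
  proof (rule Ck_on_Suc_derivI[OF assms(1)])
    show "((\<lambda>x. G x \<bullet> v) has_derivative (\<lambda>h. (\<Sum>e\<in>Basis. (v \<bullet> e) *\<^sub>R H e x) \<bullet> h)) (at x)" if "x \<in> S" for x
      using C1_on_grad_inner[of S G H v] assms(2) that by (auto simp: C2_on_def C1_on_def)
    show "Ck_on 0 (\<lambda>x. (\<Sum>e\<in>Basis. (v \<bullet> e) *\<^sub>R H e x) \<bullet> w) S" for w
      using assms(2) by (auto simp: C2_on_def C1_on_def intro!: continuous_intros)
  qed
  then have "Ck_on (Suc 1) u S"
    using assms by (intro Ck_on_Suc_derivI[of S u "\<lambda>x h. G x \<bullet> h"]) (auto simp: C2_on_def C1_on_def)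
  then show ?thesis by (simp add: numeral_2_eq_2)
qed

lemma laplacian_C2_on:
  assumes "open S" "C2_on S u G H" "x \<in> S"
  shows "laplacian u x = (\<Sum>e\<in>Basis. H e x \<bullet> e)"
  unfolding laplacian_def
proof (rule sum.cong[OF refl])
  fix e :: plane assume e: "e \<in> Basis"
  have "C1_on S (\<lambda>y. frechet_derivative u (at y) e) (H e)"
    using frechet_derivative_C1_on[OF C2_on_C1[OF assms(2)]]
    by (intro C1_on_transform[OF C2_on_C1_grad[OF assms(2) e] assms(1)]) simp
  from frechet_derivative_C1_on[OF this assms(3)]
  show "frechet_derivative (\<lambda>y. frechet_derivative u (at y) e) (at x) e = H e x \<bullet> e"
    by simp
qed

lemma smooth_C2_on:
  assumes "smooth u" obtains G H where "C2_on UNIV u G H"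
  using Ck_on_2_imp_C2_on assms by blast

section \<open>Convolution\<close>

fun bump_poly :: "nat \<Rightarrow> real poly" where
  "bump_poly 0 = 1"
| "bump_poly (Suc n) = [:0, 0, 1:] * (bump_poly n - pderiv (bump_poly n))"

text \<open>\<open>bump n\<close> is the \<open>n\<close>-th derivative of the function that is
  \<open>exp (- 1 / t)\<close> for \<open>t > 0\<close> and 0 elsewhere. The recursion of
  \<open>bump_poly\<close> is the product rule for \<open>q (1 / t) * exp (- 1 / t)\<close>, whose
  derivative has the polynomial factor \<open>X^2 * (q - q')\<close> in
  \<open>1 / t\<close>.\<close>

definition bump :: "nat \<Rightarrow> real \<Rightarrow> real" where
  "bump n t = (if t \<le> 0 then 0 else poly (bump_poly n) (inverse t) * exp (- inverse t))"

lemma poly_div_exp_tendsto_0: "((\<lambda>x::real. poly q x * exp (- x)) \<longlongrightarrow> 0) at_top"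
proof -
  have "((\<lambda>x::real. \<Sum>i\<le>degree q. coeff q i * (x ^ i / exp x)) \<longlongrightarrow> (\<Sum>i\<le>degree q. coeff q i * 0)) at_top"
    by (intro tendsto_intros tendsto_power_div_exp_0)
  then show ?thesis
    by (simp add: poly_altdef exp_minus sum_divide_distrib sum_distrib_right field_simps)
qed

lemma bump_has_derivative: "(bump n has_real_derivative bump (Suc n) t) (at t)"
proof -
  consider "t < 0" | "t > 0" | "t = 0" by linarith
  then show ?thesis
  proof cases
    case 1
    have "((\<lambda>t. 0) has_real_derivative 0) (at t)" by simp
    then show ?thesis
      using 1 has_field_derivative_transform_within_open[of "\<lambda>t. 0" 0 t "{..<0}" "bump n"]
      by (simp add: bump_def)
  next
    case 2
    have "((\<lambda>t. poly (bump_poly n) (inverse t) * exp (- inverse t)) has_real_derivative bump (Suc n) t) (at t)"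
      using 2 by (auto intro!: derivative_eq_intros DERIV_chain2[OF poly_DERIV] simp: bump_def field_simps power2_eq_square)
    then show ?thesis
      using 2 has_field_derivative_transform_within_open[of _ _ t "{0<..}" "bump n"]
      by (simp add: bump_def)
  next
    case 3
    \<comment> \<open>The difference quotient at 0 contributes one more factor \<open>1 / x\<close>,
      which is absorbed into the polynomial.\<close>
    have "((\<lambda>x::real. poly ([:0,1:] * bump_poly n) (inverse x) * exp (- inverse x)) \<longlongrightarrow> 0) (at_right 0)"
      using filterlim_compose[OF poly_div_exp_tendsto_0 filterlim_inverse_at_top_right] .
    then have "((\<lambda>x. bump n x / x) \<longlongrightarrow> 0) (at_right 0)"
      by (rule Lim_transform_eventually)
         (auto simp: eventually_at_right_field bump_def field_simps intro!: exI[of _ 1])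
    moreover have "((\<lambda>x. bump n x / x) \<longlongrightarrow> 0) (at_left 0)"
      by (rule Lim_transform_eventually[of "\<lambda>_. 0"])
         (auto simp: eventually_at_left_field bump_def intro!: exI[of _ "-1"])
    ultimately have "((\<lambda>x. bump n x / x) \<longlongrightarrow> 0) (at 0)"
      using filterlim_split_at by blast
    then show ?thesis
      using 3 by (simp add: has_field_derivative_iff bump_def)
  qed
qed

lemma bump_0: "bump 0 t = (if t \<le> 0 then 0 else exp (- inverse t))"
  by (simp add: bump_def)

text \<open>Uniform continuity of the gradient on a unit neighbourhood of \<open>K\<close> makes the
  error of the linear approximation uniform over \<open>K\<close>. This uniformity lets difference
  quotients pass under a convolution integral.\<close>

lemma C1_uniform_expansion:
  assumes "C1_on UNIV b G" "compact K" "\<epsilon> > 0"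
  obtains \<delta> where "\<delta> > 0"
    "\<And>x h. x \<in> K \<Longrightarrow> norm h < \<delta> \<Longrightarrow> \<bar>b (x + h) - b x - G x \<bullet> h\<bar> \<le> \<epsilon> * norm h"
proof -
  define K' where "K' = {x + y |x y. x \<in> K \<and> y \<in> cball (0::plane) 1}"
  have "compact K'" unfolding K'_def by (intro compact_sums assms compact_cball)
  moreover have "continuous_on K' G"
    using assms(1) C1_on_continuous_grad continuous_on_subset by blast
  ultimately have "uniformly_continuous_on K' G" by (rule compact_uniformly_continuous[rotated])
  then obtain d where d: "d > 0" "\<And>x x'. x \<in> K' \<Longrightarrow> x' \<in> K' \<Longrightarrow> dist x' x < d \<Longrightarrow> dist (G x') (G x) < \<epsilon>"
    unfolding uniformly_continuous_on_def using assms(3) by meson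
  show ?thesis
  proof (rule that[of "min 1 d"])
    fix x h :: plane assume x: "x \<in> K" and h: "norm h < min 1 d"
    \<comment> \<open>The mean value inequality is applied to \<open>b\<close> minus its linear part
      at \<open>x\<close>, whose gradient \<open>G z - G x\<close> is small.\<close>
    have "\<bar>(b (x + h) - G x \<bullet> (x + h)) - (b x - G x \<bullet> x)\<bar> \<le> \<epsilon> * norm ((x + h) - x)"
      unfolding real_norm_def[symmetric]
    proof (rule differentiable_bound[where S="cball x (norm h)"])
      fix z assume z: "z \<in> cball x (norm h)"
      show "((\<lambda>z. b z - G x \<bullet> z) has_derivative (\<lambda>v. (G z - G x) \<bullet> v)) (at z within cball x (norm h))"
        using assms(1) by (auto intro!: derivative_eq_intros has_derivative_at_withinI[OF C1_on_deriv] simp: inner_diff_left)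
      have "z = x + (z - x)" "x = x + 0" "z - x \<in> cball 0 1"
        using z h by (auto simp: dist_norm norm_minus_commute)
      then have "z \<in> K'" "x \<in> K'" using x unfolding K'_def
        by (blast, metis (mono_tags, lifting) centre_in_cball mem_Collect_eq zero_le_one)
      then have "dist (G z) (G x) < \<epsilon>"
        using z h by (intro d) (auto simp: dist_commute)
      then have "norm (G z - G x) \<le> \<epsilon>" by (simp add: dist_norm)
      then have "norm ((G z - G x) \<bullet> v) \<le> \<epsilon> * norm v" for v
        by (metis Cauchy_Schwarz_ineq2 mult_right_mono norm_ge_zero order_trans real_norm_def)
      then show "onorm ((\<bullet>) (G z - G x)) \<le> \<epsilon>"
        by (intro onorm_bound) (use assms in auto)
    qed (auto simp: dist_norm)
    then show "\<bar>b (x + h) - b x - G x \<bullet> h\<bar> \<le> \<epsilon> * norm h"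
      by (simp add: inner_add_right algebra_simps)
  qed (use d in auto)
qed

section \<open>Differentiation under the convolution integral\<close>

definition loc_int :: "(plane \<Rightarrow> real) \<Rightarrow> bool" where
  "loc_int a \<longleftrightarrow> a \<in> borel_measurable borel \<and> (\<forall>R. integrable lborel (\<lambda>y. indicator (cball 0 R) y * a y))"

text \<open>The second factor may be vector valued because the gradient of \<open>conv a b\<close>
  is \<open>conv a G\<close> with \<open>G\<close> the gradient of \<open>b\<close>.\<close>

definition conv :: "(plane \<Rightarrow> real) \<Rightarrow> (plane \<Rightarrow> 'b::euclidean_space) \<Rightarrow> plane \<Rightarrow> 'b" where
  "conv a b x = (LINT y|lborel. a y *\<^sub>R b (x - y))"

lemma conv_integrable:
  fixes b :: "plane \<Rightarrow> 'b::euclidean_space"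
  assumes a: "loc_int a" and b: "continuous_on UNIV b"
    and supp: "\<And>y. norm y > R \<Longrightarrow> a y = 0 \<or> b (x - y) = 0"
  shows "integrable lborel (\<lambda>y. a y *\<^sub>R b (x - y))"
proof -
  have "compact ((\<lambda>y. b (x - y)) ` cball 0 R)"
    by (intro compact_continuous_image continuous_on_compose2[OF b] continuous_intros) auto
  then obtain M where M: "\<And>y. y \<in> cball 0 R \<Longrightarrow> norm (b (x - y)) \<le> M"
    unfolding image_def bounded_iff using compact_imp_bounded by (force simp: bounded_iff)
  have bm[measurable]: "b \<in> borel_measurable borel" using b by (simp add: borel_measurable_continuous_onI)
  have am[measurable]: "a \<in> borel_measurable borel" using a by (simp add: loc_int_def)
  have "integrable lborel (\<lambda>y. M * \<bar>indicator (cball 0 R) y * a y\<bar>)"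
    using a by (auto simp: loc_int_def)
  then show ?thesis
  proof (rule Bochner_Integration.integrable_bound)
    show "(\<lambda>y. a y *\<^sub>R b (x - y)) \<in> borel_measurable lborel"
      by measurable
    show "AE y in lborel. norm (a y *\<^sub>R b (x - y)) \<le> norm (M * \<bar>indicator (cball 0 R) y * a y\<bar>)"
    proof (rule AE_I2)
      fix y
      show "norm (a y *\<^sub>R b (x - y)) \<le> norm (M * \<bar>indicator (cball 0 R) y * a y\<bar>)"
      proof (cases "norm y \<le> R")
        case True
        then have "norm (b (x - y)) \<le> \<bar>M\<bar>" using M by force
        then show ?thesis using True by (simp add: abs_mult mult.commute[of "\<bar>M\<bar>"] mult_left_mono)
      qed (use supp[of y] in auto)
    qed
  qed
qed

text \<open>The support condition covers compact support of either factor: in both cases the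
  integrand at \<open>x\<close> vanishes for \<open>norm y > R + norm x\<close>.\<close>

lemma conv_continuous:
  fixes b :: "plane \<Rightarrow> 'b::euclidean_space"
  assumes a: "loc_int a" and b: "continuous_on UNIV b"
    and supp: "\<And>x y. norm y > R + norm x \<Longrightarrow> a y = 0 \<or> b (x - y) = 0"
  shows "continuous_on UNIV (conv a b)"
  unfolding continuous_on_iff
proof (intro ballI allI impI)
  fix x :: plane and e :: real assume "e > 0"
  \<comment> \<open>The extra 1 leaves room for all points within distance 1 of \<open>x\<close>, so
    one ball serves for every nearby integrand.\<close>
  define r where "r = R + norm x + 1"
  define A where "A = (LINT y|lborel. \<bar>indicator (cball 0 r) y * a y\<bar>)"
  have "A \<ge> 0" unfolding A_def by simp
  define \<epsilon> where "\<epsilon> = e / (A + 1)"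
  have \<epsilon>: "\<epsilon> > 0" "\<epsilon> * A < e" using \<open>A \<ge> 0\<close> \<open>e > 0\<close> by (auto simp: \<epsilon>_def field_simps)
  have "uniformly_continuous_on (cball 0 (norm x + 1 + r)) b"
    by (intro compact_uniformly_continuous compact_cball continuous_on_subset[OF b]) auto
  then obtain d where d: "d > 0" "\<And>z z'. norm z \<le> norm x + 1 + r \<Longrightarrow> norm z' \<le> norm x + 1 + r \<Longrightarrow>
      dist z' z < d \<Longrightarrow> dist (b z') (b z) < \<epsilon>"
    unfolding uniformly_continuous_on_def using \<epsilon>(1) by force
  show "\<exists>d>0. \<forall>x'\<in>UNIV. dist x' x < d \<longrightarrow> dist (conv a b x') (conv a b x) < e"
  proof (intro exI[of _ "min 1 d"] conjI ballI impI)
    fix x' assume x': "dist x' x < min 1 d"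
    then have nx': "norm x' \<le> norm x + 1"
      using norm_triangle_sub[of x' x] by (simp add: dist_norm)
    have s: "a y *\<^sub>R b (z - y) = 0" if "norm y > r" "norm z \<le> norm x + 1" for y z
      using supp[of z y] that by (auto simp: r_def)
    have i: "integrable lborel (\<lambda>y. a y *\<^sub>R b (z - y))" if "norm z \<le> norm x + 1" for z
      using s[OF _ that] by (intro conv_integrable[OF a b, of r]) auto
    have "norm (conv a b x' - conv a b x) = norm (LINT y|lborel. a y *\<^sub>R b (x' - y) - a y *\<^sub>R b (x - y))"
      unfolding conv_def using nx' by (subst Bochner_Integration.integral_diff) (auto intro: i)
    also have "\<dots> \<le> (LINT y|lborel. \<epsilon> * \<bar>indicator (cball 0 r) y * a y\<bar>)"
    proof (rule Bochner_Integration.integral_norm_bound_integral)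
      show "integrable lborel (\<lambda>y. a y *\<^sub>R b (x' - y) - a y *\<^sub>R b (x - y))"
        using nx' by (intro Bochner_Integration.integrable_diff i) auto
      show "integrable lborel (\<lambda>y. \<epsilon> * \<bar>indicator (cball 0 r) y * a y\<bar>)"
        using a by (auto simp: loc_int_def)
      fix y
      show "norm (a y *\<^sub>R b (x' - y) - a y *\<^sub>R b (x - y)) \<le> \<epsilon> * \<bar>indicator (cball 0 r) y * a y\<bar>"
      proof (cases "norm y \<le> r")
        case True
        have "dist (b (x' - y)) (b (x - y)) < \<epsilon>"
          using True nx' x' norm_triangle_ineq4[of x y] norm_triangle_ineq4[of x' y]
          by (intro d) (auto simp: dist_norm)
        then show ?thesis using True
          by (simp add: scaleR_diff_right[symmetric] dist_norm mult.commute[of \<epsilon>] mult_left_mono)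
      next
        case False
        then show ?thesis using s[of y x] s[of y x'] nx' by (simp del: scaleR_eq_0_iff)
      qed
    qed
    also have "\<dots> = \<epsilon> * A" by (simp add: A_def)
    finally show "dist (conv a b x') (conv a b x) < e" using \<epsilon>(2) by (simp add: dist_norm)
  qed (use d in auto)
qed

lemma conv_C1:
  assumes a: "loc_int a" and b: "C1_on UNIV b G"
    and supp: "\<And>x y. norm y > R + norm x \<Longrightarrow> a y = 0 \<or> b (x - y) = 0"
  shows "C1_on UNIV (conv a b) (conv a G)"
proof -
  have cb: "continuous_on UNIV b" and cG: "continuous_on UNIV G"
    using b C1_on_continuous C1_on_continuous_grad by auto
  \<comment> \<open>The support condition is strict in \<open>x\<close>, so if
    \<open>a y \<noteq> 0\<close> then \<open>b\<close> vanishes in a neighbourhood of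
    \<open>x - y\<close>, and with it the gradient.\<close>
  have suppG: "a y = 0 \<or> G (x - y) = 0" if "norm y > R + norm x" for x y
  proof (cases "a y = 0")
    case False
    have "(b has_derivative (\<lambda>h. G (x - y) \<bullet> h)) (at (x - y))" using b by (simp add: C1_on_def)
    moreover have "(b has_derivative (\<lambda>h. 0)) (at (x - y))"
    proof (rule has_derivative_transform_within_open[of "\<lambda>_. 0" _ _ UNIV "{z. norm (z + y) < norm y - R}"])
      show "open {z. norm (z + y) < norm y - R}" by (intro open_Collect_less continuous_intros)
      show "0 = b z" if "z \<in> {z. norm (z + y) < norm y - R}" for z
        using supp[of "z + y" y] that False by auto
    qed (use that in auto)
    ultimately have "G (x - y) \<bullet> h = 0" for h by (metis has_derivative_unique)
    then have "G (x - y) = 0" by (metis inner_eq_zero_iff)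
    then show ?thesis by simp
  qed auto
  have "(conv a b has_derivative (\<lambda>h. conv a G x \<bullet> h)) (at x)" for x
    unfolding has_derivative_at_alt
  proof (intro conjI allI impI bounded_linear_inner_right)
    fix e :: real assume "e > 0"
    define r where "r = R + norm x + 1"
    define A where "A = (LINT y|lborel. \<bar>indicator (cball 0 r) y * a y\<bar>)"
    have "A \<ge> 0" unfolding A_def by simp
    define \<epsilon> where "\<epsilon> = e / (A + 1)"
    have \<epsilon>: "\<epsilon> > 0" "\<epsilon> * A \<le> e" using \<open>A \<ge> 0\<close> \<open>e > 0\<close> by (auto simp: \<epsilon>_def field_simps)
    obtain d where d: "d > 0" "\<And>z h. z \<in> cball 0 (norm x + r) \<Longrightarrow> norm h < d \<Longrightarrow>
        \<bar>b (z + h) - b z - G z \<bullet> h\<bar> \<le> \<epsilon> * norm h"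
      using C1_uniform_expansion[OF b compact_cball \<epsilon>(1)] by blast
    show "\<exists>d>0. \<forall>x'. norm (x' - x) < d \<longrightarrow>
        norm (conv a b x' - conv a b x - conv a G x \<bullet> (x' - x)) \<le> e * norm (x' - x)"
    proof (intro exI[of _ "min 1 d"] conjI allI impI)
      fix x' assume x': "norm (x' - x) < min 1 d"
      then have nx': "norm x' \<le> norm x + 1"
        using norm_triangle_sub[of x' x] by simp
      have s: "a y = 0 \<or> b (z - y) = 0" if "norm y > r" "norm z \<le> norm x + 1" for y z
        using supp[of z y] that by (auto simp: r_def)
      have i: "integrable lborel (\<lambda>y. a y *\<^sub>R b (z - y))" if "norm z \<le> norm x + 1" for z
        using s[OF _ that] by (intro conv_integrable[OF a cb, of r]) auto
      have iG: "integrable lborel (\<lambda>y. a y *\<^sub>R G (x - y))"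
        using suppG[of x] by (intro conv_integrable[OF a cG, of r]) (auto simp: r_def)
      let ?E = "\<lambda>y. a y *\<^sub>R b (x' - y) - a y *\<^sub>R b (x - y) - (a y *\<^sub>R G (x - y)) \<bullet> (x' - x)"
      have iE: "integrable lborel ?E"
        using nx' by (intro Bochner_Integration.integrable_diff i integrable_inner_left iG) auto
      have "norm (conv a b x' - conv a b x - conv a G x \<bullet> (x' - x)) = norm (LINT y|lborel. ?E y)"
        unfolding conv_def using nx' iG i[of x] i[of x']
        by (simp only: Bochner_Integration.integral_diff Bochner_Integration.integrable_diff
              integrable_inner_left integral_inner_left[symmetric] le_add_same_cancel1 zero_le_one)
      also have "\<dots> \<le> (LINT y|lborel. \<epsilon> * norm (x' - x) * \<bar>indicator (cball 0 r) y * a y\<bar>)"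
      proof (rule Bochner_Integration.integral_norm_bound_integral[OF iE])
        show "integrable lborel (\<lambda>y. \<epsilon> * norm (x' - x) * \<bar>indicator (cball 0 r) y * a y\<bar>)"
          using a by (auto simp: loc_int_def)
        fix y
        show "norm (?E y) \<le> \<epsilon> * norm (x' - x) * \<bar>indicator (cball 0 r) y * a y\<bar>"
        proof (cases "norm y \<le> r")
          case True
          have "\<bar>b ((x - y) + (x' - x)) - b (x - y) - G (x - y) \<bullet> (x' - x)\<bar> \<le> \<epsilon> * norm (x' - x)"
            using True x' norm_triangle_ineq4[of x y] by (intro d) auto
          moreover have "?E y = a y * (b ((x - y) + (x' - x)) - b (x - y) - G (x - y) \<bullet> (x' - x))"
            by (simp add: algebra_simps)
          ultimately show ?thesis using True
            by (simp add: abs_mult mult.commute mult_left_mono)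
        next
          case False
          then have "a y = 0 \<or> (b (x' - y) = 0 \<and> b (x - y) = 0 \<and> G (x - y) = 0)"
            using s[of y x] s[of y x'] suppG[of x y] nx' by (auto simp: r_def)
          then show ?thesis using False by auto
        qed
      qed
      also have "\<dots> = \<epsilon> * A * norm (x' - x)" by (simp add: A_def)
      also have "\<dots> \<le> e * norm (x' - x)" using \<epsilon>(2) by (intro mult_right_mono) auto
      finally show "norm (conv a b x' - conv a b x - conv a G x \<bullet> (x' - x)) \<le> e * norm (x' - x)" .
    qed (use d in auto)
  qed
  then show ?thesis
    using conv_continuous[OF a cG suppG] by (simp add: C1_on_def)
qed

section \<open>Integration in the plane\<close>

lemma distr_lborel_reflect: "distr lborel borel (\<lambda>y. x - y) = (lborel :: plane measure)"
  using lborel_affine[of "-1" x] by (simp add: density_1)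

lemma nn_integral_reflect:
  fixes g :: "plane \<Rightarrow> ennreal"
  assumes [measurable]: "g \<in> borel_measurable borel"
  shows "(\<integral>\<^sup>+y. g (x - y) \<partial>lborel) = (\<integral>\<^sup>+y. g y \<partial>lborel)"
  by (subst (2) distr_lborel_reflect[of x, symmetric]) (simp add: nn_integral_distr)

lemma integral_reflect_plane:
  fixes g :: "plane \<Rightarrow> 'b::euclidean_space"
  assumes [measurable]: "g \<in> borel_measurable borel"
  shows "(LINT y|lborel. g (x - y)) = (LINT y|lborel. g y)"
  by (subst (2) distr_lborel_reflect[of x, symmetric]) (simp add: integral_distr)

lemma integrable_reflect_plane:
  fixes g :: "plane \<Rightarrow> 'b::euclidean_space"
  assumes "g \<in> borel_measurable borel"
  shows "integrable lborel (\<lambda>y. g (x - y)) \<longleftrightarrow> integrable lborel g"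
  by (subst (2) distr_lborel_reflect[of x, symmetric]) (simp add: integrable_distr_eq assms)

lemma integral_scale_plane:
  fixes g :: "plane \<Rightarrow> real"
  assumes [measurable]: "g \<in> borel_measurable borel" and "c > 0"
  shows "(LINT y|lborel. g y) = c\<^sup>2 * (LINT y|lborel. g (x + c *\<^sub>R y))"
  using assms(2) by (subst lborel_affine[of c x]) (auto simp: integral_density integral_distr)

text \<open>Polar coordinates for radial integrands: both measures give the half-line up to
  \<open>a \<ge> 0\<close> the mass \<open>pi * a^2\<close>, and half-lines form an
  intersection-stable generator.\<close>

lemma distr_lborel_norm:
  "distr lborel borel (norm :: plane \<Rightarrow> real) = density lborel (\<lambda>r. ennreal (2 * pi * r) * indicator {0..} r)"
    (is "?M = ?N")
proof (rule measure_eqI_generator_eq[where E="range (\<lambda>a::real. {..a})" and A="\<lambda>n. {..real n}" and \<Omega>=UNIV])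
  show "Int_stable (range (\<lambda>a::real. {..a}))"
    by (auto simp: Int_stable_def intro!: range_eqI[of _ _ "min _ _"])
  show "sets ?M = sigma_sets UNIV (range (\<lambda>a::real. {..a}))" "sets ?N = sigma_sets UNIV (range (\<lambda>a::real. {..a}))"
    by (simp_all add: borel_eq_atMost)
  show "(\<Union>i. {..real i}) = UNIV" using real_arch_simple by auto
  have M: "emeasure ?M {..a} = ennreal (pi * (max a 0)\<^sup>2)" for a
  proof (cases "a \<ge> 0")
    case True
    have "norm -` {..a} = cball (0::plane) a" by auto
    then show ?thesis using True emeasure_cball[of a "0::plane"] by (simp add: emeasure_distr unit_ball_vol_2)
  next
    case False
    then have "norm -` {..a} = ({}::plane set)" using norm_ge_zero order_trans by (auto, blast)
    then show ?thesis using False by (simp add: emeasure_distr)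
  qed
  then show "emeasure ?M {..real i} \<noteq> \<infinity>" for i by simp
  fix X assume "X \<in> range (\<lambda>a::real. {..a})"
  then obtain a where X: "X = {..a}" by auto
  \<comment> \<open>For \<open>a < 0\<close> the interval on the right still contains the point 0,
    where the density vanishes.\<close>
  have "ennreal (2 * pi * r) * indicator {0..} r * indicator {..a} r = ennreal (2 * pi * r) * indicator {0..max a 0} r" for r
    by (cases "r = 0") (auto simp: indicator_def max_def)
  then have "emeasure ?N {..a} = (\<integral>\<^sup>+r. ennreal (2 * pi * r) * indicator {0..max a 0} r \<partial>lborel)"
    by (simp add: emeasure_density)
  also have "\<dots> = ennreal (pi * (max a 0)\<^sup>2 - pi * 0\<^sup>2)"
    by (rule nn_integral_FTC_Icc) (auto intro!: derivative_eq_intros)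
  finally show "emeasure ?M X = emeasure ?N X" using M X by simp
qed auto

lemma nn_integral_radial:
  assumes [measurable]: "g \<in> borel_measurable borel"
  shows "(\<integral>\<^sup>+x. g (norm (x::plane)) \<partial>lborel) = (\<integral>\<^sup>+r. ennreal (2 * pi * r) * indicator {0..} r * g r \<partial>lborel)"
proof -
  have "(\<integral>\<^sup>+x. g (norm (x::plane)) \<partial>lborel) = (\<integral>\<^sup>+r. g r \<partial>distr lborel borel (norm :: plane \<Rightarrow> real))"
    by (simp add: nn_integral_distr)
  then show ?thesis unfolding distr_lborel_norm by (simp add: nn_integral_density)
qed

lemma C1_on_grad_eq_0:
  assumes "C1_on S f g" "open T" "\<And>y. y \<in> T \<Longrightarrow> f y = 0" "y \<in> S" "y \<in> T"
  shows "g y = 0"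
proof -
  have "((\<lambda>_. 0) has_derivative (\<lambda>h. 0)) (at y)" by simp
  then have "(f has_derivative (\<lambda>h. 0)) (at y)"
    by (rule has_derivative_transform_within_open[OF _ assms(2,5)]) (simp add: assms(3))
  then have "g y \<bullet> h = 0" for h
    using C1_on_deriv[OF assms(1,4)] by (metis has_derivative_unique)
  then show ?thesis by (metis inner_eq_zero_iff)
qed

text \<open>By translation invariance the convolution of the constant 1 with \<open>F\<close> is
  constant. Its gradient is the convolution of 1 with \<open>G\<close>, which is the integral of
  \<open>G\<close>. This is the divergence theorem in the form used here.\<close>

lemma integral_grad_eq_0:
  assumes F: "C1_on UNIV F G" and supp: "\<And>x. norm x > R \<Longrightarrow> F x = 0"
  shows "integrable lborel G" "(LINT x|lborel. G x) = 0"
proof -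
  have "open {z::plane. norm z > R}"
    by (intro open_Collect_less continuous_on_const continuous_on_norm continuous_on_id)
  then have G0: "G x = 0" if "norm x > R" for x
    by (rule C1_on_grad_eq_0[OF F]) (use supp that in auto)
  have cF: "continuous_on UNIV F" "continuous_on UNIV G"
    using F C1_on_continuous C1_on_continuous_grad by auto
  then have m: "F \<in> borel_measurable borel" "G \<in> borel_measurable borel"
    by (auto simp: borel_measurable_continuous_onI)
  have "integrable lborel (\<lambda>x. indicator (cball 0 R) x *\<^sub>R G x)"
    using cF continuous_on_subset by (intro borel_integrable_compact) auto
  also have "(\<lambda>x. indicator (cball 0 R) x *\<^sub>R G x) = G"
    using G0 by (auto simp: fun_eq_iff indicator_def)
  finally show iG: "integrable lborel G" .
  have "loc_int (\<lambda>y. 1)"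
    using borel_integrable_compact[of "cball 0 R" "\<lambda>_::plane. 1::real" for R]
    by (auto simp: loc_int_def)
  moreover have "\<And>x y. R + norm x < norm y \<Longrightarrow> (1::real) = 0 \<or> F (x - y) = 0"
    using supp norm_triangle_ineq3 by (metis add.commute add_less_imp_less_right less_le_trans
        norm_minus_commute norm_triangle_sub)
  ultimately have "C1_on UNIV (conv (\<lambda>y. 1) F) (conv (\<lambda>y. 1) G)"
    by (intro conv_C1[OF _ F]) auto
  moreover have "conv (\<lambda>y. 1) F = (\<lambda>x. LINT y|lborel. F y)" "conv (\<lambda>y. 1) G = (\<lambda>x. LINT y|lborel. G y)"
    unfolding conv_def using integral_reflect_plane m by auto
  ultimately have "((\<lambda>x::plane. LINT y|lborel. F y) has_derivative (\<lambda>h. (LINT y|lborel. G y) \<bullet> h)) (at 0)"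
    by (simp add: C1_on_def)
  moreover have "((\<lambda>x::plane. LINT y|lborel. F y) has_derivative (\<lambda>h. 0)) (at 0)" by simp
  ultimately have "(LINT y|lborel. G y) \<bullet> h = 0" for h by (metis has_derivative_unique)
  then show "(LINT x|lborel. G x) = 0" by (metis inner_eq_zero_iff)
qed

lemma C1_on_Un:
  assumes "open S" "open T" "C1_on S u G" "C1_on T u G"
  shows "C1_on (S \<union> T) u G"
  using assms by (auto simp: C1_on_def intro: continuous_on_open_Un)

lemma C1_on_mult:
  assumes "C1_on S u G" "C1_on S v K"
  shows "C1_on S (\<lambda>x. u x * v x) (\<lambda>x. u x *\<^sub>R K x + v x *\<^sub>R G x)"
  unfolding C1_on_def
proof (intro conjI ballI)
  fix x assume "x \<in> S"
  then have "((\<lambda>x. u x * v x) has_derivative (\<lambda>h. u x * (K x \<bullet> h) + (G x \<bullet> h) * v x)) (at x)"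
    using assms by (intro has_derivative_mult) (auto simp: C1_on_def)
  then show "((\<lambda>x. u x * v x) has_derivative (\<lambda>h. (u x *\<^sub>R K x + v x *\<^sub>R G x) \<bullet> h)) (at x)"
    by (simp add: inner_add_left mult.commute)
qed (intro continuous_on_add continuous_on_scaleR C1_on_continuous[OF assms(1)] C1_on_continuous[OF assms(2)]
      C1_on_continuous_grad[OF assms(1)] C1_on_continuous_grad[OF assms(2)])

lemma C1_on_diff:
  assumes "C1_on S u G" "C1_on S v K"
  shows "C1_on S (\<lambda>x. u x - v x) (\<lambda>x. G x - K x)"
  using assms by (auto simp: C1_on_def inner_diff_left intro!: continuous_on_diff has_derivative_diff)

lemma C1_on_cong:
  assumes "C1_on S u G" "open S" "\<And>x. x \<in> S \<Longrightarrow> v x = u x" "\<And>x. x \<in> S \<Longrightarrow> K x = G x"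
  shows "C1_on S v K"
proof -
  have "C1_on S v G" by (rule C1_on_transform[OF assms(1-3)])
  moreover have "continuous_on S K \<longleftrightarrow> continuous_on S G"
    using assms(4) by (rule continuous_on_cong[OF refl])
  ultimately show ?thesis using assms(4) by (simp add: C1_on_def)
qed

text \<open>Because \<open>v\<close> is \<open>C2\<close> on the whole plane and vanishes off the
  disk, the field \<open>u grad v - v grad u\<close> extends by zero to a \<open>C1\<close> field
  with compact support, whose divergence has integral zero. For \<open>u\<close> only regularity
  near the disk enters.\<close>

lemma green_second_identity:
  assumes S: "open S" "cball c R \<subseteq> S"
    and u: "C2_on S u Gu Hu" and v: "C2_on UNIV v Gv Hv"
    and supp: "\<And>y. dist c y > R \<Longrightarrow> v y = 0"
  shows "(LINT y|lborel. indicator (cball c R) y * (u y * (\<Sum>e\<in>Basis. Hv e y \<bullet> e)))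
       = (LINT y|lborel. indicator (cball c R) y * (v y * (\<Sum>e\<in>Basis. Hu e y \<bullet> e)))"
proof -
  let ?T = "- cball c R"
  have oT: "open ?T" by (simp add: open_Compl)
  have v0: "v y = 0" if "y \<in> ?T" for y using supp that by auto
  have Gv0: "Gv y = 0" if "y \<in> ?T" for y using C1_on_grad_eq_0[OF C2_on_C1[OF v] oT v0 UNIV_I that] .
  have Hv0: "Hv e y = 0" if "y \<in> ?T" "e \<in> Basis" for y e
    using C1_on_grad_eq_0[OF C2_on_C1_grad[OF v that(2)] oT _ UNIV_I that(1)] Gv0 by simp
  \<comment> \<open>The component of \<open>u grad v - v grad u\<close> in direction
    \<open>e\<close>. The default 0 off \<open>S\<close> agrees with the formula on the part of
    \<open>S\<close> outside the disk, where \<open>v\<close> and its derivatives vanish.\<close>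
  define F where "F e y = (if y \<in> S then u y * (Gv y \<bullet> e) - v y * (Gu y \<bullet> e) else 0)" for e y
  define G where "G e y = (if y \<in> S then (u y *\<^sub>R Hv e y + (Gv y \<bullet> e) *\<^sub>R Gu y) - (v y *\<^sub>R Hu e y + (Gu y \<bullet> e) *\<^sub>R Gv y) else 0)" for e y
  have FG: "C1_on UNIV (F e) (G e)" if e: "e \<in> Basis" for e
  proof -
    have v': "C1_on S v Gv" "C1_on S (\<lambda>y. Gv y \<bullet> e) (Hv e)"
      using C1_on_subset C2_on_C1[OF v] C2_on_C1_grad[OF v e] by blast+
    note c1 = C1_on_diff[OF C1_on_mult[OF C2_on_C1[OF u] v'(2)] C1_on_mult[OF v'(1) C2_on_C1_grad[OF u e]]]
    have "C1_on S (F e) (G e)"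
      by (rule C1_on_cong[OF c1 S(1)]) (simp_all add: F_def G_def)
    moreover have "C1_on ?T (F e) (G e)"
    proof (rule C1_on_cong[OF _ oT])
      show "C1_on ?T (\<lambda>_. 0) (\<lambda>_. 0)" by (simp add: C1_on_def)
    qed (use v0 Gv0 Hv0 e in \<open>auto simp: F_def G_def\<close>)
    moreover have "S \<union> ?T = UNIV" using S by auto
    ultimately show ?thesis using C1_on_Un[OF S(1), of ?T] by auto
  qed
  have F0: "F e y = 0" if "norm y > norm c + R" "e \<in> Basis" for e y
  proof -
    have "dist c y > R" using that norm_triangle_sub[of y c] by (simp add: dist_norm norm_minus_commute)
    then have "y \<in> ?T" by auto
    then show ?thesis using v0 Gv0 by (auto simp: F_def)
  qed
  have I: "integrable lborel (G e)" "(LINT y|lborel. G e y) = 0" if "e \<in> Basis" for e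
    using integral_grad_eq_0[OF FG[OF that] F0[OF _ that]] by auto
  have "(LINT y|lborel. (\<Sum>e\<in>Basis. G e y \<bullet> e)) = 0"
    using I by (simp add: Bochner_Integration.integral_sum)
  \<comment> \<open>In the divergence the products of first derivatives of \<open>u\<close> and
    \<open>v\<close> cancel.\<close>
  moreover have "(\<Sum>e\<in>Basis. G e y \<bullet> e) = indicator (cball c R) y * (u y * (\<Sum>e\<in>Basis. Hv e y \<bullet> e))
      - indicator (cball c R) y * (v y * (\<Sum>e\<in>Basis. Hu e y \<bullet> e))" for y
  proof (cases "y \<in> cball c R")
    case True
    then have "y \<in> S" using S by auto
    then show ?thesis using True
      by (simp add: G_def inner_diff_left inner_add_left sum_subtractf sum.distrib sum_distrib_left mult.commute)
  next
    case False
    then show ?thesis using v0 Gv0 Hv0 by (auto simp: G_def indicator_def intro!: sum.neutral)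
  qed
  moreover have "integrable lborel (\<lambda>y. indicator (cball c R) y * (u y * (\<Sum>e\<in>Basis. Hv e y \<bullet> e)))"
  proof -
    have "continuous_on (cball c R) (\<lambda>y. u y * (\<Sum>e\<in>Basis. Hv e y \<bullet> e))"
      using u v S by (intro continuous_on_mult continuous_on_sum continuous_on_inner continuous_on_const
           continuous_on_subset[OF C1_on_continuous[OF C2_on_C1[OF u]]]
           continuous_on_subset[OF C1_on_continuous_grad[OF C2_on_C1_grad[OF v]]]) auto
    from borel_integrable_compact[OF compact_cball this] show ?thesis by simp
  qed
  moreover have "integrable lborel (\<lambda>y. indicator (cball c R) y * (v y * (\<Sum>e\<in>Basis. Hu e y \<bullet> e)))"
  proof -
    have "continuous_on (cball c R) (\<lambda>y. v y * (\<Sum>e\<in>Basis. Hu e y \<bullet> e))"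
      using u v S by (intro continuous_on_mult continuous_on_sum continuous_on_inner continuous_on_const
           continuous_on_subset[OF C1_on_continuous[OF C2_on_C1[OF v]]]
           continuous_on_subset[OF C1_on_continuous_grad[OF C2_on_C1_grad[OF u]]]) auto
    from borel_integrable_compact[OF compact_cball this] show ?thesis by simp
  qed
  ultimately show ?thesis by simp
qed

text \<open>As \<open>n\<close> grows every factor tends to 1 inside the box, so these test
  functions approximate the indicator of the box and are dominated by it.\<close>

lemma box_bump:
  fixes a b :: plane and n :: nat
  defines "\<psi> \<equiv> (\<lambda>x. (\<Prod>e\<in>Basis. bump 0 (real n * ((x - a) \<bullet> e)) * bump 0 (real n * ((b - x) \<bullet> e))))"
  shows "test_function \<psi>" "\<And>x. \<bar>\<psi> x\<bar> \<le> indicator (box a b) x"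
proof -
  have aff: "Ck_on k (\<lambda>x. real n * ((x - a) \<bullet> e)) UNIV" "Ck_on k (\<lambda>x. real n * ((b - x) \<bullet> e)) UNIV" for k e
    using Ck_on_affine[of UNIV k "real n *\<^sub>R e" "- real n * (a \<bullet> e)"]
      Ck_on_affine[of UNIV k "- real n *\<^sub>R e" "real n * (b \<bullet> e)"]
    by (simp_all add: inner_diff_left algebra_simps inner_commute)
  have s: "smooth \<psi>"
    unfolding \<psi>_def
    by (intro allI Ck_on_prod Ck_on_mult Ck_on_compose_real[where h=bump] bump_has_derivative aff open_UNIV) auto
  have b01: "0 \<le> bump 0 t" "bump 0 t \<le> 1" for t by (auto simp: bump_0)
  show bd: "\<bar>\<psi> x\<bar> \<le> indicator (box a b) x" for x
  proof (cases "x \<in> box a b")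
    case True
    then show ?thesis unfolding \<psi>_def
      by (auto simp: abs_prod b01 abs_mult intro!: prod_le_1 mult_le_one)
  next
    case False
    then obtain e where e: "e \<in> Basis" "\<not> (a \<bullet> e < x \<bullet> e \<and> x \<bullet> e < b \<bullet> e)" by (auto simp: mem_box)
    then have "bump 0 (real n * ((x - a) \<bullet> e)) * bump 0 (real n * ((b - x) \<bullet> e)) = 0"
      by (auto simp: bump_0 inner_diff_left mult_le_0_iff)
    then have "\<psi> x = 0" unfolding \<psi>_def using e(1) by (intro prod_zero) auto
    then show ?thesis using False by simp
  qed
  have "{x. \<psi> x \<noteq> 0} \<subseteq> box a b" 
  proof (clarify, rule ccontr)
    fix x assume "\<psi> x \<noteq> 0" "x \<notin> box a b"
    then show False using bd[of x] by simp
  qed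
  then have "bounded {x. \<psi> x \<noteq> 0}" using bounded_box bounded_subset by blast
  then show "test_function \<psi>" using s by (simp add: test_function_def compact_closure)
qed

section \<open>Functions determined by their integrals against test functions\<close>

lemma test_function_cball:
  assumes "test_function \<psi>" obtains R where "R > 0" "\<And>x. norm x > R \<Longrightarrow> \<psi> x = 0"
proof -
  have "bounded {x. \<psi> x \<noteq> 0}"
    using assms compact_imp_bounded bounded_subset closure_subset unfolding test_function_def by blast
  then obtain R where "\<forall>x\<in>{x. \<psi> x \<noteq> 0}. norm x \<le> R" by (auto simp: bounded_iff)
  then show ?thesis by (intro that[of "max R 1"]) force+
qed

lemma test_functionI:
  assumes "smooth \<psi>" "\<And>x. norm x > R \<Longrightarrow> \<psi> x = 0" shows "test_function \<psi>"
proof -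
  have "{x. \<psi> x \<noteq> 0} \<subseteq> cball 0 R" using assms(2) by force
  then have "bounded {x. \<psi> x \<noteq> 0}" using bounded_cball bounded_subset by blast
  then show ?thesis using assms by (simp add: test_function_def compact_closure)
qed

text \<open>Dominated convergence along \<open>box_bump\<close> gives zero integrals over all boxes.
  The measures whose densities are the positive and negative parts of \<open>h\<close> therefore
  agree on boxes, hence everywhere, and both parts coincide almost everywhere.\<close>

lemma AE_eq_0_of_test_functions:
  assumes h: "loc_int h" and test: "\<And>\<psi>. test_function \<psi> \<Longrightarrow> (LINT x|lborel. h x * \<psi> x) = 0"
  shows "AE x in lborel. h x = 0"
proof -
  have [measurable]: "h \<in> borel_measurable borel" using h by (simp add: loc_int_def)
  have ib: "integrable lborel (\<lambda>x. indicator (box a b) x * h x)" for a b :: plane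
  proof -
    obtain R where "box a b \<subseteq> ball 0 R" using bounded_subset_ballD[OF bounded_box, of a b 0] by blast
    then have R: "box a b \<subseteq> cball 0 R" using ball_subset_cball by blast
    have "integrable lborel (\<lambda>y. indicator (cball 0 R) y * h y)" using h by (simp add: loc_int_def)
    then show ?thesis
    proof (rule Bochner_Integration.integrable_bound)
      show "AE x in lborel. norm (indicator (box a b) x * h x) \<le> norm (indicator (cball 0 R) x * h x)"
        using R by (intro AE_I2) (simp add: indicator_def subset_iff)
    qed measurable
  qed
  have box0: "(LINT x|lborel. indicator (box a b) x * h x) = 0" for a b :: plane
  proof -
    define \<psi> where "\<psi> n x = (\<Prod>e\<in>Basis. bump 0 (real n * ((x - a) \<bullet> e)) * bump 0 (real n * ((b - x) \<bullet> e)))" for n x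
    have bb: "test_function (\<psi> n)" "\<bar>\<psi> n x\<bar> \<le> indicator (box a b) x" for n x
      unfolding \<psi>_def using box_bump[where a=a and b=b and n=n] by auto
    have [measurable]: "\<psi> n \<in> borel_measurable borel" for n
    proof -
      have "Ck_on 0 (\<psi> n) UNIV" using bb(1)[of n] unfolding test_function_def by blast
      then show ?thesis by (simp add: borel_measurable_continuous_onI)
    qed
    have lim1: "(\<lambda>n. bump 0 (real n * t)) \<longlonglongrightarrow> 1" if "t > 0" for t
    proof -
      have "(\<lambda>n. exp (- (inverse t * inverse (real n)))) \<longlonglongrightarrow> exp (- (inverse t * 0))"
        by (intro tendsto_intros lim_inverse_n)
      then have "(\<lambda>n. exp (- (inverse t * inverse (real n)))) \<longlonglongrightarrow> 1" by simp
      then show ?thesis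
      proof (rule Lim_transform_eventually)
        show "\<forall>\<^sub>F n in sequentially. exp (- (inverse t * inverse (real n))) = bump 0 (real n * t)"
          using eventually_gt_at_top[of "0::nat"]
        proof eventually_elim
          case (elim n)
          then have "real n * t > 0" using that by simp
          then show ?case by (simp add: bump_0 mult.commute)
        qed
      qed
    qed
    have "(\<lambda>n. LINT x|lborel. h x * \<psi> n x) \<longlonglongrightarrow> (LINT x|lborel. h x * indicator (box a b) x)"
    proof (rule integral_dominated_convergence[where w="\<lambda>x. \<bar>indicator (box a b) x * h x\<bar>"])
      show "AE x in lborel. (\<lambda>n. h x * \<psi> n x) \<longlonglongrightarrow> h x * indicator (box a b) x"
      proof (rule AE_I2)
        fix x
        show "(\<lambda>n. h x * \<psi> n x) \<longlonglongrightarrow> h x * indicator (box a b) x"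
        proof (cases "x \<in> box a b")
          case True
          then have "(\<lambda>n. \<psi> n x) \<longlonglongrightarrow> (\<Prod>e\<in>(Basis::plane set). 1 * 1)"
            unfolding \<psi>_def by (intro tendsto_prod tendsto_mult lim1) (auto simp: mem_box inner_diff_left)
          then show ?thesis using True by (auto intro!: tendsto_eq_intros)
        next
          case False
          then have "\<psi> n x = 0" for n using bb(2)[of n x] by simp
          then show ?thesis using False by simp
        qed
      qed
      show "AE x in lborel. norm (h x * \<psi> n x) \<le> \<bar>indicator (box a b) x * h x\<bar>" for n
        using bb(2)[of n] by (auto simp: abs_mult mult.commute[of "\<bar>h _\<bar>"] intro!: mult_right_mono)
    qed (use ib in auto)
    then have "(LINT x|lborel. h x * indicator (box a b) x) = 0"
      using test[OF bb(1)] by (simp add: LIMSEQ_const_iff)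
    then show ?thesis by (simp add: mult.commute)
  qed
  \<comment> \<open>\<open>ennreal\<close> sends negative reals to 0, so these are the positive and
    the negative part of \<open>h\<close>.\<close>
  let ?p = "\<lambda>x. ennreal (h x)" and ?n = "\<lambda>x. ennreal (- h x)"
  have "density lborel ?p = density lborel ?n"
  proof (rule measure_eqI_generator_eq[where E="range (\<lambda>(a, b). box a b)" and \<Omega>=UNIV and A="\<lambda>n. box (- real n *\<^sub>R One) (real n *\<^sub>R One)"])
    show "Int_stable (range (\<lambda>(a, b::plane). box a b))"
      by (auto simp: Int_stable_def box_Int_box)
    show "sets (density lborel ?p) = sigma_sets UNIV (range (\<lambda>(a, b). box a b))"
      "sets (density lborel ?n) = sigma_sets UNIV (range (\<lambda>(a, b). box a b))"
      by (simp_all add: borel_eq_box)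
    show "(\<Union>n. box (- real n *\<^sub>R One) (real n *\<^sub>R One)) = (UNIV :: plane set)"
      using UN_box_eq_UNIV by auto
    have fin: "(\<integral>\<^sup>+x. ennreal (s * h x) * indicator (box a b) x \<partial>lborel) < \<infinity>" if "\<bar>s\<bar> = 1" for a b :: plane and s
    proof -
      have "s * h x \<le> \<bar>h x\<bar>" for x
        using that abs_ge_self[of "s * h x"] by (simp add: abs_mult)
      then have "(\<integral>\<^sup>+x. ennreal (s * h x) * indicator (box a b) x \<partial>lborel) \<le> (\<integral>\<^sup>+x. ennreal (norm (indicator (box a b) x * h x)) \<partial>lborel)"
        by (intro nn_integral_mono) (auto simp: indicator_def intro!: ennreal_leI)
      also have "\<dots> < \<infinity>" using ib by (simp add: integrable_iff_bounded)
      finally show ?thesis .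
    qed
    then show "emeasure (density lborel ?p) (box (- real n *\<^sub>R One) (real n *\<^sub>R One)) \<noteq> \<infinity>" for n
      using fin[of 1] by (auto simp: emeasure_density less_top)
    fix X :: "plane set" assume "X \<in> range (\<lambda>(a, b). box a b)"
    then obtain a b where X: "X = box a b" by auto
    have eq: "(\<integral>\<^sup>+x. ennreal (s * h x) * indicator (box a b) x \<partial>lborel)
      = (\<integral>\<^sup>+x. ennreal (s * (indicator (box a b) x * h x)) \<partial>lborel)" for s
      by (intro nn_integral_cong) (auto simp: indicator_def)
    define A where "A = (\<integral>\<^sup>+x. ennreal (h x) * indicator (box a b) x \<partial>lborel)"
    define B where "B = (\<integral>\<^sup>+x. ennreal (- h x) * indicator (box a b) x \<partial>lborel)"
    have AB: "A < top" "B < top" using fin[of 1 a b] fin[of "-1" a b] unfolding A_def B_def by simp_all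
    have "A = (\<integral>\<^sup>+x. ennreal (indicator (box a b) x * h x) \<partial>lborel)"
      "B = (\<integral>\<^sup>+x. ennreal (- (indicator (box a b) x * h x)) \<partial>lborel)"
      using eq[of 1] eq[of "-1"] unfolding A_def B_def by simp_all
    then have "0 = enn2real A - enn2real B"
      using box0[of a b] real_lebesgue_integral_def[OF ib[of a b]] by simp
    then have "ennreal (enn2real A) = ennreal (enn2real B)" by simp
    then have "A = B" using AB by (simp only: ennreal_enn2real)
    then show "emeasure (density lborel ?p) X = emeasure (density lborel ?n) X"
      unfolding A_def B_def X by (subst (1 2) emeasure_density) auto
  qed auto
  then have "AE x in lborel. ?p x = ?n x"
    by (subst (asm) sigma_finite_measure.density_unique_iff) (auto simp: sigma_finite_lborel)
  then show ?thesis
  proof eventually_elim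
    case (elim x)
    then have "enn2real (ennreal (h x)) = enn2real (ennreal (- h x))" by simp
    then show ?case by (cases "h x \<ge> 0") (simp_all add: ennreal_neg)
  qed
qed

lemma AE_lborel_continuous_eq_0:
  fixes h :: "plane \<Rightarrow> real"
  assumes "continuous_on UNIV h" "AE x in lborel. h x = 0"
  shows "h x = 0"
proof (rule ccontr)
  assume "h x \<noteq> 0"
  have "open {x. h x \<noteq> 0}"
    using assms(1) by (intro open_Collect_neq continuous_on_const)
  have "{x. h x \<noteq> 0} \<noteq> {}" using \<open>h x \<noteq> 0\<close> by auto
  with \<open>open _\<close> have "\<not> negligible {x. h x \<noteq> 0}" by (rule open_not_negligible)
  moreover have "{x. h x \<noteq> 0} \<in> null_sets lborel"
    using assms(2) \<open>open _\<close> by (subst AE_iff_null_sets) auto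
  ultimately show False
    using negligible_iff_null_sets null_sets_completionI by blast
qed

section \<open>A logarithmic kernel with compact support\<close>

lemma DERIV_If_le:
  fixes f g :: "real \<Rightarrow> real"
  assumes "x \<le> a \<Longrightarrow> (f has_real_derivative D) (at x)" "x \<ge> a \<Longrightarrow> (g has_real_derivative D) (at x)" "f a = g a"
  shows "((\<lambda>y. if y \<le> a then f y else g y) has_real_derivative D) (at x)" (is "(?h has_real_derivative D) _")
proof -
  consider "x < a" | "x > a" | "x = a" by linarith
  then show ?thesis
  proof cases
    case 1
    show ?thesis
      by (rule has_field_derivative_transform_within_open[where S="{..<a}" and f=f]) (use 1 assms in auto)
  next
    case 2
    show ?thesis
      by (rule has_field_derivative_transform_within_open[where S="{a<..}" and f=g]) (use 2 assms in auto)
  next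
    case 3
    have f: "((\<lambda>y. (f y - f a) / (y - a)) \<longlongrightarrow> D) (at a)" and g: "((\<lambda>y. (g y - g a) / (y - a)) \<longlongrightarrow> D) (at a)"
      using assms 3 by (auto simp: has_field_derivative_iff)
    have "((\<lambda>y. (?h y - ?h a) / (y - a)) \<longlongrightarrow> D) (at_left a)"
      by (rule Lim_transform_eventually[OF filterlim_mono[OF f order_refl]])
         (auto simp: at_within_le_at eventually_at_filter)
    moreover have "((\<lambda>y. (?h y - ?h a) / (y - a)) \<longlongrightarrow> D) (at_right a)"
      by (rule Lim_transform_eventually[OF filterlim_mono[OF g order_refl]])
         (auto simp: at_within_le_at eventually_at_filter assms(3))
    ultimately show ?thesis
      using 3 filterlim_split_at by (auto simp: has_field_derivative_iff)
  qed
qed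

definition cutoff :: "real \<Rightarrow> real" where "cutoff s = max 0 (1 - s)"

lemma cutoff_nonneg: "cutoff s \<ge> 0" and cutoff_le_1: "s \<ge> 0 \<Longrightarrow> cutoff s \<le> 1" and cutoff_eq_0: "s \<ge> 1 \<Longrightarrow> cutoff s = 0"
  by (auto simp: cutoff_def)

lemma cutoff_power_deriv:
  "((\<lambda>s. cutoff s ^ Suc (Suc n)) has_real_derivative - real (Suc (Suc n)) * cutoff s ^ Suc n) (at s)"
proof -
  have "((\<lambda>s. if s \<le> 1 then (1 - s) ^ Suc (Suc n) else 0) has_real_derivative - real (Suc (Suc n)) * cutoff s ^ Suc n) (at s)"
  proof (rule DERIV_If_le)
    assume "s \<le> 1"
    have "((\<lambda>s. (1 - s) ^ Suc (Suc n)) has_real_derivative real (Suc (Suc n)) * (1 - s) ^ (Suc (Suc n) - Suc 0) * (- 1)) (at s)"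
      by (rule DERIV_chain2[OF DERIV_pow]) (auto intro!: derivative_eq_intros)
    then show "((\<lambda>s. (1 - s) ^ Suc (Suc n)) has_real_derivative - real (Suc (Suc n)) * cutoff s ^ Suc n) (at s)"
      by (rule DERIV_cong) (use \<open>s \<le> 1\<close> in \<open>simp add: cutoff_def algebra_simps\<close>)
  qed (auto simp: cutoff_def)
  then show ?thesis
    by (rule back_subst[of "\<lambda>f. (f has_real_derivative _) _"]) (auto simp: cutoff_def fun_eq_iff)
qed

text \<open>The closed form of \<open>\<integral>\<^sub>s\<^sup>1 (1 - t)\<^sup>4 / t dt\<close>.\<close>

definition log_cutoff :: "real \<Rightarrow> real" where
  "log_cutoff s = (if s \<le> 1 then - ln s - 4 * (1 - s) + 3 * (1 - s^2) - 4/3 * (1 - s^3) + 1/4 * (1 - s^4) else 0)"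

lemma log_cutoff_eq_0: "s \<ge> 1 \<Longrightarrow> log_cutoff s = 0"
  by (cases "s = 1") (auto simp: log_cutoff_def)

lemma log_cutoff_measurable[measurable]: "log_cutoff \<in> borel_measurable borel"
  unfolding log_cutoff_def[abs_def] by measurable

lemma cutoff_measurable[measurable]: "cutoff \<in> borel_measurable borel"
  unfolding cutoff_def[abs_def] by measurable

lemma log_cutoff_deriv:
  assumes "s > 0"
  shows "(log_cutoff has_real_derivative - (cutoff s ^ 4 / s)) (at s)"
  unfolding log_cutoff_def[abs_def]
proof (rule DERIV_If_le)
  assume "s \<le> 1"
  have "((\<lambda>s. - ln s - 4 * (1 - s) + 3 * (1 - s^2) - 4/3 * (1 - s^3) + 1/4 * (1 - s^4))
     has_real_derivative - (1 / s) + 4 - 6 * s + 4 * s^2 - s^3) (at s)"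
    using assms by (auto intro!: derivative_eq_intros)
  also have "- (1 / s) + 4 - 6 * s + 4 * s^2 - s^3 = - (cutoff s ^ 4 / s)"
    using assms \<open>s \<le> 1\<close> by (simp add: cutoff_def field_simps power2_eq_square power3_eq_cube power4_eq_xxxx)
  finally show "((\<lambda>s. - ln s - 4 * (1 - s) + 3 * (1 - s^2) - 4/3 * (1 - s^3) + 1/4 * (1 - s^4))
     has_real_derivative - (cutoff s ^ 4 / s)) (at s)" .
qed (auto simp: cutoff_def)

lemma log_cutoff_deriv2:
  assumes "s > 0"
  shows "((\<lambda>s. - (cutoff s ^ 4 / s)) has_real_derivative (4 * cutoff s ^ 3 / s + cutoff s ^ 4 / s^2)) (at s)"
proof -
  have "((\<lambda>s. cutoff s ^ 4) has_real_derivative - 4 * cutoff s ^ 3) (at s)"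
    using cutoff_power_deriv[of 2 s] by simp
  then have "((\<lambda>s. - (cutoff s ^ 4 / s)) has_real_derivative - ((- 4 * cutoff s ^ 3 * s - cutoff s ^ 4 * 1) / (s * s))) (at s)"
    using assms by (intro DERIV_minus DERIV_divide DERIV_ident) auto
  then show ?thesis
    by (rule DERIV_cong) (use assms in \<open>simp add: field_simps power2_eq_square\<close>)
qed

lemma log_cutoff_antimono:
  assumes "0 < s" "s \<le> t" shows "log_cutoff t \<le> log_cutoff s"
  using assms(2)
proof (rule DERIV_nonpos_imp_nonincreasing)
  fix x assume "s \<le> x" "x \<le> t"
  then show "\<exists>y. (log_cutoff has_real_derivative y) (at x) \<and> y \<le> 0"
    using assms cutoff_nonneg[of x] by (intro exI[of _ "- (cutoff x ^ 4 / x)"] conjI log_cutoff_deriv) auto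
qed

text \<open>The derivative is \<open>(1 - cutoff x ^ 4) / x\<close>. Together with the monotonicity
  of \<open>log_cutoff\<close> itself this bounds its increments by those of \<open>ln\<close>,
  uniformly in later rescalings.\<close>

lemma log_cutoff_ln_mono:
  assumes "0 < s" "s \<le> t" shows "log_cutoff s + ln s \<le> log_cutoff t + ln t"
  using assms(2)
proof (rule DERIV_nonneg_imp_nondecreasing)
  fix x assume x: "s \<le> x" "x \<le> t"
  have "cutoff x ^ 4 \<le> 1" using x assms cutoff_nonneg[of x] cutoff_le_1[of x] by (intro power_le_one) auto
  then show "\<exists>y. ((\<lambda>s. log_cutoff s + ln s) has_real_derivative y) (at x) \<and> 0 \<le> y"
    using x assms by (intro exI[of _ "- (cutoff x ^ 4 / x) + 1 / x"] conjI DERIV_add log_cutoff_deriv)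
      (auto intro!: derivative_eq_intros simp: field_simps)
qed

lemma log_cutoff_nonneg: "s > 0 \<Longrightarrow> log_cutoff s \<ge> 0"
  using log_cutoff_antimono[of s "max s 1"] log_cutoff_eq_0[of "max s 1"] by simp

lemma log_cutoff_diff_le:
  assumes "s > 0" "t > 0" shows "\<bar>log_cutoff s - log_cutoff t\<bar> \<le> \<bar>ln s - ln t\<bar>"
  using log_cutoff_antimono[of s t] log_cutoff_ln_mono[of s t] log_cutoff_antimono[of t s] log_cutoff_ln_mono[of t s] assms
    ln_mono[of s t] ln_mono[of t s]
  by (cases "s \<le> t") auto

text \<open>Apply \<open>ln t \<le> t - 1\<close> to \<open>t = s powr (- a)\<close>. The exponent
  stays free: a small one makes a high power of the kernel integrable, and \<open>1 / 4\<close>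
  yields its growth in the radius.\<close>

lemma log_cutoff_le_powr:
  assumes "s > 0" "a > 0" shows "log_cutoff s \<le> s powr (- a) / a"
proof (cases "s \<ge> 1")
  case True then show ?thesis using assms by (simp add: log_cutoff_eq_0)
next
  case False
  have "log_cutoff s \<le> - ln s" using log_cutoff_ln_mono[of s 1] assms False by (simp add: log_cutoff_eq_0)
  also have "\<dots> = ln (s powr (- a)) / a" using assms by (simp add: ln_powr)
  also have "\<dots> \<le> s powr (- a) / a"
    using assms ln_le_minus_one[of "s powr (-a)"] by (intro divide_right_mono) auto
  finally show ?thesis .
qed

text \<open>These satisfy \<open>-\<Delta>(ker R 0) = \<delta>\<^sub>0 - rho R\<close> with the Dirac mass \<open>\<delta>\<^sub>0\<close>. A parameter \<open>\<delta> > 0\<close>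
  smooths the singularity at the origin.\<close>

definition ker :: "real \<Rightarrow> real \<Rightarrow> plane \<Rightarrow> real" where
  "ker R \<delta> x = max 0 (log_cutoff ((norm x)\<^sup>2 / R\<^sup>2 + \<delta>)) / (4 * pi)"

definition rho :: "real \<Rightarrow> plane \<Rightarrow> real" where
  "rho R x = 4 / (pi * R\<^sup>2) * cutoff ((norm x)\<^sup>2 / R\<^sup>2) ^ 3"

lemma ker_measurable[measurable]: "ker R \<delta> \<in> borel_measurable borel"
  unfolding ker_def[abs_def] by measurable

lemma rho_measurable[measurable]: "rho R \<in> borel_measurable borel"
  unfolding rho_def[abs_def] by measurable

lemma rho_nonneg: "rho R x \<ge> 0"
  using cutoff_nonneg by (simp add: rho_def)

lemma rho_le: "rho R x \<le> 4 / (pi * R\<^sup>2)"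
  unfolding rho_def using cutoff_nonneg[of "(norm x)\<^sup>2 / R\<^sup>2"] cutoff_le_1[of "(norm x)\<^sup>2 / R\<^sup>2"]
  by (intro mult_left_le power_le_one) auto

lemma norm_sq_ge_1: "R > 0 \<Longrightarrow> norm x \<ge> R \<Longrightarrow> (norm (x::plane))\<^sup>2 / R\<^sup>2 \<ge> 1"
  by (simp add: power_mono)

lemma rho_eq_0: "R > 0 \<Longrightarrow> norm x \<ge> R \<Longrightarrow> rho R x = 0"
  unfolding rho_def using cutoff_eq_0[OF norm_sq_ge_1] by simp

lemma ker_eq_0:
  assumes "R > 0" "\<delta> \<ge> 0" "norm x \<ge> R" shows "ker R \<delta> x = 0"
proof -
  have "1 \<le> (norm x)\<^sup>2 / R\<^sup>2" by (rule norm_sq_ge_1[OF assms(1,3)])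
  then have "1 \<le> (norm x)\<^sup>2 / R\<^sup>2 + \<delta>" using assms(2) by linarith
  then show ?thesis by (simp add: ker_def log_cutoff_eq_0)
qed

lemma ker_nonneg: "ker R \<delta> x \<ge> 0"
  by (simp add: ker_def)

text \<open>For \<open>R > 0\<close> and \<open>\<delta> \<ge> 0\<close> the maximum in
  \<open>ker\<close> acts only at the origin with \<open>\<delta> = 0\<close>, where the convention
  \<open>ln 0 = 0\<close> would make \<open>log_cutoff\<close> negative.\<close>

lemma ker_eq_log_cutoff:
  assumes "\<delta> \<ge> 0" "\<delta> > 0 \<or> x \<noteq> 0" "R > 0"
  shows "ker R \<delta> x = log_cutoff ((norm x)\<^sup>2 / R\<^sup>2 + \<delta>) / (4 * pi)"
proof -
  have "(norm x)\<^sup>2 / R\<^sup>2 + \<delta> > 0" using assms by (auto simp: add_pos_nonneg add_nonneg_pos)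
  then show ?thesis unfolding ker_def using log_cutoff_nonneg by simp
qed

lemma ker_le_ker_0:
  assumes "\<delta> \<ge> 0" "x \<noteq> 0" "R > 0" shows "ker R \<delta> x \<le> ker R 0 x"
  unfolding ker_def using assms by (intro divide_right_mono max.mono order_refl log_cutoff_antimono) auto

lemma ker_minus: "ker R \<delta> (- x) = ker R \<delta> x" and rho_minus: "rho R (- x) = rho R x"
  by (auto simp: ker_def rho_def)

text \<open>The profile is a function of the squared distance, which is smooth at the centre, unlike
  the distance itself.\<close>

lemma C2_on_radial:
  fixes R :: real and a :: plane
  assumes h: "\<And>t. t \<ge> 0 \<Longrightarrow> (h has_real_derivative h' t) (at t)"
    and h': "\<And>t. t \<ge> 0 \<Longrightarrow> (h' has_real_derivative h'' t) (at t)"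
    and h'': "continuous_on {0..} h''"
  defines "s \<equiv> \<lambda>x::plane. (norm (x - a))\<^sup>2 / R\<^sup>2"
  shows "C2_on UNIV (\<lambda>x. h (s x)) (\<lambda>x. (2 / R\<^sup>2 * h' (s x)) *\<^sub>R (x - a))
    (\<lambda>e x. (2 / R\<^sup>2 * h' (s x)) *\<^sub>R e + (4 / R^4 * h'' (s x) * ((x - a) \<bullet> e)) *\<^sub>R (x - a))"
proof -
  have s0: "s x \<ge> 0" for x by (simp add: s_def)
  have ds: "(s has_derivative (\<lambda>h. 2 / R\<^sup>2 * ((x - a) \<bullet> h))) (at x)" for x
    unfolding s_def power2_norm_eq_inner divide_inverse
    by (auto intro!: derivative_eq_intros simp: inner_commute fun_eq_iff)
  have cs: "continuous_on UNIV s"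
    unfolding s_def divide_inverse by (intro continuous_intros)
  have dh: "((\<lambda>x. h (s x)) has_derivative (\<lambda>v. h' (s x) * (2 / R\<^sup>2 * ((x - a) \<bullet> v)))) (at x)" for x
    by (rule has_derivative_compose[OF ds has_field_derivative_imp_has_derivative[OF h[OF s0]]])
  have dh': "((\<lambda>x. h' (s x)) has_derivative (\<lambda>v. h'' (s x) * (2 / R\<^sup>2 * ((x - a) \<bullet> v)))) (at x)" for x
    by (rule has_derivative_compose[OF ds has_field_derivative_imp_has_derivative[OF h'[OF s0]]])
  have ch': "continuous_on UNIV (\<lambda>x. h' (s x))"
    using dh' by (meson continuous_at_imp_continuous_on has_derivative_continuous)
  have ch'': "continuous_on UNIV (\<lambda>x. h'' (s x))"
    using s0 by (intro continuous_on_compose2[OF h'' cs]) auto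
  show ?thesis
    unfolding C2_on_def
  proof (intro conjI ballI)
    show "C1_on UNIV (\<lambda>x. h (s x)) (\<lambda>x. (2 / R\<^sup>2 * h' (s x)) *\<^sub>R (x - a))"
      unfolding C1_on_def
    proof (intro conjI ballI)
      show "((\<lambda>x. h (s x)) has_derivative (\<bullet>) ((2 / R\<^sup>2 * h' (s x)) *\<^sub>R (x - a))) (at x)" for x
        by (rule has_derivative_eq_rhs[OF dh]) (simp add: fun_eq_iff)
      show "continuous_on UNIV (\<lambda>x. (2 / R\<^sup>2 * h' (s x)) *\<^sub>R (x - a))"
        by (intro continuous_on_scaleR continuous_on_mult continuous_on_const ch' continuous_on_diff continuous_on_id)
    qed
    fix e :: plane
    have alg: "2 / R\<^sup>2 * (A * (v \<bullet> e) + (B * (2 / R\<^sup>2 * (w \<bullet> v))) * (w \<bullet> e))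
        = ((2 / R\<^sup>2 * A) *\<^sub>R e + (4 / R^4 * B * (w \<bullet> e)) *\<^sub>R w) \<bullet> v" for A B v w
      by (simp add: inner_add_left inner_commute algebra_simps power2_eq_square power4_eq_xxxx)
    show "C1_on UNIV (\<lambda>x. (2 / R\<^sup>2 * h' (s x)) *\<^sub>R (x - a) \<bullet> e)
      (\<lambda>x. (2 / R\<^sup>2 * h' (s x)) *\<^sub>R e + (4 / R^4 * h'' (s x) * ((x - a) \<bullet> e)) *\<^sub>R (x - a))"
      unfolding C1_on_def
    proof (intro conjI ballI)
      fix x
      have "((\<lambda>x. 2 / R\<^sup>2 * (h' (s x) * ((x - a) \<bullet> e))) has_derivative
         (\<lambda>v. 2 / R\<^sup>2 * (h' (s x) * (v \<bullet> e) + (h'' (s x) * (2 / R\<^sup>2 * ((x - a) \<bullet> v))) * ((x - a) \<bullet> e)))) (at x)"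
        by (intro has_derivative_mult_right has_derivative_mult dh' has_derivative_inner_left
            has_derivative_diff[OF has_derivative_ident has_derivative_const, simplified])
      from has_derivative_eq_rhs[OF this ext[OF alg]]
      show "((\<lambda>x. (2 / R\<^sup>2 * h' (s x)) *\<^sub>R (x - a) \<bullet> e) has_derivative
         (\<bullet>) ((2 / R\<^sup>2 * h' (s x)) *\<^sub>R e + (4 / R^4 * h'' (s x) * ((x - a) \<bullet> e)) *\<^sub>R (x - a))) (at x)"
        by (rule back_subst[of "\<lambda>f. (f has_derivative _) _"]) (simp only: fun_eq_iff inner_scaleR_left mult.assoc simp_thms)
      show "continuous_on UNIV (\<lambda>x. (2 / R\<^sup>2 * h' (s x)) *\<^sub>R e + (4 / R^4 * h'' (s x) * ((x - a) \<bullet> e)) *\<^sub>R (x - a))"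
        by (intro continuous_on_add continuous_on_scaleR continuous_on_mult continuous_on_inner
            continuous_on_const ch' ch'' continuous_on_diff continuous_on_id)
    qed
  qed
qed

text \<open>The trace of \<open>c\<close> times the identity plus \<open>d\<close> times the
  projection-like matrix \<open>z z^T\<close>; the factor 2 is the dimension.\<close>

lemma sum_Basis_radial:
  "(\<Sum>e\<in>(Basis::plane set). (c *\<^sub>R e + (d * (z \<bullet> e)) *\<^sub>R z) \<bullet> e) = 2 * c + d * (norm z)\<^sup>2"
proof -
  have "(\<Sum>e\<in>(Basis::plane set). (c *\<^sub>R e + (d * (z \<bullet> e)) *\<^sub>R z) \<bullet> e) = (\<Sum>e\<in>(Basis::plane set). c + d * ((z \<bullet> e) * (z \<bullet> e)))"
    by (intro sum.cong) (auto simp: inner_add_left)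
  also have "\<dots> = 2 * c + d * (norm z)\<^sup>2"
    by (simp add: sum.distrib sum_distrib_left[symmetric] euclidean_inner[of z z, symmetric] power2_norm_eq_inner)
  finally show ?thesis .
qed

section \<open>Integrability of the kernel and of its powers\<close>

lemma inv_norm_measurable[measurable]: "(\<lambda>z::plane. indicator (cball 0 R) z / norm z) \<in> borel_measurable borel"
  by (intro borel_measurable_divide borel_measurable_indicator borel_closed closed_cball
      borel_measurable_norm)

lemma nn_integral_inv_norm:
  assumes "R \<ge> 0"
  shows "(\<integral>\<^sup>+z. ennreal (indicator (cball 0 R) z / norm (z::plane)) \<partial>lborel) = ennreal (2 * pi * R)"
proof -
  have "indicator (cball 0 R) z = (indicator {..R} (norm z) :: real)" for z :: plane
    by (simp add: indicator_def)
  then have "(\<integral>\<^sup>+z. ennreal (indicator (cball 0 R) z / norm (z::plane)) \<partial>lborel) =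
      (\<integral>\<^sup>+z. (\<lambda>r. ennreal (indicator {..R} r / r)) (norm (z::plane)) \<partial>lborel)" by simp
  also have "\<dots> = (\<integral>\<^sup>+r. ennreal (2 * pi * r) * indicator {0..} r * ennreal (indicator {..R} r / r) \<partial>lborel)"
    by (rule nn_integral_radial) measurable
  also have "\<dots> = (\<integral>\<^sup>+r. ennreal (2 * pi) * indicator {0..R} r \<partial>lborel)"
  proof (rule nn_integral_cong_AE)
    show "AE r in lborel. ennreal (2 * pi * r) * indicator {0..} r * ennreal (indicator {..R} r / r)
        = ennreal (2 * pi) * indicator {0..R} r"
      using AE_lborel_singleton[of 0]
      by eventually_elim (auto simp: indicator_def ennreal_mult'[symmetric])
  qed
  also have "\<dots> = ennreal (2 * pi * R)"
    using assms by (simp add: nn_integral_cmult ennreal_mult)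
  finally show ?thesis .
qed

lemma integrable_inv_norm: "integrable lborel (\<lambda>z::plane. indicator (cball 0 R) z / norm z)"
proof (cases "R \<ge> 0")
  case True
  show ?thesis
  proof (rule integrableI_bounded)
    show "(\<integral>\<^sup>+z. ennreal (norm (indicator (cball 0 R) z / norm (z::plane))) \<partial>lborel) < \<infinity>"
      using nn_integral_inv_norm[OF True] by simp
  qed simp
next
  case False
  then have "indicator (cball 0 R) z = (0::real)" for z :: plane
    by (simp add: indicator_def not_le)
  then show ?thesis by simp
qed

lemma integrable_inv_norm_shift: "integrable lborel (\<lambda>y::plane. indicator (cball 0 R) (x - y) / norm (x - y))"
  by (rule integrable_reflect_plane[OF inv_norm_measurable, THEN iffD2, OF integrable_inv_norm])

text \<open>The exponent \<open>a = 1 / (2 * N)\<close> in \<open>log_cutoff_le_powr\<close> makes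
  the \<open>N\<close>-th power of the bound a multiple of \<open>s powr (- 1 / 2)\<close>, that is
  of \<open>R / norm x\<close>, whose singularity is integrable in the plane.\<close>

lemma ker_power_le:
  assumes "R > 0" "x \<noteq> 0" "N \<ge> 1"
  shows "ker R 0 x ^ N \<le> (real N / (2 * pi)) ^ N * (R * (indicator (cball 0 R) x / norm x))"
proof (cases "norm x \<ge> R")
  case True
  then have "ker R 0 x = 0" using assms by (intro ker_eq_0) auto
  then show ?thesis using assms by (simp add: power_0_left)
next
  case False
  define s where "s = (norm x)\<^sup>2 / R\<^sup>2"
  have s: "s > 0" using assms by (simp add: s_def)
  define a where "a = 1 / (2 * real N)"
  have a: "a > 0" using assms by (simp add: a_def)
  have "ker R 0 x = log_cutoff s / (4 * pi)" using assms by (simp add: ker_eq_log_cutoff s_def)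
  also have "\<dots> \<le> s powr (- a) / a / (4 * pi)"
    using s a by (intro divide_right_mono log_cutoff_le_powr) auto
  finally have "ker R 0 x ^ N \<le> (s powr (- a) / a / (4 * pi)) ^ N"
    by (intro power_mono ker_nonneg)
  also have "\<dots> = (s powr (- a)) ^ N * (1 / (a * (4 * pi))) ^ N"
    unfolding power_mult_distrib[symmetric] by simp
  also have "1 / (a * (4 * pi)) = real N / (2 * pi)" using assms by (simp add: a_def field_simps)
  also have "(s powr (- a)) ^ N = s powr (- (1 / 2))"
    using s assms by (simp add: powr_power a_def)
  also have "s powr (- (1 / 2)) = inverse (sqrt s)" using s by (simp add: powr_minus powr_half_sqrt)
  also have "\<dots> = R / norm x" using assms by (simp add: s_def real_sqrt_divide)
  finally show ?thesis using False by (simp add: mult.commute)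
qed

lemma integrable_ker_power:
  assumes "R > 0" "N \<ge> 1" shows "integrable lborel (\<lambda>z. ker R 0 z ^ N)"
proof (rule Bochner_Integration.integrable_bound)
  show "integrable lborel (\<lambda>x::plane. (real N / (2 * pi)) ^ N * (R * (indicator (cball 0 R) x / norm x)))"
    by (intro integrable_mult_right integrable_inv_norm)
  show "AE x in lborel. norm (ker R 0 x ^ N) \<le> norm ((real N / (2 * pi)) ^ N * (R * (indicator (cball 0 R) x / norm x)))"
    using AE_lborel_singleton[of 0]
  proof eventually_elim
    case (elim x)
    have "norm (ker R 0 x ^ N) = ker R 0 x ^ N" by (simp add: ker_nonneg)
    then show ?case
      using order_trans[OF ker_power_le[OF assms(1) elim assms(2)] abs_ge_self] by (simp only: real_norm_def)
  qed
qed measurable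

lemma integrable_ker: "R > 0 \<Longrightarrow> integrable lborel (\<lambda>y. ker R 0 (x - y))"
  using integrable_ker_power[of R 1] integrable_reflect_plane[of "ker R 0" x] by simp

text \<open>The gradient of \<open>ker R \<delta>\<close> for \<open>\<delta> > 0\<close>. For
  \<open>\<delta> = 0\<close> the same formula is the gradient off the origin, of size about
  \<open>1 / (2 * pi * norm z)\<close> near it.\<close>

definition grad_ker :: "real \<Rightarrow> real \<Rightarrow> plane \<Rightarrow> plane" where
  "grad_ker R \<delta> z = (let \<sigma> = (norm z)\<^sup>2 / R\<^sup>2 + \<delta> in (2 / R\<^sup>2 * (- (cutoff \<sigma> ^ 4 / \<sigma>) / (4 * pi))) *\<^sub>R z)"

text \<open>In the variable \<open>t = norm (y - x)^2 / R^2\<close> the planar Laplacian of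
  \<open>h t\<close> is \<open>4 / R^2 * (h' + t * h'')\<close>. The term without the factor
  \<open>\<delta>\<close> becomes \<open>rho R\<close> in the limit; among the others, the one with
  \<open>\<delta> * cutoff^4 / \<sigma>^2\<close> concentrates to a point mass at \<open>x\<close>
  and the remaining one disappears.\<close>

lemma ker_C2_on:
  fixes x :: plane and R \<delta> :: real
  assumes "R > 0" "\<delta> > 0"
  defines "\<sigma> \<equiv> (\<lambda>y::plane. (norm (y - x))\<^sup>2 / R\<^sup>2 + \<delta>)"
  obtains Hs where "C2_on UNIV (\<lambda>y. ker R \<delta> (y - x)) (\<lambda>y. grad_ker R \<delta> (y - x)) Hs"
    "\<And>y. (\<Sum>e\<in>Basis. Hs e y \<bullet> e) = 1 / (pi * R\<^sup>2) *
       (4 * cutoff (\<sigma> y) ^ 3 - \<delta> * (4 * cutoff (\<sigma> y) ^ 3 / \<sigma> y + cutoff (\<sigma> y) ^ 4 / (\<sigma> y)\<^sup>2))"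
proof -
  define h where "h t = log_cutoff (t + \<delta>) / (4 * pi)" for t
  define h' where "h' t = - (cutoff (t + \<delta>) ^ 4 / (t + \<delta>)) / (4 * pi)" for t
  define h'' where "h'' t = (4 * cutoff (t + \<delta>) ^ 3 / (t + \<delta>) + cutoff (t + \<delta>) ^ 4 / (t + \<delta>)\<^sup>2) / (4 * pi)" for t
  have "(h has_real_derivative h' t) (at t)" if "t \<ge> 0" for t
    unfolding h_def h'_def using that assms
    by (intro DERIV_cdivide log_cutoff_deriv[THEN DERIV_shift[THEN iffD1]]) auto
  moreover have "(h' has_real_derivative h'' t) (at t)" if "t \<ge> 0" for t
    unfolding h''_def h'_def using that assms
    by (intro DERIV_cdivide log_cutoff_deriv2[THEN DERIV_shift[THEN iffD1]]) auto
  moreover have "continuous_on {0..} h''"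
    unfolding h''_def cutoff_def using assms by (intro continuous_intros) auto
  ultimately have "C2_on UNIV (\<lambda>y. h ((norm (y - x))\<^sup>2 / R\<^sup>2)) (\<lambda>y. (2 / R\<^sup>2 * h' ((norm (y - x))\<^sup>2 / R\<^sup>2)) *\<^sub>R (y - x))
    (\<lambda>e y. (2 / R\<^sup>2 * h' ((norm (y - x))\<^sup>2 / R\<^sup>2)) *\<^sub>R e + (4 / R^4 * h'' ((norm (y - x))\<^sup>2 / R\<^sup>2) * ((y - x) \<bullet> e)) *\<^sub>R (y - x))"
    by (rule C2_on_radial)
  then have C: "C2_on UNIV (\<lambda>y. h ((norm (y - x))\<^sup>2 / R\<^sup>2)) (\<lambda>y. grad_ker R \<delta> (y - x))
    (\<lambda>e y. (2 / R\<^sup>2 * h' ((norm (y - x))\<^sup>2 / R\<^sup>2)) *\<^sub>R e + (4 / R^4 * h'' ((norm (y - x))\<^sup>2 / R\<^sup>2) * ((y - x) \<bullet> e)) *\<^sub>R (y - x))"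
    unfolding grad_ker_def h'_def Let_def .
  show ?thesis
  proof (rule that[OF C2_on_transform[OF C]])
    show "ker R \<delta> (y - x) = h ((norm (y - x))\<^sup>2 / R\<^sup>2)" for y
      using assms by (simp add: ker_eq_log_cutoff h_def)
    fix y
    have pos: "\<sigma> y > 0" using assms by (simp add: \<sigma>_def add_nonneg_pos)
    have "4 * (- (Q4 / s)) + 4 * (s - \<delta>) * (4 * Q3 / s + Q4 / s\<^sup>2) = 4 * (4 * Q3 - \<delta> * (4 * Q3 / s + Q4 / s\<^sup>2))"
      if "s > 0" for s Q3 Q4 :: real
      using that by (simp add: field_simps power2_eq_square)
    note alg = this[OF pos, of "cutoff (\<sigma> y) ^ 4" "cutoff (\<sigma> y) ^ 3"]
    have "(\<Sum>e\<in>Basis. ((2 / R\<^sup>2 * h' ((norm (y - x))\<^sup>2 / R\<^sup>2)) *\<^sub>R e + (4 / R^4 * h'' ((norm (y - x))\<^sup>2 / R\<^sup>2) * ((y - x) \<bullet> e)) *\<^sub>R (y - x)) \<bullet> e)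
        = 2 * (2 / R\<^sup>2 * h' ((norm (y - x))\<^sup>2 / R\<^sup>2)) + 4 / R^4 * h'' ((norm (y - x))\<^sup>2 / R\<^sup>2) * (norm (y - x))\<^sup>2"
      by (rule sum_Basis_radial)
    also have "\<dots> = 1 / R\<^sup>2 * (4 * h' ((norm (y - x))\<^sup>2 / R\<^sup>2) + 4 * ((norm (y - x))\<^sup>2 / R\<^sup>2) * h'' ((norm (y - x))\<^sup>2 / R\<^sup>2))"
      using assms by (simp add: field_simps power2_eq_square power4_eq_xxxx)
    also have t: "(norm (y - x))\<^sup>2 / R\<^sup>2 = \<sigma> y - \<delta>" by (simp add: \<sigma>_def)
    also have "4 * h' (\<sigma> y - \<delta>) + 4 * (\<sigma> y - \<delta>) * h'' (\<sigma> y - \<delta>)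
        = (4 * (- (cutoff (\<sigma> y) ^ 4 / \<sigma> y)) + 4 * (\<sigma> y - \<delta>) * (4 * cutoff (\<sigma> y) ^ 3 / \<sigma> y + cutoff (\<sigma> y) ^ 4 / (\<sigma> y)\<^sup>2)) / (4 * pi)"
    proof -
      have "4 * (- A / (4 * pi)) + 4 * w * (C / (4 * pi)) = (4 * - A + 4 * w * C) / (4 * pi)" for A w C :: real
        by (simp add: field_simps)
      then show ?thesis unfolding h'_def h''_def diff_add_cancel .
    qed
    also have "\<dots> = (4 * cutoff (\<sigma> y) ^ 3 - \<delta> * (4 * cutoff (\<sigma> y) ^ 3 / \<sigma> y + cutoff (\<sigma> y) ^ 4 / (\<sigma> y)\<^sup>2)) / pi"
    proof -
      have "4 * X / (4 * pi) = X / pi" for X :: real by simp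
      then show ?thesis unfolding alg .
    qed
    finally show "(\<Sum>e\<in>Basis. ((2 / R\<^sup>2 * h' ((norm (y - x))\<^sup>2 / R\<^sup>2)) *\<^sub>R e + (4 / R^4 * h'' ((norm (y - x))\<^sup>2 / R\<^sup>2) * ((y - x) \<bullet> e)) *\<^sub>R (y - x)) \<bullet> e)
       = 1 / (pi * R\<^sup>2) * (4 * cutoff (\<sigma> y) ^ 3 - \<delta> * (4 * cutoff (\<sigma> y) ^ 3 / \<sigma> y + cutoff (\<sigma> y) ^ 4 / (\<sigma> y)\<^sup>2))"
      by (simp add: t mult.commute)
  qed auto
qed

text \<open>The rescaled profile of the concentrating term in the Laplacian of the smoothed kernel.
  Its mass \<open>pi\<close> fixes the normalisation \<open>1 / (4 * pi)\<close> of
  \<open>ker\<close>.\<close>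

lemma integral_inv_sq: 
  "integrable lborel (\<lambda>z::plane. 1 / (1 + (norm z)\<^sup>2)\<^sup>2)" "(LINT z|lborel. 1 / (1 + (norm (z::plane))\<^sup>2)\<^sup>2) = pi"
proof -
  have "(\<integral>\<^sup>+z. ennreal (1 / (1 + (norm (z::plane))\<^sup>2)\<^sup>2) \<partial>lborel)
      = (\<integral>\<^sup>+r. ennreal (2 * pi * r) * indicator {0..} r * ennreal (1 / (1 + r\<^sup>2)\<^sup>2) \<partial>lborel)"
    by (rule nn_integral_radial[of "\<lambda>r. ennreal (1 / (1 + r\<^sup>2)\<^sup>2)"]) measurable
  also have "\<dots> = (\<integral>\<^sup>+r. ennreal (2 * pi * r / (1 + r\<^sup>2)\<^sup>2) * indicator {0..} r \<partial>lborel)"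
    by (intro nn_integral_cong) (auto simp: indicator_def ennreal_mult'[symmetric])
  also have "\<dots> = ennreal (0 - (- pi / (1 + 0\<^sup>2)))"
  proof (rule nn_integral_FTC_atLeast)
    fix r :: real assume "0 \<le> r"
    have "1 + r\<^sup>2 \<noteq> 0" by (metis add_pos_nonneg less_irrefl zero_le_power2 zero_less_one)
    then show "((\<lambda>r. - pi / (1 + r\<^sup>2)) has_real_derivative 2 * pi * r / (1 + r\<^sup>2)\<^sup>2) (at r)"
      by (auto intro!: derivative_eq_intros simp: power2_eq_square)
    show "0 \<le> 2 * pi * r / (1 + r\<^sup>2)\<^sup>2" using \<open>0 \<le> r\<close> by simp
  next
    show "((\<lambda>r. - pi / (1 + r\<^sup>2)) \<longlongrightarrow> 0) at_top"
      by (intro tendsto_divide_0[OF tendsto_const] filterlim_at_top_imp_at_infinity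
          filterlim_tendsto_add_at_top[OF tendsto_const] filterlim_pow_at_top filterlim_ident) auto
  qed measurable
  also have "\<dots> = ennreal pi" by simp
  finally have nn: "(\<integral>\<^sup>+z. ennreal (1 / (1 + (norm (z::plane))\<^sup>2)\<^sup>2) \<partial>lborel) = ennreal pi" .
  show "integrable lborel (\<lambda>z::plane. 1 / (1 + (norm z)\<^sup>2)\<^sup>2)"
    by (rule integrableI_bounded) (simp_all add: nn)
  then show "(LINT z|lborel. 1 / (1 + (norm (z::plane))\<^sup>2)\<^sup>2) = pi"
    using nn by (subst integral_eq_nn_integral) auto
qed

text \<open>Green's second identity with the kernel smoothed by \<open>d n\<close>, followed by
  \<open>d n \<longlonglongrightarrow> 0\<close>. The Laplacian of the kernel splits into three
  terms: \<open>A1\<close> gives the average against \<open>rho R\<close>, \<open>A2\<close>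
  vanishes by dominated convergence, and \<open>A3\<close> recovers the value at the centre.\<close>

lemma green_representation:
  assumes R: "R > 0" and S: "open S" "cball x R \<subseteq> S" and u: "C2_on S u G Hu"
  shows "u x = (LINT y|lborel. rho R (x - y) * u y) + (LINT y|lborel. ker R 0 (x - y) * (- laplacian u y))"
    (is "_ = ?P + ?K")
proof -
  define B where "B = cball x R"
  have B[measurable]: "B \<in> sets borel" by (simp add: B_def)
  define L where "L y = (\<Sum>e\<in>Basis. Hu e y \<bullet> e)" for y
  have L: "laplacian u y = L y" if "y \<in> B" for y
    using laplacian_C2_on[OF S(1) u] that S(2) by (auto simp: B_def L_def)
  have cu: "continuous_on B u"
    using C1_on_continuous[OF C2_on_C1[OF u]] S(2) continuous_on_subset B_def by blast
  have cL: "continuous_on B L"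
    unfolding L_def using continuous_on_subset[OF C1_on_continuous_grad[OF C2_on_C1_grad[OF u]], of _ B] S(2)
    by (intro continuous_on_sum continuous_on_inner continuous_on_const) (auto simp: B_def)
  have "compact B" by (simp add: B_def)
  have "compact (u ` B)" "compact (L ` B)" using cu cL \<open>compact B\<close> compact_continuous_image by blast+
  then obtain M1 M2 where "\<And>y. y \<in> B \<Longrightarrow> \<bar>u y\<bar> \<le> M1" "\<And>y. y \<in> B \<Longrightarrow> \<bar>L y\<bar> \<le> M2"
    by (auto dest!: compact_imp_bounded simp: bounded_iff) blast
  then obtain M where M: "\<And>y. y \<in> B \<Longrightarrow> \<bar>u y\<bar> \<le> M" "\<And>y. y \<in> B \<Longrightarrow> \<bar>L y\<bar> \<le> M" "M \<ge> 0"
    by (metis abs_ge_zero linorder_le_cases order_trans)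
  \<comment> \<open>Truncation to the disk gives bounded Borel functions on the whole plane,
    whatever \<open>u\<close> is outside \<open>S\<close>.\<close>
  define v where "v y = indicator B y * u y" for y
  define l where "l y = indicator B y * L y" for y
  have iv: "integrable lborel v" and il: "integrable lborel l"
    using borel_integrable_compact[OF \<open>compact B\<close> cu] borel_integrable_compact[OF \<open>compact B\<close> cL]
    by (simp_all add: v_def[abs_def] l_def[abs_def])
  then have [measurable]: "v \<in> borel_measurable borel" "l \<in> borel_measurable borel"
    using borel_measurable_integrable by fastforce+
  have vM: "\<bar>v y\<bar> \<le> M * indicator B y" "\<bar>l y\<bar> \<le> M * indicator B y" for y
    using M by (auto simp: v_def l_def indicator_def)
  have iB: "integrable lborel (\<lambda>y. c * indicator B y)" for c :: real
    using borel_integrable_compact[OF \<open>compact B\<close>, of "\<lambda>_. 1::real"] by simp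
  define d where "d n = inverse (real (Suc n))" for n
  have d: "d n > 0" for n by (simp add: d_def)
  have d0: "d \<longlonglongrightarrow> 0" unfolding d_def by (rule LIMSEQ_inverse_real_of_nat)
  define t where "t y = (norm (y - x))\<^sup>2 / R\<^sup>2" for y
  have [measurable]: "t \<in> borel_measurable borel" unfolding t_def by measurable
  have t0: "t y \<ge> 0" for y by (simp add: t_def)
  have q01: "0 \<le> cutoff s" "0 \<le> s \<Longrightarrow> cutoff s \<le> 1" "0 \<le> cutoff s ^ k" "0 \<le> s \<Longrightarrow> cutoff s ^ k \<le> 1" for s k
    using cutoff_nonneg cutoff_le_1 power_le_one by auto
  have qc: "isCont cutoff s" for s unfolding cutoff_def by (intro continuous_intros)
  define p where "p = pi * R\<^sup>2"
  have p: "p > 0" using R by (simp add: p_def)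
  define A1 where "A1 n = (LINT y|lborel. v y * (4 / p * cutoff (t y + d n) ^ 3))" for n
  define A2 where "A2 n = (LINT y|lborel. v y * (4 / p * cutoff (t y + d n) ^ 3 * (d n / (t y + d n))))" for n
  define A3 where "A3 n = (LINT y|lborel. v y * (d n * cutoff (t y + d n) ^ 4 / (p * (t y + d n)\<^sup>2)))" for n
  define A4 where "A4 n = (LINT y|lborel. ker R (d n) (y - x) * l y)" for n
  have bd: "\<bar>v y * g\<bar> \<le> (M * c) * indicator B y" if "\<bar>g\<bar> \<le> c" for y g c
  proof -
    have "\<bar>v y\<bar> * \<bar>g\<bar> \<le> (M * indicator B y) * c"
      using vM(1) that M(3) by (intro mult_mono) auto
    then show ?thesis by (simp add: abs_mult mult.commute mult.left_commute)
  qed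
  have ib: "integrable lborel (\<lambda>y. v y * g y)"
    if [measurable]: "g \<in> borel_measurable borel" and g: "\<And>y. \<bar>g y\<bar> \<le> c" for g c
  proof (rule Bochner_Integration.integrable_bound[OF iB[of "M * c"]])
    show "AE y in lborel. norm (v y * g y) \<le> norm (M * c * indicator B y)"
      using bd[OF g] by (intro AE_I2) (metis order_trans abs_ge_self real_norm_def)
  qed measurable
  have s0: "t y + d n > 0" for y n using t0[of y] d[of n] by linarith
  have g1: "\<bar>4 / p * cutoff (t y + d n) ^ 3\<bar> \<le> 4 / p" for y n
    using q01(3,4)[of "t y + d n" 3] p s0[of y n] by (simp add: abs_mult divide_right_mono)
  have g2: "\<bar>4 / p * cutoff (t y + d n) ^ 3 * (d n / (t y + d n))\<bar> \<le> 4 / p" for y n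
  proof -
    have "\<bar>d n / (t y + d n)\<bar> \<le> 1" using s0[of y n] d[of n] t0[of y] by simp
    then have "\<bar>4 / p * cutoff (t y + d n) ^ 3\<bar> * \<bar>d n / (t y + d n)\<bar> \<le> 4 / p * 1"
      using g1[of y n] p by (intro mult_mono) auto
    then show ?thesis by (simp only: abs_mult mult_1_right)
  qed
  have g3: "\<bar>d n * cutoff (t y + d n) ^ 4 / (p * (t y + d n)\<^sup>2)\<bar> \<le> d n * 1 / (p * (d n)\<^sup>2)" for y n
  proof -
    have "d n * cutoff (t y + d n) ^ 4 / (p * (t y + d n)\<^sup>2) \<le> d n * 1 / (p * (d n)\<^sup>2)"
      using s0[of y n] d[of n] t0[of y] p q01(3,4)[of "t y + d n" 4]
      by (intro frac_le mult_left_mono power_mono mult_nonneg_nonneg) auto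
    then show ?thesis using d[of n] p q01(3)[of _ 4] by (simp add: abs_mult)
  qed
  have i1: "integrable lborel (\<lambda>y. v y * (4 / p * cutoff (t y + d n) ^ 3))" for n
    by (rule ib[OF _ g1]) measurable
  have i2: "integrable lborel (\<lambda>y. v y * (4 / p * cutoff (t y + d n) ^ 3 * (d n / (t y + d n))))" for n
    by (rule ib[OF _ g2]) measurable
  have i3: "integrable lborel (\<lambda>y. v y * (d n * cutoff (t y + d n) ^ 4 / (p * (t y + d n)\<^sup>2)))" for n
    by (rule ib[OF _ g3]) measurable
  have eq: "A1 n - A2 n - A3 n = A4 n" for n
  proof -
    obtain Hk where k: "C2_on UNIV (\<lambda>y. ker R (d n) (y - x)) (\<lambda>y. grad_ker R (d n) (y - x)) Hk"
      "\<And>y. (\<Sum>e\<in>Basis. Hk e y \<bullet> e) = 1 / p * (4 * cutoff (t y + d n) ^ 3 - d n * (4 * cutoff (t y + d n) ^ 3 / (t y + d n) + cutoff (t y + d n) ^ 4 / (t y + d n)\<^sup>2))"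
      using ker_C2_on[OF R d[of n], of x] unfolding t_def p_def by blast
    have "ker R (d n) (y - x) = 0" if "dist x y > R" for y
      using that R d[of n] by (intro ker_eq_0) (auto simp: dist_norm norm_minus_commute)
    from green_second_identity[OF S u k(1) this]
    have "(LINT y|lborel. indicator B y * (u y * (\<Sum>e\<in>Basis. Hk e y \<bullet> e))) = A4 n"
      unfolding B_def[symmetric] L_def[symmetric] A4_def l_def by (simp add: mult.left_commute)
    moreover have "indicator B y * (u y * (\<Sum>e\<in>Basis. Hk e y \<bullet> e)) =
        v y * (4 / p * cutoff (t y + d n) ^ 3) - v y * (4 / p * cutoff (t y + d n) ^ 3 * (d n / (t y + d n)))
        - v y * (d n * cutoff (t y + d n) ^ 4 / (p * (t y + d n)\<^sup>2))" for y
      unfolding k(2) v_def by (simp add: divide_inverse algebra_simps)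
    ultimately show ?thesis
      unfolding A1_def A2_def A3_def using i1 i2 i3 by (simp add: Bochner_Integration.integral_diff)
  qed
  have td: "(\<lambda>n. t y + d n) \<longlonglongrightarrow> t y" for y
    using tendsto_add[OF tendsto_const d0, of "t y"] by simp
  have L1: "A1 \<longlonglongrightarrow> (LINT y|lborel. v y * (4 / p * cutoff (t y) ^ 3))"
    unfolding A1_def
  proof (rule integral_dominated_convergence[OF _ _ iB[of "M * (4 / p)"]])
    show "AE y in lborel. (\<lambda>n. v y * (4 / p * cutoff (t y + d n) ^ 3)) \<longlonglongrightarrow> v y * (4 / p * cutoff (t y) ^ 3)"
      by (intro AE_I2 tendsto_mult tendsto_const tendsto_power isCont_tendsto_compose[OF qc td])
    show "AE y in lborel. norm (v y * (4 / p * cutoff (t y + d n) ^ 3)) \<le> M * (4 / p) * indicator B y" for n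
      using bd[OF g1] by simp
  qed measurable
  have L2: "A2 \<longlonglongrightarrow> (LINT y::plane|lborel. 0)"
    unfolding A2_def
  proof (rule integral_dominated_convergence[OF _ _ iB[of "M * (4 / p)"]])
    show "AE y in lborel. (\<lambda>n. v y * (4 / p * cutoff (t y + d n) ^ 3 * (d n / (t y + d n)))) \<longlonglongrightarrow> 0"
      using AE_lborel_singleton[of x]
    proof eventually_elim
      case (elim y)
      then have "t y \<noteq> 0" using R by (simp add: t_def)
      then have "(\<lambda>n. v y * (4 / p * cutoff (t y + d n) ^ 3 * (d n / (t y + d n)))) \<longlonglongrightarrow> v y * (4 / p * cutoff (t y) ^ 3 * (0 / t y))"
        by (intro tendsto_mult tendsto_const tendsto_power isCont_tendsto_compose[OF qc td] tendsto_divide d0 td)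
      then show ?case by simp
    qed
    show "AE y in lborel. norm (v y * (4 / p * cutoff (t y + d n) ^ 3 * (d n / (t y + d n)))) \<le> M * (4 / p) * indicator B y" for n
      using bd[OF g2] by simp
  qed measurable
  have cv: "isCont v x"
  proof -
    have "isCont u x" using cu R unfolding B_def
      by (intro continuous_on_interior[of "cball x R"]) auto
    moreover have "eventually (\<lambda>y. v y = u y) (nhds x)"
      using R by (auto simp: eventually_nhds v_def B_def intro!: exI[of _ "ball x R"])
    ultimately show ?thesis by (simp add: isCont_cong)
  qed
  have L3: "A3 \<longlonglongrightarrow> v x"
  proof -
    \<comment> \<open>At this scale \<open>t + d n\<close> becomes
      \<open>d n * (1 + (norm z)^2)\<close>, so all powers of \<open>d n\<close> and
      \<open>R\<close> cancel outside \<open>v\<close> and \<open>cutoff\<close>.\<close>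
    define c where "c n = R * sqrt (d n)" for n
    have c: "c n > 0" "(c n)\<^sup>2 = R\<^sup>2 * d n" for n
      using R d[of n] by (simp_all add: c_def power_mult_distrib)
    have tc: "t (x + c n *\<^sub>R z) = d n * (norm z)\<^sup>2" for n z
      using R c by (simp add: t_def power_mult_distrib)
    have "A3 = (\<lambda>n. LINT z|lborel. v (x + c n *\<^sub>R z) * cutoff (d n * (1 + (norm z)\<^sup>2)) ^ 4 * (1 / (1 + (norm z)\<^sup>2)\<^sup>2 / pi))"
    proof (rule ext)
      fix n
      have "A3 n = (c n)\<^sup>2 * (LINT z|lborel. v (x + c n *\<^sub>R z) *
         (d n * cutoff (t (x + c n *\<^sub>R z) + d n) ^ 4 / (p * (t (x + c n *\<^sub>R z) + d n)\<^sup>2)))"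
        unfolding A3_def by (rule integral_scale_plane) (use c in measurable)
      also have "\<dots> = (LINT z|lborel. (c n)\<^sup>2 * (v (x + c n *\<^sub>R z) *
         (d n * cutoff (t (x + c n *\<^sub>R z) + d n) ^ 4 / (p * (t (x + c n *\<^sub>R z) + d n)\<^sup>2))))"
        by (rule Bochner_Integration.integral_mult_right_zero[symmetric])
      also have "\<dots> = (LINT z|lborel. v (x + c n *\<^sub>R z) * cutoff (d n * (1 + (norm z)\<^sup>2)) ^ 4 * (1 / (1 + (norm z)\<^sup>2)\<^sup>2 / pi))"
      proof (rule Bochner_Integration.integral_cong[OF refl])
        fix z :: plane
        have e: "t (x + c n *\<^sub>R z) + d n = d n * (1 + (norm z)\<^sup>2)" by (simp add: tc algebra_simps)
        have alg: "R\<^sup>2 * D * (V * (D * Q / (pi * R\<^sup>2 * (D * N)\<^sup>2))) = V * Q * (1 / N\<^sup>2 / pi)"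
          if "D > 0" "N > 0" for D V Q N :: real
          using that R by (simp add: field_simps power2_eq_square)
        have "1 + (norm z)\<^sup>2 > 0" by (simp add: add_pos_nonneg)
        then show "(c n)\<^sup>2 * (v (x + c n *\<^sub>R z) * (d n * cutoff (t (x + c n *\<^sub>R z) + d n) ^ 4 / (p * (t (x + c n *\<^sub>R z) + d n)\<^sup>2)))
            = v (x + c n *\<^sub>R z) * cutoff (d n * (1 + (norm z)\<^sup>2)) ^ 4 * (1 / (1 + (norm z)\<^sup>2)\<^sup>2 / pi)"
          unfolding e c(2) p_def by (rule alg[OF d])
      qed
      finally show "A3 n = (LINT z|lborel. v (x + c n *\<^sub>R z) * cutoff (d n * (1 + (norm z)\<^sup>2)) ^ 4 * (1 / (1 + (norm z)\<^sup>2)\<^sup>2 / pi))" .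
    qed
    moreover have "(\<lambda>n. LINT z|lborel. v (x + c n *\<^sub>R z) * cutoff (d n * (1 + (norm z)\<^sup>2)) ^ 4 * (1 / (1 + (norm z)\<^sup>2)\<^sup>2 / pi))
        \<longlonglongrightarrow> (LINT z::plane|lborel. v x * (1 / (1 + (norm z)\<^sup>2)\<^sup>2 / pi))"
    proof (rule integral_dominated_convergence)
      show "integrable lborel (\<lambda>z::plane. M * (1 / (1 + (norm z)\<^sup>2)\<^sup>2 / pi))"
        by (intro integrable_mult_right integrable_divide integral_inv_sq)
      show "AE z in lborel. (\<lambda>n. v (x + c n *\<^sub>R z) * cutoff (d n * (1 + (norm z)\<^sup>2)) ^ 4 * (1 / (1 + (norm z)\<^sup>2)\<^sup>2 / pi))
        \<longlonglongrightarrow> v x * (1 / (1 + (norm z)\<^sup>2)\<^sup>2 / pi)"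
      proof (rule AE_I2)
        fix z :: plane
        have c0: "c \<longlonglongrightarrow> R * sqrt 0" unfolding c_def by (intro tendsto_intros d0)
        have "(\<lambda>n. x + c n *\<^sub>R z) \<longlonglongrightarrow> x + (R * sqrt 0) *\<^sub>R z" by (intro tendsto_add tendsto_scaleR tendsto_const c0)
        then have "(\<lambda>n. v (x + c n *\<^sub>R z)) \<longlonglongrightarrow> v x" using isCont_tendsto_compose[OF cv] by simp
        moreover have "(\<lambda>n. cutoff (d n * (1 + (norm z)\<^sup>2))) \<longlonglongrightarrow> cutoff (0 * (1 + (norm z)\<^sup>2))"
          by (intro isCont_tendsto_compose[OF qc] tendsto_mult d0 tendsto_const)
        ultimately have "(\<lambda>n. v (x + c n *\<^sub>R z) * cutoff (d n * (1 + (norm z)\<^sup>2)) ^ 4 * (1 / (1 + (norm z)\<^sup>2)\<^sup>2 / pi))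
           \<longlonglongrightarrow> v x * cutoff (0 * (1 + (norm z)\<^sup>2)) ^ 4 * (1 / (1 + (norm z)\<^sup>2)\<^sup>2 / pi)"
          by (intro tendsto_mult tendsto_power tendsto_const)
        then show "(\<lambda>n. v (x + c n *\<^sub>R z) * cutoff (d n * (1 + (norm z)\<^sup>2)) ^ 4 * (1 / (1 + (norm z)\<^sup>2)\<^sup>2 / pi))
           \<longlonglongrightarrow> v x * (1 / (1 + (norm z)\<^sup>2)\<^sup>2 / pi)" by (simp add: cutoff_def)
      qed
      show "AE z in lborel. norm (v (x + c n *\<^sub>R z) * cutoff (d n * (1 + (norm z)\<^sup>2)) ^ 4 * (1 / (1 + (norm z)\<^sup>2)\<^sup>2 / pi))
         \<le> M * (1 / (1 + (norm z)\<^sup>2)\<^sup>2 / pi)" for n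
      proof (rule AE_I2)
        fix z :: plane
        have "\<bar>v (x + c n *\<^sub>R z)\<bar> \<le> M"
          using vM(1)[of "x + c n *\<^sub>R z"] M(3) by (cases "x + c n *\<^sub>R z \<in> B") auto
        moreover have "\<bar>cutoff (d n * (1 + (norm z)\<^sup>2)) ^ 4\<bar> \<le> 1" using q01 d[of n] by simp
        ultimately have "\<bar>v (x + c n *\<^sub>R z)\<bar> * \<bar>cutoff (d n * (1 + (norm z)\<^sup>2)) ^ 4\<bar> \<le> M * 1"
          using M(3) by (intro mult_mono) auto
        then have "\<bar>v (x + c n *\<^sub>R z)\<bar> * \<bar>cutoff (d n * (1 + (norm z)\<^sup>2)) ^ 4\<bar> * (1 / (1 + (norm z)\<^sup>2)\<^sup>2 / pi) \<le> M * 1 * (1 / (1 + (norm z)\<^sup>2)\<^sup>2 / pi)"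
          by (intro mult_right_mono) auto
        then show "norm (v (x + c n *\<^sub>R z) * cutoff (d n * (1 + (norm z)\<^sup>2)) ^ 4 * (1 / (1 + (norm z)\<^sup>2)\<^sup>2 / pi))
           \<le> M * (1 / (1 + (norm z)\<^sup>2)\<^sup>2 / pi)"
          by (simp add: abs_mult)
      qed
    qed measurable
    moreover have "(LINT z::plane|lborel. v x * (1 / (1 + (norm z)\<^sup>2)\<^sup>2 / pi)) = v x"
      by (simp only: Bochner_Integration.integral_mult_right_zero integral_divide_zero integral_inv_sq) simp
    ultimately show ?thesis by (simp only:)
  qed
  have L4: "A4 \<longlonglongrightarrow> (LINT y|lborel. ker R 0 (y - x) * l y)"
    unfolding A4_def
  proof (rule integral_dominated_convergence)
    show "integrable lborel (\<lambda>y. M * ker R 0 (x - y))"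
      by (intro integrable_mult_right integrable_ker R)
    show "AE y in lborel. (\<lambda>n. ker R (d n) (y - x) * l y) \<longlonglongrightarrow> ker R 0 (y - x) * l y"
      using AE_lborel_singleton[of x]
    proof eventually_elim
      case (elim y)
      have "t y > 0" using R elim by (simp add: t_def)
      then have "(\<lambda>n. log_cutoff (t y + d n) / (4 * pi)) \<longlonglongrightarrow> log_cutoff (t y) / (4 * pi)"
        by (intro tendsto_divide tendsto_const isCont_tendsto_compose[OF DERIV_isCont[OF log_cutoff_deriv] td]) auto
      then show ?case
        using ker_eq_log_cutoff[of "d _" "y - x" R] ker_eq_log_cutoff[of 0 "y - x" R] R elim d unfolding t_def
        by (intro tendsto_mult tendsto_const) (simp add: less_imp_le)
    qed
    show "AE y in lborel. norm (ker R (d n) (y - x) * l y) \<le> M * ker R 0 (x - y)" for n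
      using AE_lborel_singleton[of x]
    proof eventually_elim
      case (elim y)
      have "\<bar>ker R (d n) (y - x)\<bar> \<le> ker R 0 (x - y)"
        using ker_le_ker_0[of "d n" "y - x" R] elim d[of n] R ker_nonneg[of R "d n" "y - x"] ker_minus[of R 0 "y - x"]
        by simp
      moreover have "\<bar>l y\<bar> \<le> M" using vM(2)[of y] M(3) by (cases "y \<in> B") auto
      ultimately have "\<bar>ker R (d n) (y - x)\<bar> * \<bar>l y\<bar> \<le> ker R 0 (x - y) * M"
        by (intro mult_mono ker_nonneg) auto
      then show ?case by (simp add: abs_mult mult.commute)
    qed
  qed measurable
  have "(\<lambda>n. A1 n - A2 n - A3 n) \<longlonglongrightarrow> (LINT y|lborel. v y * (4 / p * cutoff (t y) ^ 3)) - (LINT y::plane|lborel. 0) - v x"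
    by (intro tendsto_diff L1 L2 L3)
  then have "(LINT y|lborel. v y * (4 / p * cutoff (t y) ^ 3)) - v x = (LINT y|lborel. ker R 0 (y - x) * l y)"
    using LIMSEQ_unique[OF L4] by (simp add: eq)
  moreover have "v x = u x" using R by (simp add: v_def B_def)
  moreover have "(LINT y|lborel. v y * (4 / p * cutoff (t y) ^ 3)) = ?P"
  proof (rule Bochner_Integration.integral_cong[OF refl])
    fix y show "v y * (4 / p * cutoff (t y) ^ 3) = rho R (x - y) * u y"
      using rho_eq_0[of R "x - y"] R
      by (cases "y \<in> B") (auto simp: v_def t_def p_def rho_def B_def dist_norm norm_minus_commute)
  qed
  moreover have "(LINT y|lborel. ker R 0 (y - x) * l y) = - ?K"
    unfolding Bochner_Integration.integral_minus[symmetric]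
  proof (rule Bochner_Integration.integral_cong[OF refl])
    fix y show "ker R 0 (y - x) * l y = - (ker R 0 (x - y) * - laplacian u y)"
      using ker_eq_0[of R 0 "x - y"] R ker_minus[of R 0 "x - y"] L[of y]
      by (cases "y \<in> B") (auto simp: l_def B_def dist_norm)
  qed
  ultimately show ?thesis by linarith
qed

section \<open>Regularity of distributional solutions\<close>

lemma conv_commute:
  fixes a b :: "plane \<Rightarrow> real"
  assumes [measurable]: "a \<in> borel_measurable borel" "b \<in> borel_measurable borel"
  shows "conv a b x = conv b a x"
proof -
  have "(LINT y|lborel. (\<lambda>y. a (x - y) * b y) (x - y)) = (LINT y|lborel. a (x - y) * b y)"
    by (rule integral_reflect_plane) measurable
  then show ?thesis by (simp add: conv_def mult.commute)
qed

lemma loc_int_measurable: "loc_int a \<Longrightarrow> a \<in> borel_measurable borel"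
  by (simp add: loc_int_def)

lemma loc_int_continuous: "continuous_on UNIV a \<Longrightarrow> loc_int a"
  using borel_integrable_compact[OF compact_cball, of 0 _ a] continuous_on_subset[of UNIV a]
  by (auto simp: loc_int_def borel_measurable_continuous_onI)

lemma loc_int_integrable: "integrable lborel a \<Longrightarrow> loc_int a"
  unfolding loc_int_def
  by (auto intro: integrable_real_mult_indicator simp: mult.commute)

text \<open>Evenness of \<open>g\<close> turns \<open>g (z - x)\<close> into
  \<open>g (x - z)\<close>, so convolution with \<open>g\<close> is symmetric for the pairing of
  \<open>w\<close> with \<open>\<psi>\<close>. The supports of \<open>g\<close> and
  \<open>\<psi>\<close> confine \<open>x\<close> to the ball of radius \<open>R + R'\<close>, where
  \<open>w\<close> is integrable.\<close>

lemma conv_fubini: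
  fixes g w \<psi> :: "plane \<Rightarrow> real"
  assumes g: "integrable lborel g" "\<And>y. norm y > R \<Longrightarrow> g y = 0" "\<And>y. g (- y) = g y"
    and w: "loc_int w"
    and \<psi>[measurable]: "\<psi> \<in> borel_measurable borel" and M: "\<And>y. \<bar>\<psi> y\<bar> \<le> M" and supp: "\<And>y. norm y > R' \<Longrightarrow> \<psi> y = 0"
  shows "integrable lborel (\<lambda>z. \<psi> z * conv w g z)"
    and "(LINT x|lborel. w x * conv \<psi> g x) = (LINT z|lborel. \<psi> z * conv w g z)"
    and "integrable lborel (\<lambda>x. w x * conv \<psi> g x)"
proof -
  have [measurable]: "g \<in> borel_measurable borel" "w \<in> borel_measurable borel"
    using borel_measurable_integrable[OF g(1)] loc_int_measurable[OF w] by auto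
  define F where "F x z = w x * g (z - x) * \<psi> z" for x z
  have [measurable]: "case_prod F \<in> borel_measurable (lborel \<Otimes>\<^sub>M lborel)"
    unfolding F_def by measurable
  define A where "A = (LINT z|lborel. \<bar>g z\<bar>)"
  define \<rho> where "\<rho> = R + R'"
  have ig: "integrable lborel (\<lambda>z. \<bar>g (z - x)\<bar>)" "(LINT z|lborel. \<bar>g (z - x)\<bar>) = A" for x
  proof -
    have e: "(\<lambda>z. \<bar>g (z - x)\<bar>) = (\<lambda>z. \<bar>g (x - z)\<bar>)" using g(3)[of "x - _"] by simp
    show "integrable lborel (\<lambda>z. \<bar>g (z - x)\<bar>)"
      unfolding e by (rule integrable_reflect_plane[THEN iffD2]) (use g in auto)
    show "(LINT z|lborel. \<bar>g (z - x)\<bar>) = A"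
      unfolding e A_def by (rule integral_reflect_plane) simp
  qed
  have M0: "M \<ge> 0" using M[of 0] by linarith
  have F0: "F x z = 0" if "norm x > \<rho>" for x z
  proof (cases "norm z > R'")
    case False
    then have "norm (z - x) > R" using that norm_triangle_ineq2[of x z] by (simp add: \<rho>_def norm_minus_commute)
    then show ?thesis using g(2) by (simp add: F_def)
  qed (simp add: F_def supp)
  have Fle: "norm (F x z) \<le> \<bar>w x\<bar> * M * \<bar>g (z - x)\<bar>" for x z
    using mult_left_mono[OF M[of z], of "\<bar>w x\<bar> * \<bar>g (z - x)\<bar>"]
    by (simp add: F_def abs_mult mult.commute mult.left_commute)
  have iF: "integrable lborel (F x)" for x
  proof (rule Bochner_Integration.integrable_bound)
    show "integrable lborel (\<lambda>z. \<bar>w x\<bar> * M * \<bar>g (z - x)\<bar>)" by (intro integrable_mult_right ig)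
    show "AE z in lborel. norm (F x z) \<le> norm (\<bar>w x\<bar> * M * \<bar>g (z - x)\<bar>)"
      using Fle by (intro AE_I2) (metis abs_ge_self order_trans real_norm_def)
  qed (simp add: F_def)
  have "integrable (lborel \<Otimes>\<^sub>M lborel) (case_prod F)"
  proof (rule lborel_pair.Fubini_integrable)
    show "AE x in lborel. integrable lborel (\<lambda>y. case_prod F (x, y))" using iF by simp
    show "integrable lborel (\<lambda>x. LINT y|lborel. norm (case_prod F (x, y)))"
    proof (rule Bochner_Integration.integrable_bound)
      show "integrable lborel (\<lambda>x. M * A * \<bar>indicator (cball 0 \<rho>) x * w x\<bar>)"
        using w by (auto simp: loc_int_def)
      show "AE x in lborel. norm (LINT y|lborel. norm (case_prod F (x, y))) \<le> norm (M * A * \<bar>indicator (cball 0 \<rho>) x * w x\<bar>)"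
      proof (rule AE_I2)
        fix x
        show "norm (LINT y|lborel. norm (case_prod F (x, y))) \<le> norm (M * A * \<bar>indicator (cball 0 \<rho>) x * w x\<bar>)"
        proof (cases "norm x > \<rho>")
          case True then show ?thesis using F0 by simp
        next
          case False
          have "(LINT y|lborel. norm (F x y)) \<le> (LINT z|lborel. \<bar>w x\<bar> * M * \<bar>g (z - x)\<bar>)"
            using iF Fle by (intro integral_mono integrable_mult_right ig integrable_norm) auto
          also have "\<dots> = \<bar>w x\<bar> * M * A" using ig(2)[of x] by simp
          finally show ?thesis using False M0 by (simp add: abs_mult A_def mult.commute mult.left_commute)
        qed
      qed
    qed measurable
  qed simp
  note I = lborel_pair.Fubini_integral[OF this] lborel_pair.integrable_snd[OF this] lborel_pair.integrable_fst[OF this]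
  have c1: "(LINT z|lborel. F x z) = w x * conv \<psi> g x" for x
  proof -
    have "F x z = w x * (\<psi> z * g (x - z))" for z using g(3)[of "x - z"] by (simp add: F_def mult.commute)
    then show ?thesis by (simp add: conv_def)
  qed
  have c2: "(LINT x|lborel. F x z) = \<psi> z * conv w g z" for z
  proof -
    have "F x z = \<psi> z * (w x * g (z - x))" for x by (simp add: F_def mult.commute)
    then show ?thesis by (simp add: conv_def)
  qed
  show "integrable lborel (\<lambda>z. \<psi> z * conv w g z)" using I(2) by (simp add: c2)
  show "(LINT x|lborel. w x * conv \<psi> g x) = (LINT z|lborel. \<psi> z * conv w g z)"
    using I(1) by (simp add: c1 c2)
  show "integrable lborel (\<lambda>x. w x * conv \<psi> g x)" using I(3) by (simp add: c1)
qed

lemma conv_measurable[measurable]: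
  assumes [measurable]: "a \<in> borel_measurable borel" "b \<in> borel_measurable borel"
  shows "conv a (b :: plane \<Rightarrow> real) \<in> borel_measurable borel"
proof -
  have "conv a b \<in> borel_measurable lborel"
    unfolding conv_def[abs_def] by (rule lborel.borel_measurable_lebesgue_integral) measurable
  then show ?thesis by simp
qed

lemma loc_int_conv:
  assumes g: "integrable lborel g" "\<And>y. norm y > R \<Longrightarrow> g y = 0" "\<And>y. g (- y) = g y"
    and w: "loc_int w"
  shows "loc_int (conv w g)"
  unfolding loc_int_def
proof (intro conjI allI)
  show "conv w g \<in> borel_measurable borel"
    using borel_measurable_integrable[OF g(1)] loc_int_measurable[OF w] by (intro conv_measurable) auto
  show "integrable lborel (\<lambda>y. indicator (cball 0 r) y * conv w g y)" for r
    by (rule conv_fubini(1)[OF g w, where M=1 and R'=r]) (auto simp: indicator_def)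
qed

lemma conv_C2:
  assumes a: "loc_int a" and b: "C2_on UNIV b G Hs"
    and supp: "(\<forall>y. norm y > R \<longrightarrow> a y = 0) \<or> (\<forall>y. norm y > R \<longrightarrow> b y = 0)"
  shows "C2_on UNIV (conv a b) (conv a G) (\<lambda>e. conv a (Hs e))"
  unfolding C2_on_def
proof (intro conjI ballI)
  have far: "norm (x - y) > R" if "R + norm x < norm y" for x y :: plane
    using that norm_triangle_ineq2[of y x] by (simp add: norm_minus_commute)
  have z: "norm y > R" if "R + norm x < norm y" for x y :: plane
    using that norm_ge_zero[of x] by linarith
  show "C1_on UNIV (conv a b) (conv a G)"
    by (rule conv_C1[OF a C2_on_C1[OF b], of R]) (use supp far z in blast)
  fix e :: plane assume e: "e \<in> Basis"
  have Gz: "(\<forall>y. norm y > R \<longrightarrow> a y = 0) \<or> (\<forall>y. norm y > R \<longrightarrow> G y = 0)"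
  proof -
    have "open {z::plane. norm z > R}"
      by (intro open_Collect_less continuous_on_const continuous_on_norm continuous_on_id)
    then show ?thesis using supp C1_on_grad_eq_0[OF C2_on_C1[OF b], of "{z::plane. norm z > R}"] by blast
  qed
  have "C1_on UNIV (conv a (\<lambda>x. G x \<bullet> e)) (conv a (Hs e))"
    by (rule conv_C1[OF a C2_on_C1_grad[OF b e], of R]) (use Gz far z in force)
  moreover have "conv a (\<lambda>x. G x \<bullet> e) x = conv a G x \<bullet> e" for x
  proof -
    have "integrable lborel (\<lambda>y. a y *\<^sub>R G (x - y))"
      by (rule conv_integrable[OF a C1_on_continuous_grad[OF C2_on_C1[OF b]], of "R + norm x"]) (use Gz far z in blast)
    then show ?thesis unfolding conv_def by (subst integral_inner_left[symmetric]) auto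
  qed
  then have "conv a (\<lambda>x. G x \<bullet> e) = (\<lambda>x. conv a G x \<bullet> e)" by (rule ext)
  ultimately show "C1_on UNIV (\<lambda>x. conv a G x \<bullet> e) (conv a (Hs e))" by (simp only:)
qed

text \<open>All derivatives fall on \<open>\<psi>\<close>. The induction generalises over
  \<open>\<psi>\<close>, because its directional derivatives are again smooth.\<close>

lemma Ck_on_conv:
  assumes a: "loc_int a" "\<And>y. norm y > R \<Longrightarrow> a y = 0" and \<psi>: "smooth \<psi>"
  shows "Ck_on k (conv a \<psi>) UNIV"
  using \<psi>
proof (induction k arbitrary: \<psi>)
  case 0
  have z: "norm y > R" if "R + norm x < norm y" for x y :: plane
    using that norm_ge_zero[of x] by linarith
  have "continuous_on UNIV \<psi>" using spec[OF 0, of 0] by simp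
  then show ?case using a(2) z by (auto intro!: conv_continuous[OF a(1), of _ R])
next
  case (Suc k)
  have z: "norm y > R" if "R + norm x < norm y" for x y :: plane
    using that norm_ge_zero[of x] by linarith
  obtain G Hs where "C2_on UNIV \<psi> G Hs" using smooth_C2_on[OF Suc.prems] .
  then have G: "C1_on UNIV \<psi> G" by (rule C2_on_C1)
  have c: "C1_on UNIV (conv a \<psi>) (conv a G)"
    by (rule conv_C1[OF a(1) G, of R]) (use a(2) z in blast)
  have Gv: "conv a G x \<bullet> v = conv a (\<lambda>x. frechet_derivative \<psi> (at x) v) x" for x v
  proof -
    have "integrable lborel (\<lambda>y. a y *\<^sub>R G (x - y))"
      by (rule conv_integrable[OF a(1) C1_on_continuous_grad[OF G], of R]) (use a(2) in blast)
    then show ?thesis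
      unfolding conv_def by (subst integral_inner_left[symmetric]) (auto simp: frechet_derivative_C1_on[OF G])
  qed
  show ?case
  proof (rule Ck_on_Suc_derivI[of UNIV _ "\<lambda>x h. conv a G x \<bullet> h"])
    show "Ck_on k (\<lambda>x. conv a G x \<bullet> v) UNIV" for v
    proof -
      have "Ck_on j (\<lambda>x. frechet_derivative \<psi> (at x) v) UNIV" for j
        using spec[OF Suc.prems, of "Suc j"] by simp
      then show ?thesis unfolding Gv using Suc.IH[of "\<lambda>x. frechet_derivative \<psi> (at x) v"] by simp
    qed
  qed (use c in \<open>auto simp: C1_on_def\<close>)
qed

lemma loc_int_ker: "R > 0 \<Longrightarrow> loc_int (ker R 0)"
  using integrable_ker_power[of R 1] by (intro loc_int_integrable) simp

lemma integrable_rho: "R > 0 \<Longrightarrow> integrable lborel (rho R)"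
proof -
  assume R: "R > 0"
  have "continuous_on UNIV (rho R)" unfolding rho_def[abs_def] cutoff_def divide_inverse by (intro continuous_intros)
  then have "integrable lborel (\<lambda>x. indicator (cball 0 R) x * rho R x)"
    using loc_int_continuous unfolding loc_int_def by blast
  moreover have "indicator (cball 0 R) x * rho R x = rho R x" for x
    using rho_eq_0[OF R, of x] by (cases "norm x \<le> R") auto
  ultimately show ?thesis by simp
qed

text \<open>This is the function with which the weak equation is tested: it inverts the Laplacian on
  \<open>\<psi>\<close> up to a smoothing. The formula is Green's representation of
  \<open>\<psi>\<close>, with the Laplacian taken out of the convolution.\<close>

lemma test_conv_ker:
  assumes R: "R > 0" and \<psi>: "test_function \<psi>"
  shows "test_function (conv \<psi> (ker R 0))"
    and "laplacian (conv \<psi> (ker R 0)) x = conv \<psi> (rho R) x - \<psi> x"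
proof -
  have sm: "smooth \<psi>" using \<psi> by (simp add: test_function_def)
  have c0: "continuous_on UNIV \<psi>" using spec[OF sm, of 0] by simp
  have [measurable]: "\<psi> \<in> borel_measurable borel"
    using c0 by (simp add: borel_measurable_continuous_onI)
  obtain R' where R': "R' > 0" "\<And>x. norm x > R' \<Longrightarrow> \<psi> x = 0" using test_function_cball[OF \<psi>] by blast
  have k0: "norm y > R \<Longrightarrow> ker R 0 y = 0" for y using ker_eq_0[OF R, of 0 y] by simp
  have cc: "conv \<psi> (ker R 0) = conv (ker R 0) \<psi>" by (rule ext, rule conv_commute) auto
  show "test_function (conv \<psi> (ker R 0))"
  proof (rule test_functionI)
    show "smooth (conv \<psi> (ker R 0))"
      unfolding cc using Ck_on_conv[OF loc_int_ker[OF R] k0 sm] by blast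
    show "conv \<psi> (ker R 0) x = 0" if "norm x > R + R'" for x
    proof -
      have "\<psi> y *\<^sub>R ker R 0 (x - y) = 0" for y
        using k0[of "x - y"] R'(2)[of y] that norm_triangle_ineq[of "x - y" y] by (cases "norm y > R'") auto
      then show ?thesis unfolding conv_def by (simp only: Bochner_Integration.integral_zero)
    qed
  qed
  obtain G Hs where C: "C2_on UNIV \<psi> G Hs" using smooth_C2_on[OF sm] .
  have L: "laplacian \<psi> = (\<lambda>x. \<Sum>e\<in>Basis. Hs e x \<bullet> e)"
    using laplacian_C2_on[OF open_UNIV C] by auto
  have "C2_on UNIV (conv (ker R 0) \<psi>) (conv (ker R 0) G) (\<lambda>e. conv (ker R 0) (Hs e))"
    by (rule conv_C2[OF loc_int_ker[OF R] C, of R]) (use k0 in blast)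
  from laplacian_C2_on[OF open_UNIV this]
  have "laplacian (conv \<psi> (ker R 0)) x = (\<Sum>e\<in>Basis. conv (ker R 0) (Hs e) x \<bullet> e)" by (simp add: cc)
  also have "\<dots> = conv (ker R 0) (laplacian \<psi>) x"
  proof -
    have i: "integrable lborel (\<lambda>y. ker R 0 y *\<^sub>R Hs e (x - y))" if "e \<in> Basis" for e
      by (rule conv_integrable[OF loc_int_ker[OF R] C1_on_continuous_grad[OF C2_on_C1_grad[OF C that]], of R])
         (use k0 in blast)
    have "(\<Sum>e\<in>Basis. conv (ker R 0) (Hs e) x \<bullet> e) = (\<Sum>e\<in>Basis. LINT y|lborel. (ker R 0 y *\<^sub>R Hs e (x - y)) \<bullet> e)"
      unfolding conv_def by (intro sum.cong refl integral_inner_left[symmetric] i)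
    also have "\<dots> = (LINT y|lborel. (\<Sum>e\<in>Basis. (ker R 0 y *\<^sub>R Hs e (x - y)) \<bullet> e))"
      by (rule Bochner_Integration.integral_sum[symmetric]) (intro integrable_inner_left i)
    finally show ?thesis by (simp add: conv_def L sum_distrib_left)
  qed
  also have "\<dots> = (LINT y|lborel. laplacian \<psi> y * ker R 0 (x - y))"
  proof -
    have "laplacian \<psi> \<in> borel_measurable borel"
      unfolding L by (intro borel_measurable_continuous_onI continuous_on_sum continuous_on_inner continuous_on_const
          C1_on_continuous_grad[OF C2_on_C1_grad[OF C]])
    then show ?thesis by (subst conv_commute) (auto simp: conv_def)
  qed
  also have "\<dots> = conv \<psi> (rho R) x - \<psi> x"
    using green_representation[OF R open_UNIV subset_UNIV C, of x]
    by (simp add: conv_def mult.commute)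
  finally show "laplacian (conv \<psi> (ker R 0)) x = conv \<psi> (rho R) x - \<psi> x" .
qed

text \<open>Test the equation with \<open>conv \<psi> (ker R 0)\<close> and move both convolutions
  onto \<open>w\<close> and \<open>f\<close> by Fubini. The difference of the two sides is then
  orthogonal to every test function \<open>\<psi>\<close>.\<close>

lemma weak_solution_representation:
  assumes w: "loc_int w" and f: "integrable lborel f" and R: "R > 0"
    and weak: "\<And>\<psi>. test_function \<psi> \<Longrightarrow> - (LINT x|lborel. w x * laplacian \<psi> x) = (LINT x|lborel. f x * \<psi> x)"
  shows "AE x in lborel. w x = conv w (rho R) x + conv f (ker R 0) x"
proof -
  have k: "integrable lborel (ker R 0)" "\<And>y. norm y > R \<Longrightarrow> ker R 0 y = 0" "\<And>y. ker R 0 (- y) = ker R 0 y"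
    using integrable_ker_power[OF R, of 1] ker_eq_0[OF R, of 0] ker_minus by auto
  have r: "integrable lborel (rho R)" "\<And>y. norm y > R \<Longrightarrow> rho R y = 0" "\<And>y. rho R (- y) = rho R y"
    using integrable_rho[OF R] rho_eq_0[OF R] rho_minus by auto
  define h where "h x = w x - conv w (rho R) x - conv f (ker R 0) x" for x
  have lf: "loc_int f" using f by (rule loc_int_integrable)
  have lw: "loc_int (conv w (rho R))" and lk: "loc_int (conv f (ker R 0))"
    using loc_int_conv[OF r w] loc_int_conv[OF k lf] by auto
  have "loc_int h"
    using w lw lk unfolding loc_int_def h_def by (auto simp: right_diff_distrib)
  moreover have "(LINT x|lborel. h x * \<psi> x) = 0" if t: "test_function \<psi>" for \<psi>
  proof -
    have c0: "continuous_on UNIV \<psi>" using t by (metis Ck_on.simps(1) test_function_def)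
    have m[measurable]: "\<psi> \<in> borel_measurable borel" using c0 by (simp add: borel_measurable_continuous_onI)
    obtain R' where R': "R' > 0" "\<And>x. norm x > R' \<Longrightarrow> \<psi> x = 0" using test_function_cball[OF t] by blast
    have "compact (\<psi> ` cball 0 R')"
      by (intro compact_continuous_image continuous_on_subset[OF c0]) auto
    then obtain M0 where "\<forall>y\<in>\<psi> ` cball 0 R'. norm y \<le> M0"
      using compact_imp_bounded bounded_iff by blast
    then have M0: "\<And>x. norm x \<le> R' \<Longrightarrow> \<bar>\<psi> x\<bar> \<le> M0" by simp
    have M: "\<bar>\<psi> x\<bar> \<le> max M0 0" for x using M0[of x] R'(2)[of x] by (cases "norm x \<le> R'") auto
    note Fr = conv_fubini[OF r w m M R'(2)] and Fk = conv_fubini[OF k lf m M R'(2)]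
    have iw: "integrable lborel (\<lambda>x. w x * \<psi> x)"
      using conv_integrable[OF w c0, of "R'" 0]
    proof -
      have "continuous_on UNIV (\<lambda>y. \<psi> (- y))" by (intro continuous_on_compose2[OF c0] continuous_on_minus continuous_on_id) auto
      from conv_integrable[OF w this, of R' 0] R'(2) show ?thesis by simp
    qed
    note iwr = Fr(3)
    have "- (LINT x|lborel. w x * laplacian (conv \<psi> (ker R 0)) x) = (LINT x|lborel. f x * conv \<psi> (ker R 0) x)"
      by (rule weak[OF test_conv_ker(1)[OF R t]])
    also have "\<dots> = (LINT x|lborel. \<psi> x * conv f (ker R 0) x)" by (rule Fk(2))
    also have "(LINT x|lborel. w x * laplacian (conv \<psi> (ker R 0)) x) = (LINT x|lborel. w x * conv \<psi> (rho R) x - w x * \<psi> x)"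
      by (simp add: test_conv_ker(2)[OF R t] algebra_simps)
    also have "\<dots> = (LINT x|lborel. w x * conv \<psi> (rho R) x) - (LINT x|lborel. w x * \<psi> x)"
      by (rule Bochner_Integration.integral_diff[OF iwr iw])
    also have "(LINT x|lborel. w x * conv \<psi> (rho R) x) = (LINT z|lborel. \<psi> z * conv w (rho R) z)" by (rule Fr(2))
    finally have "(LINT x|lborel. w x * \<psi> x) - (LINT x|lborel. \<psi> x * conv w (rho R) x) - (LINT x|lborel. \<psi> x * conv f (ker R 0) x) = 0"
      by simp
    also have "(LINT x|lborel. w x * \<psi> x) - (LINT x|lborel. \<psi> x * conv w (rho R) x) - (LINT x|lborel. \<psi> x * conv f (ker R 0) x)
        = (LINT x|lborel. w x * \<psi> x - \<psi> x * conv w (rho R) x - \<psi> x * conv f (ker R 0) x)"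
      by (simp only: Bochner_Integration.integral_diff Bochner_Integration.integrable_diff iw Fr(1) Fk(1))
    also have "\<dots> = (LINT x|lborel. h x * \<psi> x)"
      by (simp add: h_def algebra_simps)
    finally show ?thesis .
  qed
  ultimately have "AE x in lborel. h x = 0" by (rule AE_eq_0_of_test_functions)
  then show ?thesis by eventually_elim (simp add: h_def)
qed

text \<open>The convolution of \<open>f\<close> with the kernel, taken in \<open>ennreal\<close> so
  that it can be estimated before it is known to be finite.\<close>

definition pot :: "(plane \<Rightarrow> real) \<Rightarrow> plane \<Rightarrow> ennreal" where
  "pot f x = (\<integral>\<^sup>+y. ennreal (ker 1 0 (x - y)) * ennreal (f y) \<partial>lborel)"

lemma pot_measurable[measurable]:
  assumes [measurable]: "f \<in> borel_measurable borel"
  shows "pot f \<in> borel_measurable borel"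
proof -
  have "pot f \<in> borel_measurable lborel"
    unfolding pot_def[abs_def] by measurable
  then show ?thesis by simp
qed

text \<open>Only an inequality, because \<open>conv\<close> has the default value 0 where the
  integral diverges.\<close>

lemma conv_ker_le_pot:
  assumes [measurable]: "f \<in> borel_measurable borel" and f: "\<And>x. f x \<ge> 0"
  shows "ennreal (conv f (ker 1 0) x) \<le> pot f x"
proof -
  have "conv f (ker 1 0) x = enn2real (\<integral>\<^sup>+y. ennreal (f y * ker 1 0 (x - y)) \<partial>lborel)"
    unfolding conv_def real_scaleR_def
    by (rule integral_eq_nn_integral) (use f ker_nonneg in auto)
  also have "(\<integral>\<^sup>+y. ennreal (f y * ker 1 0 (x - y)) \<partial>lborel) = pot f x"
    unfolding pot_def using f ker_nonneg by (simp add: ennreal_mult mult.commute)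
  finally show ?thesis
    by (cases "pot f x = top") (simp_all add: ennreal_enn2real less_top)
qed

text \<open>Jensen's inequality is only needed for powers \<open>2^n\<close>, where iterated Cauchy--Schwarz suffices.\<close>

lemma pot_power_le:
  assumes [measurable]: "f \<in> borel_measurable borel"
  defines "F \<equiv> (\<integral>\<^sup>+y. ennreal (f y) \<partial>lborel)"
  shows "pot f x ^ (2 ^ n) \<le> F ^ (2 ^ n - 1) * (\<integral>\<^sup>+y. ennreal (ker 1 0 (x - y) ^ (2 ^ n)) * ennreal (f y) \<partial>lborel)"
proof (induction n)
  case 0
  then show ?case by (simp add: pot_def)
next
  case (Suc n)
  let ?N = "2 ^ n :: nat"
  let ?A = "\<lambda>N. \<integral>\<^sup>+y. ennreal (ker 1 0 (x - y) ^ N) * ennreal (f y) \<partial>lborel"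
  have D: "(\<integral>\<^sup>+y. g y \<partial>density lborel (\<lambda>y. ennreal (f y))) = (\<integral>\<^sup>+y. g y * ennreal (f y) \<partial>lborel)"
    if [measurable]: "g \<in> borel_measurable borel" for g
    by (simp add: nn_integral_density mult.commute)
  \<comment> \<open>Cauchy-Schwarz for the measure with density \<open>f\<close>, whose total mass
    is \<open>F\<close>, against the constant 1; this doubles the exponent.\<close>
  have "(?A ?N)\<^sup>2 \<le> ?A (2 * ?N) * F"
  proof -
    have "(\<integral>\<^sup>+y. ennreal (ker 1 0 (x - y) ^ ?N) * 1 \<partial>density lborel (\<lambda>y. ennreal (f y)))\<^sup>2
      \<le> (\<integral>\<^sup>+y. (ennreal (ker 1 0 (x - y) ^ ?N))\<^sup>2 \<partial>density lborel (\<lambda>y. ennreal (f y)))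
        * (\<integral>\<^sup>+y. 1\<^sup>2 \<partial>density lborel (\<lambda>y. ennreal (f y)))"
      by (rule Cauchy_Schwarz_nn_integral) measurable
    moreover have "(ennreal (ker 1 0 (x - y) ^ ?N))\<^sup>2 = ennreal (ker 1 0 (x - y) ^ (2 * ?N))" for y
      by (simp add: ennreal_power ker_nonneg power_mult[symmetric] mult.commute)
    ultimately show ?thesis by (simp add: D F_def del: nn_integral_const)
  qed
  then have "(F ^ (?N - 1))\<^sup>2 * (?A ?N)\<^sup>2 \<le> (F ^ (?N - 1))\<^sup>2 * (?A (2 * ?N) * F)"
    by (rule mult_left_mono) simp
  moreover have "(pot f x ^ ?N)\<^sup>2 \<le> (F ^ (?N - 1) * ?A ?N)\<^sup>2"
    using Suc.IH by (intro power_mono) auto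
  ultimately have "(pot f x ^ ?N)\<^sup>2 \<le> (F ^ (?N - 1))\<^sup>2 * (?A (2 * ?N) * F)"
    by (simp add: power_mult_distrib)
  also have "\<dots> = F ^ Suc ((?N - 1) * 2) * ?A (2 * ?N)"
    by (simp add: power_mult[symmetric] ac_simps)
  also have "Suc ((?N - 1) * 2) = 2 ^ Suc n - 1"
  proof -
    have "?N \<ge> 1" by simp
    then show ?thesis by (cases ?N) simp_all
  qed
  finally show ?case by (simp add: power_mult[symmetric] mult.commute)
qed

text \<open>Integrating \<open>pot_power_le\<close> and exchanging the integrals yields the last
  factor \<open>F\<close>. With \<open>integrable_ker_power\<close> this puts the potential of an
  integrable \<open>f\<close> into \<open>L^N\<close> for every power \<open>N\<close> of
  two.\<close>

lemma nn_integral_pot_power: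
  assumes [measurable]: "f \<in> borel_measurable borel"
  defines "F \<equiv> (\<integral>\<^sup>+y. ennreal (f y) \<partial>lborel)"
  shows "(\<integral>\<^sup>+x. pot f x ^ (2 ^ n) \<partial>lborel) \<le> F ^ (2 ^ n) * (\<integral>\<^sup>+z. ennreal (ker 1 0 z ^ (2 ^ n)) \<partial>lborel)"
proof -
  let ?N = "2 ^ n :: nat"
  let ?k = "\<lambda>z. ennreal (ker 1 0 z ^ ?N)"
  have "(\<integral>\<^sup>+x. pot f x ^ ?N \<partial>lborel) \<le> (\<integral>\<^sup>+x. F ^ (?N - 1) * (\<integral>\<^sup>+y. ?k (x - y) * ennreal (f y) \<partial>lborel) \<partial>lborel)"
    using pot_power_le[of f _ n] unfolding F_def by (intro nn_integral_mono) auto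
  also have "\<dots> = F ^ (?N - 1) * (\<integral>\<^sup>+x. (\<integral>\<^sup>+y. ?k (x - y) * ennreal (f y) \<partial>lborel) \<partial>lborel)"
    by (rule nn_integral_cmult) measurable
  also have "(\<integral>\<^sup>+x. (\<integral>\<^sup>+y. ?k (x - y) * ennreal (f y) \<partial>lborel) \<partial>lborel) = (\<integral>\<^sup>+y. (\<integral>\<^sup>+x. ?k (x - y) * ennreal (f y) \<partial>lborel) \<partial>lborel)"
    by (rule lborel_pair.Fubini') measurable
  also have "\<dots> = (\<integral>\<^sup>+y. ennreal (f y) * (\<integral>\<^sup>+z. ?k z \<partial>lborel) \<partial>lborel)"
  proof (rule nn_integral_cong)
    fix y
    have "(\<integral>\<^sup>+x. ?k (x - y) * ennreal (f y) \<partial>lborel) = (\<integral>\<^sup>+x. ?k (x - y) \<partial>lborel) * ennreal (f y)"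
      by (rule nn_integral_multc) measurable
    also have "(\<integral>\<^sup>+x. ?k (x - y) \<partial>lborel) = (\<integral>\<^sup>+x. ?k (y - x) \<partial>lborel)"
      using ker_minus[of 1 0 "y - _"] by simp
    also have "\<dots> = (\<integral>\<^sup>+z. ?k z \<partial>lborel)"
      by (rule nn_integral_reflect) measurable
    finally show "(\<integral>\<^sup>+x. ?k (x - y) * ennreal (f y) \<partial>lborel) = ennreal (f y) * (\<integral>\<^sup>+z. ?k z \<partial>lborel)"
      by (simp add: mult.commute)
  qed
  also have "\<dots> = F * (\<integral>\<^sup>+z. ?k z \<partial>lborel)" unfolding F_def by (rule nn_integral_multc) measurable
  also have "F ^ (?N - 1) * (F * (\<integral>\<^sup>+z. ?k z \<partial>lborel)) = F ^ Suc (?N - 1) * (\<integral>\<^sup>+z. ?k z \<partial>lborel)"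
    by (simp only: power_Suc ac_simps)
  finally show ?thesis by simp
qed

lemma add_power_le_nat:
  fixes a b :: real assumes "a \<ge> 0" "b \<ge> 0"
  shows "(a + b) ^ N \<le> 2 ^ N * (a ^ N + b ^ N)"
proof -
  have "(a + b) ^ N \<le> (2 * max a b) ^ N" using assms by (intro power_mono) auto
  also have "\<dots> = 2 ^ N * max a b ^ N" by (simp add: power_mult_distrib)
  also have "max a b ^ N \<le> a ^ N + b ^ N" using assms by (auto simp: max_def)
  finally show ?thesis by simp
qed

text \<open>The high integrability of the potential bounds the integrals of \<open>f^2\<close> over
  unit disks uniformly. As the kernel is also square integrable and supported in the unit disk, the
  potential is then bounded, hence so is \<open>w\<close> from above.\<close>

lemma weak_solution_bounded:
  fixes w :: "plane \<Rightarrow> real" and p :: real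
  assumes p: "p > 1" and w: "loc_int w" 
  defines "f \<equiv> (\<lambda>x. pos_part (w x) powr p)"
  assumes f: "integrable lborel f"
    and rep: "AE x in lborel. w x = conv w (rho 1) x + conv f (ker 1 0) x"
  obtains M where "M \<ge> 0" "AE x in lborel. w x \<le> M"
proof -
  have mw[measurable]: "w \<in> borel_measurable borel" by (rule loc_int_measurable[OF w])
  have mf[measurable]: "f \<in> borel_measurable borel" unfolding f_def pos_part_def by measurable
  have mp[measurable]: "pot f \<in> borel_measurable borel" by (rule pot_measurable[OF mf])
  have cb[measurable]: "cball x 1 \<in> sets borel" for x :: plane by simp
  have f0: "f x \<ge> 0" for x by (simp add: f_def)
  define F where "F = (\<integral>\<^sup>+y. ennreal (f y) \<partial>lborel)"
  have F: "F < \<infinity>" using f f0 unfolding F_def by (simp add: integrable_iff_bounded)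
  \<comment> \<open>Since \<open>t \<le> t powr p\<close> for \<open>t \<ge> 1\<close>. This bounds
    the average of \<open>w\<close> from above by the mass of \<open>f\<close>, although
    \<open>w\<close> may be very negative.\<close>
  have wf: "w x \<le> 1 + f x" for x
  proof (cases "w x \<le> 1")
    case False
    then have "w x powr 1 \<le> w x powr p" using p by (intro powr_mono) auto
    then show ?thesis using False by (simp add: f_def pos_part_def)
  qed (use f0[of x] in linarith)
  define M0 where "M0 = (LINT y|lborel. rho 1 y) + 4 / pi * (LINT y|lborel. f y)"
  have rw: "conv w (rho 1) x \<le> M0" for x
  proof -
    have r0: "rho 1 (x - y) = 0" if "norm y > 1 + norm x" for y
      using that norm_triangle_ineq2[of y x] by (intro rho_eq_0) (auto simp: norm_minus_commute)
    have cr: "continuous_on UNIV (rho 1)" unfolding rho_def[abs_def] cutoff_def divide_inverse by (intro continuous_intros)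
    have ir: "integrable lborel (\<lambda>y. rho 1 (x - y))"
      using integrable_reflect_plane[of "rho 1" x] integrable_rho[of 1] by simp
    have "conv w (rho 1) x \<le> (LINT y|lborel. rho 1 (x - y) + 4 / pi * f y)"
      unfolding conv_def real_scaleR_def
    proof (rule integral_mono)
      show "integrable lborel (\<lambda>y. w y * rho 1 (x - y))"
        using conv_integrable[OF w cr, of "1 + norm x" x] r0 by simp
      show "integrable lborel (\<lambda>y. rho 1 (x - y) + 4 / pi * f y)"
        using ir f by simp
      fix y
      have "w y * rho 1 (x - y) \<le> (1 + f y) * rho 1 (x - y)"
        using wf[of y] rho_nonneg by (rule mult_right_mono)
      also have "f y * rho 1 (x - y) \<le> f y * (4 / pi)"
        using rho_le[of 1 "x - y"] f0[of y] by (intro mult_left_mono) auto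
      then have "(1 + f y) * rho 1 (x - y) \<le> rho 1 (x - y) + 4 / pi * f y"
        by (simp add: algebra_simps)
      finally show "w y * rho 1 (x - y) \<le> rho 1 (x - y) + 4 / pi * f y" .
    qed
    also have "\<dots> = M0"
      unfolding M0_def using ir f by (simp add: integral_reflect_plane)
    finally show ?thesis .
  qed
  have M0: "M0 \<ge> 0" unfolding M0_def using rho_nonneg f0 by (intro add_nonneg_nonneg mult_nonneg_nonneg Bochner_Integration.integral_nonneg) auto
  \<comment> \<open>The power of two must dominate \<open>2 * p\<close>, because \<open>f^2\<close>
    is at most a bound on \<open>w\<close> raised to \<open>2 * p\<close>. Below,
    \<open>m \<ge> 1\<close> makes the powers of \<open>m + T\<close> increase with the
    exponent.\<close>
  obtain n :: nat where n: "2 * p \<le> 2 ^ n"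
    using real_arch_pow[of 2 "2 * p"] by (auto intro: less_imp_le)
  define N where "N = (2::nat) ^ n"
  define m where "m = 1 + M0"
  have m: "m \<ge> 1" using M0 by (simp add: m_def)
  have fsq: "AE x in lborel. ennreal ((f x)\<^sup>2) \<le> ennreal (2 ^ N) * (ennreal (m ^ N) + pot f x ^ N)"
    using rep
  proof eventually_elim
    case (elim x)
    define T where "T = conv f (ker 1 0) x"
    have T: "T \<ge> 0" unfolding T_def conv_def using f0 ker_nonneg by (intro Bochner_Integration.integral_nonneg) auto
    have "pos_part (w x) \<le> m + T" using elim rw[of x] T M0 by (simp add: pos_part_def m_def T_def)
    then have "pos_part (w x) powr p \<le> (m + T) powr p"
      using p by (intro powr_mono2) (auto simp: pos_part_def)
    then have "(f x)\<^sup>2 \<le> ((m + T) powr p)\<^sup>2" unfolding f_def by (intro power_mono) auto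
    also have "\<dots> = (m + T) powr (2 * p)" using m T by (simp add: powr_power)
    also have "\<dots> \<le> (m + T) powr (real N)" using n m T by (intro powr_mono) (auto simp: N_def)
    also have "\<dots> = (m + T) ^ N" using m T by (intro powr_realpow) auto
    also have "\<dots> \<le> 2 ^ N * (m ^ N + T ^ N)" using m T by (intro add_power_le_nat) auto
    finally have "ennreal ((f x)\<^sup>2) \<le> ennreal (2 ^ N * (m ^ N + T ^ N))" by (rule ennreal_leI)
    also have "\<dots> = ennreal (2 ^ N) * (ennreal (m ^ N) + ennreal T ^ N)"
      using m T by (simp add: ennreal_mult ennreal_plus ennreal_power)
    also have "\<dots> \<le> ennreal (2 ^ N) * (ennreal (m ^ N) + pot f x ^ N)"
      using conv_ker_le_pot[OF mf f0, of x] unfolding T_def by (intro mult_left_mono add_left_mono power_mono) auto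
    finally show ?case .
  qed
  define K where "K j = (\<integral>\<^sup>+z. ennreal (ker 1 0 z ^ j) \<partial>lborel)" for j
  have K: "K j < \<infinity>" if "j \<ge> 1" for j
    using integrable_ker_power[of 1 j] that unfolding K_def by (simp add: integrable_iff_bounded ker_nonneg)
  define C where "C = ennreal (2 ^ N) * (ennreal (m ^ N) * ennreal pi + F ^ N * K N)"
  have "N \<ge> 1" by (simp add: N_def)
  have C: "C < \<infinity>" unfolding C_def using F K[OF \<open>N \<ge> 1\<close>]
    by (auto simp: less_top[symmetric] ennreal_mult_eq_top_iff ennreal_add_eq_top power_eq_top_ennreal)
  have fC: "(\<integral>\<^sup>+y. ennreal ((f y)\<^sup>2) * indicator (cball x 1) y \<partial>lborel) \<le> C" for x
  proof -
    have "(\<integral>\<^sup>+y. ennreal ((f y)\<^sup>2) * indicator (cball x 1) y \<partial>lborel)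
       \<le> (\<integral>\<^sup>+y. ennreal (2 ^ N) * (ennreal (m ^ N) * indicator (cball x 1) y + pot f y ^ N) \<partial>lborel)"
    proof (rule nn_integral_mono_AE)
      show "AE y in lborel. ennreal ((f y)\<^sup>2) * indicator (cball x 1) y \<le> ennreal (2 ^ N) * (ennreal (m ^ N) * indicator (cball x 1) y + pot f y ^ N)"
        using fsq by eventually_elim (auto simp: indicator_def)
    qed
    also have "\<dots> = ennreal (2 ^ N) * (\<integral>\<^sup>+y. (ennreal (m ^ N) * indicator (cball x 1) y + pot f y ^ N) \<partial>lborel)"
      by (rule nn_integral_cmult) measurable
    also have "(\<integral>\<^sup>+y. (ennreal (m ^ N) * indicator (cball x 1) y + pot f y ^ N) \<partial>lborel)
       = (\<integral>\<^sup>+y. ennreal (m ^ N) * indicator (cball x 1) y \<partial>lborel) + (\<integral>\<^sup>+y. pot f y ^ N \<partial>lborel)"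
      by (rule nn_integral_add) measurable
    also have "(\<integral>\<^sup>+y. ennreal (m ^ N) * indicator (cball x 1) y \<partial>lborel) = ennreal (m ^ N) * ennreal pi"
      by (simp add: nn_integral_cmult_indicator emeasure_cball unit_ball_vol_2)
    also have "(\<integral>\<^sup>+y. pot f y ^ N \<partial>lborel) \<le> F ^ N * K N"
      using nn_integral_pot_power[OF mf, of n] unfolding F_def K_def N_def .
    finally show ?thesis unfolding C_def by (auto simp: add_left_mono mult_left_mono)
  qed
  have potC: "pot f x \<le> K 2 + C" for x
  proof -
    have "pot f x \<le> (\<integral>\<^sup>+y. ennreal (ker 1 0 (x - y) ^ 2) + ennreal ((f y)\<^sup>2) * indicator (cball x 1) y \<partial>lborel)"
      unfolding pot_def
    proof (rule nn_integral_mono)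
      fix y
      show "ennreal (ker 1 0 (x - y)) * ennreal (f y) \<le> ennreal (ker 1 0 (x - y) ^ 2) + ennreal ((f y)\<^sup>2) * indicator (cball x 1) y"
      proof (cases "y \<in> cball x 1")
        case True
        let ?k = "ker 1 0 (x - y)"
        \<comment> \<open>The elementary inequality \<open>k f \<le> k^2 + f^2\<close> separates
          kernel and density.\<close>
        have "0 \<le> (?k - f y)\<^sup>2" "0 \<le> ?k * f y" using ker_nonneg f0 by auto
        then have "?k * f y \<le> ?k ^ 2 + (f y)\<^sup>2" by (simp add: power2_diff)
        then have "ennreal (?k * f y) \<le> ennreal (?k ^ 2 + (f y)\<^sup>2)" by (rule ennreal_leI)
        then show ?thesis using True ker_nonneg f0 by (simp add: ennreal_mult ennreal_plus)
      next
        case False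
        then have "ker 1 0 (x - y) = 0" by (intro ker_eq_0) (auto simp: dist_norm)
        then show ?thesis by simp
      qed
    qed
    also have "\<dots> = (\<integral>\<^sup>+y. ennreal (ker 1 0 (x - y) ^ 2) \<partial>lborel) + (\<integral>\<^sup>+y. ennreal ((f y)\<^sup>2) * indicator (cball x 1) y \<partial>lborel)"
      by (rule nn_integral_add) measurable
    also have "(\<integral>\<^sup>+y. ennreal (ker 1 0 (x - y) ^ 2) \<partial>lborel) = K 2"
      unfolding K_def by (rule nn_integral_reflect) measurable
    finally show ?thesis using fC[of x] by (meson add_left_mono order_trans)
  qed
  define M where "M = M0 + enn2real (K 2 + C)"
  show ?thesis
  proof (rule that[of M])
    show "M \<ge> 0" using M0 by (simp add: M_def)
    show "AE x in lborel. w x \<le> M"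
      using rep
    proof eventually_elim
      case (elim x)
      have "ennreal (conv f (ker 1 0) x) \<le> K 2 + C" using conv_ker_le_pot[OF mf f0, of x] potC[of x] by (rule order_trans)
      also have "\<dots> = ennreal (enn2real (K 2 + C))" using K[of 2] C by (simp add: ennreal_enn2real)
      finally have "conv f (ker 1 0) x \<le> enn2real (K 2 + C)" by (simp add: ennreal_le_iff)
      then show ?case using elim rw[of x] by (simp add: M_def)
    qed
  qed
qed

section \<open>Potentials of bounded and of continuous densities\<close>

lemma grad_ker_measurable[measurable]: "grad_ker R \<delta> \<in> borel_measurable borel"
  unfolding grad_ker_def[abs_def] Let_def by measurable

text \<open>The bound does not depend on \<open>\<delta>\<close>, so it dominates the gradients as
  the smoothing is removed.\<close>

lemma grad_ker_norm_le:
  assumes "\<delta> \<ge> 0"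
  shows "norm (grad_ker 1 \<delta> z) \<le> 1 / (2 * pi) * (indicator (cball 0 1) z / norm z)"
proof (cases "z = 0 \<or> norm z > 1")
  case True
  have "cutoff ((norm z)\<^sup>2 + \<delta>) = 0" if "norm z > 1"
    using one_less_power[OF that, of 2] assms by (intro cutoff_eq_0) linarith
  then show ?thesis using True by (auto simp: grad_ker_def Let_def)
next
  case False
  define \<sigma> where "\<sigma> = (norm z)\<^sup>2 + \<delta>"
  have s: "\<sigma> \<ge> (norm z)\<^sup>2" "(norm z)\<^sup>2 > 0" using assms False by (auto simp: \<sigma>_def)
  have "cutoff \<sigma> ^ 4 \<le> 1" using cutoff_nonneg[of \<sigma>] cutoff_le_1[of \<sigma>] s by (intro power_le_one) auto
  then have "cutoff \<sigma> ^ 4 / \<sigma> \<le> 1 / (norm z)\<^sup>2" using s cutoff_nonneg[of \<sigma>] by (intro frac_le) auto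
  then have "1 / (2 * pi) * (cutoff \<sigma> ^ 4 / \<sigma> * norm z) \<le> 1 / (2 * pi) * (1 / (norm z)\<^sup>2 * norm z)"
    by (intro mult_left_mono mult_right_mono) auto
  moreover have "norm (grad_ker 1 \<delta> z) = 1 / (2 * pi) * (cutoff \<sigma> ^ 4 / \<sigma> * norm z)"
    using less_le_trans[OF s(2,1)] by (simp add: grad_ker_def Let_def \<sigma>_def[symmetric])
  ultimately show ?thesis using False by (simp add: power2_eq_square mult.commute mult.left_commute)
qed

lemma integrable_gker_conv:
  assumes [measurable]: "g \<in> borel_measurable borel" and g: "\<And>y. \<bar>g y\<bar> \<le> M" and "\<delta> \<ge> 0"
  shows "integrable lborel (\<lambda>y. g y *\<^sub>R grad_ker 1 \<delta> (x - y))"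
proof (rule Bochner_Integration.integrable_bound)
  show "integrable lborel (\<lambda>y::plane. M * (1 / (2 * pi) * (indicator (cball 0 1) (x - y) / norm (x - y))))"
    by (intro integrable_mult_right integrable_inv_norm_shift)
  show "AE y in lborel. norm (g y *\<^sub>R grad_ker 1 \<delta> (x - y)) \<le> norm (M * (1 / (2 * pi) * (indicator (cball 0 1) (x - y) / norm (x - y))))"
  proof (rule AE_I2)
    fix y
    have "\<bar>g y\<bar> * norm (grad_ker 1 \<delta> (x - y)) \<le> M * (1 / (2 * pi) * (indicator (cball 0 1) (x - y) / norm (x - y)))"
      using g[of y] grad_ker_norm_le[OF assms(3), of "x - y"] by (intro mult_mono) auto
    then show "norm (g y *\<^sub>R grad_ker 1 \<delta> (x - y)) \<le> norm (M * (1 / (2 * pi) * (indicator (cball 0 1) (x - y) / norm (x - y))))"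
      unfolding norm_scaleR real_norm_def by (rule order_trans[OF _ abs_ge_self])
  qed
qed measurable

text \<open>Convergence in \<open>L^1\<close> of the kernels is convergence of the convolutions with
  a bounded function, uniformly in the base point.\<close>

lemma grad_ker_L1_tendsto:
  assumes d: "\<And>n. d n > 0" "d \<longlonglongrightarrow> 0"
  shows "(\<lambda>n. LINT z|lborel. norm (grad_ker 1 (d n) z - grad_ker 1 0 z)) \<longlonglongrightarrow> 0"
proof -
  have "(\<lambda>n. LINT z|lborel. norm (grad_ker 1 (d n) z - grad_ker 1 0 z)) \<longlonglongrightarrow> (LINT z::plane|lborel. 0)"
  proof (rule integral_dominated_convergence)
    show "integrable lborel (\<lambda>z::plane. 2 * (1 / (2 * pi) * (indicator (cball 0 1) z / norm z)))"
      by (intro integrable_mult_right integrable_inv_norm)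
    show "AE z in lborel. (\<lambda>n. norm (grad_ker 1 (d n) z - grad_ker 1 0 z)) \<longlonglongrightarrow> 0"
      using AE_lborel_singleton[of 0]
    proof eventually_elim
      case (elim z)
      have qc: "isCont cutoff s" for s unfolding cutoff_def by (intro continuous_intros)
      have s: "(\<lambda>n. (norm z)\<^sup>2 + d n) \<longlonglongrightarrow> (norm z)\<^sup>2 + 0" by (intro tendsto_add tendsto_const d)
      have "(\<lambda>n. grad_ker 1 (d n) z) \<longlonglongrightarrow> grad_ker 1 0 z"
        unfolding grad_ker_def Let_def power_one div_by_1 using elim
        by (intro tendsto_scaleR tendsto_mult tendsto_divide tendsto_minus tendsto_power tendsto_const
            isCont_tendsto_compose[OF qc] s) auto
      then have "(\<lambda>n. norm (grad_ker 1 (d n) z - grad_ker 1 0 z)) \<longlonglongrightarrow> norm (grad_ker 1 0 z - grad_ker 1 0 z)"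
        by (intro tendsto_norm tendsto_diff tendsto_const)
      then show ?case by simp
    qed
    show "AE z in lborel. norm (norm (grad_ker 1 (d n) z - grad_ker 1 0 z)) \<le> 2 * (1 / (2 * pi) * (indicator (cball 0 1) z / norm z))" for n
    proof (rule AE_I2)
      fix z :: plane
      have "norm (grad_ker 1 (d n) z - grad_ker 1 0 z) \<le> norm (grad_ker 1 (d n) z) + norm (grad_ker 1 0 z)" by (rule norm_triangle_ineq4)
      also have "\<dots> \<le> 1 / (2 * pi) * (indicator (cball 0 1) z / norm z) + 1 / (2 * pi) * (indicator (cball 0 1) z / norm z)"
        using d(1)[of n] by (intro add_mono grad_ker_norm_le) auto
      finally show "norm (norm (grad_ker 1 (d n) z - grad_ker 1 0 z)) \<le> 2 * (1 / (2 * pi) * (indicator (cball 0 1) z / norm z))"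
        unfolding real_norm_def abs_norm_cancel by linarith
    qed
  qed measurable
  then show ?thesis by simp
qed

lemma loc_int_bounded:
  assumes [measurable]: "g \<in> borel_measurable borel" and g: "\<And>y. \<bar>g y\<bar> \<le> M"
  shows "loc_int g"
  unfolding loc_int_def
proof (intro conjI allI)
  fix R
  have "integrable lborel (\<lambda>y::plane. indicator (cball 0 R) y *\<^sub>R M)"
    using borel_integrable_compact[OF compact_cball, of 0 R "\<lambda>_. M"] by simp
  then show "integrable lborel (\<lambda>y. indicator (cball 0 R) y * g y)"
    by (rule Bochner_Integration.integrable_bound)
       (auto simp: indicator_def intro!: order_trans[OF g] AE_I2 borel_measurable_times borel_measurable_indicator)
qed fact

text \<open>The potentials of the smoothed kernels converge pointwise, and their gradients differ
  from the limit by at most \<open>M * E n\<close>, with \<open>E n\<close> independent of the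
  point. A uniform limit of continuous gradients is again a continuous gradient.\<close>

lemma conv_ker_C1_bounded:
  assumes [measurable]: "g \<in> borel_measurable borel" and g: "\<And>y. \<bar>g y\<bar> \<le> M"
  shows "C1_on UNIV (conv g (ker 1 0)) (conv g (grad_ker 1 0))"
proof -
  define d where "d n = inverse (real (Suc n))" for n
  have d: "d n > 0" for n by (simp add: d_def)
  have d0: "d \<longlonglongrightarrow> 0" unfolding d_def by (rule LIMSEQ_inverse_real_of_nat)
  have lg: "loc_int g" by (rule loc_int_bounded[OF assms])
  have M0: "M \<ge> 0" using g[of 0] by linarith
  define E where "E n = (LINT z|lborel. norm (grad_ker 1 (d n) z - grad_ker 1 0 z))" for n
  have E: "E \<longlonglongrightarrow> 0" unfolding E_def by (rule grad_ker_L1_tendsto[OF d d0])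
  have C: "C1_on UNIV (conv g (ker 1 (d n))) (conv g (grad_ker 1 (d n)))" for n
  proof (rule conv_C1[OF lg, of _ _ 1])
    obtain Hs where "C2_on UNIV (\<lambda>y. ker 1 (d n) (y - 0)) (\<lambda>y. grad_ker 1 (d n) (y - 0)) Hs"
      using ker_C2_on[OF zero_less_one d, of n 0] by blast
    then show "C1_on UNIV (ker 1 (d n)) (grad_ker 1 (d n))" using C2_on_C1 by force
    fix x y :: plane assume "1 + norm x < norm y"
    then have "ker 1 (d n) (x - y) = 0"
      using d[of n] norm_triangle_ineq2[of y x] by (intro ker_eq_0) (auto simp: norm_minus_commute)
    then show "g y = 0 \<or> ker 1 (d n) (x - y) = 0" by simp
  qed
  have i: "integrable lborel (\<lambda>y. g y *\<^sub>R grad_ker 1 \<delta> (x - y))" if "\<delta> \<ge> 0" for x \<delta>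
    by (rule integrable_gker_conv[OF assms that])
  have close: "norm (conv g (grad_ker 1 (d n)) x - conv g (grad_ker 1 0) x) \<le> M * E n" for n x
  proof -
    have i0: "integrable lborel (\<lambda>z. norm (grad_ker 1 (d n) (x - z) - grad_ker 1 0 (x - z)))"
      using integrable_gker_conv[of "\<lambda>_. 1" 1 "d n" x] integrable_gker_conv[of "\<lambda>_. 1" 1 0 x] d[of n]
      by (intro integrable_norm Bochner_Integration.integrable_diff) auto
    have "conv g (grad_ker 1 (d n)) x - conv g (grad_ker 1 0) x = (LINT y|lborel. g y *\<^sub>R grad_ker 1 (d n) (x - y) - g y *\<^sub>R grad_ker 1 0 (x - y))"
      unfolding conv_def using d[of n] by (intro Bochner_Integration.integral_diff[symmetric] i) auto
    also have "norm \<dots> \<le> (LINT y|lborel. M * norm (grad_ker 1 (d n) (x - y) - grad_ker 1 0 (x - y)))"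
    proof (rule Bochner_Integration.integral_norm_bound_integral)
      show "integrable lborel (\<lambda>y. g y *\<^sub>R grad_ker 1 (d n) (x - y) - g y *\<^sub>R grad_ker 1 0 (x - y))"
        using d[of n] by (intro Bochner_Integration.integrable_diff i) auto
      show "integrable lborel (\<lambda>y. M * norm (grad_ker 1 (d n) (x - y) - grad_ker 1 0 (x - y)))"
        using i0 by (rule integrable_mult_right)
      show "norm (g y *\<^sub>R grad_ker 1 (d n) (x - y) - g y *\<^sub>R grad_ker 1 0 (x - y)) \<le> M * norm (grad_ker 1 (d n) (x - y) - grad_ker 1 0 (x - y))" for y
        using g[of y] by (simp add: scaleR_diff_right[symmetric] mult_right_mono)
    qed
    also have "\<dots> = M * (LINT y|lborel. norm (grad_ker 1 (d n) (x - y) - grad_ker 1 0 (x - y)))" by simp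
    also have "(LINT y|lborel. norm (grad_ker 1 (d n) (x - y) - grad_ker 1 0 (x - y))) = E n"
      unfolding E_def by (rule integral_reflect_plane[of "\<lambda>z. norm (grad_ker 1 (d n) z - grad_ker 1 0 z)"]) measurable
    finally show ?thesis .
  qed
  have small: "\<forall>\<^sub>F n in sequentially. M * E n < e" if "e > 0" for e
  proof -
    have "(\<lambda>n. M * E n) \<longlonglongrightarrow> M * 0" by (intro tendsto_mult tendsto_const E)
    then show ?thesis using that order_tendstoD(2) by fastforce
  qed
  have lim: "(\<lambda>n. conv g (ker 1 (d n)) x) \<longlonglongrightarrow> conv g (ker 1 0) x" for x
    unfolding conv_def
  proof (rule integral_dominated_convergence)
    show "integrable lborel (\<lambda>y. M * ker 1 0 (x - y))" by (intro integrable_mult_right integrable_ker) simp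
    show "AE y in lborel. (\<lambda>n. g y *\<^sub>R ker 1 (d n) (x - y)) \<longlonglongrightarrow> g y *\<^sub>R ker 1 0 (x - y)"
      using AE_lborel_singleton[of x]
    proof eventually_elim
      case (elim y)
      have "(norm (x - y))\<^sup>2 > 0" using elim by simp
      then have "(\<lambda>n. log_cutoff ((norm (x - y))\<^sup>2 + d n) / (4 * pi)) \<longlonglongrightarrow> log_cutoff ((norm (x - y))\<^sup>2 + 0) / (4 * pi)"
        by (intro tendsto_divide tendsto_const isCont_tendsto_compose[OF DERIV_isCont[OF log_cutoff_deriv]] tendsto_add d0) auto
      then show ?case
        using ker_eq_log_cutoff[of "d _" "x - y" 1] ker_eq_log_cutoff[of 0 "x - y" 1] elim d
        by (intro tendsto_scaleR tendsto_const) (simp add: less_imp_le)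
    qed
    show "AE y in lborel. norm (g y *\<^sub>R ker 1 (d n) (x - y)) \<le> M * ker 1 0 (x - y)" for n
      using AE_lborel_singleton[of x]
    proof eventually_elim
      case (elim y)
      have "\<bar>g y\<bar> * ker 1 (d n) (x - y) \<le> M * ker 1 0 (x - y)"
        using elim d[of n] g[of y] M0 by (intro mult_mono ker_le_ker_0 ker_nonneg) auto
      then show ?case by (simp add: abs_mult ker_nonneg)
    qed
  qed measurable
  have "\<exists>l. \<forall>x\<in>UNIV. (\<lambda>n. conv g (ker 1 (d n)) x) \<longlonglongrightarrow> l x \<and> (l has_derivative (\<lambda>h. conv g (grad_ker 1 0) x \<bullet> h)) (at x within UNIV)"
  proof (rule has_derivative_sequence[where f="\<lambda>n. conv g (ker 1 (d n))"
        and f'="\<lambda>n x h. conv g (grad_ker 1 (d n)) x \<bullet> h", OF convex_UNIV _ _ UNIV_I lim[of 0]])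
    show "(conv g (ker 1 (d n)) has_derivative (\<lambda>h. conv g (grad_ker 1 (d n)) x \<bullet> h)) (at x within UNIV)" for n x
      using C[of n] by (simp add: C1_on_def)
    fix e :: real assume "e > 0"
    show "\<forall>\<^sub>F n in sequentially. \<forall>x\<in>UNIV. \<forall>h. norm (conv g (grad_ker 1 (d n)) x \<bullet> h - conv g (grad_ker 1 0) x \<bullet> h) \<le> e * norm h"
      using small[OF \<open>e > 0\<close>]
    proof eventually_elim
      case (elim n)
      show ?case
      proof (intro ballI allI)
        fix x h
        have "norm (conv g (grad_ker 1 (d n)) x \<bullet> h - conv g (grad_ker 1 0) x \<bullet> h) \<le> norm (conv g (grad_ker 1 (d n)) x - conv g (grad_ker 1 0) x) * norm h"
          unfolding inner_diff_left[symmetric] real_norm_def by (rule Cauchy_Schwarz_ineq2)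
        also have "\<dots> \<le> e * norm h" using close[of n x] elim by (intro mult_right_mono) auto
        finally show "norm (conv g (grad_ker 1 (d n)) x \<bullet> h - conv g (grad_ker 1 0) x \<bullet> h) \<le> e * norm h" .
      qed
    qed
  qed
  then obtain l where l: "\<And>x. (\<lambda>n. conv g (ker 1 (d n)) x) \<longlonglongrightarrow> l x" "\<And>x. (l has_derivative (\<lambda>h. conv g (grad_ker 1 0) x \<bullet> h)) (at x)"
    by auto
  have "l = conv g (ker 1 0)" using LIMSEQ_unique[OF l(1) lim] by (rule ext)
  moreover have "continuous_on UNIV (conv g (grad_ker 1 0))"
  proof (rule uniform_limit_theorem[where f="\<lambda>n. conv g (grad_ker 1 (d n))" and F=sequentially])
    show "\<forall>\<^sub>F n in sequentially. continuous_on UNIV (conv g (grad_ker 1 (d n)))"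
      using C1_on_continuous_grad[OF C] by simp
    show "uniform_limit UNIV (\<lambda>n. conv g (grad_ker 1 (d n))) (conv g (grad_ker 1 0)) sequentially"
      unfolding uniform_limit_iff
    proof (intro allI impI)
      fix e :: real assume "e > 0"
      show "\<forall>\<^sub>F n in sequentially. \<forall>x\<in>UNIV. dist (conv g (grad_ker 1 (d n)) x) (conv g (grad_ker 1 0) x) < e"
        using small[OF \<open>e > 0\<close>] close by (auto elim!: eventually_mono simp: dist_norm intro: le_less_trans)
    qed
  qed simp
  ultimately show ?thesis using l(2) by (simp add: C1_on_def)
qed

text \<open>The kernel lives in the unit disk, so on the ball of radius \<open>r\<close> only the
  values of \<open>g\<close> on the ball of radius \<open>r + 1\<close> enter, and there
  \<open>g\<close> is bounded.\<close>

lemma conv_ker_C1: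
  assumes g: "continuous_on UNIV g"
  shows "C1_on UNIV (conv g (ker 1 0)) (conv g (grad_ker 1 0))"
proof -
  have loc: "C1_on (ball 0 r) (conv g (ker 1 0)) (conv g (grad_ker 1 0))" for r
  proof -
    define g1 where "g1 y = indicator (cball 0 (r + 1)) y * g y" for y
    have "compact (g ` cball 0 (r + 1))" by (intro compact_continuous_image continuous_on_subset[OF g]) auto
    then obtain M where M: "\<forall>y\<in>g ` cball 0 (r + 1). norm y \<le> M"
      using compact_imp_bounded bounded_iff by blast
    have "\<bar>g1 y\<bar> \<le> max M 0" for y using M by (cases "y \<in> cball 0 (r + 1)") (auto simp: g1_def le_max_iff_disj)
    moreover have "g1 \<in> borel_measurable borel"
      unfolding g1_def using g by (intro borel_measurable_times borel_measurable_indicator borel_measurable_continuous_onI) auto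
    ultimately have "C1_on UNIV (conv g1 (ker 1 0)) (conv g1 (grad_ker 1 0))" by (intro conv_ker_C1_bounded)
    then have "C1_on (ball 0 r) (conv g1 (ker 1 0)) (conv g1 (grad_ker 1 0))" using C1_on_subset by blast
    then show ?thesis
    proof (rule C1_on_cong)
      fix x :: plane assume "x \<in> ball 0 r"
      then have far: "norm (x - y) > 1" if "y \<notin> cball 0 (r + 1)" for y
        using that norm_triangle_ineq2[of y x] by (auto simp: norm_minus_commute)
      show "conv g (ker 1 0) x = conv g1 (ker 1 0) x"
        unfolding conv_def using far ker_eq_0[of 1 0]
        by (intro Bochner_Integration.integral_cong refl) (force simp: g1_def indicator_def less_imp_le)
      have "grad_ker 1 0 z = 0" if "norm z > 1" for z
        using grad_ker_norm_le[of 0 z] that by simp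
      then show "conv g (grad_ker 1 0) x = conv g1 (grad_ker 1 0) x"
        unfolding conv_def using far
        by (intro Bochner_Integration.integral_cong refl) (force simp: g1_def indicator_def)
    qed simp
  qed
  show ?thesis
    unfolding C1_on_def
  proof (intro conjI ballI)
    show "(conv g (ker 1 0) has_derivative (\<bullet>) (conv g (grad_ker 1 0) x)) (at x)" for x
      by (rule C1_on_deriv[OF loc[of "norm x + 1"]]) simp
    have "isCont (conv g (grad_ker 1 0)) x" for x
      using C1_on_continuous_grad[OF loc[of "norm x + 1"]] by (simp add: continuous_on_eq_continuous_at)
    then show "continuous_on UNIV (conv g (grad_ker 1 0))" by (simp add: continuous_at_imp_continuous_on)
  qed
qed

text \<open>Differentiating the cube of \<open>cutoff\<close> twice leaves
  \<open>6 * cutoff\<close>, which is still continuous at the edge of the support.\<close>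

lemma rho_C2_on:
  assumes "R > 0" obtains G Hs where "C2_on UNIV (rho R) G Hs"
proof -
  define c where "c = 4 / (pi * R\<^sup>2)"
  have 3: "((\<lambda>s. c * cutoff s ^ 3) has_real_derivative c * (- 3 * cutoff s ^ 2)) (at s)" for s
    using cutoff_power_deriv[of 1 s] by (intro DERIV_cmult) (simp add: eval_nat_numeral)
  have 2: "((\<lambda>s. c * (- 3 * cutoff s ^ 2)) has_real_derivative c * (- 3 * (- 2 * cutoff s))) (at s)" for s
    using cutoff_power_deriv[of 0 s] by (intro DERIV_cmult) (simp add: eval_nat_numeral)
  have "continuous_on {0..} (\<lambda>s. c * (- 3 * (- 2 * cutoff s)))" unfolding cutoff_def by (intro continuous_intros)
  from C2_on_radial[OF 3 2 this, of 0 R] show ?thesis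
    by (intro that[of "\<lambda>x. (2 / R\<^sup>2 * (c * (- 3 * cutoff ((norm (x - 0))\<^sup>2 / R\<^sup>2) ^ 2))) *\<^sub>R (x - 0)"]) 
       (simp add: rho_def[abs_def] c_def)
qed

lemma C1_on_add:
  assumes "C1_on S u G" "C1_on S v K" shows "C1_on S (\<lambda>x. u x + v x) (\<lambda>x. G x + K x)"
  unfolding C1_on_def
proof (intro conjI ballI)
  fix x assume "x \<in> S"
  then show "((\<lambda>x. u x + v x) has_derivative (\<bullet>) (G x + K x)) (at x)"
    using has_derivative_add[OF C1_on_deriv[OF assms(1)] C1_on_deriv[OF assms(2)]] by (simp add: inner_add_left[abs_def])
qed (intro continuous_on_add C1_on_continuous_grad[OF assms(1)] C1_on_continuous_grad[OF assms(2)])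

lemma C2_on_add:
  assumes "C2_on S u G Hs" "C2_on S v K L"
  shows "C2_on S (\<lambda>x. u x + v x) (\<lambda>x. G x + K x) (\<lambda>e x. Hs e x + L e x)"
  unfolding C2_on_def inner_add_left
  using C1_on_add[OF C2_on_C1[OF assms(1)] C2_on_C1[OF assms(2)]]
    C1_on_add[OF C2_on_C1_grad[OF assms(1)] C2_on_C1_grad[OF assms(2)]] by blast

text \<open>At zero the difference quotient is at most \<open>\<bar>h\<bar> powr (p - 1)\<close>,
  which tends to 0 because \<open>p > 1\<close>; the nonlinearity is thus continuously
  differentiable across zero.\<close>

lemma pos_part_powr_deriv:
  assumes "p > 1"
  shows "((\<lambda>t. pos_part t powr p) has_real_derivative p * pos_part t powr (p - 1)) (at t)"
proof -
  consider "t < 0" | "t > 0" | "t = 0" by linarith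
  then show ?thesis
  proof cases
    case 1
    show ?thesis
      by (rule has_field_derivative_transform_within_open[of "\<lambda>_. 0" _ _ "{..<0}"]) (use 1 in \<open>auto simp: pos_part_def\<close>)
  next
    case 2
    have "((\<lambda>t. t powr p) has_real_derivative p * t powr (p - 1)) (at t)"
      using 2 by (rule has_real_derivative_powr)
    then have "((\<lambda>t. pos_part t powr p) has_real_derivative p * t powr (p - 1)) (at t)"
      by (rule has_field_derivative_transform_within_open[where S="{0<..}"]) (use 2 in \<open>auto simp: pos_part_def\<close>)
    then show ?thesis using 2 by (simp add: pos_part_def)
  next
    case 3
    have "((\<lambda>h::real. \<bar>h\<bar> powr (p - 1)) \<longlongrightarrow> \<bar>0\<bar> powr (p - 1)) (at 0)"
      using assms by (intro tendsto_powr' tendsto_rabs tendsto_ident_at tendsto_const) auto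
    then have "((\<lambda>h::real. \<bar>h\<bar> powr (p - 1)) \<longlongrightarrow> 0) (at 0)" using assms by simp
    then have "((\<lambda>h. pos_part h powr p / h) \<longlongrightarrow> 0) (at 0)"
    proof (rule Lim_null_comparison[rotated])
      show "\<forall>\<^sub>F h in at 0. norm (pos_part h powr p / h) \<le> \<bar>h\<bar> powr (p - 1)"
        unfolding eventually_at_filter
      proof (intro always_eventually allI impI)
        fix h :: real assume "h \<noteq> 0"
        show "norm (pos_part h powr p / h) \<le> \<bar>h\<bar> powr (p - 1)"
        proof (cases "h > 0")
          case True then show ?thesis by (simp add: pos_part_def powr_diff)
        next
          case False
          then have "pos_part h = 0" by (simp add: pos_part_def)
          then show ?thesis by simp
        qed
      qed
    qed
    then show ?thesis using 3 assms by (simp add: has_field_derivative_iff pos_part_def)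
  qed
qed

lemma C1_on_compose_real:
  assumes u: "C1_on S u G" and h: "\<And>t. (h has_real_derivative h' t) (at t)" and h': "continuous_on UNIV h'"
  shows "C1_on S (\<lambda>x. h (u x)) (\<lambda>x. h' (u x) *\<^sub>R G x)"
  unfolding C1_on_def
proof (intro conjI ballI)
  fix x assume "x \<in> S"
  from has_derivative_compose[OF C1_on_deriv[OF u this] has_field_derivative_imp_has_derivative[OF h]]
  show "((\<lambda>x. h (u x)) has_derivative (\<bullet>) (h' (u x) *\<^sub>R G x)) (at x)"
    by (rule has_derivative_eq_rhs) (simp add: fun_eq_iff)
qed (intro continuous_on_scaleR C1_on_continuous_grad[OF u] continuous_on_compose2[OF h' C1_on_continuous[OF u]], simp)

lemma laplacian_eq_0_outside:
  assumes "C2_on UNIV \<psi> G Hs" "open T" "\<And>x. x \<in> T \<Longrightarrow> \<psi> x = 0" "x \<in> T" "e \<in> Basis"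
  shows "Hs e x = 0"
proof -
  have "G y = 0" if "y \<in> T" for y
    using C1_on_grad_eq_0[OF C2_on_C1[OF assms(1)] assms(2,3) UNIV_I that] .
  then show ?thesis
    using C1_on_grad_eq_0[OF C2_on_C1_grad[OF assms(1,5)] assms(2) _ UNIV_I assms(4)] by simp
qed

lemma conv_cong_AE:
  assumes [measurable]: "f \<in> borel_measurable borel" "g \<in> borel_measurable borel" "b \<in> borel_measurable borel"
    and "AE x in lborel. f x = g x"
  shows "conv f (b :: plane \<Rightarrow> real) = conv g b"
  unfolding conv_def
proof (rule ext, rule integral_cong_AE)
  show "AE y in lborel. f y *\<^sub>R b (x - y) = g y *\<^sub>R b (x - y)" for x
    using assms(4) by eventually_elim simp
qed measurable

lemma continuous_laplacian: "C2_on UNIV u G Hs \<Longrightarrow> continuous_on UNIV (laplacian u)"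
proof -
  assume C: "C2_on UNIV u G Hs"
  have "laplacian u = (\<lambda>x. \<Sum>e\<in>Basis. Hs e x \<bullet> e)" using laplacian_C2_on[OF open_UNIV C] by auto
  then show ?thesis
    by (simp only:) (intro continuous_on_sum continuous_on_inner continuous_on_const C1_on_continuous_grad[OF C2_on_C1_grad[OF C]])
qed

text \<open>A bounded density makes \<open>u\<close> a \<open>C1\<close> function, so the density is
  \<open>C1\<close> as well, which gives \<open>C2\<close>. Green's identity then turns the weak
  equation into an identity of continuous functions tested against all \<open>\<psi>\<close>, hence
  into a pointwise one.\<close>

lemma weak_solution_regular:
  fixes w :: "plane \<Rightarrow> real" and p :: real
  assumes p: "p > 1" and w: "loc_int w" 
  defines "f \<equiv> (\<lambda>x. pos_part (w x) powr p)"
  assumes f: "integrable lborel f"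
    and weak: "\<And>\<psi>. test_function \<psi> \<Longrightarrow> - (LINT x|lborel. w x * laplacian \<psi> x) = (LINT x|lborel. f x * \<psi> x)"
  obtains u G Hs M where "AE x in lborel. w x = u x" "C2_on UNIV u G Hs"
    "\<And>x. - laplacian u x = pos_part (u x) powr p" "\<And>x. u x \<le> M"
proof -
  have mw[measurable]: "w \<in> borel_measurable borel" by (rule loc_int_measurable[OF w])
  have mf[measurable]: "f \<in> borel_measurable borel" unfolding f_def pos_part_def by measurable
  have rep: "AE x in lborel. w x = conv w (rho 1) x + conv f (ker 1 0) x"
    by (rule weak_solution_representation[OF w f _ weak]) auto
  obtain M where M: "M \<ge> 0" "AE x in lborel. w x \<le> M"
    using weak_solution_bounded[OF p w f[unfolded f_def] rep[unfolded f_def]] by blast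
  obtain Gr Hr where r: "C2_on UNIV (rho 1) Gr Hr" using rho_C2_on[of 1] by auto
  have P: "C2_on UNIV (conv w (rho 1)) (conv w Gr) (\<lambda>e. conv w (Hr e))"
    by (rule conv_C2[OF w r, of 1]) (use rho_eq_0[of 1] in auto)
  define u where "u x = conv w (rho 1) x + conv f (ker 1 0) x" for x
  have wu: "AE x in lborel. w x = u x" using rep by (simp add: u_def)
  \<comment> \<open>Truncation makes the density bounded everywhere rather than almost everywhere
    and leaves the convolution unchanged.\<close>
  define f1 where "f1 x = min (f x) (M powr p)" for x
  have "AE x in lborel. f x = f1 x"
    using M(2)
  proof eventually_elim
    case (elim x)
    then have "f x \<le> M powr p" using M(1) p unfolding f_def by (intro powr_mono2) (auto simp: pos_part_def)
    then show ?case by (simp add: f1_def)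
  qed
  then have ff1: "conv f (ker 1 0) = conv f1 (ker 1 0)"
    by (intro conv_cong_AE) (auto simp: f1_def[abs_def])
  have "\<bar>f1 x\<bar> \<le> M powr p" for x by (auto simp: f1_def f_def)
  then have C1k: "C1_on UNIV (conv f1 (ker 1 0)) (conv f1 (grad_ker 1 0))"
    by (intro conv_ker_C1_bounded) (auto simp: f1_def[abs_def])
  define Gu where "Gu x = conv w Gr x + conv f1 (grad_ker 1 0) x" for x
  have C1u: "C1_on UNIV u Gu"
    unfolding u_def[abs_def] Gu_def[abs_def] ff1 by (rule C1_on_add[OF C2_on_C1[OF P] C1k])
  define f2 where "f2 x = pos_part (u x) powr p" for x
  define G2 where "G2 x = (p * pos_part (u x) powr (p - 1)) *\<^sub>R Gu x" for x
  have "continuous_on UNIV (\<lambda>t. p * pos_part t powr (p - 1))"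
    unfolding pos_part_def using p
    by (intro continuous_on_mult continuous_on_const continuous_on_powr' continuous_on_max continuous_on_id) auto
  then have C1f2: "C1_on UNIV f2 G2"
    unfolding f2_def[abs_def] G2_def[abs_def] by (intro C1_on_compose_real[OF C1u pos_part_powr_deriv[OF p]])
  have cf2: "continuous_on UNIV f2" by (rule C1_on_continuous[OF C1f2])
  then have mf2[measurable]: "f2 \<in> borel_measurable borel" by (simp add: borel_measurable_continuous_onI)
  have ff2: "AE x in lborel. f x = f2 x" using wu by eventually_elim (simp add: f_def f2_def)
  then have kf2: "conv f (ker 1 0) = conv (ker 1 0) f2"
    by (subst conv_cong_AE[OF _ _ _ ff2]) (auto simp: conv_commute intro!: ext)
  have k0: "ker 1 0 y = 0" if "norm y > 1" for y using ker_eq_0[of 1 0 y] that by simp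
  have z: "norm y > 1" if "1 + norm x < norm y" for x y :: plane
    using that norm_ge_zero[of x] by linarith
  have K: "C1_on UNIV (conv (ker 1 0) f2) (conv (ker 1 0) G2)"
    by (rule conv_C1[OF loc_int_ker C1f2, of _ 1]) (use k0 z in \<open>auto simp del: One_nat_def\<close>)
  \<comment> \<open>One derivative falls on the density and the other on the kernel, so the
    non-integrable second derivatives of the kernel never appear.\<close>
  have "C2_on UNIV (conv (ker 1 0) f2) (conv (ker 1 0) G2) (\<lambda>e. conv (\<lambda>x. G2 x \<bullet> e) (grad_ker 1 0))"
    unfolding C2_on_def
  proof (intro conjI ballI K)
    fix e :: plane
    have ce: "continuous_on UNIV (\<lambda>x. G2 x \<bullet> e)"
      by (intro continuous_on_inner C1_on_continuous_grad[OF C1f2] continuous_on_const)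
    have "conv (\<lambda>x. G2 x \<bullet> e) (ker 1 0) = (\<lambda>x. conv (ker 1 0) G2 x \<bullet> e)"
    proof (rule ext)
      fix x
      have "conv (\<lambda>x. G2 x \<bullet> e) (ker 1 0) x = conv (ker 1 0) (\<lambda>x. G2 x \<bullet> e) x"
        by (rule conv_commute) (use ce in \<open>auto simp: borel_measurable_continuous_onI\<close>)
      moreover have "integrable lborel (\<lambda>y. ker 1 0 y *\<^sub>R G2 (x - y))"
        by (rule conv_integrable[OF loc_int_ker C1_on_continuous_grad[OF C1f2], of _ 1]) (use k0 in auto)
      ultimately show "conv (\<lambda>x. G2 x \<bullet> e) (ker 1 0) x = conv (ker 1 0) G2 x \<bullet> e"
        unfolding conv_def by (subst integral_inner_left[symmetric]) auto
    qed
    then show "C1_on UNIV (\<lambda>x. conv (ker 1 0) G2 x \<bullet> e) (conv (\<lambda>x. G2 x \<bullet> e) (grad_ker 1 0))"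
      using conv_ker_C1[OF ce] by (simp only:)
  qed
  from C2_on_add[OF P this] obtain G Hs where U: "C2_on UNIV u G Hs"
    unfolding u_def[abs_def] kf2 by blast
  have cL: "continuous_on UNIV (laplacian u)" by (rule continuous_laplacian[OF U])
  have cu: "continuous_on UNIV u" by (rule C1_on_continuous[OF C1u])
  have pde: "- laplacian u x - f2 x = 0" for x
  proof (rule AE_lborel_continuous_eq_0[of "\<lambda>x. - laplacian u x - f2 x"])
    show c: "continuous_on UNIV (\<lambda>x. - laplacian u x - f2 x)"
      by (intro continuous_on_diff continuous_on_minus cL cf2)
    show "AE x in lborel. - laplacian u x - f2 x = 0"
    proof (rule AE_eq_0_of_test_functions[OF loc_int_continuous[OF c]])
      fix \<psi> assume t: "test_function \<psi>"
      have sm: "smooth \<psi>" using t by (simp add: test_function_def)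
      have c0: "continuous_on UNIV \<psi>" using spec[OF sm, of 0] by simp
      have m[measurable]: "\<psi> \<in> borel_measurable borel" using c0 by (simp add: borel_measurable_continuous_onI)
      obtain R where R: "R > 0" "\<And>x. norm x > R \<Longrightarrow> \<psi> x = 0" using test_function_cball[OF t] by blast
      obtain G\<psi> H\<psi> where C: "C2_on UNIV \<psi> G\<psi> H\<psi>" using smooth_C2_on[OF sm] .
      have L\<psi>: "laplacian \<psi> = (\<lambda>x. \<Sum>e\<in>Basis. H\<psi> e x \<bullet> e)" using laplacian_C2_on[OF open_UNIV C] by auto
      have Lu: "laplacian u = (\<lambda>x. \<Sum>e\<in>Basis. Hs e x \<bullet> e)" using laplacian_C2_on[OF open_UNIV U] by auto
      have oT: "open {z::plane. norm z > R}"
        by (intro open_Collect_less continuous_on_const continuous_on_norm continuous_on_id)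
      have L0: "laplacian \<psi> x = 0" if "norm x > R" for x
        unfolding L\<psi> using laplacian_eq_0_outside[OF C oT, of x] R(2) that by (intro sum.neutral) auto
      have mL[measurable]: "laplacian \<psi> \<in> borel_measurable borel"
        using continuous_laplacian[OF C] by (simp add: borel_measurable_continuous_onI)
      have mu[measurable]: "u \<in> borel_measurable borel" using cu by (simp add: borel_measurable_continuous_onI)
      have ic: "integrable lborel (\<lambda>x. g x * \<psi> x)" if "continuous_on UNIV g" for g
      proof -
        have "integrable lborel (\<lambda>x. indicator (cball 0 R) x *\<^sub>R (g x * \<psi> x))"
          by (intro borel_integrable_compact continuous_on_mult continuous_on_subset[OF that] continuous_on_subset[OF c0]) auto
        also have "(\<lambda>x. indicator (cball 0 R) x *\<^sub>R (g x * \<psi> x)) = (\<lambda>x. g x * \<psi> x)"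
          using R(2) by (auto simp: fun_eq_iff indicator_def)
        finally show ?thesis .
      qed
      have "(LINT x|lborel. f2 x * \<psi> x) = (LINT x|lborel. f x * \<psi> x)"
        by (rule integral_cong_AE) (use ff2 in \<open>auto elim!: eventually_mono\<close>)
      also have "\<dots> = - (LINT x|lborel. w x * laplacian \<psi> x)" using weak[OF t] by simp
      also have "(LINT x|lborel. w x * laplacian \<psi> x) = (LINT x|lborel. u x * laplacian \<psi> x)"
        by (rule integral_cong_AE) (use wu in \<open>auto elim!: eventually_mono\<close>)
      also have "\<dots> = (LINT y|lborel. indicator (cball 0 R) y * (u y * laplacian \<psi> y))"
        using L0 by (intro Bochner_Integration.integral_cong refl) (auto simp: indicator_def)
      also have "\<dots> = (LINT y|lborel. indicator (cball 0 R) y * (u y * (\<Sum>e\<in>Basis. H\<psi> e y \<bullet> e)))"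
        by (simp only: L\<psi>)
      also have "\<dots> = (LINT y|lborel. indicator (cball 0 R) y * (\<psi> y * (\<Sum>e\<in>Basis. Hs e y \<bullet> e)))"
        by (rule green_second_identity[OF open_UNIV subset_UNIV U C]) (use R in \<open>auto simp: dist_norm\<close>)
      also have "\<dots> = (LINT y|lborel. laplacian u y * \<psi> y)"
        using R(2) unfolding Lu by (intro Bochner_Integration.integral_cong refl) (auto simp: indicator_def)
      finally have e: "(LINT x|lborel. f2 x * \<psi> x) = - (LINT y|lborel. laplacian u y * \<psi> y)" .
      have "(LINT x|lborel. (- laplacian u x - f2 x) * \<psi> x) = (LINT x|lborel. - (laplacian u x * \<psi> x) - f2 x * \<psi> x)"
        by (simp add: left_diff_distrib)
      also have "\<dots> = - (LINT x|lborel. laplacian u x * \<psi> x) - (LINT x|lborel. f2 x * \<psi> x)"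
        using ic[OF cL] ic[OF cf2] by (simp add: Bochner_Integration.integral_diff)
      finally show "(LINT x|lborel. (- laplacian u x - f2 x) * \<psi> x) = 0" using e by simp
    qed
  qed
  \<comment> \<open>The excess over \<open>M\<close> is continuous and vanishes almost everywhere,
    which upgrades the essential bound to a pointwise one.\<close>
  have "max 0 (u x - M) = 0" for x
  proof (rule AE_lborel_continuous_eq_0[of "\<lambda>x. max 0 (u x - M)"])
    show "continuous_on UNIV (\<lambda>x. max 0 (u x - M))"
      by (intro continuous_on_max continuous_on_diff continuous_on_const cu)
    show "AE x in lborel. max 0 (u x - M) = 0"
      using wu M(2) by eventually_elim simp
  qed
  then have uM: "u x \<le> M" for x using max.cobounded2[of "u x - M" 0] by simp
  show ?thesis
    using that[OF wu U _ uM] pde by (simp add: f2_def)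
qed

section \<open>The logarithmic representation\<close>

text \<open>The oscillation of \<open>rho R\<close> is compared with the wider bump
  \<open>rho (3 * R)\<close>. For \<open>norm a \<le> 2 * R\<close> the cutoff at scale
  \<open>3 * R\<close> is at least \<open>1 - 4 / 9 = 5 / 9\<close>, whence
  \<open>(9 / 5)^3\<close>. The factor 9 is the ratio of the areas, and \<open>15 = 3 * 5\<close>
  comes from the cube and from \<open>norm a + norm b \<le> 5 * R\<close>.\<close>

lemma rho_diff_le:
  assumes "R > 0" "norm (a - b) \<le> R"
  shows "\<bar>rho R a - rho R b\<bar> \<le> 15 * 9 * (9 / 5) ^ 3 * (norm (a - b) / R) * rho (3 * R) a"
proof (cases "norm a > 2 * R")
  case True
  then have "norm b \<ge> R" "norm a \<ge> R" using assms norm_triangle_ineq2[of a b] by auto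
  then have "rho R a = 0" "rho R b = 0" using rho_eq_0[OF assms(1)] by auto
  then show ?thesis using assms rho_nonneg by simp
next
  case False
  define d where "d = norm (a - b)"
  define s where "s = (norm a)\<^sup>2 / R\<^sup>2"
  define t where "t = (norm b)\<^sup>2 / R\<^sup>2"
  have nb: "norm b \<le> 3 * R" using False assms norm_triangle_ineq2[of b a] by (simp add: norm_minus_commute)
  have d0: "d \<ge> 0" "d \<le> R" using assms by (auto simp: d_def)
  have q01: "0 \<le> cutoff x" "0 \<le> x \<Longrightarrow> cutoff x \<le> 1" for x using cutoff_nonneg cutoff_le_1 by auto
  have qst: "\<bar>cutoff s - cutoff t\<bar> \<le> \<bar>s - t\<bar>" by (auto simp: cutoff_def)
  have st: "0 \<le> s" "0 \<le> t" by (auto simp: s_def t_def)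
  have "cutoff s ^ 3 - cutoff t ^ 3 = (cutoff s - cutoff t) * (cutoff s * cutoff s + cutoff s * cutoff t + cutoff t * cutoff t)"
    by (simp add: power3_eq_cube algebra_simps)
  then have "\<bar>cutoff s ^ 3 - cutoff t ^ 3\<bar> = \<bar>cutoff s - cutoff t\<bar> * (cutoff s * cutoff s + cutoff s * cutoff t + cutoff t * cutoff t)"
    using q01 by (simp add: abs_mult)
  also have "\<dots> \<le> \<bar>s - t\<bar> * (1 + 1 + 1)"
    using q01 st by (intro mult_mono qst add_mono mult_le_one) auto
  finally have c: "\<bar>cutoff s ^ 3 - cutoff t ^ 3\<bar> \<le> 3 * \<bar>s - t\<bar>" by simp
  have "\<bar>s - t\<bar> = \<bar>norm a - norm b\<bar> * (norm a + norm b) / R\<^sup>2"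
    by (simp add: s_def t_def diff_divide_distrib[symmetric] power2_eq_square abs_mult square_diff_square_factored)
  also have "\<dots> \<le> d * (5 * R) / R\<^sup>2"
    using norm_triangle_ineq3[of a b] False nb d0 unfolding d_def
    by (intro divide_right_mono mult_mono) auto
  also have "\<dots> = 5 * (d / R)" using assms by (simp add: power2_eq_square)
  finally have "3 * \<bar>s - t\<bar> \<le> 3 * (5 * (d / R))" by (rule mult_left_mono) simp
  with c have c2: "\<bar>cutoff s ^ 3 - cutoff t ^ 3\<bar> \<le> 15 * (d / R)" by simp
  have "(norm a)\<^sup>2 \<le> (2 * R)\<^sup>2" using False by (intro power_mono) auto
  then have "(norm a)\<^sup>2 / (3 * R)\<^sup>2 \<le> 4 / 9" using assms by (simp add: field_simps power2_eq_square)
  then have "5 / 9 \<le> cutoff ((norm a)\<^sup>2 / (3 * R)\<^sup>2)" unfolding cutoff_def by simp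
  then have q3: "(5 / 9) ^ 3 \<le> cutoff ((norm a)\<^sup>2 / (3 * R)\<^sup>2) ^ 3" by (intro power_mono) auto
  have "rho R a - rho R b = 4 / (pi * R\<^sup>2) * (cutoff s ^ 3 - cutoff t ^ 3)"
    unfolding rho_def s_def t_def by (rule right_diff_distrib[symmetric])
  then have "\<bar>rho R a - rho R b\<bar> = 4 / (pi * R\<^sup>2) * \<bar>cutoff s ^ 3 - cutoff t ^ 3\<bar>"
    by (simp only: abs_mult) simp
  also have "\<dots> \<le> 4 / (pi * R\<^sup>2) * (15 * (d / R))" using c2 by (intro mult_left_mono) auto
  also have "\<dots> = 15 * 9 * (9 / 5) ^ 3 * (d / R) * (4 / (pi * (3 * R)\<^sup>2) * (5 / 9) ^ 3)"
    using assms by (simp add: field_simps power2_eq_square power3_eq_cube)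
  also have "\<dots> \<le> 15 * 9 * (9 / 5) ^ 3 * (d / R) * rho (3 * R) a"
    unfolding rho_def using q3 d0 assms by (intro mult_left_mono) auto
  finally show ?thesis by (simp add: d_def)
qed

text \<open>The exponent \<open>1 / 4\<close> limits the growth in \<open>R\<close> to
  \<open>sqrt R\<close>, which the factor \<open>1 / R\<close> of \<open>rho_diff_le\<close>
  outweighs.\<close>

lemma ker_le_sqrt:
  assumes "R > 0" "z \<noteq> 0"
  shows "ker R 0 z \<le> sqrt R / pi * (1 + indicator (cball 0 1) z / norm z)"
proof -
  have s: "(norm z)\<^sup>2 / R\<^sup>2 > 0" using assms by simp
  have "ker R 0 z = log_cutoff ((norm z)\<^sup>2 / R\<^sup>2) / (4 * pi)" using assms by (simp add: ker_eq_log_cutoff)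
  also have "\<dots> \<le> ((norm z)\<^sup>2 / R\<^sup>2) powr (- (1 / 4)) / (1 / 4) / (4 * pi)"
    using s by (intro divide_right_mono log_cutoff_le_powr) auto
  also have "((norm z)\<^sup>2 / R\<^sup>2) powr (- (1 / 4)) = sqrt (R / norm z)"
  proof -
    have "(norm z)\<^sup>2 / R\<^sup>2 = (norm z / R) powr 2" using assms by (simp add: power_divide)
    then have "((norm z)\<^sup>2 / R\<^sup>2) powr (- (1 / 4)) = (norm z / R) powr (- (1 / 2))"
      by (simp only: powr_powr) simp
    also have "\<dots> = sqrt (R / norm z)"
      using assms by (simp add: powr_minus powr_half_sqrt real_sqrt_divide)
    finally show ?thesis .
  qed
  also have "sqrt (R / norm z) / (1 / 4) / (4 * pi) = sqrt R / pi * (1 / sqrt (norm z))"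
    by (simp add: real_sqrt_divide)
  also have "\<dots> \<le> sqrt R / pi * (1 + indicator (cball 0 1) z / norm z)"
  proof (rule mult_left_mono)
    show "1 / sqrt (norm z) \<le> 1 + indicator (cball 0 1) z / norm z"
    proof (cases "norm z \<le> 1")
      case True
      have "norm z = sqrt (norm z) * sqrt (norm z)" by simp
      also have "\<dots> \<le> sqrt (norm z) * 1" using True by (intro mult_left_mono) auto
      finally have "norm z \<le> sqrt (norm z)" by simp
      then have "1 / sqrt (norm z) \<le> 1 / norm z" using assms by (intro frac_le) auto
      then show ?thesis using True by simp
    next
      case False
      then have "1 / sqrt (norm z) \<le> 1 / 1" by (intro divide_left_mono) auto
      then show ?thesis using False by simp
    qed
  qed (use assms in auto)
  finally show ?thesis .
qed

text \<open>Above 1 the logarithm has Lipschitz constant 1, below 1 the inverse of the smaller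
  argument. Both inverses appear so that the bound is symmetric and integrable in the plane.\<close>

lemma ln_diff_le:
  assumes "a > 0" "b > 0" "\<bar>a - b\<bar> \<le> d"
  shows "\<bar>ln a - ln b\<bar> \<le> d * (1 + (if a \<le> 1 then 1 / a else 0) + (if b \<le> 1 then 1 / b else (0::real)))"
proof -
  have *: "\<bar>ln a - ln b\<bar> \<le> d * (1 + (if a \<le> 1 then 1 / a else 0) + (if b \<le> 1 then 1 / b else (0::real)))"
    if "0 < a" "a \<le> b" "\<bar>a - b\<bar> \<le> d" for a b
  proof -
    have d: "d \<ge> 0" using that by linarith
    have "\<bar>ln a - ln b\<bar> = ln (b / a)" using that by (simp add: ln_div)
    also have "\<dots> \<le> b / a - 1" using that by (intro ln_le_minus_one) auto
    also have "\<dots> = (b - a) / a" using that by (simp add: diff_divide_distrib)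
    also have "\<dots> \<le> d / a" using that by (intro divide_right_mono) auto
    also have "\<dots> \<le> d * (1 + (if a \<le> 1 then 1 / a else 0))"
    proof (cases "a \<le> 1")
      case False
      then have "d / a \<le> d / 1" using d by (intro divide_left_mono) auto
      then show ?thesis using False by simp
    qed (use d that in \<open>auto simp: algebra_simps\<close>)
    also have "\<dots> \<le> d * (1 + (if a \<le> 1 then 1 / a else 0) + (if b \<le> 1 then 1 / b else (0::real)))"
      using that d by (intro mult_left_mono) auto
    finally show ?thesis .
  qed
  show ?thesis
  proof (cases "a \<le> b")
    case True then show ?thesis using * assms by blast
  next
    case False
    then have "\<bar>ln b - ln a\<bar> \<le> d * (1 + (if b \<le> 1 then 1 / b else 0) + (if a \<le> 1 then 1 / a else (0::real)))"
      using *[of b a] assms by (simp add: abs_minus_commute)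
    then show ?thesis by (simp add: abs_minus_commute add_ac)
  qed
qed

text \<open>Near 0 the function \<open>log_cutoff s + ln s\<close> is a polynomial, so its values at
  \<open>s / n^2\<close> and \<open>t / n^2\<close> have the same limit, and the divergent terms
  \<open>ln (n^2)\<close> cancel.\<close>

lemma log_cutoff_diff_tendsto:
  assumes "s > 0" "t > 0"
  shows "(\<lambda>n. log_cutoff (s / (real n)\<^sup>2) - log_cutoff (t / (real n)\<^sup>2)) \<longlonglongrightarrow> ln t - ln s"
proof -
  define Q where "Q x = - 4 * (1 - x) + 3 * (1 - x^2) - 4/3 * (1 - x^3) + 1/4 * (1 - x^4)" for x :: real
  have l0: "(\<lambda>n. s / (real n)\<^sup>2) \<longlonglongrightarrow> 0" for s :: real
    by (intro tendsto_divide_0[OF tendsto_const] filterlim_at_top_imp_at_infinity filterlim_pow_at_top filterlim_real_sequentially) auto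
  have lQ: "(\<lambda>n. log_cutoff (s / (real n)\<^sup>2) + ln (s / (real n)\<^sup>2)) \<longlonglongrightarrow> Q 0" if "s > 0" for s
  proof -
    have "(\<lambda>n. Q (s / (real n)\<^sup>2)) \<longlonglongrightarrow> Q 0"
      unfolding Q_def by (intro tendsto_intros l0)
    moreover have "\<forall>\<^sub>F n in sequentially. Q (s / (real n)\<^sup>2) = log_cutoff (s / (real n)\<^sup>2) + ln (s / (real n)\<^sup>2)"
      using order_tendstoD(2)[OF l0[of s] zero_less_one] by eventually_elim (simp add: log_cutoff_def Q_def)
    ultimately show ?thesis by (rule Lim_transform_eventually)
  qed
  have "(\<lambda>n. (log_cutoff (s / (real n)\<^sup>2) + ln (s / (real n)\<^sup>2)) - (log_cutoff (t / (real n)\<^sup>2) + ln (t / (real n)\<^sup>2)) + (ln t - ln s)) \<longlonglongrightarrow> Q 0 - Q 0 + (ln t - ln s)"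
    by (intro tendsto_intros lQ assms)
  moreover have "\<forall>\<^sub>F n in sequentially. (log_cutoff (s / (real n)\<^sup>2) + ln (s / (real n)\<^sup>2)) - (log_cutoff (t / (real n)\<^sup>2) + ln (t / (real n)\<^sup>2)) + (ln t - ln s)
     = log_cutoff (s / (real n)\<^sup>2) - log_cutoff (t / (real n)\<^sup>2)"
    using eventually_gt_at_top[of "0::nat"] by eventually_elim (use assms in \<open>simp add: ln_div\<close>)
  ultimately show ?thesis by (auto intro: Lim_transform_eventually)
qed

text \<open>The bound \<open>M\<close> is one-sided, since a nonconstant solution tends to
  \<open>- \<infinity>\<close>.\<close>

locale plane_solution =
  fixes u :: "plane \<Rightarrow> real" and G :: "plane \<Rightarrow> plane" and Hs :: "plane \<Rightarrow> plane \<Rightarrow> plane" and M p :: real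
  assumes p: "p > 1" and C2: "C2_on UNIV u G Hs" and le_M: "\<And>x. u x \<le> M"
    and pde: "\<And>x. - laplacian u x = pos_part (u x) powr p"
    and int: "integrable lborel (\<lambda>x. pos_part (u x) powr p)"
begin

definition f :: "plane \<Rightarrow> real" where "f x = pos_part (u x) powr p"

definition Mf :: real where "Mf = max M 0 powr p"

lemma cont_u: "continuous_on UNIV u"
  using C1_on_continuous[OF C2_on_C1[OF C2]] .

lemma cont_f: "continuous_on UNIV f"
  unfolding f_def[abs_def] pos_part_def using p
  by (intro continuous_on_powr' continuous_on_max cont_u continuous_on_const) auto

lemma f_measurable[measurable]: "f \<in> borel_measurable borel"
  using cont_f by (simp add: borel_measurable_continuous_onI)

lemma int_f: "integrable lborel f"
  using int unfolding f_def[abs_def] .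

lemma f_nonneg: "f x \<ge> 0"
  by (simp add: f_def)

lemma f_le_Mf: "f x \<le> Mf"
  unfolding f_def Mf_def pos_part_def using p le_M[of x] by (intro powr_mono2) auto

lemma Mf_nonneg: "Mf \<ge> 0"
  using f_nonneg[of 0] f_le_Mf[of 0] by linarith

lemma integral_f_nonneg: "(LINT x|lborel. f x) \<ge> 0"
  using f_nonneg by (intro Bochner_Integration.integral_nonneg) auto

lemma green: 
  assumes "R > 0" 
  shows "u x = (LINT y|lborel. rho R (x - y) * u y) + (LINT y|lborel. ker R 0 (x - y) * f y)"
  using green_representation[OF assms open_UNIV subset_UNIV C2, of x] by (simp add: pde f_def)

text \<open>Green's representation of the constant 1.\<close>

lemma integral_rho:
  assumes "R > 0" shows "(LINT y|lborel. rho R (x - y)) = 1"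
proof -
  have "C2_on UNIV (\<lambda>_::plane. 1) (\<lambda>_. 0) (\<lambda>_ _. 0)" by (simp add: C2_on_def C1_on_def)
  from green_representation[OF assms open_UNIV subset_UNIV this, of x] laplacian_C2_on[OF open_UNIV this]
  show ?thesis by simp
qed

lemma integrable_rho_mult:
  assumes "R > 0" "continuous_on UNIV g" shows "integrable lborel (\<lambda>y. rho R (x - y) * g y)"
proof -
  have "rho R (x - y) = 0" if "norm y > R + norm x" for y
    using that norm_triangle_ineq2[of y x] by (intro rho_eq_0 assms) (auto simp: norm_minus_commute)
  moreover have "continuous_on UNIV (rho R)" unfolding rho_def[abs_def] cutoff_def divide_inverse by (intro continuous_intros)
  ultimately show ?thesis
    using conv_integrable[OF loc_int_continuous[OF assms(2)], of "rho R" "R + norm x" x] by (simp add: mult.commute)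
qed

lemma integrable_ker_f: "R > 0 \<Longrightarrow> integrable lborel (\<lambda>y. ker R 0 (x - y) * f y)"
proof (rule Bochner_Integration.integrable_bound)
  assume "R > 0"
  then show "integrable lborel (\<lambda>y. ker R 0 (x - y) * Mf)" by (intro integrable_mult_left integrable_ker)
  show "AE y in lborel. norm (ker R 0 (x - y) * f y) \<le> norm (ker R 0 (x - y) * Mf)"
    using f_nonneg f_le_Mf ker_nonneg Mf_nonneg by (intro AE_I2) (simp add: mult_left_mono)
qed measurable

definition K where "K R x = (LINT y|lborel. ker R 0 (x - y) * f y)"
definition P where "P R x = (LINT y|lborel. rho R (x - y) * u y)"

lemma integral_inv_norm_shift: "(LINT y|lborel. indicator (cball 0 1) (x - y) / norm (x - y :: plane)) = 2 * pi"
proof -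
  have "(LINT y|lborel. indicator (cball 0 1) (x - y) / norm (x - y :: plane)) = (LINT z|lborel. indicator (cball 0 1) z / norm (z :: plane))"
    by (rule integral_reflect_plane[of "\<lambda>z. indicator (cball 0 1) z / norm z"]) measurable
  also have "\<dots> = 2 * pi"
    by (subst integral_eq_nn_integral) (auto simp: nn_integral_inv_norm intro!: AE_I2)
  finally show ?thesis .
qed

lemma K_le: 
  assumes "R > 0" 
  shows "K R x \<le> sqrt R / pi * ((LINT y|lborel. f y) + Mf * (2 * pi))"
proof -
  let ?i = "\<lambda>y. indicator (cball 0 1) (x - y) / norm (x - y)"
  have "K R x \<le> (LINT y|lborel. sqrt R / pi * (f y + Mf * ?i y))"
    unfolding K_def
  proof (rule integral_mono_AE[OF integrable_ker_f[OF assms]])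
    show "integrable lborel (\<lambda>y. sqrt R / pi * (f y + Mf * ?i y))"
      by (intro integrable_mult_right Bochner_Integration.integrable_add int_f integrable_inv_norm_shift)
    show "AE y in lborel. ker R 0 (x - y) * f y \<le> sqrt R / pi * (f y + Mf * ?i y)"
      using AE_lborel_singleton[of x]
    proof eventually_elim
      case (elim y)
      have "ker R 0 (x - y) * f y \<le> sqrt R / pi * (1 + ?i y) * f y"
        using ker_le_sqrt[OF assms, of "x - y"] elim f_nonneg by (intro mult_right_mono) auto
      also have "\<dots> = sqrt R / pi * (f y + f y * ?i y)" by (simp add: algebra_simps)
      also have "\<dots> \<le> sqrt R / pi * (f y + Mf * ?i y)"
        using f_le_Mf[of y] assms by (intro mult_left_mono add_left_mono mult_right_mono) auto
      finally show ?case .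
    qed
  qed
  also have "\<dots> = sqrt R / pi * ((LINT y|lborel. f y) + Mf * (2 * pi))"
    using int_f integrable_inv_norm_shift[of 1 x] integral_inv_norm_shift[of x]
    by (simp only: Bochner_Integration.integral_mult_right_zero Bochner_Integration.integral_add integrable_mult_right)
  finally show ?thesis .
qed

text \<open>As \<open>M - u\<close> is nonnegative, \<open>rho_diff_le\<close> can be integrated
  against it. The result is an average at scale \<open>3 * R\<close>, which Green's formula at that
  scale rewrites as \<open>M - u x + K (3 * R) x\<close>.\<close>

lemma P_diff_le:
  assumes R: "R > 0" "norm (x - x') \<le> R"
  shows "\<bar>P R x - P R x'\<bar> \<le> 15 * 9 * (9 / 5) ^ 3 * (norm (x - x') / R) * (M - u x + K (3 * R) x)"
proof -
  let ?c = "15 * 9 * (9 / 5) ^ 3 * (norm (x - x') / R)"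
  have cM: "continuous_on UNIV (\<lambda>y. M - u y)" by (intro continuous_on_diff continuous_on_const cont_u)
  have e: "P R x = M - (LINT y|lborel. rho R (x - y) * (M - u y))" if "R > 0" for R x
  proof -
    have "(LINT y|lborel. rho R (x - y) * (M - u y)) = (LINT y|lborel. rho R (x - y) * M - rho R (x - y) * u y)"
      by (simp add: right_diff_distrib)
    also have "\<dots> = (LINT y|lborel. rho R (x - y) * M) - P R x"
      unfolding P_def by (intro Bochner_Integration.integral_diff integrable_rho_mult that cont_u continuous_on_const)
    finally show ?thesis using integral_rho[OF that, of x] by simp
  qed
  have "\<bar>P R x - P R x'\<bar> = \<bar>(LINT y|lborel. rho R (x - y) * (M - u y) - rho R (x' - y) * (M - u y))\<bar>"
    unfolding e[OF R(1)] by (subst Bochner_Integration.integral_diff) (auto intro!: integrable_rho_mult R cM)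
  also have "\<dots> \<le> (LINT y|lborel. ?c * (rho (3 * R) (x - y) * (M - u y)))"
    unfolding real_norm_def[symmetric]
  proof (rule Bochner_Integration.integral_norm_bound_integral)
    show "integrable lborel (\<lambda>y. rho R (x - y) * (M - u y) - rho R (x' - y) * (M - u y))"
      by (intro Bochner_Integration.integrable_diff integrable_rho_mult R cM)
    show "integrable lborel (\<lambda>y. ?c * (rho (3 * R) (x - y) * (M - u y)))"
      using R by (intro integrable_mult_right integrable_rho_mult cM) auto
    fix y
    have "\<bar>rho R (x - y) - rho R (x' - y)\<bar> * (M - u y) \<le> ?c * rho (3 * R) (x - y) * (M - u y)"
      using rho_diff_le[OF R(1), of "x - y" "x' - y"] R(2) le_M[of y] by (intro mult_right_mono) auto
    then show "norm (rho R (x - y) * (M - u y) - rho R (x' - y) * (M - u y)) \<le> ?c * (rho (3 * R) (x - y) * (M - u y))"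
      using le_M[of y] by (simp only: left_diff_distrib[symmetric] real_norm_def abs_mult mult.assoc abs_of_nonneg diff_ge_0_iff_ge)
  qed
  also have "\<dots> = ?c * (M - P (3 * R) x)" using e[of "3 * R" x] R by simp
  also have "M - P (3 * R) x = M - u x + K (3 * R) x"
    using green[of "3 * R" x] R unfolding P_def K_def by simp
  finally show ?thesis .
qed

lemma ln_integrable: "integrable lborel (\<lambda>y. (ln (norm (x' - y)) - ln (norm (x - y))) * f y)"
  and ln_dominated: "AE y in lborel. \<bar>ln (norm (x' - y)) - ln (norm (x - y))\<bar> * f y \<le>
     norm (x' - x) * (f y + Mf * (indicator (cball 0 1) (x' - y) / norm (x' - y)) + Mf * (indicator (cball 0 1) (x - y) / norm (x - y)))"
  and ln_dominator: "integrable lborel (\<lambda>y. norm (x' - x) * (f y + Mf * (indicator (cball 0 1) (x' - y) / norm (x' - y)) + Mf * (indicator (cball 0 1) (x - y) / norm (x - y))))"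
proof -
  let ?i = "\<lambda>x y. indicator (cball 0 1) (x - y) / norm (x - y :: plane)"
  show dom: "AE y in lborel. \<bar>ln (norm (x' - y)) - ln (norm (x - y))\<bar> * f y \<le> norm (x' - x) * (f y + Mf * ?i x' y + Mf * ?i x y)"
    using AE_lborel_singleton[of x] AE_lborel_singleton[of x']
  proof eventually_elim
    case (elim y)
    have i: "(if norm (z - y) \<le> 1 then 1 / norm (z - y) else 0) = ?i z y" for z by (simp add: indicator_def)
    have "\<bar>norm (x' - y) - norm (x - y)\<bar> \<le> norm (x' - x)" using norm_triangle_ineq3[of "x' - y" "x - y"] by simp
    then have "\<bar>ln (norm (x' - y)) - ln (norm (x - y))\<bar> \<le> norm (x' - x) * (1 + ?i x' y + ?i x y)"
      using ln_diff_le[of "norm (x' - y)" "norm (x - y)" "norm (x' - x)"] elim unfolding i by auto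
    then have "\<bar>ln (norm (x' - y)) - ln (norm (x - y))\<bar> * f y \<le> norm (x' - x) * (1 + ?i x' y + ?i x y) * f y"
      using f_nonneg by (rule mult_right_mono)
    also have "\<dots> = norm (x' - x) * (f y + f y * ?i x' y + f y * ?i x y)" by (simp add: algebra_simps)
    also have "\<dots> \<le> norm (x' - x) * (f y + Mf * ?i x' y + Mf * ?i x y)"
      using f_le_Mf[of y] by (intro mult_left_mono add_mono order_refl mult_right_mono) auto
    finally show ?case .
  qed
  show ib: "integrable lborel (\<lambda>y. norm (x' - x) * (f y + Mf * ?i x' y + Mf * ?i x y))"
    by (intro integrable_mult_right Bochner_Integration.integrable_add int_f integrable_inv_norm_shift)
  show "integrable lborel (\<lambda>y. (ln (norm (x' - y)) - ln (norm (x - y))) * f y)"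
  proof (rule Bochner_Integration.integrable_bound[OF ib])
    show "AE y in lborel. norm ((ln (norm (x' - y)) - ln (norm (x - y))) * f y) \<le> norm (norm (x' - x) * (f y + Mf * ?i x' y + Mf * ?i x y))"
      using dom
    proof eventually_elim
      case (elim y)
      have "norm ((ln (norm (x' - y)) - ln (norm (x - y))) * f y) = \<bar>ln (norm (x' - y)) - ln (norm (x - y))\<bar> * f y"
        using f_nonneg by (simp add: abs_mult)
      then show ?case using order_trans[OF elim abs_ge_self] by (simp only: real_norm_def)
    qed
  qed measurable
qed

text \<open>Dominated convergence: increments of \<open>log_cutoff\<close> are bounded by increments
  of \<open>ln\<close>, in which the radius \<open>n\<close> cancels.\<close>

lemma K_diff_tendsto:
  "(\<lambda>n. K (real n) x - K (real n) x') \<longlonglongrightarrow> 1 / (2 * pi) * (LINT y|lborel. (ln (norm (x' - y)) - ln (norm (x - y))) * f y)"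
proof -
  let ?D = "\<lambda>y. norm (x' - x) * (f y + Mf * (indicator (cball 0 1) (x' - y) / norm (x' - y)) + Mf * (indicator (cball 0 1) (x - y) / norm (x - y)))"
  \<comment> \<open>The value 0 at \<open>n = 0\<close>, where the radius degenerates, makes the
    domination hold for every \<open>n\<close>.\<close>
  have A: "(\<lambda>n. LINT y|lborel. (if n = 0 then 0 else (ker (real n) 0 (x - y) - ker (real n) 0 (x' - y)) * f y)) \<longlonglongrightarrow>
      (LINT y|lborel. 1 / (2 * pi) * ((ln (norm (x' - y)) - ln (norm (x - y))) * f y))"
  proof (rule integral_dominated_convergence)
    show "integrable lborel (\<lambda>y. 1 / (2 * pi) * ?D y)" by (intro integrable_mult_right ln_dominator)
    have kH: "ker (real n) 0 (z - y) = log_cutoff ((norm (z - y))\<^sup>2 / (real n)\<^sup>2) / (4 * pi)" if "z \<noteq> y" "n > 0" for n z y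
      using ker_eq_log_cutoff[of 0 "z - y" "real n"] that by simp
    have l2: "ln ((norm z)\<^sup>2) = 2 * ln (norm z)" if "z \<noteq> 0" for z :: plane
      using that by (simp add: ln_realpow)
    show "AE y in lborel. (\<lambda>n. if n = 0 then 0 else (ker (real n) 0 (x - y) - ker (real n) 0 (x' - y)) * f y) \<longlonglongrightarrow>
       1 / (2 * pi) * ((ln (norm (x' - y)) - ln (norm (x - y))) * f y)"
      using AE_lborel_singleton[of x] AE_lborel_singleton[of x']
    proof eventually_elim
      case (elim y)
      have "(\<lambda>n. (log_cutoff ((norm (x - y))\<^sup>2 / (real n)\<^sup>2) - log_cutoff ((norm (x' - y))\<^sup>2 / (real n)\<^sup>2)) / (4 * pi) * f y) \<longlonglongrightarrow>
        (ln ((norm (x' - y))\<^sup>2) - ln ((norm (x - y))\<^sup>2)) / (4 * pi) * f y"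
        using elim by (intro tendsto_mult tendsto_divide tendsto_const log_cutoff_diff_tendsto) auto
      also have "(ln ((norm (x' - y))\<^sup>2) - ln ((norm (x - y))\<^sup>2)) / (4 * pi) * f y = 1 / (2 * pi) * ((ln (norm (x' - y)) - ln (norm (x - y))) * f y)"
        using l2[of "x - y"] l2[of "x' - y"] elim by (simp add: field_simps)
      finally show ?case
      proof (rule Lim_transform_eventually)
        show "\<forall>\<^sub>F n in sequentially. (log_cutoff ((norm (x - y))\<^sup>2 / (real n)\<^sup>2) - log_cutoff ((norm (x' - y))\<^sup>2 / (real n)\<^sup>2)) / (4 * pi) * f y
          = (if n = 0 then 0 else (ker (real n) 0 (x - y) - ker (real n) 0 (x' - y)) * f y)"
          using eventually_gt_at_top[of "0::nat"] 
        proof eventually_elim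
          case (elim n)
          then show ?case using \<open>y \<noteq> x\<close> \<open>y \<noteq> x'\<close> kH[of x y n] kH[of x' y n] by (simp add: diff_divide_distrib)
        qed
      qed
    qed
    show "AE y in lborel. norm (if n = 0 then 0 else (ker (real n) 0 (x - y) - ker (real n) 0 (x' - y)) * f y) \<le> 1 / (2 * pi) * ?D y" for n
      using AE_lborel_singleton[of x] AE_lborel_singleton[of x'] ln_dominated[of x' x]
    proof eventually_elim
      case (elim y)
      have D0: "?D y \<ge> 0" using f_nonneg Mf_nonneg by auto
      show ?case
      proof (cases "n = 0")
        case True then show ?thesis using D0 by simp
      next
        case False
        have "\<bar>ker (real n) 0 (x - y) - ker (real n) 0 (x' - y)\<bar> = \<bar>log_cutoff ((norm (x - y))\<^sup>2 / (real n)\<^sup>2) - log_cutoff ((norm (x' - y))\<^sup>2 / (real n)\<^sup>2)\<bar> / (4 * pi)"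
          using elim False kH[of x y n] kH[of x' y n] by (simp add: diff_divide_distrib[symmetric] abs_divide)
        also have "\<dots> \<le> \<bar>ln ((norm (x - y))\<^sup>2 / (real n)\<^sup>2) - ln ((norm (x' - y))\<^sup>2 / (real n)\<^sup>2)\<bar> / (4 * pi)"
          using elim False by (intro divide_right_mono log_cutoff_diff_le) auto
        also have "\<dots> = 1 / (2 * pi) * \<bar>ln (norm (x' - y)) - ln (norm (x - y))\<bar>"
        proof -
          have "\<bar>2 * a - 2 * b\<bar> / (4 * pi) = 1 / (2 * pi) * \<bar>b - a\<bar>" for a b :: real
            by (auto simp: abs_if field_simps)
          then show ?thesis using elim False l2[of "x - y"] l2[of "x' - y"] by (simp add: ln_div)
        qed
        finally have "\<bar>ker (real n) 0 (x - y) - ker (real n) 0 (x' - y)\<bar> * f y \<le> 1 / (2 * pi) * \<bar>ln (norm (x' - y)) - ln (norm (x - y))\<bar> * f y"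
          using f_nonneg by (rule mult_right_mono)
        also have "\<dots> \<le> 1 / (2 * pi) * ?D y" unfolding mult.assoc using elim(3) by (intro mult_left_mono) auto
        finally show ?thesis using False f_nonneg by (simp add: abs_mult)
      qed
    qed
  qed measurable
  have E: "\<forall>\<^sub>F n in sequentially. (LINT y|lborel. (if n = 0 then 0 else (ker (real n) 0 (x - y) - ker (real n) 0 (x' - y)) * f y)) = K (real n) x - K (real n) x'"
    using eventually_gt_at_top[of "0::nat"]
  proof eventually_elim
    case (elim n)
    then show ?case unfolding K_def
      by (simp add: left_diff_distrib Bochner_Integration.integral_diff integrable_ker_f)
  qed
  from Lim_transform_eventually[OF A E] show ?thesis
    by (simp only: Bochner_Integration.integral_mult_right_zero)
qed

text \<open>A Liouville-type estimate: the factor \<open>1 / n\<close> of \<open>P_diff_le\<close>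
  meets a potential of size \<open>sqrt n\<close>, so the difference of the averages is of order
  \<open>1 / sqrt n\<close>.\<close>

lemma P_diff_tendsto: "(\<lambda>n. P (real n) x - P (real n) x') \<longlonglongrightarrow> 0"
proof (rule Lim_null_comparison)
  define B where "B = ((LINT y|lborel. f y) + Mf * (2 * pi)) / pi"
  let ?c = "15 * 9 * (9 / 5) ^ 3 * norm (x - x') :: real"
  let ?b = "\<lambda>n. ?c * ((M - u x) / real n + sqrt 3 * B / sqrt (real n))"
  show "\<forall>\<^sub>F n in sequentially. norm (P (real n) x - P (real n) x') \<le> ?b n"
    using eventually_ge_at_top[of "nat \<lceil>norm (x - x')\<rceil> + 1"]
  proof eventually_elim
    case (elim n)
    then have n: "real n > 0" "norm (x - x') \<le> real n" by linarith+
    have "\<bar>P (real n) x - P (real n) x'\<bar> \<le> 15 * 9 * (9 / 5) ^ 3 * (norm (x - x') / real n) * (M - u x + K (3 * real n) x)"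
      by (rule P_diff_le[OF n])
    also have "\<dots> \<le> 15 * 9 * (9 / 5) ^ 3 * (norm (x - x') / real n) * (M - u x + sqrt (3 * real n) * B)"
      using K_le[of "3 * real n" x] n by (intro mult_left_mono add_left_mono) (auto simp: B_def)
    also have "\<dots> = ?c * ((M - u x) / real n + sqrt 3 * B * (sqrt (real n) / real n))"
      by (simp add: real_sqrt_mult add_divide_distrib diff_divide_distrib distrib_left algebra_simps)
    also have "sqrt (real n) / real n = 1 / sqrt (real n)" using n by (simp add: real_div_sqrt field_simps)
    finally show ?case by simp
  qed
  have "?b \<longlonglongrightarrow> ?c * (0 + 0)"
    by (intro tendsto_mult tendsto_add tendsto_const tendsto_divide_0[OF tendsto_const] filterlim_at_top_imp_at_infinity
        filterlim_real_sequentially filterlim_compose[OF sqrt_at_top filterlim_real_sequentially])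
  then show "?b \<longlonglongrightarrow> 0" by simp
qed

text \<open>Differences are taken because \<open>f\<close> is only integrable: the integral of
  \<open>ln (norm (x - y)) * f y\<close> alone might diverge, while the difference of two logarithms
  is bounded at infinity.\<close>

theorem log_representation:
  "u x - u x' = 1 / (2 * pi) * (LINT y|lborel. (ln (norm (x' - y)) - ln (norm (x - y))) * f y)"
proof -
  have "(\<lambda>n. (P (real n) x - P (real n) x') + (K (real n) x - K (real n) x')) \<longlonglongrightarrow> 0 + 1 / (2 * pi) * (LINT y|lborel. (ln (norm (x' - y)) - ln (norm (x - y))) * f y)"
    by (intro tendsto_add P_diff_tendsto K_diff_tendsto)
  moreover have "\<forall>\<^sub>F n in sequentially. (P (real n) x - P (real n) x') + (K (real n) x - K (real n) x') = u x - u x'"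
    using eventually_gt_at_top[of "0::nat"]
  proof eventually_elim
    case (elim n)
    then show ?case using green[of "real n" x] green[of "real n" x'] unfolding P_def K_def by simp
  qed
  ultimately have "(\<lambda>n. u x - u x') \<longlonglongrightarrow> 0 + 1 / (2 * pi) * (LINT y|lborel. (ln (norm (x' - y)) - ln (norm (x - y))) * f y)"
    by (rule Lim_transform_eventually)
  then show ?thesis by (simp add: LIMSEQ_const_iff)
qed

end

section \<open>Reflections and behaviour at infinity\<close>

definition reflect :: "plane \<Rightarrow> real \<Rightarrow> plane \<Rightarrow> plane" where
  "reflect e l x = x + (2 * (l - e \<bullet> x)) *\<^sub>R e"

text \<open>The squared distance to \<open>y\<close> changes by four times the product of the signed
  distances of \<open>x\<close> and \<open>y\<close> to the line. It grows if both lie on the same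
  side and shrinks if the line separates them.\<close>

lemma norm_reflect_diff:
  assumes "norm e = 1"
  shows "(norm (reflect e l x - y))\<^sup>2 = (norm (x - y))\<^sup>2 + 4 * (l - e \<bullet> x) * (l - e \<bullet> y)"
proof -
  have e: "e \<bullet> e = 1" using assms by (simp add: norm_eq_1)
  have *: "(norm (z + c *\<^sub>R e))\<^sup>2 = (norm z)\<^sup>2 + 2 * c * (e \<bullet> z) + c\<^sup>2" for z c
    unfolding power2_norm_eq_inner by (simp add: inner_add_left inner_add_right inner_commute e power2_eq_square algebra_simps)
  have eq: "reflect e l x - y = (x - y) + (2 * (l - e \<bullet> x)) *\<^sub>R e" by (simp add: reflect_def)
  show ?thesis unfolding eq * by (simp add: inner_diff_right power2_eq_square algebra_simps)
qed

context plane_solution begin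

lemma f_eq_0_imp: "f x = 0 \<Longrightarrow> u x \<le> 0"
  by (simp add: f_def pos_part_def)

lemma f_eq_0_iff: "f x = 0 \<longleftrightarrow> u x \<le> 0"
  using p by (auto simp: f_def pos_part_def)

lemma constant_case:
  assumes "(LINT x|lborel. f x) = 0"
  shows "u x = u 0" "u x \<le> 0"
proof -
  have "AE x in lborel. f x = 0"
    using integral_nonneg_eq_0_iff_AE[OF int_f] f_nonneg assms by simp
  then have f0: "f x = 0" for x by (rule AE_lborel_continuous_eq_0[OF cont_f])
  show "u x = u 0" using log_representation[of x 0] by (simp add: f0)
  show "u x \<le> 0" using f_eq_0_imp[OF f0] .
qed

text \<open>Let the disk of radius \<open>A\<close> carry the mass \<open>mA > 3 / 4 * m\<close>. It
  contributes at most \<open>(ln (2 * A) - ln (norm x)) * mA\<close>, and the mass outside at most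
  \<open>(ln 2 + ln (norm x)) * (m - mA)\<close> plus a bounded term from points near
  \<open>x\<close>. The coefficient of \<open>ln (norm x)\<close> is thus at most
  \<open>m - 2 * mA \<le> - m / 2\<close>, and the factor \<open>1 / (2 * pi)\<close> gives
  \<open>m / (4 * pi)\<close>.\<close>

lemma decay:
  assumes m: "(LINT x|lborel. f x) > 0"
  obtains C r where "r \<ge> 1" "\<And>x. norm x \<ge> r \<Longrightarrow> u x \<le> C - (LINT x|lborel. f x) / (4 * pi) * ln (norm x)"
proof -
  define m where "m = (LINT x|lborel. f x)"
  have m0: "m > 0" using m by (simp add: m_def)
  have ind[measurable]: "cball 0 A \<in> sets (borel :: plane measure)" for A by simp
  have "(\<lambda>n. LINT y|lborel. indicator (cball 0 (real n)) y * f y) \<longlonglongrightarrow> (LINT y|lborel. f y)"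
  proof (rule integral_dominated_convergence[OF _ _ int_f])
    show "AE y in lborel. (\<lambda>n. indicator (cball 0 (real n)) y * f y) \<longlonglongrightarrow> f y"
    proof (rule AE_I2)
      fix y :: plane
      have "\<forall>\<^sub>F n in sequentially. f y = indicator (cball 0 (real n)) y * f y"
        using eventually_ge_at_top[of "nat \<lceil>norm y\<rceil>"] 
      proof eventually_elim
        case (elim n)
        then have "norm y \<le> real n" by linarith
        then show ?case by simp
      qed
      then show "(\<lambda>n. indicator (cball 0 (real n)) y * f y) \<longlonglongrightarrow> f y"
        by (rule Lim_transform_eventually[OF tendsto_const])
    qed
    show "AE y in lborel. norm (indicator (cball 0 (real n)) y * f y) \<le> f y" for n
      using f_nonneg by (intro AE_I2) (simp add: indicator_def)
  qed measurable
  then have "\<forall>\<^sub>F n in sequentially. 3 / 4 * m < (LINT y|lborel. indicator (cball 0 (real n)) y * f y)"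
    using m0 by (intro order_tendstoD(1)) (auto simp: m_def)
  then have "\<forall>\<^sub>F n in sequentially. 3 / 4 * m < (LINT y|lborel. indicator (cball 0 (real n)) y * f y) \<and> n \<ge> 1"
    using eventually_ge_at_top by (rule eventually_conj)
  then obtain n where n: "3 / 4 * m < (LINT y|lborel. indicator (cball 0 (real n)) y * f y)" "n \<ge> 1"
    using eventually_happens by fastforce
  define A where "A = real n"
  have A: "A \<ge> 1" using n by (simp add: A_def)
  define mA where "mA = (LINT y|lborel. indicator (cball 0 A) y * f y)"
  have mA: "3 / 4 * m < mA" using n by (simp add: mA_def A_def)
  have imA: "integrable lborel (\<lambda>y. indicator (cball 0 A) y * f y)"
    using loc_int_integrable[OF int_f] by (simp add: loc_int_def)
  define C where "C = u 0 + 1 / (2 * pi) * (ln (2 * A) * mA + ln 2 * (m - mA) + 2 * pi * Mf)"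
  show ?thesis
  proof (rule that[of "2 * A" C])
    show "1 \<le> 2 * A" using A by simp
    fix x :: plane assume x: "2 * A \<le> norm x"
    define L where "L = ln (norm x)"
    have nx: "norm x > 0" using x A by linarith
    have L: "L \<ge> 0" unfolding L_def using x A by (intro ln_ge_zero) linarith
    let ?i = "\<lambda>y. indicator (cball 0 1) (x - y) / norm (x - y)"
    have l1: "ln (1 + norm x) \<le> ln 2 + L"
    proof -
      have "ln (1 + norm x) \<le> ln (2 * norm x)" using x A by (intro ln_mono) auto
      also have "\<dots> = ln 2 + L" unfolding L_def using nx by (simp add: ln_mult)
      finally show ?thesis .
    qed
    have lA: "ln A \<ge> 0" using A by simp
    have "(LINT y|lborel. (ln (norm (0 - y)) - ln (norm (x - y))) * f y)
        \<le> (LINT y|lborel. (ln (2 * A) - L) * (indicator (cball 0 A) y * f y) + (ln 2 + L) * (f y - indicator (cball 0 A) y * f y) + Mf * ?i y)"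
    proof (rule integral_mono_AE[OF ln_integrable])
      show "integrable lborel (\<lambda>y. (ln (2 * A) - L) * (indicator (cball 0 A) y * f y) + (ln 2 + L) * (f y - indicator (cball 0 A) y * f y) + Mf * ?i y)"
        by (intro Bochner_Integration.integrable_add integrable_mult_right Bochner_Integration.integrable_diff imA int_f integrable_inv_norm_shift)
      show "AE y in lborel. (ln (norm (0 - y)) - ln (norm (x - y))) * f y \<le>
        (ln (2 * A) - L) * (indicator (cball 0 A) y * f y) + (ln 2 + L) * (f y - indicator (cball 0 A) y * f y) + Mf * ?i y"
        using AE_lborel_singleton[of x] AE_lborel_singleton[of 0]
      proof eventually_elim
        case (elim y)
        have pos: "norm (x - y) > 0" "norm y > 0" using elim by auto
        have i0: "?i y \<ge> 0" by simp
        show ?case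
        proof (cases "norm y \<le> A")
          case True
          have "norm x / 2 \<le> norm (x - y)" using True x norm_triangle_ineq2[of x y] by linarith
          then have "ln (norm x / 2) \<le> ln (norm (x - y))" using x A by (intro ln_mono) auto
          moreover have "ln (norm x / 2) = L - ln 2" unfolding L_def using nx by (simp add: ln_div)
          moreover have "ln (norm y) \<le> ln A" using True pos by (intro ln_mono) auto
          moreover have "ln (2 * A) = ln 2 + ln A" using A by (simp add: ln_mult)
          ultimately have "ln (norm (0 - y)) - ln (norm (x - y)) \<le> ln (2 * A) - L" by simp
          then have "(ln (norm (0 - y)) - ln (norm (x - y))) * f y \<le> (ln (2 * A) - L) * f y"
            using f_nonneg by (rule mult_right_mono)
          moreover have "Mf * ?i y \<ge> 0" using i0 Mf_nonneg by (rule mult_nonneg_nonneg[rotated])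
          ultimately show ?thesis using True by simp
        next
          case False
          have ny: "norm y \<le> norm (x - y) + norm x" using norm_triangle_ineq4[of x "x - y"] by simp
          have "(ln (norm (0 - y)) - ln (norm (x - y))) \<le> ln 2 + L + ?i y"
          proof (cases "norm (x - y) \<ge> 1")
            case True
            have "norm (x - y) + norm x \<le> norm (x - y) * (1 + norm x)"
              using mult_right_mono[OF True norm_ge_zero[of x]] by (simp add: algebra_simps)
            then have "ln (norm y) \<le> ln (norm (x - y) * (1 + norm x))" using ny pos by (intro ln_mono) auto
            also have "\<dots> = ln (norm (x - y)) + ln (1 + norm x)" 
              using pos add_pos_nonneg[OF zero_less_one norm_ge_zero, of x] by (simp add: ln_mult)
            finally show ?thesis using l1 i0 unfolding diff_0 norm_minus_cancel by linarith
          next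
            case near: False
            have "ln (norm y) \<le> ln (1 + norm x)" using ny near pos by (intro ln_mono) auto
            moreover have "- ln (norm (x - y)) \<le> 1 / norm (x - y)"
              using ln_le_minus_one[of "1 / norm (x - y)"] pos by (simp add: ln_div)
            moreover have "?i y = 1 / norm (x - y)" using near by (simp add: indicator_def)
            ultimately show ?thesis using l1 unfolding diff_0 norm_minus_cancel by linarith
          qed
          then have "(ln (norm (0 - y)) - ln (norm (x - y))) * f y \<le> (ln 2 + L + ?i y) * f y"
            using f_nonneg by (rule mult_right_mono)
          also have "\<dots> = (ln 2 + L) * f y + f y * ?i y" by (simp add: algebra_simps)
          also have "\<dots> \<le> (ln 2 + L) * f y + Mf * ?i y"
            using f_le_Mf[of y] i0 by (intro add_left_mono mult_right_mono) auto
          finally show ?thesis using False by simp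
        qed
      qed
    qed
    also have "\<dots> = (ln (2 * A) - L) * mA + (ln 2 + L) * (m - mA) + Mf * (2 * pi)"
      using imA int_f integrable_inv_norm_shift[of 1 x] integral_inv_norm_shift[of x]
      by (simp only: Bochner_Integration.integral_add Bochner_Integration.integral_mult_right_zero Bochner_Integration.integral_diff
          Bochner_Integration.integrable_add integrable_mult_right Bochner_Integration.integrable_diff mA_def m_def)
    also have "\<dots> = (ln (2 * A) * mA + ln 2 * (m - mA) + 2 * pi * Mf) - L * (2 * mA - m)" by (simp add: algebra_simps)
    also have "\<dots> \<le> (ln (2 * A) * mA + ln 2 * (m - mA) + 2 * pi * Mf) - L * (m / 2)"
      using L mA by (intro diff_left_mono mult_left_mono) auto
    finally have I: "1 / (2 * pi) * (LINT y|lborel. (ln (norm (0 - y)) - ln (norm (x - y))) * f y)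
      \<le> 1 / (2 * pi) * ((ln (2 * A) * mA + ln 2 * (m - mA) + 2 * pi * Mf) - L * (m / 2))"
      by (rule mult_left_mono) simp
    have "u x \<le> 1 / (2 * pi) * ((ln (2 * A) * mA + ln 2 * (m - mA) + 2 * pi * Mf) - L * (m / 2)) + u 0"
      unfolding log_representation[of x 0, unfolded diff_eq_eq] by (rule add_right_mono[OF I])
    also have "\<dots> = C - m / (4 * pi) * L"
    proof -
      have "1 / (2 * pi) * (Y - L * (m / 2)) + c = c + 1 / (2 * pi) * Y - m / (4 * pi) * L" for Y c :: real
        by (simp add: right_diff_distrib)
      then show ?thesis unfolding C_def .
    qed
    finally show "u x \<le> C - (LINT x|lborel. f x) / (4 * pi) * ln (norm x)"
      unfolding L_def m_def .
  qed
qed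

lemma tends_to_minus_infinity:
  assumes m: "(LINT x|lborel. f x) > 0"
  obtains r where "r \<ge> 1" "\<And>x. norm x \<ge> r \<Longrightarrow> u x \<le> c"
proof (rule decay[OF m])
  fix r C assume C: "r \<ge> 1" "\<And>x. norm x \<ge> r \<Longrightarrow> u x \<le> C - (LINT x|lborel. f x) / (4 * pi) * ln (norm x)"
  define a where "a = (LINT x|lborel. f x) / (4 * pi)"
  have a: "a > 0" using m by (simp add: a_def)
  define r' where "r' = max r (exp ((C - c) / a))"
  show thesis
  proof (rule that[of r'])
    show "r' \<ge> 1" using C(1) by (simp add: r'_def)
    fix x :: plane assume x: "norm x \<ge> r'"
    then have "(C - c) / a \<le> ln (norm x)" using C(1) by (subst ln_ge_iff) (auto simp: r'_def)
    then have "C - c \<le> a * ln (norm x)" using a by (simp add: field_simps)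
    then show "u x \<le> c" using C(2)[of x, folded a_def] x by (simp add: r'_def)
  qed
qed

text \<open>For \<open>y\<close> in the bounded support of \<open>f\<close>, reflecting
  \<open>x\<close> raises the squared distance to \<open>y\<close> by at most a multiple of
  \<open>norm x\<close>, whereas that distance is at least \<open>norm x / 2\<close>. By
  \<open>ln t \<le> t - 1\<close> the logarithm grows by at most order
  \<open>1 / norm x\<close>.\<close>

lemma reflect_diff_lower:
  assumes e: "norm e = 1" and R: "R > 0" "\<And>y. norm y > R \<Longrightarrow> f y = 0" and eps: "\<epsilon> > 0"
  obtains r where "\<And>x. norm x > r \<Longrightarrow> u (reflect e l x) - u x \<ge> - \<epsilon>"
proof -
  define m where "m = (LINT x|lborel. f x)"
  define B where "B t = 1 / (2 * pi) * (8 * (\<bar>l\<bar> + t) * (\<bar>l\<bar> + R) / t\<^sup>2 * m)" for t :: real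
  have "(B \<longlongrightarrow> 1 / (2 * pi) * (8 * (0 + 0) * (\<bar>l\<bar> + R) * m)) at_top"
  proof -
    have "((\<lambda>t. 1 / (2 * pi) * (8 * (\<bar>l\<bar> / t\<^sup>2 + 1 / t) * (\<bar>l\<bar> + R) * m)) \<longlongrightarrow> 1 / (2 * pi) * (8 * (0 + 0) * (\<bar>l\<bar> + R) * m)) at_top"
      by (intro tendsto_mult tendsto_const tendsto_add tendsto_divide_0[OF tendsto_const] filterlim_at_top_imp_at_infinity
          filterlim_pow_at_top filterlim_ident) auto
    then show ?thesis
    proof (rule Lim_transform_eventually)
      show "\<forall>\<^sub>F t in at_top. 1 / (2 * pi) * (8 * (\<bar>l\<bar> / t\<^sup>2 + 1 / t) * (\<bar>l\<bar> + R) * m) = B t"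
        using eventually_gt_at_top[of 0] by eventually_elim (simp add: B_def field_simps power2_eq_square)
    qed
  qed
  then have "\<forall>\<^sub>F t in at_top. B t < \<epsilon>" using eps by (intro order_tendstoD(2)) auto
  then obtain T where T: "\<And>t. t \<ge> T \<Longrightarrow> B t < \<epsilon>" unfolding eventually_at_top_linorder by blast
  show ?thesis
  proof (rule that[of "max T (2 * R)"])
    fix x :: plane assume x: "norm x > max T (2 * R)"
    define t where "t = norm x"
    have t: "t > 2 * R" "t > 0" "t \<ge> T" using x R(1) by (auto simp: t_def)
    define c where "c = 8 * (\<bar>l\<bar> + t) * (\<bar>l\<bar> + R) / t\<^sup>2"
    have "(LINT y|lborel. - c * f y) \<le> (LINT y|lborel. (ln (norm (x - y)) - ln (norm (reflect e l x - y))) * f y)"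
    proof (rule integral_mono_AE)
      show "integrable lborel (\<lambda>y. - c * f y)" by (intro integrable_mult_right int_f)
      show "integrable lborel (\<lambda>y. (ln (norm (x - y)) - ln (norm (reflect e l x - y))) * f y)" by (rule ln_integrable)
      show "AE y in lborel. - c * f y \<le> (ln (norm (x - y)) - ln (norm (reflect e l x - y))) * f y"
        using AE_lborel_singleton[of "reflect e l x"]
      proof eventually_elim
        case (elim y)
        show ?case
        proof (cases "norm y > R")
          case True then show ?thesis using R(2) by simp
        next
          case False
          define a where "a = norm (x - y)"
          define b where "b = norm (reflect e l x - y)"
          have a: "a \<ge> t / 2" using False t norm_triangle_ineq2[of x y] by (simp add: a_def t_def)
          then have a0: "a > 0" using t by linarith
          have b0: "b > 0" using elim by (simp add: b_def)
          have "\<bar>e \<bullet> x\<bar> \<le> t" "\<bar>e \<bullet> y\<bar> \<le> R"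
            using Cauchy_Schwarz_ineq2[of e x] Cauchy_Schwarz_ineq2[of e y] e False by (auto simp: t_def)
          then have "\<bar>(l - e \<bullet> x) * (l - e \<bullet> y)\<bar> \<le> (\<bar>l\<bar> + t) * (\<bar>l\<bar> + R)"
            unfolding abs_mult by (intro mult_mono) auto
          then have "(l - e \<bullet> x) * (l - e \<bullet> y) \<le> (\<bar>l\<bar> + t) * (\<bar>l\<bar> + R)" by (rule abs_le_D1)
          then have ba: "b\<^sup>2 - a\<^sup>2 \<le> 4 * ((\<bar>l\<bar> + t) * (\<bar>l\<bar> + R))"
            unfolding a_def b_def norm_reflect_diff[OF e] mult.assoc by linarith
          have "2 * (ln b - ln a) = ln (b\<^sup>2 / a\<^sup>2)" using a0 b0 by (simp add: ln_div ln_realpow)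
          also have "\<dots> \<le> b\<^sup>2 / a\<^sup>2 - 1" using a0 b0 by (intro ln_le_minus_one) auto
          also have "\<dots> = (b\<^sup>2 - a\<^sup>2) / a\<^sup>2" using a0 by (simp add: diff_divide_distrib)
          also have "\<dots> \<le> 4 * ((\<bar>l\<bar> + t) * (\<bar>l\<bar> + R)) / a\<^sup>2" using ba by (intro divide_right_mono) auto
          also have "\<dots> \<le> 4 * ((\<bar>l\<bar> + t) * (\<bar>l\<bar> + R)) / (t / 2)\<^sup>2"
            using a t R(1) by (intro divide_left_mono power_mono mult_pos_pos) auto
          also have "\<dots> = 2 * c" by (simp add: c_def power2_eq_square)
          finally have "- c \<le> ln a - ln b" by simp
          then show ?thesis using f_nonneg unfolding a_def b_def by (rule mult_right_mono)
        qed
      qed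
    qed
    then have "- c * m \<le> (LINT y|lborel. (ln (norm (x - y)) - ln (norm (reflect e l x - y))) * f y)"
      by (simp add: m_def)
    then have "1 / (2 * pi) * (- c * m) \<le> 1 / (2 * pi) * (LINT y|lborel. (ln (norm (x - y)) - ln (norm (reflect e l x - y))) * f y)"
      by (rule mult_left_mono) simp
    also have "\<dots> = u (reflect e l x) - u x" by (rule log_representation[symmetric])
    also have "1 / (2 * pi) * (- c * m) = - B t" by (simp add: B_def c_def)
    finally show "u (reflect e l x) - u x \<ge> - \<epsilon>" using T[OF t(3)] by linarith
  qed
qed

end

section \<open>Moving planes\<close>

lemma C1_on_compose_affine:
  assumes u: "C1_on S u G" and A: "linear A" "\<And>v w. A v \<bullet> w = v \<bullet> A w"
    and T: "\<And>x. x \<in> S' \<Longrightarrow> A x + b \<in> S"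
  shows "C1_on S' (\<lambda>x. u (A x + b)) (\<lambda>x. A (G (A x + b)))"
  unfolding C1_on_def
proof (intro conjI ballI)
  fix x assume x: "x \<in> S'"
  have "((\<lambda>x. A x + b) has_derivative A) (at x)"
    using A(1) by (auto intro!: derivative_eq_intros linear_imp_has_derivative)
  from has_derivative_compose[OF this C1_on_deriv[OF u T[OF x]]]
  show "((\<lambda>x. u (A x + b)) has_derivative (\<bullet>) (A (G (A x + b)))) (at x)"
    by (rule has_derivative_eq_rhs) (simp add: fun_eq_iff A(2))
next
  have cA: "continuous_on X A" for X using A(1) by (rule linear_continuous_on_compose[OF continuous_on_id])
  have "continuous_on S' (\<lambda>x. A x + b)" by (intro continuous_on_add cA continuous_on_const)
  then have "continuous_on S' (\<lambda>x. G (A x + b))"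
    using T by (intro continuous_on_compose2[OF C1_on_continuous_grad[OF u]]) auto
  then show "continuous_on S' (\<lambda>x. A (G (A x + b)))"
    using A(1) by (rule linear_continuous_on_compose)
qed

text \<open>A self-adjoint \<open>A\<close> whose square is \<open>k\<close> times the identity
  covers reflections, with \<open>k = 1\<close>, and dilations by \<open>R\<close>, with
  \<open>k = R^2\<close>.\<close>

lemma laplacian_compose_affine:
  assumes S: "open S" and S': "open S'" and u: "C2_on S u G Hs" and A: "linear A" "\<And>v w. A v \<bullet> w = v \<bullet> A w" "\<And>v. A (A v) = k *\<^sub>R v"
    and T: "\<And>x. x \<in> S' \<Longrightarrow> A x + b \<in> S"
  obtains K where "C2_on S' (\<lambda>x. u (A x + b)) (\<lambda>x. A (G (A x + b))) K"
    "\<And>x. x \<in> S' \<Longrightarrow> laplacian (\<lambda>x. u (A x + b)) x = k * laplacian u (A x + b)"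
proof -
  define K where "K e x = A (\<Sum>c\<in>Basis. (A e \<bullet> c) *\<^sub>R Hs c (A x + b))" for e x
  interpret A: linear A by fact
  have C: "C2_on S' (\<lambda>x. u (A x + b)) (\<lambda>x. A (G (A x + b))) K"
    unfolding C2_on_def
  proof (intro conjI ballI)
    show "C1_on S' (\<lambda>x. u (A x + b)) (\<lambda>x. A (G (A x + b)))"
      by (rule C1_on_compose_affine[OF C2_on_C1[OF u] A(1,2) T])
    fix e :: plane
    have "C1_on S (\<lambda>x. G x \<bullet> A e) (\<lambda>x. \<Sum>c\<in>Basis. (A e \<bullet> c) *\<^sub>R Hs c x)"
      by (rule C1_on_grad_inner) (use u in \<open>simp add: C2_on_def\<close>)
    from C1_on_compose_affine[OF this A(1,2) T]
    show "C1_on S' (\<lambda>x. A (G (A x + b)) \<bullet> e) (K e)"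
      unfolding K_def[abs_def] A(2) .
  qed
  show ?thesis
  proof (rule that[OF C])
    fix x assume x: "x \<in> S'"
    have "laplacian (\<lambda>x. u (A x + b)) x = (\<Sum>e\<in>Basis. K e x \<bullet> e)" by (rule laplacian_C2_on[OF S' C x])
    also have "\<dots> = (\<Sum>e\<in>Basis. \<Sum>c\<in>Basis. (e \<bullet> A c) * (Hs c (A x + b) \<bullet> A e))"
      by (simp add: K_def A(2) inner_sum_left)
    also have "\<dots> = (\<Sum>c\<in>Basis. \<Sum>e\<in>Basis. (e \<bullet> A c) * (Hs c (A x + b) \<bullet> A e))" by (rule sum.swap)
    also have "\<dots> = (\<Sum>c\<in>Basis. Hs c (A x + b) \<bullet> A (\<Sum>e\<in>Basis. (A c \<bullet> e) *\<^sub>R e))"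
      by (simp add: A.sum A.scale inner_sum_right inner_commute)
    also have "\<dots> = k * (\<Sum>c\<in>Basis. Hs c (A x + b) \<bullet> c)"
      by (simp add: euclidean_representation A(3) sum_distrib_left)
    also have "(\<Sum>c\<in>Basis. Hs c (A x + b) \<bullet> c) = laplacian u (A x + b)"
      by (rule laplacian_C2_on[OF S u T[OF x], symmetric])
    finally show "laplacian (\<lambda>x. u (A x + b)) x = k * laplacian u (A x + b)" .
  qed
qed

lemma C2_on_diff:
  assumes "C2_on S u G Hs" "C2_on S v K L"
  shows "C2_on S (\<lambda>x. u x - v x) (\<lambda>x. G x - K x) (\<lambda>e x. Hs e x - L e x)"
  unfolding C2_on_def inner_diff_left
  using C1_on_diff[OF C2_on_C1[OF assms(1)] C2_on_C1[OF assms(2)]]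
    C1_on_diff[OF C2_on_C1_grad[OF assms(1)] C2_on_C1_grad[OF assms(2)]] by blast

lemma laplacian_diff:
  assumes "open S" "C2_on S u G Hs" "C2_on S v K L" "x \<in> S"
  shows "laplacian (\<lambda>x. u x - v x) x = laplacian u x - laplacian v x"
  using laplacian_C2_on[OF assms(1) C2_on_diff[OF assms(2,3)] assms(4)]
    laplacian_C2_on[OF assms(1,2,4)] laplacian_C2_on[OF assms(1,3,4)]
  by (simp add: inner_diff_left sum_subtractf)

lemma laplacian_local_min:
  assumes S: "open S" "x \<in> S" and v: "C2_on S v G Hs" and min: "\<And>y. y \<in> S \<Longrightarrow> v x \<le> v y"
  shows "laplacian v x \<ge> 0"
proof -
  obtain r where r: "r > 0" "ball x r \<subseteq> S" using S open_contains_ball by blast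
  have "Hs e x \<bullet> e \<ge> 0" if e: "e \<in> Basis" for e
  proof (rule ccontr)
    assume neg: "\<not> Hs e x \<bullet> e \<ge> 0"
    have S': "x + t *\<^sub>R e \<in> S" if "\<bar>t\<bar> < r" for t
      using that e r(2) by (auto simp: dist_norm)
    have line: "((\<lambda>t. x + t *\<^sub>R e) has_derivative (\<lambda>t. t *\<^sub>R e)) (at t)" for t
      by (auto intro!: derivative_eq_intros)
    have d1: "((\<lambda>t. v (x + t *\<^sub>R e)) has_real_derivative G (x + t *\<^sub>R e) \<bullet> e) (at t)" if "\<bar>t\<bar> < r" for t
      unfolding has_field_derivative_def
      by (rule has_derivative_eq_rhs[OF has_derivative_compose[OF line C1_on_deriv[OF C2_on_C1[OF v] S'[OF that]]]])
         (simp add: fun_eq_iff)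
    have d2: "((\<lambda>t. G (x + t *\<^sub>R e) \<bullet> e) has_real_derivative Hs e (x + t *\<^sub>R e) \<bullet> e) (at t)" if "\<bar>t\<bar> < r" for t
      unfolding has_field_derivative_def
      by (rule has_derivative_eq_rhs[OF has_derivative_compose[OF line C1_on_deriv[OF C2_on_C1_grad[OF v e] S'[OF that]]]])
         (simp add: fun_eq_iff)
    have "G (x + 0 *\<^sub>R e) \<bullet> e = 0"
    proof (rule DERIV_local_min[OF d1])
      show "0 < r" by fact
      show "\<forall>y. \<bar>0 - y\<bar> < r \<longrightarrow> v (x + 0 *\<^sub>R e) \<le> v (x + y *\<^sub>R e)" using min S' by simp
    qed (use r in simp)
    then have G0: "G x \<bullet> e = 0" by simp
    obtain d where d: "d > 0" "\<And>h. 0 < h \<Longrightarrow> h < d \<Longrightarrow> G (x + (0 + h) *\<^sub>R e) \<bullet> e < G (x + 0 *\<^sub>R e) \<bullet> e"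
      using DERIV_neg_dec_right[OF d2[of 0]] neg r by auto
    define b where "b = min d r / 2"
    have b: "0 < b" "b < d" "b < r" using d r by (auto simp: b_def)
    have "v (x + b *\<^sub>R e) < v (x + 0 *\<^sub>R e)"
    proof (rule DERIV_neg_imp_decreasing_open[OF b(1), of "\<lambda>t. v (x + t *\<^sub>R e)"])
      fix t assume t: "0 < t" "t < b"
      show "\<exists>y. ((\<lambda>t. v (x + t *\<^sub>R e)) has_real_derivative y) (at t) \<and> y < 0"
        using d1[of t] d(2)[of t] t b G0 by (intro exI[of _ "G (x + t *\<^sub>R e) \<bullet> e"]) auto
    next
      show "continuous_on {0..b} (\<lambda>t. v (x + t *\<^sub>R e))"
        using b by (intro continuous_at_imp_continuous_on ballI DERIV_isCont[OF d1]) auto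
    qed
    moreover have "v x \<le> v (x + b *\<^sub>R e)" using min S' b by simp
    ultimately show False by simp
  qed
  then show ?thesis using laplacian_C2_on[OF S(1) v S(2)] by (simp add: sum_nonneg)
qed

text \<open>At a zero, Green's representation writes 0 as a sum of two nonnegative integrals. As
  \<open>rho R (x - y)\<close> is positive inside the disk, \<open>z\<close> vanishes there. The
  zero set is therefore open, closed in \<open>D\<close>, and not empty.\<close>

lemma strong_minimum_principle:
  assumes D: "open D" "connected D" and z: "C2_on D z G Hs" and nonneg: "\<And>x. x \<in> D \<Longrightarrow> z x \<ge> 0"
    and super: "\<And>x. x \<in> D \<Longrightarrow> laplacian z x \<le> 0" and x0: "x0 \<in> D" "z x0 = 0" and x: "x \<in> D"
  shows "z x = 0"
proof -
  have cz: "continuous_on D z" by (rule C1_on_continuous[OF C2_on_C1[OF z]])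
  have loc: "z y = 0" if x: "x \<in> D" "z x = 0" and R: "R > 0" "cball x R \<subseteq> D" and y: "y \<in> ball x R" for x y R
  proof (rule ccontr)
    assume "z y \<noteq> 0"
    then have zy: "z y > 0" using nonneg[OF subsetD[OF R(2) subsetD[OF ball_subset_cball y]]] by simp
    define U where "U = ball x R \<inter> z -` {0<..} \<inter> D"
    have "open (D \<inter> z -` {0<..})" using cz D(1) by (rule continuous_open_preimage) auto
    then have "open U" unfolding U_def by (metis Int_assoc Int_commute open_Int open_ball)
    moreover have "y \<in> U" using y zy R by (auto simp: U_def)
    ultimately have nn: "\<not> negligible U" using open_not_negligible by blast
    have r0: "rho R (x - y) = 0" "ker R 0 (x - y) = 0" if "y \<notin> cball x R" for y
      using that rho_eq_0[OF R(1), of "x - y"] ker_eq_0[OF R(1), of 0 "x - y"] by (auto simp: dist_norm)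
    have p1: "rho R (x - y) * z y \<ge> 0" for y
      using nonneg[of y] R(2) r0(1)[of y] rho_nonneg[of R "x - y"] by (cases "y \<in> cball x R") auto
    have p2: "ker R 0 (x - y) * (- laplacian z y) \<ge> 0" for y
      using super[of y] R(2) r0(2)[of y] ker_nonneg[of R 0 "x - y"]
      by (cases "y \<in> cball x R") (auto intro!: mult_nonneg_nonpos)
    have "(LINT y|lborel. rho R (x - y) * z y) + (LINT y|lborel. ker R 0 (x - y) * (- laplacian z y)) = 0"
      using green_representation[OF R(1) D(1) R(2) z] x by simp
    moreover have "(LINT y|lborel. rho R (x - y) * z y) \<ge> 0" "(LINT y|lborel. ker R 0 (x - y) * (- laplacian z y)) \<ge> 0"
      by (rule Bochner_Integration.integral_nonneg, rule p1, rule Bochner_Integration.integral_nonneg, rule p2)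
    ultimately have I0: "(LINT y|lborel. rho R (x - y) * z y) = 0" by linarith
    have "continuous_on (cball x R) (\<lambda>y. rho R (x - y) * z y)"
      unfolding rho_def cutoff_def divide_inverse using continuous_on_subset[OF cz R(2)]
      by (intro continuous_intros) auto
    from borel_integrable_compact[OF compact_cball this]
    have "integrable lborel (\<lambda>y. indicator (cball x R) y * (rho R (x - y) * z y))" by simp
    also have "(\<lambda>y. indicator (cball x R) y * (rho R (x - y) * z y)) = (\<lambda>y. rho R (x - y) * z y)"
      using r0(1) by (auto simp: fun_eq_iff indicator_def)
    finally have "AE y in lborel. rho R (x - y) * z y = 0"
      using integral_nonneg_eq_0_iff_AE[of lborel "\<lambda>y. rho R (x - y) * z y"] I0 p1 by simp
    moreover have rpos: "rho R (x - y) > 0" if "y \<in> U" for y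
    proof -
      have "norm (x - y) < R" using that by (simp add: U_def dist_norm)
      then have "(norm (x - y))\<^sup>2 < R\<^sup>2" by (intro power_strict_mono) auto
      then show ?thesis using R by (simp add: rho_def cutoff_def)
    qed
    moreover have "z y > 0" if "y \<in> U" for y using that by (simp add: U_def)
    ultimately have "AE y in lborel. y \<notin> U"
      using less_irrefl[of 0] by (auto elim!: eventually_mono simp: mult_eq_0_iff) (metis less_irrefl)+
    then have "U \<in> null_sets lborel" using \<open>open U\<close> by (subst AE_iff_null_sets) auto
    then show False using nn negligible_iff_null_sets null_sets_completionI by blast
  qed
  define Z where "Z = {x \<in> D. z x = 0}"
  have "openin (top_of_set D) Z"
  proof -
    have "\<exists>r>0. ball x r \<subseteq> Z" if "x \<in> Z" for x
    proof -
      have "x \<in> D" using that by (simp add: Z_def)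
      with D(1)[unfolded open_contains_cball] have "\<exists>R>0. cball x R \<subseteq> D" by (rule bspec)
      then obtain R where R: "R > 0" "cball x R \<subseteq> D" by blast
      have "ball x R \<subseteq> Z"
        using loc[OF _ _ R] that R(2) ball_subset_cball[of x R] by (auto simp: Z_def)
      then show ?thesis using R by blast
    qed
    then have "open Z" unfolding open_contains_ball by blast
    then show ?thesis by (auto simp: Z_def openin_open_eq[OF D(1)])
  qed
  moreover have "closedin (top_of_set D) Z"
    unfolding Z_def using continuous_closedin_preimage_constant[OF cz, of 0] by (simp add: vimage_def Int_def)
  ultimately have "Z = {} \<or> Z = D" using D(2) connected_clopen by blast
  then show ?thesis using x0 x by (auto simp: Z_def)
qed

lemma inner_reflect: "norm e = 1 \<Longrightarrow> e \<bullet> reflect e l x = 2 * l - e \<bullet> x"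
  by (simp add: reflect_def inner_add_right norm_eq_1 algebra_simps)

lemma reflect_reflect: "norm e = 1 \<Longrightarrow> reflect e l (reflect e l x) = x"
  by (simp add: reflect_def inner_add_right norm_eq_1 algebra_simps)

lemma reflect_eq: "e \<bullet> x = l \<Longrightarrow> reflect e l x = x"
  by (simp add: reflect_def)

lemma laplacian_reflect:
  assumes e: "norm e = 1" and S: "open S" "open S'" and u: "C2_on S u G Hs" and T: "\<And>x. x \<in> S' \<Longrightarrow> reflect e l x \<in> S"
  obtains G' K where "C2_on S' (\<lambda>x. u (reflect e l x)) G' K"
    "\<And>x. x \<in> S' \<Longrightarrow> laplacian (\<lambda>x. u (reflect e l x)) x = laplacian u (reflect e l x)"
proof -
  define A where "A x = x - (2 * (e \<bullet> x)) *\<^sub>R e" for x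
  have r: "reflect e l x = A x + (2 * l) *\<^sub>R e" for x
    by (simp add: reflect_def A_def right_diff_distrib scaleR_diff_left)
  have A1: "linear A"
    unfolding A_def by (rule linearI) (simp_all add: inner_add_right algebra_simps scaleR_add_left)
  have A2: "A v \<bullet> w = v \<bullet> A w" for v w
    by (simp add: A_def inner_diff_left inner_diff_right inner_commute)
  have A3: "A (A v) = 1 *\<^sub>R v" for v
    using e by (simp add: A_def inner_diff_right norm_eq_1)
  have T': "x \<in> S' \<Longrightarrow> A x + (2 * l) *\<^sub>R e \<in> S" for x using T by (simp add: r)
  obtain K where K: "C2_on S' (\<lambda>x. u (A x + (2 * l) *\<^sub>R e)) (\<lambda>x. A (G (A x + (2 * l) *\<^sub>R e))) K"
    "\<And>x. x \<in> S' \<Longrightarrow> laplacian (\<lambda>x. u (A x + (2 * l) *\<^sub>R e)) x = 1 * laplacian u (A x + (2 * l) *\<^sub>R e)"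
    by (rule laplacian_compose_affine[OF S u A1 A2 A3 T']) blast+
  show ?thesis
    by (rule that[OF K(1)[folded r]]) (use K(2)[folded r] in simp)
qed

section \<open>The moving plane argument for a general domain\<close>

lemma pos_part_powr_lipschitz:
  assumes "p > 1" "s \<le> t" "t \<le> M"
  shows "pos_part t powr p - pos_part s powr p \<le> p * pos_part M powr (p - 1) * (t - s)"
proof (cases "s = t")
  case False
  then have "s < t" using assms by simp
  then obtain z where z: "s < z" "z < t" "pos_part t powr p - pos_part s powr p = (t - s) * (p * pos_part z powr (p - 1))"
    using MVT2[OF _ pos_part_powr_deriv[OF assms(1)]] by blast
  have "pos_part z powr (p - 1) \<le> pos_part M powr (p - 1)"
    using z assms by (intro powr_mono2) (auto simp: pos_part_def)
  then have "(t - s) * (p * pos_part z powr (p - 1)) \<le> (t - s) * (p * pos_part M powr (p - 1))"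
    using assms by (intro mult_left_mono) auto
  then show ?thesis using z by (simp add: mult_ac)
qed simp

lemma pos_part_powr_mono: "p > 1 \<Longrightarrow> s \<le> t \<Longrightarrow> pos_part s powr p \<le> pos_part t powr p"
  by (intro powr_mono2) (auto simp: pos_part_def)

text \<open>Serves both the entire solution, with \<open>\<Omega> = UNIV\<close>, and the Emden
  solution extended by zero. In the choice of \<open>k\<close>,
  \<open>p * pos_part M powr (p - 1)\<close> is a Lipschitz constant of the nonlinearity, 2 bounds
  the barrier above, and \<open>exp (- 1)\<close> is the infimum of its exponential in the slab of
  width \<open>1 / k\<close>.\<close>

locale moving_plane =
  fixes u :: "plane \<Rightarrow> real" and \<Omega> :: "plane set" and G :: "plane \<Rightarrow> plane" and Hs :: "plane \<Rightarrow> plane \<Rightarrow> plane"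
    and p M k R :: real and e :: plane
  assumes p: "p > 1" and cont: "continuous_on UNIV u" and \<Omega>: "open \<Omega>" and C2: "C2_on \<Omega> u G Hs"
    and pde: "\<And>x. x \<in> \<Omega> \<Longrightarrow> - laplacian u x = pos_part (u x) powr p"
    and M: "\<And>x. u x \<le> M" and e: "norm e = 1"
    and k: "k > 0" "k\<^sup>2 * exp (- 1) > 2 * (p * pos_part M powr (p - 1))"
    and R: "\<And>x. norm x > R \<Longrightarrow> u x \<le> 0"
begin

abbreviation "\<tau> \<equiv> reflect e"

definition dominates :: "real \<Rightarrow> bool" where
  "dominates l \<longleftrightarrow> (\<forall>x. e \<bullet> x \<le> l \<longrightarrow> u x \<le> u (\<tau> l x))"

text \<open>The first clause is void for \<open>\<Omega> = UNIV\<close>. It is needed for the disk, where \<open>u\<close> is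
  extended by zero and solves the equation only inside.\<close>

definition admissible :: "real \<Rightarrow> bool" where
  "admissible l \<longleftrightarrow> (\<forall>x. e \<bullet> x < l \<longrightarrow> u (\<tau> l x) < u x \<longrightarrow> x \<in> \<Omega> \<and> \<tau> l x \<in> \<Omega>) \<and>
     (\<forall>\<epsilon>>0. \<exists>r. \<forall>x. e \<bullet> x < l \<longrightarrow> norm x > r \<longrightarrow> u (\<tau> l x) - u x \<ge> - \<epsilon>)"

lemma cont_\<tau>: "continuous_on X (\<tau> l)"
  unfolding reflect_def by (intro continuous_intros)

text \<open>On the half-plane left of the line it lies between 1 and 2, so dividing by it preserves
  signs and compactness at infinity, and it is strictly superharmonic.\<close>

lemma barrier:
  obtains G' K where "C2_on UNIV (\<lambda>x. 2 - exp (k * (e \<bullet> x - l))) G' K"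
    "\<And>x. laplacian (\<lambda>x. 2 - exp (k * (e \<bullet> x - l))) x = - (k\<^sup>2 * exp (k * (e \<bullet> x - l)))"
proof -
  define E where "E x = exp (k * (e \<bullet> x - l))" for x
  have dE: "(E has_derivative (\<lambda>h. E x * (k * (e \<bullet> h)))) (at x)" for x
    unfolding E_def by (auto intro!: derivative_eq_intros)
  have cE: "continuous_on UNIV E" unfolding E_def by (intro continuous_intros)
  have C: "C2_on UNIV (\<lambda>x. 2 - E x) (\<lambda>x. (- k * E x) *\<^sub>R e) (\<lambda>b x. (- k\<^sup>2 * E x * (e \<bullet> b)) *\<^sub>R e)"
    unfolding C2_on_def C1_on_def
  proof (intro conjI ballI)
    show "((\<lambda>x. 2 - E x) has_derivative (\<bullet>) ((- k * E x) *\<^sub>R e)) (at x)" for x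
      by (rule has_derivative_eq_rhs[OF has_derivative_diff[OF has_derivative_const dE]]) (simp add: fun_eq_iff)
    show "continuous_on UNIV (\<lambda>x. (- k * E x) *\<^sub>R e)" 
      by (intro continuous_on_scaleR continuous_on_mult continuous_on_const cE)
    fix b
    show "continuous_on UNIV (\<lambda>x. (- k\<^sup>2 * E x * (e \<bullet> b)) *\<^sub>R e)" 
      by (intro continuous_on_scaleR continuous_on_mult continuous_on_const cE)
    show "((\<lambda>x. (- k * E x) *\<^sub>R e \<bullet> b) has_derivative (\<bullet>) ((- k\<^sup>2 * E x * (e \<bullet> b)) *\<^sub>R e)) (at x)" for x
      unfolding inner_scaleR_left
      by (rule has_derivative_eq_rhs[OF has_derivative_mult_left[OF has_derivative_mult_right[OF dE]]])
         (simp add: fun_eq_iff power2_eq_square)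
  qed
  show ?thesis
  proof (rule that)
    show "C2_on UNIV (\<lambda>x. 2 - exp (k * (e \<bullet> x - l))) (\<lambda>x. (- k * E x) *\<^sub>R e) (\<lambda>b x. (- k\<^sup>2 * E x * (e \<bullet> b)) *\<^sub>R e)"
      using C unfolding E_def .
    fix x
    have "laplacian (\<lambda>x. 2 - E x) x = (\<Sum>b\<in>Basis. (- k\<^sup>2 * E x * (e \<bullet> b)) *\<^sub>R e \<bullet> b)"
      by (rule laplacian_C2_on[OF open_UNIV C UNIV_I])
    also have "\<dots> = - k\<^sup>2 * E x * (\<Sum>b\<in>Basis. (e \<bullet> b) * (e \<bullet> b))"
      by (simp add: sum_distrib_left mult.assoc)
    also have "(\<Sum>b\<in>Basis. (e \<bullet> b) * (e \<bullet> b)) = 1"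
      using e by (simp add: euclidean_inner[symmetric] norm_eq_1)
    finally show "laplacian (\<lambda>x. 2 - exp (k * (e \<bullet> x - l))) x = - (k\<^sup>2 * exp (k * (e \<bullet> x - l)))"
      by (simp add: E_def)
  qed
qed

text \<open>Let \<open>z = u \<circ> \<tau> l - u\<close> and let \<open>g\<close> be the barrier. If \<open>z\<close> were negative somewhere, then \<open>z / g\<close> would
  have a negative minimum \<open>- m\<close>, at a point \<open>a\<close> of the slab of width \<open>1 / k\<close>. As \<open>z + m g\<close> is minimal at \<open>a\<close>,
  its Laplacian is nonnegative there, whereas the choice of \<open>k\<close> makes \<open>-\<Delta>g\<close> exceed the Lipschitz
  constant of the nonlinearity times \<open>g\<close>.\<close>

lemma narrow:
  assumes adm: "admissible l" and away: "\<And>x. e \<bullet> x \<le> l - 1 / k \<Longrightarrow> u x > 0 \<Longrightarrow> u x \<le> u (\<tau> l x)"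
  shows "dominates l"
proof (rule ccontr)
  define z where "z x = u (\<tau> l x) - u x" for x
  define g where "g x = 2 - exp (k * (e \<bullet> x - l))" for x
  assume "\<not> dominates l"
  then obtain x1 where x1: "e \<bullet> x1 \<le> l" "z x1 < 0" by (auto simp: dominates_def z_def not_le)
  have g: "1 \<le> g x" "g x \<le> 2" if "e \<bullet> x \<le> l" for x
    using that k(1) by (auto simp: g_def mult_nonneg_nonpos)
  have cz: "continuous_on UNIV z"
    unfolding z_def by (intro continuous_on_diff cont continuous_on_compose2[OF cont cont_\<tau>]) auto
  have cg: "continuous_on UNIV g" unfolding g_def by (intro continuous_intros)
  \<comment> \<open>The barrier is at most 2, so the minimal quotient is at most
    \<open>z x1 / 2 = - 2 * \<epsilon>\<close>. Outside the ball of radius \<open>r\<close>, where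
    \<open>z \<ge> - \<epsilon>\<close>, no smaller quotient can occur, since the barrier is at
    least 1.\<close>
  define \<epsilon> where "\<epsilon> = - z x1 / 4"
  have \<epsilon>: "\<epsilon> > 0" using x1 by (simp add: \<epsilon>_def)
  from adm[unfolded admissible_def, THEN conjunct2, rule_format, OF this]
  obtain r where r: "\<And>x. e \<bullet> x < l \<Longrightarrow> norm x > r \<Longrightarrow> z x \<ge> - \<epsilon>"
    unfolding z_def by blast
  have z0: "z x = 0" if "e \<bullet> x = l" for x using reflect_eq[OF that] by (simp add: z_def)
  define C where "C = cball 0 (max r (norm x1)) \<inter> {x. e \<bullet> x \<le> l}"
  have cC: "compact C" unfolding C_def
    by (intro compact_Int_closed compact_cball closed_halfspace_le)
  have x1C: "x1 \<in> C" using x1 by (simp add: C_def)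
  then have neC: "C \<noteq> {}" by blast
  have g0: "g x \<noteq> 0" if "x \<in> C" for x using g(1)[of x] that by (simp add: C_def)
  have "continuous_on C (\<lambda>x. z x / g x)"
    using g0 by (intro continuous_on_divide continuous_on_subset[OF cz] continuous_on_subset[OF cg]) auto
  from continuous_attains_inf[OF cC neC this]
  obtain a where a: "a \<in> C" "\<forall>x\<in>C. z a / g a \<le> z x / g x" by (rule bexE)
  define m where "m = z a / g a"
  have "m \<le> z x1 / g x1" unfolding m_def using a(2) x1C by (rule bspec)
  also have "\<dots> \<le> z x1 / 2" using x1(2) g[OF x1(1)] by (simp add: field_simps)
  finally have m: "m \<le> - 2 * \<epsilon>" by (simp add: \<epsilon>_def)
  then have m0: "m < 0" using \<epsilon> by simp
  have mz: "m * g x \<le> z x" if "e \<bullet> x \<le> l" for x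
  proof (cases "x \<in> C")
    case True
    then show ?thesis using bspec[OF a(2) True] g[OF that] unfolding m_def[symmetric] by (simp add: field_simps)
  next
    case False
    then have "norm x > r" using that by (auto simp: C_def)
    then have "z x \<ge> - \<epsilon>" using r[of x] z0[of x] that \<epsilon> by (cases "e \<bullet> x = l") auto
    moreover have "m * g x \<le> m * 1" using m0 g[OF that] by (intro mult_left_mono_neg) auto
    ultimately show ?thesis using m \<epsilon> by linarith
  qed
  have al: "e \<bullet> a \<le> l" using a(1) by (simp add: C_def)
  have za: "z a = m * g a" using g[OF al] by (simp add: m_def)
  then have zneg: "z a < 0" using m0 g[OF al] by (simp add: mult_neg_pos)
  then have al': "e \<bullet> a < l" using al z0[of a] by (cases "e \<bullet> a = l") auto
  \<comment> \<open>As \<open>z\<close> vanishes on the line, the minimum lies strictly to its left;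
    there admissibility ensures that the equation holds at \<open>a\<close> and at its
    reflection.\<close>
  then have a\<Omega>: "a \<in> \<Omega>" "\<tau> l a \<in> \<Omega>" using adm zneg unfolding admissible_def z_def by auto
  define S where "S = \<Omega> \<inter> \<tau> l -` \<Omega> \<inter> {x. e \<bullet> x < l}"
  have oS: "open S" unfolding S_def
    by (intro open_Int \<Omega> open_vimage cont_\<tau> open_halfspace_lt)
  have aS: "a \<in> S" using a\<Omega> al' by (simp add: S_def)
  obtain G1 K1 where r1: "C2_on S (\<lambda>x. u (\<tau> l x)) G1 K1"
    "\<And>x. x \<in> S \<Longrightarrow> laplacian (\<lambda>x. u (\<tau> l x)) x = laplacian u (\<tau> l x)"
    by (rule laplacian_reflect[OF e \<Omega> oS C2]) (auto simp: S_def)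
  have r2: "C2_on S u G Hs" by (rule C2_on_subset[OF C2]) (auto simp: S_def)
  obtain G3 K3 where "C2_on UNIV (\<lambda>x. 2 - exp (k * (e \<bullet> x - l))) G3 K3"
    "\<And>x. laplacian (\<lambda>x. 2 - exp (k * (e \<bullet> x - l))) x = - (k\<^sup>2 * exp (k * (e \<bullet> x - l)))"
    by (rule barrier[of l]) blast
  note r3 = this[folded g_def]
  have r3': "C2_on S (\<lambda>x. m * g x) (\<lambda>x. m *\<^sub>R G3 x) (\<lambda>b x. m *\<^sub>R K3 b x)"
    using C2_on_subset[OF r3(1), of S] unfolding C2_on_def C1_on_def inner_scaleR_left
    by (auto intro!: has_derivative_mult_right continuous_on_scaleR continuous_on_const)
  have z2: "C2_on S z (\<lambda>x. G1 x - G x) (\<lambda>b x. K1 b x - Hs b x)"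
    unfolding z_def[abs_def] by (rule C2_on_diff[OF r1(1) r2])
  have "laplacian (\<lambda>x. z x - m * g x) a \<ge> 0"
    by (rule laplacian_local_min[OF oS aS C2_on_diff[OF z2 r3']]) (use mz za in \<open>auto simp: S_def\<close>)
  moreover have "laplacian (\<lambda>x. z x - m * g x) a = laplacian z a - laplacian (\<lambda>x. m * g x) a"
    by (rule laplacian_diff[OF oS z2 r3' aS])
  moreover have "laplacian (\<lambda>x. m * g x) a = m * laplacian g a"
    using laplacian_C2_on[OF oS r3' aS] laplacian_C2_on[OF open_UNIV r3(1), of a] by (simp add: sum_distrib_left)
  moreover have "laplacian z a = laplacian u (\<tau> l a) - laplacian u a"
    unfolding z_def[abs_def] using laplacian_diff[OF oS r1(1) r2 aS] r1(2)[OF aS] by simp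
  ultimately have L: "laplacian u (\<tau> l a) - laplacian u a + m * (k\<^sup>2 * exp (k * (e \<bullet> a - l))) \<ge> 0"
    by (simp add: r3(2))
  have L': "- m * (k\<^sup>2 * exp (k * (e \<bullet> a - l))) \<le> pos_part (u a) powr p - pos_part (u (\<tau> l a)) powr p"
    using L pde[OF a\<Omega>(1)] pde[OF a\<Omega>(2)] by simp
  have Epos: "- m * (k\<^sup>2 * exp (k * (e \<bullet> a - l))) > 0"
    using mult_neg_pos[OF m0, of "k\<^sup>2 * exp (k * (e \<bullet> a - l))"] k(1) by simp
  \<comment> \<open>Otherwise the nonlinearity vanishes at \<open>a\<close>, and the right side of
    \<open>L'\<close> is nonpositive. This is why \<open>away\<close> concerns only points where
    \<open>u\<close> is positive.\<close>
  have ua: "u a > 0"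
  proof (rule ccontr)
    assume "\<not> u a > 0"
    then have "pos_part (u a) powr p = 0" by (simp add: pos_part_def)
    then show False using L' Epos powr_ge_zero[of "pos_part (u (\<tau> l a))" p] by linarith
  qed
  have "e \<bullet> a > l - 1 / k" using away[of a] ua zneg by (force simp: z_def)
  then have "k * (e \<bullet> a - l) > - 1" using k(1) by (simp add: field_simps)
  then have "exp (- 1) \<le> exp (k * (e \<bullet> a - l))" by simp
  then have "- m * (k\<^sup>2 * exp (- 1)) \<le> - m * (k\<^sup>2 * exp (k * (e \<bullet> a - l)))"
    using m0 by (intro mult_left_mono) auto
  also have "\<dots> \<le> p * pos_part M powr (p - 1) * (u a - u (\<tau> l a))"
    using L' pos_part_powr_lipschitz[OF p, of "u (\<tau> l a)" "u a" M] M[of a] zneg by (simp add: z_def)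
  also have "\<dots> = p * pos_part M powr (p - 1) * (- m * g a)"
  proof -
    have "u a - u (\<tau> l a) = - m * g a" using za by (simp add: z_def)
    then show ?thesis by (simp only:)
  qed
  also have "\<dots> \<le> p * pos_part M powr (p - 1) * (- m * 2)"
    using p m0 g[OF al] by (intro mult_left_mono) auto
  finally have "- m * (k\<^sup>2 * exp (- 1)) \<le> - m * (2 * (p * pos_part M powr (p - 1)))" by (simp add: mult_ac)
  then show False using m0 k(2) by (simp add: mult_le_cancel_left)
qed

text \<open>Left of \<open>- R\<close> the function is nonpositive, so the hypothesis of
  \<open>narrow\<close> is vacuous.\<close>

lemma dominates_start:
  assumes "admissible l" "l \<le> - R" shows "dominates l"
proof (rule narrow[OF assms(1)])
  fix x assume x: "e \<bullet> x \<le> l - 1 / k" "u x > 0"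
  have "1 / k > 0" using k by simp
  then have "e \<bullet> x < - R" using x(1) assms(2) by linarith
  then have "norm x > R" using Cauchy_Schwarz_ineq2[of e x] e by simp
  then show "u x \<le> u (\<tau> l x)" using R[of x] x by simp
qed

lemma dominates_closed:
  assumes "\<And>m. m < l \<Longrightarrow> dominates m" shows "dominates l"
  unfolding dominates_def
proof (intro allI impI)
  fix x assume x: "e \<bullet> x \<le> l"
  show "u x \<le> u (\<tau> l x)"
  proof (cases "e \<bullet> x = l")
    case True then show ?thesis by (simp add: reflect_eq)
  next
    case False
    have "continuous_on UNIV (\<lambda>m. u (\<tau> m x))"
      unfolding reflect_def by (intro continuous_on_compose2[OF cont] continuous_intros) auto
    then have "((\<lambda>m. u (\<tau> m x)) \<longlongrightarrow> u (\<tau> l x)) (at_left l)"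
      unfolding continuous_on_def by (auto intro: tendsto_within_subset)
    moreover have "\<forall>\<^sub>F m in at_left l. u x \<le> u (\<tau> m x)"
      unfolding eventually_at_left_field using False x assms unfolding dominates_def
      by (intro exI[of _ "e \<bullet> x"]) auto
    ultimately show ?thesis by (rule tendsto_lowerbound) simp
  qed
qed

text \<open>On the compact part of the closure of \<open>u > 0\<close> at distance at least
  \<open>1 / (2 * k)\<close> from the line, the strict inequality survives a small motion by uniform
  continuity. \<open>narrow\<close> takes care of the slab that remains.\<close>

lemma dominates_open:
  assumes adm: "\<And>m. m < l' \<Longrightarrow> admissible m" and l: "l < l'"
    and pos: "\<And>x. e \<bullet> x < l \<Longrightarrow> x \<in> closure {x. u x > 0} \<Longrightarrow> u x < u (\<tau> l x)"
  shows "\<exists>\<delta>>0. \<forall>m. l < m \<longrightarrow> m < l + \<delta> \<longrightarrow> dominates m"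
proof -
  define C where "C = closure {x. u x > 0} \<inter> {x. e \<bullet> x \<le> l - 1 / (2 * k)}"
  have "x \<in> cball 0 R" if "u x > 0" for x using R[of x] that by (cases "norm x > R") auto
  then have "{x. u x > 0} \<subseteq> cball 0 R" by blast
  then have "bounded {x. u x > 0}" using bounded_cball bounded_subset by blast
  then have cC: "compact C" unfolding C_def
    by (intro compact_Int_closed closed_halfspace_le) (simp add: compact_closure)
  have k2: "1 / (2 * k) > 0" using k by simp
  have posC: "0 < u (\<tau> l x) - u x" if "x \<in> C" for x
  proof -
    have "e \<bullet> x < l" using that k2 unfolding C_def Int_iff mem_Collect_eq by linarith
    then show ?thesis using pos[of x] that by (simp add: C_def)
  qed
  have cF: "continuous_on ({l..l+1} \<times> C) (\<lambda>(m, x). u (\<tau> m x) - u x)"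
    unfolding case_prod_unfold reflect_def
    by (intro continuous_on_diff continuous_on_compose2[OF cont] continuous_intros) auto
  have "\<exists>c>0. \<forall>x\<in>C. c \<le> u (\<tau> l x) - u x"
  proof (cases "C = {}")
    case False
    have "continuous_on C (\<lambda>x. u (\<tau> l x) - u x)"
      unfolding reflect_def by (intro continuous_on_diff continuous_on_compose2[OF cont] continuous_intros) auto
    from continuous_attains_inf[OF cC False this]
    obtain a where "a \<in> C" "\<forall>x\<in>C. u (\<tau> l a) - u a \<le> u (\<tau> l x) - u x" by (rule bexE)
    then show ?thesis using posC[of a] by blast
  qed (auto intro: exI[of _ 1])
  then obtain c where c: "c > 0" "\<And>x. x \<in> C \<Longrightarrow> c \<le> u (\<tau> l x) - u x" by blast
  have "uniformly_continuous_on ({l..l+1} \<times> C) (\<lambda>(m, x). u (\<tau> m x) - u x)"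
    by (rule compact_uniformly_continuous[OF cF]) (intro compact_Times compact_Icc cC)
  then obtain d where d: "d > 0" "\<And>a b. a \<in> {l..l+1} \<times> C \<Longrightarrow> b \<in> {l..l+1} \<times> C \<Longrightarrow> dist b a < d \<Longrightarrow>
     dist (case b of (m, x) \<Rightarrow> u (\<tau> m x) - u x) (case a of (m, x) \<Rightarrow> u (\<tau> m x) - u x) < c"
    unfolding uniformly_continuous_on_def using c(1) by meson
  \<comment> \<open>The bound \<open>1 / (2 * k)\<close> puts positive points at distance
    \<open>1 / k\<close> left of the new line into \<open>C\<close>; the bound 1 keeps the line
    within the range of uniform continuity.\<close>
  define \<delta> where "\<delta> = Min {1, d, l' - l, 1 / (2 * k)}"
  have \<delta>: "\<delta> > 0" "\<delta> \<le> 1" "\<delta> \<le> d" "\<delta> \<le> l' - l" "\<delta> \<le> 1 / (2 * k)" using d l k2 by (auto simp: \<delta>_def)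
  show ?thesis
  proof (intro exI[of _ \<delta>] conjI allI impI \<delta>(1))
    fix m assume m: "l < m" "m < l + \<delta>"
    show "dominates m"
    proof (rule narrow[OF adm])
      show "m < l'" using m \<delta> by linarith
      fix x assume x: "e \<bullet> x \<le> m - 1 / k" "u x > 0"
      have "1 / k = 2 * (1 / (2 * k))" by simp
      then have "e \<bullet> x \<le> l - 1 / (2 * k)" using x(1) m \<delta>(5) by linarith
      then have xC: "x \<in> C" using x(2) closure_subset[of "{x. u x > 0}"] by (auto simp: C_def)
      have "dist (u (\<tau> m x) - u x) (u (\<tau> l x) - u x) < c"
        using d(2)[of "(l, x)" "(m, x)"] xC m \<delta> by (simp add: dist_Pair_Pair dist_real_def)
      then show "u x \<le> u (\<tau> m x)" using c(2)[OF xC] by (simp add: dist_real_def)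
    qed
  qed
qed

text \<open>Continuous induction: at the infimum of the failing positions domination holds by
  \<open>dominates_closed\<close>, and \<open>step\<close> then passes beyond it.\<close>

lemma dominates_induct:
  assumes start: "\<And>m. m \<le> a \<Longrightarrow> m < l' \<Longrightarrow> dominates m"
    and step: "\<And>l. l < l' \<Longrightarrow> (\<And>m. m \<le> l \<Longrightarrow> dominates m) \<Longrightarrow> \<exists>\<delta>>0. \<forall>m. l < m \<longrightarrow> m < l + \<delta> \<longrightarrow> dominates m"
    and m: "m < l'"
  shows "dominates m"
proof (rule ccontr)
  assume neg: "\<not> dominates m"
  define B where "B = {b. b < l' \<and> \<not> dominates b}"
  have B: "m \<in> B" "\<And>b. b \<in> B \<Longrightarrow> a \<le> b" using neg m start by (auto simp: B_def) (meson linorder_le_cases)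
  then have bb: "bdd_below B" by (meson bdd_belowI)
  define l where "l = Inf B"
  have lm: "l \<le> m" unfolding l_def by (rule cInf_lower[OF B(1) bb])
  have below: "dominates b" if "b < l" for b
  proof (rule ccontr)
    assume "\<not> dominates b"
    then have "b \<in> B" using that lm m by (simp add: B_def)
    then have "l \<le> b" unfolding l_def using bb by (rule cInf_lower)
    then show False using that by simp
  qed
  then have dl: "dominates l" by (rule dominates_closed)
  then have "dominates b" if "b \<le> l" for b using below that by (cases "b = l") auto
  then obtain \<delta> where \<delta>: "\<delta> > 0" "\<And>b. l < b \<Longrightarrow> b < l + \<delta> \<Longrightarrow> dominates b"
    using step[of l] lm m by auto
  obtain b where b: "b \<in> B" "b < l + \<delta>"
    using cInf_lessD[of B "l + \<delta>"] B(1) \<delta>(1) unfolding l_def by auto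
  have "l \<le> b" unfolding l_def using b(1) bb by (rule cInf_lower)
  then show False using b \<delta>(2)[of b] dl unfolding B_def by (cases "b = l") auto
qed

text \<open>Where domination holds, monotonicity of the nonlinearity makes the difference
  superharmonic, so the strong minimum principle applies to it.\<close>

lemma dominates_strict_or_equal:
  assumes D: "open D" "connected D" "\<And>x. x \<in> D \<Longrightarrow> x \<in> \<Omega> \<and> \<tau> l x \<in> \<Omega> \<and> e \<bullet> x < l"
    and dom: "dominates l" and x: "x \<in> D" "u (\<tau> l x) = u x" and y: "y \<in> D"
  shows "u (\<tau> l y) = u y"
proof -
  obtain G1 K1 where r1: "C2_on D (\<lambda>x. u (\<tau> l x)) G1 K1"
    "\<And>x. x \<in> D \<Longrightarrow> laplacian (\<lambda>x. u (\<tau> l x)) x = laplacian u (\<tau> l x)"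
    by (rule laplacian_reflect[OF e \<Omega> D(1) C2]) (use D(3) in auto)
  have r2: "C2_on D u G Hs" by (rule C2_on_subset[OF C2]) (use D(3) in auto)
  have "u (\<tau> l y) - u y = 0"
  proof (rule strong_minimum_principle[OF D(1,2) C2_on_diff[OF r1(1) r2] _ _ x(1) _ y])
    fix x assume x: "x \<in> D"
    then have *: "u x \<le> u (\<tau> l x)" using dom D(3)[OF x] by (auto simp: dominates_def)
    then show "0 \<le> u (\<tau> l x) - u x" by simp
    show "laplacian (\<lambda>x. u (\<tau> l x) - u x) x \<le> 0"
      using laplacian_diff[OF D(1) r1(1) r2 x] r1(2)[OF x] pde[of x] pde[of "\<tau> l x"] D(3)[OF x]
        pos_part_powr_mono[OF p *] by simp
  qed (use x in simp)
  then show ?thesis by simp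
qed

end

section \<open>From reflections to radial symmetry\<close>

lemma reflect_swap:
  assumes "norm x = norm y" "x \<noteq> y"
  shows "norm ((x - y) /\<^sub>R norm (x - y)) = 1" "reflect ((x - y) /\<^sub>R norm (x - y)) 0 x = y"
proof -
  define n where "n = norm (x - y)"
  have n: "n > 0" using assms by (simp add: n_def)
  show "norm ((x - y) /\<^sub>R norm (x - y)) = 1" using assms by simp
  have "n\<^sup>2 = 2 * ((x - y) \<bullet> x)"
  proof -
    have "x \<bullet> x = y \<bullet> y" using assms(1) by (simp add: norm_eq)
    then show ?thesis
      unfolding n_def power2_norm_eq_inner by (simp add: inner_diff_left inner_diff_right inner_commute)
  qed
  moreover have "((x - y) /\<^sub>R n) \<bullet> x = ((x - y) \<bullet> x) / n" by (simp only: inner_scaleR_left divide_inverse mult.commute)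
  ultimately have "2 * (((x - y) /\<^sub>R n) \<bullet> x) = n" using n by (simp only:) (simp add: field_simps power2_eq_square)
  then have "reflect ((x - y) /\<^sub>R n) 0 x = x - n *\<^sub>R ((x - y) /\<^sub>R n)" by (simp add: reflect_def)
  also have "\<dots> = y" using n by simp
  finally show "reflect ((x - y) /\<^sub>R norm (x - y)) 0 x = y" by (simp add: n_def)
qed

text \<open>Two distinct points of equal norm are exchanged by the reflection in a line through the
  origin.\<close>

lemma radial_of_reflections:
  assumes "\<And>e x. norm e = 1 \<Longrightarrow> u (reflect e 0 x) = u x" "norm x = norm y"
  shows "u x = u y"
proof (cases "x = y")
  case False
  then show ?thesis using assms(1)[OF reflect_swap(1)[OF assms(2) False], of x] reflect_swap(2)[OF assms(2) False] by simp
qed simp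

lemma exists_slope:
  obtains k :: real where "k > 0" "k\<^sup>2 * exp (- 1) > 2 * c"
proof -
  define k where "k = 1 + 2 * \<bar>c\<bar> * exp 1"
  have "k \<ge> 1" by (simp add: k_def)
  then have "k * 1 \<le> k * k" by (intro mult_left_mono) auto
  moreover have "2 * c * exp 1 \<le> 2 * \<bar>c\<bar> * exp 1" by (intro mult_right_mono) auto
  then have "2 * c * exp 1 < k" unfolding k_def by linarith
  ultimately have "2 * c * exp 1 < k\<^sup>2" by (simp add: power2_eq_square)
  then have "2 * c < k\<^sup>2 * exp (- 1)" by (simp add: exp_minus field_simps)
  then show ?thesis using \<open>k \<ge> 1\<close> by (intro that[of k]) auto
qed

context plane_solution begin

text \<open>If no line orthogonal to \<open>e\<close> were a line of symmetry, the strict inequality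
  would hold at every position and the motion would never stop. Domination for all \<open>l\<close>
  forces \<open>u 0 \<le> u (t *\<^sub>R e)\<close> for all \<open>t \<ge> 0\<close>, against
  \<open>u\<close> tending to \<open>- \<infinity>\<close>.\<close>

lemma symmetric_direction:
  assumes m: "(LINT x|lborel. f x) > 0" and e: "norm e = 1"
  shows "\<exists>l. \<forall>x. u (reflect e l x) = u x"
proof (rule ccontr)
  assume nosym: "\<not> ?thesis"
  obtain R where R0: "R \<ge> 1" "\<And>x. norm x \<ge> R \<Longrightarrow> u x \<le> 0" by (rule tends_to_minus_infinity[OF m, of 0]) blast
  obtain k where k: "k > 0" "k\<^sup>2 * exp (- 1) > 2 * (p * pos_part M powr (p - 1))"
    by (rule exists_slope[of "p * pos_part M powr (p - 1)"]) blast
  interpret moving_plane u UNIV G Hs p M k R e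
    by unfold_locales (use p cont_u C2 pde le_M e k R0 in auto)
  have fR: "f y = 0" if "norm y > R" for y using R0(2)[of y] that f_eq_0_iff[of y] by simp
  have adm: "admissible l" for l
    unfolding admissible_def
  proof (intro conjI allI impI UNIV_I)
    fix \<epsilon> :: real assume eps: "\<epsilon> > 0"
    have "R > 0" using R0(1) by simp
    obtain r where "\<And>x. norm x > r \<Longrightarrow> u (reflect e l x) - u x \<ge> - \<epsilon>"
      by (rule reflect_diff_lower[OF e \<open>R > 0\<close> fR eps, of l]) blast+
    then show "\<exists>r. \<forall>x. e \<bullet> x < l \<longrightarrow> r < norm x \<longrightarrow> - \<epsilon> \<le> u (\<tau> l x) - u x" by blast
  qed
  have dom: "dominates l" for l
  proof (rule dominates_induct[of "- R" "l + 1"])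
    show "dominates b" if "b \<le> - R" for b by (rule dominates_start[OF adm that])
    fix b assume below: "\<And>c. c \<le> b \<Longrightarrow> dominates c"
    show "\<exists>\<delta>>0. \<forall>c. b < c \<longrightarrow> c < b + \<delta> \<longrightarrow> dominates c"
    proof (rule dominates_open[of "b + 1"])
      fix x assume x: "e \<bullet> x < b"
      have le: "u x \<le> u (\<tau> b x)" using below[of b] x by (simp add: dominates_def)
      show "u x < u (\<tau> b x)"
      proof (rule ccontr)
        assume "\<not> u x < u (\<tau> b x)"
        then have eq: "u (\<tau> b x) = u x" using le by simp
        have half: "u (\<tau> b y) = u y" if "e \<bullet> y < b" for y
          by (rule dominates_strict_or_equal[of "{x. e \<bullet> x < b}" b x y])
             (use x eq that below[of b] in \<open>auto simp: open_halfspace_lt convex_halfspace_lt convex_connected\<close>)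
        have "u (\<tau> b y) = u y" for y
        proof -
          consider "e \<bullet> y < b" | "e \<bullet> y = b" | "e \<bullet> y > b" by linarith
          then show ?thesis
          proof cases
            case 3
            then have "e \<bullet> \<tau> b y < b" by (simp add: inner_reflect[OF e])
            then show ?thesis using half[of "\<tau> b y"] by (simp add: reflect_reflect[OF e])
          qed (use half reflect_eq in auto)
        qed
        then show False using nosym by blast
      qed
    qed (auto intro: adm)
  qed simp
  have mono: "u 0 \<le> u (t *\<^sub>R e)" if "t \<ge> 0" for t
  proof -
    have "u 0 \<le> u (\<tau> (t / 2) 0)" using dom[of "t / 2"] that by (simp add: dominates_def)
    then show ?thesis by (simp add: reflect_def)
  qed
  obtain r where r: "r \<ge> 1" "\<And>x. norm x \<ge> r \<Longrightarrow> u x \<le> u 0 - 1" by (rule tends_to_minus_infinity[OF m, of "u 0 - 1"]) blast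
  show False using mono[of r] r(1) r(2)[of "r *\<^sub>R e"] e by simp
qed

text \<open>The symmetry lines of the two basis directions meet at \<open>x0\<close>, and composing
  their reflections gives the point reflection about \<open>x0\<close>. A symmetry line missing
  \<open>x0\<close> would combine with it to a translation that preserves \<open>u\<close>, which
  the decay excludes.\<close>

lemma radial_about_point:
  assumes m: "(LINT x|lborel. f x) > 0"
  obtains x0 where "\<And>x y. norm x = norm y \<Longrightarrow> u (x + x0) = u (y + x0)"
proof -
  define l where "l e = (SOME l. \<forall>x. u (reflect e l x) = u x)" for e
  have l: "u (reflect e (l e) x) = u x" if "norm e = 1" for e x
    using someI_ex[OF symmetric_direction[OF m that]] unfolding l_def by blast
  define x0 where "x0 = (\<Sum>b\<in>Basis. l b *\<^sub>R b)"
  define U where "U v = u (v + x0)" for v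
  have refl: "U (v + (2 * (l e - e \<bullet> x0 - e \<bullet> v)) *\<^sub>R e) = U v" if "norm e = 1" for e v
    using l[OF that, of "v + x0"] unfolding U_def reflect_def by (simp add: inner_add_right algebra_simps)
  have lb: "l b - b \<bullet> x0 = 0" if "b \<in> Basis" for b
    using that by (simp add: x0_def inner_sum_right inner_Basis if_distrib cong: if_cong)
  have reflB: "U (v - (2 * (b \<bullet> v)) *\<^sub>R b) = U v" if "b \<in> Basis" for b v
    using refl[of b v] lb[OF that] that by simp
  have odd: "U (- v) = U v" for v
  proof -
    define e1 :: plane where "e1 = axis 1 1"
    define e2 :: plane where "e2 = axis 2 1"
    have B: "e1 \<in> Basis" "e2 \<in> Basis" "e1 \<noteq> e2" "Basis = {e1, e2}"
      unfolding e1_def e2_def Basis_vec_def by (auto simp: axis_eq_axis UNIV_2)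
    have o: "e2 \<bullet> e1 = 0" using B inner_Basis[of e2 e1] by auto
    have "v = (\<Sum>b\<in>{e1, e2}. (v \<bullet> b) *\<^sub>R b)" unfolding B(4)[symmetric] by (simp add: euclidean_representation)
    then have v: "v = (e1 \<bullet> v) *\<^sub>R e1 + (e2 \<bullet> v) *\<^sub>R e2" using B(3) by (simp add: inner_commute)
    have "U v = U (v - (2 * (e1 \<bullet> v)) *\<^sub>R e1)" using reflB[OF B(1)] by simp
    also have "\<dots> = U ((v - (2 * (e1 \<bullet> v)) *\<^sub>R e1) - (2 * (e2 \<bullet> (v - (2 * (e1 \<bullet> v)) *\<^sub>R e1))) *\<^sub>R e2)"
      using reflB[OF B(2)] by simp
    also have "(v - (2 * (e1 \<bullet> v)) *\<^sub>R e1) - (2 * (e2 \<bullet> (v - (2 * (e1 \<bullet> v)) *\<^sub>R e1))) *\<^sub>R e2 = v - 2 *\<^sub>R ((e1 \<bullet> v) *\<^sub>R e1 + (e2 \<bullet> v) *\<^sub>R e2)"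
      using o by (simp add: inner_diff_right algebra_simps)
    also have "\<dots> = - v" unfolding v[symmetric] by (simp add: scaleR_2)
    finally show ?thesis by simp
  qed
  have zero: "l e - e \<bullet> x0 = 0" if e: "norm e = 1" for e
  proof (rule ccontr)
    define d where "d = l e - e \<bullet> x0"
    assume "l e - e \<bullet> x0 \<noteq> 0"
    then have d: "d \<noteq> 0" by (simp add: d_def)
    have ee: "e \<bullet> e = 1" using e by (simp add: norm_eq_1)
    \<comment> \<open>Reflection in the line at offset \<open>d\<close>, point reflection, and both
      once more: the composition is a translation by \<open>4 * d\<close> along
      \<open>e\<close>.\<close>
    have shift': "U (v - (4 * d) *\<^sub>R e) = U v" for v
    proof -
      define w where "w = - (v + (2 * (d - e \<bullet> v)) *\<^sub>R e)"
      have "U w = U v" using odd[of "v + (2 * (d - e \<bullet> v)) *\<^sub>R e"] refl[OF e, of v] by (simp add: w_def d_def)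
      moreover have "U (w + (2 * (d - e \<bullet> w)) *\<^sub>R e) = U w" using refl[OF e, of w] by (simp add: d_def)
      moreover have "w + (2 * (d - e \<bullet> w)) *\<^sub>R e = - (v - (4 * d) *\<^sub>R e) + 0"
        by (simp add: w_def inner_add_right ee algebra_simps) (simp add: scaleR_add_left[symmetric])
      ultimately have "U (- (v - (4 * d) *\<^sub>R e)) = U v" by simp
      then show ?thesis using odd[of "v - (4 * d) *\<^sub>R e"] by simp
    qed
    have shift: "U (v + (4 * d) *\<^sub>R e) = U v" for v using shift'[of "v + (4 * d) *\<^sub>R e"] by simp
    have "U ((real n * (4 * d)) *\<^sub>R e) = U 0" for n
    proof (induction n)
      case (Suc n)
      have "(real (Suc n) * (4 * d)) *\<^sub>R e = (real n * (4 * d)) *\<^sub>R e + (4 * d) *\<^sub>R e"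
        by (simp add: distrib_right scaleR_add_left add.commute)
      then show ?case using shift Suc by simp
    qed simp
    moreover obtain r where r: "r \<ge> 1" "\<And>x. norm x \<ge> r \<Longrightarrow> u x \<le> U 0 - 1"
      by (rule tends_to_minus_infinity[OF m, of "U 0 - 1"]) blast
    obtain n :: nat where n: "real n * \<bar>4 * d\<bar> \<ge> r + norm x0"
      using reals_Archimedean3[of "\<bar>4 * d\<bar>"] d by (auto intro: less_imp_le)
    have "norm ((real n * (4 * d)) *\<^sub>R e + x0) \<ge> r"
      using norm_triangle_ineq2[of "(real n * (4 * d)) *\<^sub>R e" "- x0"] n e by (simp add: abs_mult)
    then have "u ((real n * (4 * d)) *\<^sub>R e + x0) \<le> U 0 - 1" by (rule r(2))
    then have "U ((real n * (4 * d)) *\<^sub>R e) \<le> U 0 - 1" unfolding U_def[of "(real n * (4 * d)) *\<^sub>R e"] .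
    ultimately show False by simp
  qed
  have radU: "U x = U y" if "norm x = norm y" for x y
  proof (rule radial_of_reflections[OF _ that])
    fix e x :: plane assume "norm e = 1"
    then show "U (reflect e 0 x) = U x" using refl[of e x] zero[of e] by (simp add: reflect_def)
  qed
  show ?thesis by (rule that[of x0]) (rule radU[unfolded U_def])
qed

end

text \<open>The lines are moved only through positions \<open>l < 0\<close>, and
  \<open>l = 0\<close> is reached as a limit. The opposite direction \<open>- e\<close> then turns
  the inequality into equality.\<close>

lemma emden_radial:
  assumes p: "p > 1" and em: "emden_solution p \<phi>" and xy: "x \<in> cball 0 1" "norm x = norm y"
  shows "\<phi> x = \<phi> y"
proof -
  define u where "u x = (if x \<in> cball 0 1 then \<phi> x else 0)" for x
  obtain G Hs where C2: "C2_on (ball 0 1) \<phi> G Hs"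
    using Ck_on_2_imp_C2_on[OF open_ball] em unfolding emden_solution_def by blast
  have pos: "\<phi> x > 0" if "norm x < 1" for x using em that by (simp add: emden_solution_def)
  have bd: "\<phi> x = 0" if "norm x = 1" for x using em that by (simp add: emden_solution_def)
  have C2u: "C2_on (ball 0 1) u G Hs" by (rule C2_on_transform[OF C2 open_ball]) (simp add: u_def)
  have lapu: "laplacian u x = laplacian \<phi> x" if "x \<in> ball 0 1" for x
    using laplacian_C2_on[OF open_ball C2u that] laplacian_C2_on[OF open_ball C2 that] by simp
  have cont: "continuous_on UNIV u"
  proof -
    have "continuous_on (cball 0 1 \<union> (- ball 0 1)) (\<lambda>x. if x \<in> cball 0 1 then \<phi> x else 0)"
      by (rule continuous_on_If) (use em bd in \<open>auto simp: emden_solution_def closure_def not_less\<close>)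
    moreover have "cball 0 1 \<union> (- ball 0 1) = (UNIV :: plane set)" by auto
    ultimately show ?thesis unfolding u_def[abs_def] by simp
  qed
  have u0: "u x \<ge> 0" "norm x \<ge> 1 \<Longrightarrow> u x = 0" "norm x < 1 \<Longrightarrow> u x > 0" for x
    using pos[of x] bd[of x] by (auto simp: u_def less_eq_real_def)
  have "compact (u ` cball 0 1)" by (intro compact_continuous_image continuous_on_subset[OF cont]) auto
  then obtain M where "\<forall>y\<in>u ` cball 0 1. norm y \<le> M" using compact_imp_bounded bounded_iff by blast
  have M: "u x \<le> max M 0" for x
  proof (cases "norm x \<le> 1")
    case True
    with \<open>\<forall>y\<in>u ` cball 0 1. norm y \<le> M\<close> have "\<bar>u x\<bar> \<le> M" by simp
    then show ?thesis by simp
  qed (use u0(2)[of x] in simp)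
  obtain k where k: "k > 0" "k\<^sup>2 * exp (- 1) > 2 * (p * pos_part (max M 0) powr (p - 1))"
    by (rule exists_slope[of "p * pos_part (max M 0) powr (p - 1)"]) blast
  have half: "u x \<le> u (reflect e 0 x)" if e: "norm e = 1" and ex: "e \<bullet> x \<le> 0" for e x
  proof -
    interpret moving_plane u "ball 0 1" G Hs p "max M 0" k 1 e
    proof unfold_locales
      fix x :: plane assume x: "x \<in> ball 0 1"
      have "- laplacian \<phi> x = \<phi> x powr p" "\<phi> x > 0" using em x by (auto simp: emden_solution_def)
      then show "- laplacian u x = pos_part (u x) powr p" using lapu[OF x] x by (simp add: u_def pos_part_def)
    qed (use p cont C2u M e k u0 in auto)
    \<comment> \<open>Reflection in a line left of the origin moves points of the cap closer to the
      origin. So the part of the disk in the cap is reflected into the disk, which is what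
      admissibility requires of the extension by zero.\<close>
    have inside: "norm (\<tau> l x) < norm x" if "e \<bullet> x < l" "l < 0" for x l
    proof -
      have "4 * (l - e \<bullet> x) * l < 0" using that by (intro mult_pos_neg) auto
      then have "(norm (\<tau> l x))\<^sup>2 < (norm x)\<^sup>2" using norm_reflect_diff[OF e, of l x 0] by simp
      then show ?thesis by (rule power_less_imp_less_base) simp
    qed
    have adm: "admissible l" if l: "l < 0" for l
      unfolding admissible_def
    proof (intro conjI allI impI)
      fix x assume x: "e \<bullet> x < l" "u (\<tau> l x) < u x"
      then have "norm x < 1" using u0(1)[of "\<tau> l x"] u0(2)[of x] by (cases "norm x < 1") auto
      then show "x \<in> ball 0 1" "\<tau> l x \<in> ball 0 1" using inside[OF x(1) l] by auto
    next
      fix \<epsilon> :: real assume "\<epsilon> > 0"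
      then show "\<exists>r. \<forall>x. e \<bullet> x < l \<longrightarrow> r < norm x \<longrightarrow> - \<epsilon> \<le> u (\<tau> l x) - u x"
        using u0 by (intro exI[of _ 1]) (auto intro: order_trans[of _ 0])
    qed
    have "dominates l" if l: "l < 0" for l
    proof (rule dominates_induct[of "- 1" 0])
      show "dominates b" if "b \<le> - 1" for b by (rule dominates_start[OF adm]) (use that in auto)
      fix b :: real assume b: "b < 0" and below: "\<And>c. c \<le> b \<Longrightarrow> dominates c"
      show "\<exists>\<delta>>0. \<forall>c. b < c \<longrightarrow> c < b + \<delta> \<longrightarrow> dominates c"
      proof (rule dominates_open[OF adm b])
        fix x assume x: "e \<bullet> x < b" "x \<in> closure {x. u x > 0}"
        have "x \<in> cball 0 1" if "u x > 0" for x using u0(2)[of x] that by (cases "norm x \<ge> 1") auto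
        then have "closure {x. u x > 0} \<subseteq> cball 0 1" by (intro closure_minimal) auto
        then have nx: "norm x \<le> 1" using subsetD[OF _ x(2)] by fastforce
        show "u x < u (\<tau> b x)"
        proof (cases "norm x = 1")
          case True
          then show ?thesis using u0(2)[of x] u0(3)[of "\<tau> b x"] inside[OF x(1) b] by simp
        next
          case False
          then have nx: "norm x < 1" using nx by simp
          have ne: "- 1 < b" using x(1) Cauchy_Schwarz_ineq2[of e x] nx unfolding e by linarith
          have le: "u x \<le> u (\<tau> b x)" using below[of b] x by (simp add: dominates_def)
          show ?thesis
          proof (rule ccontr)
            assume "\<not> u x < u (\<tau> b x)"
            then have eq: "u (\<tau> b x) = u x" using le by simp
            have half: "u (\<tau> b y) = u y" if "e \<bullet> y < b" "norm y < 1" for y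
            proof (rule dominates_strict_or_equal[of "ball 0 1 \<inter> {x. e \<bullet> x < b}" b x y])
              show "open (ball 0 1 \<inter> {x. e \<bullet> x < b})" by (intro open_Int open_ball open_halfspace_lt)
              show "connected (ball 0 1 \<inter> {x. e \<bullet> x < b})"
                by (intro convex_connected convex_Int convex_ball convex_halfspace_lt)
              fix x assume x: "x \<in> ball 0 1 \<inter> {x. e \<bullet> x < b}"
              then show "x \<in> ball 0 1 \<and> \<tau> b x \<in> ball 0 1 \<and> e \<bullet> x < b" using inside[of x b] b by auto
            qed (use that x nx eq below[of b] in auto)
            have "(\<lambda>s. - s *\<^sub>R e) \<midarrow>1\<rightarrow> - 1 *\<^sub>R e" by (intro tendsto_intros)
            \<comment> \<open>Equality on the whole cap would extend by continuity to the boundary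
              point \<open>- e\<close>. There \<open>u\<close> vanishes, while its reflection is an
              interior point, where \<open>u\<close> is positive.\<close>
            have lim: "((\<lambda>s. u (\<tau> b (- s *\<^sub>R e)) - u (- s *\<^sub>R e)) \<longlongrightarrow> u (\<tau> b (- 1 *\<^sub>R e)) - u (- 1 *\<^sub>R e)) (at_left 1)"
            proof -
              have "continuous_on UNIV (\<lambda>s. u (\<tau> b (- s *\<^sub>R e)) - u (- s *\<^sub>R e))"
                unfolding reflect_def by (intro continuous_on_diff continuous_on_compose2[OF cont] continuous_intros) auto
              from bspec[OF this[unfolded continuous_on_def] UNIV_I, of 1] show ?thesis
                by (rule tendsto_within_subset) simp
            qed
            moreover have "\<forall>\<^sub>F s in at_left 1. u (\<tau> b (- s *\<^sub>R e)) - u (- s *\<^sub>R e) = 0"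
              unfolding eventually_at_left_field
            proof (intro exI[of _ "max 0 (- b)"] conjI allI impI)
              show "max 0 (- b) < 1" using ne by simp
              fix s assume s: "max 0 (- b) < s" "s < 1"
              have "e \<bullet> (- s *\<^sub>R e) = - s" using e by (simp add: norm_eq_1)
              then show "u (\<tau> b (- s *\<^sub>R e)) - u (- s *\<^sub>R e) = 0" using half[of "- s *\<^sub>R e"] s e by simp
            qed
            ultimately have "((\<lambda>s. 0) \<longlongrightarrow> u (\<tau> b (- 1 *\<^sub>R e)) - u (- 1 *\<^sub>R e)) (at_left (1::real))"
              by (rule Lim_transform_eventually)
            then have "u (\<tau> b (- 1 *\<^sub>R e)) - u (- 1 *\<^sub>R e) = 0"
              by (rule tendsto_unique[OF trivial_limit_at_left_real _ tendsto_const])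
            moreover have "norm (\<tau> b (- 1 *\<^sub>R e)) < norm (- 1 *\<^sub>R e)"
            proof (rule inside[OF _ b])
              have "e \<bullet> (- 1 *\<^sub>R e) = - 1" using e by (simp add: norm_eq_1)
              then show "e \<bullet> (- 1 *\<^sub>R e) < b" using ne by linarith
            qed
            ultimately show False using u0(2)[of "- e"] u0(3)[of "\<tau> b (- e)"] e by simp
          qed
        qed
      qed
    qed (use l in auto)
    then have "dominates 0" by (rule dominates_closed)
    then show ?thesis using ex by (simp add: dominates_def)
  qed
  have "u (reflect e 0 x) = u x" if e: "norm e = 1" for e x
  proof -
    have *: "u (reflect e 0 x) = u x" if e: "norm e = 1" "e \<bullet> x \<le> 0" for e x
    proof (rule antisym)
      show "u x \<le> u (reflect e 0 x)" by (rule half[OF that])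
      \<comment> \<open>The reflected point lies in the half-plane belonging to \<open>- e\<close>,
        and both directions define the same reflection.\<close>
      have "u (reflect e 0 x) \<le> u (reflect (- e) 0 (reflect e 0 x))"
        by (rule half) (use that in \<open>auto simp: inner_reflect\<close>)
      also have "reflect (- e) 0 (reflect e 0 x) = reflect e 0 (reflect e 0 x)" by (simp add: reflect_def)
      finally show "u (reflect e 0 x) \<le> u x" by (simp add: reflect_reflect[OF e(1)])
    qed
    show ?thesis
    proof (cases "e \<bullet> x \<le> 0")
      case False
      have "reflect (- e) 0 x = reflect e 0 x" by (simp add: reflect_def)
      then show ?thesis using *[of "- e" x] e False by simp
    qed (rule *[OF e])
  qed
  then have "u x = u y" using xy(2) by (rule radial_of_reflections)
  then show ?thesis using xy by (simp add: u_def)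
qed

section \<open>The radial equation\<close>

lemma DERIV_nonpos_imp_le:
  fixes h :: "real \<Rightarrow> real"
  assumes "a \<le> b" "continuous_on {a..b} h" "\<And>x. a < x \<Longrightarrow> x < b \<Longrightarrow> (h has_real_derivative h' x) (at x)" "\<And>x. a < x \<Longrightarrow> x < b \<Longrightarrow> h' x \<le> 0"
  shows "h b \<le> h a"
proof (cases "a = b")
  case False
  then have "a < b" using assms(1) by simp
  then obtain l z where z: "a < z" "z < b" "(h has_real_derivative l) (at z)" "h b - h a = (b - a) * l"
    using MVT[OF _ assms(2)] assms(3) real_differentiable_def by blast
  then have "l \<le> 0" using assms(3)[of z] assms(4)[of z] DERIV_unique by metis
  then have "(b - a) * l \<le> 0" using \<open>a < b\<close> by (simp add: mult_nonneg_nonpos)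
  then show ?thesis using z by simp
qed simp

text \<open>\<open>g\<close> is the restriction of a radial function to a full line through the
  centre, so it lives on a symmetric interval and its derivatives at 0 are two-sided. The singular
  equation is imposed only for \<open>r > 0\<close>; the condition \<open>g1 0 = 0\<close> replaces
  it at the centre.\<close>

definition emden_ode :: "real \<Rightarrow> real \<Rightarrow> (real \<Rightarrow> real) \<Rightarrow> (real \<Rightarrow> real) \<Rightarrow> bool" where
  "emden_ode p \<rho> g g1 \<longleftrightarrow>
     (\<forall>r. \<bar>r\<bar> < \<rho> \<longrightarrow> (g has_real_derivative g1 r) (at r) \<and> (\<exists>D. (g1 has_real_derivative D) (at r))) \<and>
     (\<forall>r. 0 < r \<longrightarrow> r < \<rho> \<longrightarrow> (g1 has_real_derivative (- (pos_part (g r) powr p) - g1 r / r)) (at r)) \<and> g1 0 = 0"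

lemma emden_odeD:
  assumes "emden_ode p \<rho> g g1"
  shows "\<bar>r\<bar> < \<rho> \<Longrightarrow> (g has_real_derivative g1 r) (at r)"
    and "\<bar>r\<bar> < \<rho> \<Longrightarrow> isCont g1 r"
    and "0 < r \<Longrightarrow> r < \<rho> \<Longrightarrow> (g1 has_real_derivative (- (pos_part (g r) powr p) - g1 r / r)) (at r)"
    and "g1 0 = 0"
    and "\<bar>r\<bar> < \<rho> \<Longrightarrow> \<exists>D. (g1 has_real_derivative D) (at r)"
  using assms unfolding emden_ode_def by (auto intro: DERIV_isCont)

text \<open>The function \<open>y = (g - h)\<^sup>2 + (g' - h')\<^sup>2\<close> satisfies \<open>y' \<le> c y\<close>, because the singular
  terms contribute \<open>- 2 (g' - h')\<^sup>2 / r \<le> 0\<close>.\<close>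

lemma emden_ode_unique:
  assumes p: "p > 1" and g: "emden_ode p \<rho> g g1" and h: "emden_ode p \<rho> h h1" and eq: "g 0 = h 0"
    and M: "\<And>r. 0 \<le> r \<Longrightarrow> r < \<rho> \<Longrightarrow> g r \<le> M" "\<And>r. 0 \<le> r \<Longrightarrow> r < \<rho> \<Longrightarrow> h r \<le> M" and r: "0 \<le> r" "r < \<rho>"
  shows "g r = h r"
proof -
  define L where "L = p * pos_part M powr (p - 1)"
  \<comment> \<open>The summand 1 absorbs the product of the two differences and \<open>L\<close>
    the nonlinear term, both through \<open>2 * a * b \<le> a^2 + b^2\<close>.\<close>
  define c where "c = 1 + L"
  define y where "y s = (g s - h s)\<^sup>2 + (g1 s - h1 s)\<^sup>2" for s
  define y' where "y' s = 2 * (g s - h s) * (g1 s - h1 s) + 2 * (g1 s - h1 s) *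
     ((- (pos_part (g s) powr p) - g1 s / s) - (- (pos_part (h s) powr p) - h1 s / s))" for s
  have L0: "L \<ge> 0" using p by (simp add: L_def)
  \<comment> \<open>The Gronwall argument: with the factor \<open>exp (- c * s)\<close> the energy
    does not increase.\<close>
  have le: "exp (- c * r) * y r \<le> exp (- c * 0) * y 0"
  proof (rule DERIV_nonpos_imp_le[OF r(1)])
    have cg: "continuous_on {0..r} g" "continuous_on {0..r} h" "continuous_on {0..r} g1" "continuous_on {0..r} h1"
      using r by (auto intro!: continuous_at_imp_continuous_on DERIV_isCont[OF emden_odeD(1)[OF g]]
          DERIV_isCont[OF emden_odeD(1)[OF h]] emden_odeD(2)[OF g] emden_odeD(2)[OF h])
    show "continuous_on {0..r} (\<lambda>s. exp (- c * s) * y s)"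
      unfolding y_def by (intro continuous_on_mult continuous_on_exp continuous_on_add continuous_on_power continuous_on_diff
          continuous_on_const continuous_on_id cg)
    fix s assume s: "0 < s" "s < r"
    then have s': "s < \<rho>" "\<bar>s\<bar> < \<rho>" using r by auto
    have d: "(y has_real_derivative y' s) (at s)"
      unfolding y_def y'_def
      by (rule DERIV_cong[OF DERIV_add[OF DERIV_power[OF DERIV_diff[OF emden_odeD(1)[OF g s'(2)] emden_odeD(1)[OF h s'(2)]], of 2]
             DERIV_power[OF DERIV_diff[OF emden_odeD(3)[OF g s(1) s'(1)] emden_odeD(3)[OF h s(1) s'(1)]], of 2]]])
         (simp add: algebra_simps)
    have "((\<lambda>s. exp (- c * s)) has_real_derivative - c * exp (- c * s)) (at s)"
      by (auto intro!: derivative_eq_intros)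
    from DERIV_mult[OF this d]
    show "((\<lambda>s. exp (- c * s) * y s) has_real_derivative (- c * exp (- c * s) * y s + y' s * exp (- c * s))) (at s)"
      by simp
    have "y' s \<le> c * y s"
    proof -
      define a where "a = g s - h s"
      define b where "b = g1 s - h1 s"
      define F where "F = pos_part (g s) powr p - (pos_part (h s) powr p)"
      have "\<bar>F\<bar> \<le> L * \<bar>a\<bar>"
      proof (cases "h s \<le> g s")
        case True
        then show ?thesis
          using pos_part_powr_lipschitz[OF p True, of M] M(1)[of s] s s' pos_part_powr_mono[OF p True] by (simp add: F_def a_def L_def)
      next
        case False
        then have "g s \<le> h s" by simp
        from pos_part_powr_lipschitz[OF p this, of M] M(2)[of s] s s' pos_part_powr_mono[OF p this] False
        show ?thesis by (simp add: F_def a_def L_def)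
      qed
      then have "\<bar>b\<bar> * \<bar>F\<bar> \<le> \<bar>b\<bar> * (L * \<bar>a\<bar>)" by (intro mult_left_mono) auto
      then have bF: "- (b * F) \<le> L * (\<bar>a\<bar> * \<bar>b\<bar>)" using abs_ge_minus_self[of "b * F"] by (simp add: abs_mult mult_ac)
      have "2 * (\<bar>a\<bar> * \<bar>b\<bar>) \<le> a\<^sup>2 + b\<^sup>2" using sum_squares_bound[of "\<bar>a\<bar>" "\<bar>b\<bar>"] by (simp add: mult.assoc)
      then have ab: "c * (2 * (\<bar>a\<bar> * \<bar>b\<bar>)) \<le> c * (a\<^sup>2 + b\<^sup>2)" using L0 by (intro mult_left_mono) (auto simp: c_def)
      have "a * b \<le> \<bar>a\<bar> * \<bar>b\<bar>" by (metis abs_ge_self abs_mult)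
      moreover have "b * (b / s) \<ge> 0" using s by simp
      moreover have "y' s = 2 * (a * b) - 2 * (b * F) - 2 * (b * (b / s))"
        unfolding y'_def a_def b_def F_def by (simp add: algebra_simps diff_divide_distrib)
      moreover have "c * (2 * (\<bar>a\<bar> * \<bar>b\<bar>)) = 2 * (\<bar>a\<bar> * \<bar>b\<bar>) + 2 * (L * (\<bar>a\<bar> * \<bar>b\<bar>))"
        by (simp add: c_def algebra_simps)
      ultimately have "y' s \<le> c * (2 * (\<bar>a\<bar> * \<bar>b\<bar>))" using bF by linarith
      also note ab
      finally show ?thesis by (simp add: y_def a_def b_def)
    qed
    then have "(y' s - c * y s) * exp (- c * s) \<le> 0" by (simp add: mult_nonpos_nonneg)
    then show "- c * exp (- c * s) * y s + y' s * exp (- c * s) \<le> 0" by (simp add: algebra_simps)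
  qed
  also have "\<dots> = 0" using eq emden_odeD(4)[OF g] emden_odeD(4)[OF h] by (simp add: y_def)
  finally have "y r \<le> 0" by (simp add: mult_le_0_iff)
  then have "(g r - h r)\<^sup>2 = 0" unfolding y_def
    using zero_le_power2[of "g r - h r"] zero_le_power2[of "g1 r - h1 r"] by linarith
  then show ?thesis by simp
qed

text \<open>Multiplication by \<open>r\<close> puts the equation into divergence form and removes
  its singularity; at \<open>r = 0\<close> the derivative vanishes because
  \<open>g1 0 = 0\<close>.\<close>

lemma emden_ode_flux:
  assumes g: "emden_ode p \<rho> g g1" and r: "0 \<le> r" "r < \<rho>"
  shows "((\<lambda>r. r * g1 r) has_real_derivative (- r * pos_part (g r) powr p)) (at r)"
proof (cases "r = 0")
  case True
  obtain D where "(g1 has_real_derivative D) (at 0)" using emden_odeD(5)[OF g, of 0] r by auto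
  from DERIV_mult[OF DERIV_ident this] show ?thesis using True emden_odeD(4)[OF g] by simp
next
  case False
  then have "0 < r" using r by simp
  from DERIV_mult[OF DERIV_ident emden_odeD(3)[OF g this r(2)]]
  show ?thesis by (rule DERIV_cong) (use \<open>0 < r\<close> in \<open>simp add: field_simps\<close>)
qed

lemma emden_ode_nonincreasing:
  assumes g: "emden_ode p \<rho> g g1" and r: "0 \<le> r" "r \<le> s" "s < \<rho>"
  shows "g s \<le> g r"
proof -
  have g1: "g1 t \<le> 0" if t: "0 < t" "t < \<rho>" for t
  proof -
    have "t * g1 t \<le> 0 * g1 0"
    proof (rule DERIV_nonpos_imp_le[where h="\<lambda>r. r * g1 r" and h'="\<lambda>x. - x * pos_part (g x) powr p"])
      show "continuous_on {0..t} (\<lambda>r. r * g1 r)"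
        using t by (intro continuous_at_imp_continuous_on ballI DERIV_isCont[OF emden_ode_flux[OF g]]) auto
      fix x assume "0 < x" "x < t"
      then show "((\<lambda>r. r * g1 r) has_real_derivative (- x * pos_part (g x) powr p)) (at x)"
        using t by (intro emden_ode_flux[OF g]) auto
      show "- x * pos_part (g x) powr p \<le> 0" using \<open>0 < x\<close> by simp
    qed (use t in simp)
    then show ?thesis using t by (simp add: mult_le_0_iff)
  qed
  show ?thesis
  proof (rule DERIV_nonpos_imp_le[OF r(2), of g g1])
    show "continuous_on {r..s} g"
      using r by (intro continuous_at_imp_continuous_on ballI DERIV_isCont[OF emden_odeD(1)[OF g]]) auto
    fix x assume "r < x" "x < s"
    then show "(g has_real_derivative g1 x) (at x)" "g1 x \<le> 0"
      using r by (auto intro!: emden_odeD(1)[OF g] g1)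
  qed
qed

text \<open>The second derivative across the ray is found from
  \<open>U (r e + t e2) = g (sqrt (r^2 + t^2))\<close>. Its first derivative in \<open>t\<close> is
  \<open>t * g1 s / s\<close>, and the derivative of that at \<open>t = 0\<close> is
  \<open>g1 r / r\<close>.\<close>

lemma radial_ode:
  fixes U :: "plane \<Rightarrow> real"
  assumes C2: "C2_on (ball 0 \<rho>) U G Hs" and \<rho>: "\<rho> > 0"
    and rad: "\<And>x y. norm x = norm y \<Longrightarrow> norm x < \<rho> \<Longrightarrow> U x = U y"
    and pde: "\<And>x. norm x < \<rho> \<Longrightarrow> - laplacian U x = pos_part (U x) powr p"
  defines "e \<equiv> axis 1 1 :: plane"
  shows "emden_ode p \<rho> (\<lambda>r. U (r *\<^sub>R e)) (\<lambda>r. G (r *\<^sub>R e) \<bullet> e)"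
proof -
  define e2 :: plane where "e2 = axis 2 1"
  have B: "e \<in> Basis" "e2 \<in> Basis" "e \<noteq> e2" "Basis = {e, e2}"
    unfolding e_def e2_def Basis_vec_def by (auto simp: axis_eq_axis UNIV_2)
  have ip: "e \<bullet> e = 1" "e2 \<bullet> e2 = 1" "e \<bullet> e2 = 0" "e2 \<bullet> e = 0" "norm e = 1"
    using B(1-3) inner_Basis[OF B(1) B(1)] inner_Basis[OF B(2) B(2)] inner_Basis[OF B(1) B(2)] inner_Basis[OF B(2) B(1)] by auto
  have line: "((\<lambda>t. a + t *\<^sub>R b) has_derivative (\<lambda>t. t *\<^sub>R b)) (at t)" for a b :: plane and t
    by (auto intro!: derivative_eq_intros)
  have d1: "((\<lambda>t. U (a + t *\<^sub>R b)) has_real_derivative G (a + t *\<^sub>R b) \<bullet> b) (at t)" if "a + t *\<^sub>R b \<in> ball 0 \<rho>" for a b t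
    unfolding has_field_derivative_def
    by (rule has_derivative_eq_rhs[OF has_derivative_compose[OF line C1_on_deriv[OF C2_on_C1[OF C2] that]]]) (simp add: fun_eq_iff)
  have d2: "((\<lambda>t. G (a + t *\<^sub>R b) \<bullet> c) has_real_derivative Hs c (a + t *\<^sub>R b) \<bullet> b) (at t)"
    if "a + t *\<^sub>R b \<in> ball 0 \<rho>" "c \<in> Basis" for a b t c
    unfolding has_field_derivative_def
    by (rule has_derivative_eq_rhs[OF has_derivative_compose[OF line C1_on_deriv[OF C2_on_C1_grad[OF C2 that(2)] that(1)]]]) (simp add: fun_eq_iff)
  define g where "g r = U (r *\<^sub>R e)" for r
  define g1 where "g1 r = G (r *\<^sub>R e) \<bullet> e" for r
  have inb: "r *\<^sub>R e \<in> ball 0 \<rho>" if "\<bar>r\<bar> < \<rho>" for r using that ip by simp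
  have D1: "(g has_real_derivative g1 r) (at r)" if "\<bar>r\<bar> < \<rho>" for r
    using d1[of 0 r e] inb[OF that] by (simp add: g_def[abs_def] g1_def)
  have D2: "(g1 has_real_derivative Hs e (r *\<^sub>R e) \<bullet> e) (at r)" if "\<bar>r\<bar> < \<rho>" for r
    using d2[of 0 r e e] inb[OF that] B by (simp add: g1_def[abs_def])
  \<comment> \<open>By radial symmetry \<open>g\<close> is even, so its derivative at 0 equals its
    own negative.\<close>
  have g0: "g1 0 = 0"
  proof -
    have "(g has_real_derivative g1 0) (at (- 0))" using D1[of 0] \<rho> by simp
    then have "((\<lambda>r. g (- r)) has_real_derivative - g1 0) (at 0)" by (subst (asm) DERIV_mirror)
    moreover have "((\<lambda>r. g (- r)) has_real_derivative g1 0) (at 0)"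
    proof (rule has_field_derivative_transform_within_open[where S="{- \<rho><..<\<rho>}"])
      show "(g has_real_derivative g1 0) (at 0)" using D1[of 0] \<rho> by simp
      show "g x = g (- x)" if "x \<in> {- \<rho><..<\<rho>}" for x
        unfolding g_def by (rule rad) (use that ip in auto)
    qed (use \<rho> in auto)
    ultimately have "- g1 0 = g1 0" by (rule DERIV_unique)
    then show ?thesis by simp
  qed
  have L: "laplacian U (r *\<^sub>R e) = Hs e (r *\<^sub>R e) \<bullet> e + g1 r / r" if r: "0 < r" "r < \<rho>" for r
  proof -
    have rb: "r *\<^sub>R e \<in> ball 0 \<rho>" using r by (intro inb) simp
    define s where "s t = sqrt (r\<^sup>2 + t\<^sup>2)" for t
    have n: "norm (r *\<^sub>R e + t *\<^sub>R e2) = s t" for t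
      unfolding norm_eq_sqrt_inner s_def by (simp add: inner_add_left inner_add_right ip power2_eq_square)
    have s0: "s 0 = r" "s t > 0" for t using r by (auto simp: s_def add_pos_nonneg)
    have ds: "(s has_real_derivative t / s t) (at t)" for t
    proof -
      have "r\<^sup>2 + t\<^sup>2 > 0" using r by (simp add: add_pos_nonneg)
      then show ?thesis unfolding s_def by (auto intro!: derivative_eq_intros simp: field_simps)
    qed
    have cs: "isCont s t" for t using ds by (rule DERIV_isCont)
    define T where "T = {t. s t < \<rho>}"
    have "continuous_on UNIV s" using cs by (simp add: continuous_at_imp_continuous_on)
    then have oT: "open T" unfolding T_def by (intro open_Collect_less continuous_on_const)
    have T0: "0 \<in> T" using r by (simp add: T_def s0)
    have eq: "G (r *\<^sub>R e + t *\<^sub>R e2) \<bullet> e2 = t * (g1 (s t) / s t)" if t: "t \<in> T" for t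
    proof (rule DERIV_unique)
      have tb: "r *\<^sub>R e + t *\<^sub>R e2 \<in> ball 0 \<rho>" using t n by (simp add: T_def)
      show "((\<lambda>t. U (r *\<^sub>R e + t *\<^sub>R e2)) has_real_derivative G (r *\<^sub>R e + t *\<^sub>R e2) \<bullet> e2) (at t)"
        by (rule d1[OF tb])
      have "((\<lambda>t. g (s t)) has_real_derivative g1 (s t) * (t / s t)) (at t)"
        by (rule DERIV_chain2[OF D1 ds]) (use t s0(2)[of t] in \<open>simp add: T_def\<close>)
      then have "((\<lambda>t. U (r *\<^sub>R e + t *\<^sub>R e2)) has_real_derivative g1 (s t) * (t / s t)) (at t)"
      proof (rule has_field_derivative_transform_within_open[OF _ oT t])
        fix t assume "t \<in> T"
        then show "g (s t) = U (r *\<^sub>R e + t *\<^sub>R e2)"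
          unfolding g_def using n[of t] s0(2)[of t] ip by (intro rad) (auto simp: T_def)
      qed
      then show "((\<lambda>t. U (r *\<^sub>R e + t *\<^sub>R e2)) has_real_derivative t * (g1 (s t) / s t)) (at t)"
        by (simp add: mult_ac)
    qed
    \<comment> \<open>Continuity of the cofactor of \<open>t\<close> suffices to differentiate the
      product at \<open>t = 0\<close>.\<close>
    have c1: "isCont (\<lambda>t. g1 (s t) / s t) 0"
      using r s0 by (intro continuous_divide isCont_o2[OF cs] cs DERIV_isCont[OF D2]) auto
    have "((\<lambda>t. (t * (g1 (s t) / s t) - 0 * (g1 (s 0) / s 0)) / (t - 0)) \<longlongrightarrow> g1 (s 0) / s 0) (at 0)"
      by (rule Lim_transform_eventually[OF c1[unfolded isCont_def]]) (auto simp: eventually_at_filter)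
    then have "((\<lambda>t. t * (g1 (s t) / s t)) has_real_derivative g1 r / r) (at 0)"
      by (simp add: has_field_derivative_iff s0)
    then have "((\<lambda>t. G (r *\<^sub>R e + t *\<^sub>R e2) \<bullet> e2) has_real_derivative g1 r / r) (at 0)"
      by (rule has_field_derivative_transform_within_open[OF _ oT T0]) (simp add: eq)
    moreover have "((\<lambda>t. G (r *\<^sub>R e + t *\<^sub>R e2) \<bullet> e2) has_real_derivative Hs e2 (r *\<^sub>R e + 0 *\<^sub>R e2) \<bullet> e2) (at 0)"
      by (rule d2) (use rb B in auto)
    ultimately have "Hs e2 (r *\<^sub>R e) \<bullet> e2 = g1 r / r" using DERIV_unique by fastforce
    moreover have "laplacian U (r *\<^sub>R e) = Hs e (r *\<^sub>R e) \<bullet> e + Hs e2 (r *\<^sub>R e) \<bullet> e2"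
      using laplacian_C2_on[OF open_ball C2 rb] B(3) unfolding B(4) by simp
    ultimately show ?thesis by simp
  qed
  have ode: "(g1 has_real_derivative (- (pos_part (g r) powr p) - g1 r / r)) (at r)" if r: "0 < r" "r < \<rho>" for r
  proof -
    have "- laplacian U (r *\<^sub>R e) = pos_part (g r) powr p" unfolding g_def by (rule pde) (use r ip in simp)
    then have "Hs e (r *\<^sub>R e) \<bullet> e = - (pos_part (g r) powr p) - g1 r / r" using L[OF r] by simp
    then show ?thesis using D2[of r] r by simp
  qed
  show ?thesis
    unfolding emden_ode_def g_def[symmetric] g1_def[symmetric] using D1 D2 ode g0 by blast
qed

text \<open>\<open>g\<close> decreases through zero at 1, so the nonlinearity vanishes beyond 1 and
  the flux \<open>s * g1 s\<close> stays at its value \<open>g1 1\<close>; one more integration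
  gives the logarithm.\<close>

lemma emden_outside:
  assumes g: "\<And>\<rho>. \<rho> > 0 \<Longrightarrow> emden_ode p \<rho> g g1" and g1: "g 1 = 0" and r: "r \<ge> 1"
  shows "g r = g1 1 * ln r"
proof (cases "r = 1")
  case False
  then have r1: "1 < r" using r by simp
  have ode: "emden_ode p (r + 1) g g1" using r by (intro g) simp
  have neg: "g s \<le> 0" if "1 \<le> s" "s \<le> r" for s
    using emden_ode_nonincreasing[OF ode, of 1 s] g1 that by simp
  have flux: "s * g1 s = 1 * g1 1" if s: "1 < s" "s \<le> r" for s
  proof (rule DERIV_isconst_end[OF s(1)])
    show "continuous_on {1..s} (\<lambda>s. s * g1 s)"
      using s by (intro continuous_at_imp_continuous_on ballI DERIV_isCont[OF emden_ode_flux[OF ode]]) auto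
    fix x assume x: "1 < x" "x < s"
    have "pos_part (g x) powr p = 0" using neg[of x] x s by (simp add: pos_part_def)
    then show "((\<lambda>s. s * g1 s) has_real_derivative 0) (at x)"
      using emden_ode_flux[OF ode, of x] x s by simp
  qed
  have "g r - g1 1 * ln r = g 1 - g1 1 * ln 1"
  proof (rule DERIV_isconst_end[OF r1])
    have D: "((\<lambda>s. g s - g1 1 * ln s) has_real_derivative g1 s - g1 1 * (1 / s)) (at s)" if "1 \<le> s" "s \<le> r" for s
      using that by (intro DERIV_diff DERIV_cmult emden_odeD(1)[OF ode] DERIV_ln_divide) auto
    then show "continuous_on {1..r} (\<lambda>s. g s - g1 1 * ln s)"
      by (intro continuous_at_imp_continuous_on ballI DERIV_isCont[OF D]) auto
    fix x assume x: "1 < x" "x < r"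
    then show "((\<lambda>s. g s - g1 1 * ln s) has_real_derivative 0) (at x)"
      using D[of x] flux[of x] by (simp add: field_simps)
  qed
  then show ?thesis using g1 by simp
qed (use g1 in simp)

text \<open>In polar coordinates the integrand is the derivative of
  \<open>- 2 * pi * r * g1 r\<close> on the unit interval, and it vanishes beyond.\<close>

lemma emden_flux_mass:
  assumes p: "p > 1" and g: "\<And>\<rho>. \<rho> > 0 \<Longrightarrow> emden_ode p \<rho> g g1" and g1: "g 1 = 0"
    and V: "\<And>x. V x = g (norm (x::plane))"
  shows "(LINT x|lborel. pos_part (V x) powr p) = - 2 * pi * g1 1"
proof -
  have cg: "continuous_on UNIV g"
  proof (intro continuous_at_imp_continuous_on ballI DERIV_isCont)
    show "(g has_real_derivative g1 x) (at x)" for x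
      using emden_odeD(1)[OF g[of "\<bar>x\<bar> + 1"], of x] by simp
  qed
  then have [measurable]: "g \<in> borel_measurable borel" by (rule borel_measurable_continuous_onI)
  have [measurable]: "(\<lambda>r. pos_part (g r) powr p) \<in> borel_measurable borel" unfolding pos_part_def by measurable
  have neg: "pos_part (g r) = 0" if "r \<ge> 1" for r
    using emden_ode_nonincreasing[OF g, of "r + 1" 1 r] g1 that by (simp add: pos_part_def)
  have "(\<integral>\<^sup>+x. ennreal (pos_part (V x) powr p) \<partial>lborel) = (\<integral>\<^sup>+r. ennreal (2 * pi * r) * indicator {0..} r * ennreal (pos_part (g r) powr p) \<partial>lborel)"
    unfolding V by (rule nn_integral_radial[of "\<lambda>r. ennreal (pos_part (g r) powr p)"]) measurable
  also have "\<dots> = (\<integral>\<^sup>+r. ennreal (2 * pi * (r * pos_part (g r) powr p)) * indicator {0..1} r \<partial>lborel)"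
    by (intro nn_integral_cong) (auto simp: indicator_def neg ennreal_mult'[symmetric] mult_ac)
  also have "\<dots> = ennreal (- 2 * pi * (1 * g1 1) - (- 2 * pi * (0 * g1 0)))"
  proof (rule nn_integral_FTC_Icc[where F="\<lambda>r. - 2 * pi * (r * g1 r)"])
    fix r :: real assume "r \<in> {0..1}"
    then have r: "0 \<le> r" "r \<le> 1" by auto
    have "((\<lambda>r. - 2 * pi * (r * g1 r)) has_real_derivative - 2 * pi * (- r * pos_part (g r) powr p)) (at r)"
      using r by (intro DERIV_cmult emden_ode_flux[OF g[of 2]]) auto
    then show "((\<lambda>r. - 2 * pi * (r * g1 r)) has_real_derivative 2 * pi * (r * pos_part (g r) powr p)) (at r)" by simp
    show "0 \<le> 2 * pi * (r * pos_part (g r) powr p)" using r by simp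
  qed simp_all
  finally have nn: "(\<integral>\<^sup>+x. ennreal (pos_part (V x) powr p) \<partial>lborel) = ennreal (- 2 * pi * g1 1)" by simp
  have "1 * g1 1 \<le> 0 * g1 0"
  proof (rule DERIV_nonpos_imp_le[where h="\<lambda>r. r * g1 r" and h'="\<lambda>x. - x * pos_part (g x) powr p"])
    show "(0::real) \<le> 1" by simp
    show "continuous_on {0..1} (\<lambda>r. r * g1 r)"
      by (intro continuous_at_imp_continuous_on ballI DERIV_isCont[OF emden_ode_flux[OF g[of 2]]]) auto
    fix x :: real assume "0 < x" "x < 1"
    then show "((\<lambda>r. r * g1 r) has_real_derivative (- x * pos_part (g x) powr p)) (at x)" "- x * pos_part (g x) powr p \<le> 0"
      using emden_ode_flux[OF g[of 2], of x] by auto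
  qed
  then have "g1 1 \<le> 0" by simp
  have "V = (\<lambda>x. g (norm x))" using V by (rule ext)
  then have "(\<lambda>x. pos_part (V x) powr p) \<in> borel_measurable lborel" by simp
  then show ?thesis
    using nn \<open>g1 1 \<le> 0\<close> by (subst integral_eq_nn_integral) (auto simp: mult_nonneg_nonpos)
qed

section \<open>Classification\<close>

lemma C2_on_cmult:
  assumes "C2_on S u G Hs"
  shows "C2_on S (\<lambda>x. c * u x) (\<lambda>x. c *\<^sub>R G x) (\<lambda>e x. c *\<^sub>R Hs e x)"
proof -
  have "C1_on S (\<lambda>x. c * u x) (\<lambda>x. c *\<^sub>R G x)" if "C1_on S u G" for u G
    using that unfolding C1_on_def inner_scaleR_left
    by (auto intro!: has_derivative_mult_right continuous_on_scaleR continuous_on_const)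
  then show ?thesis using assms unfolding C2_on_def inner_scaleR_left by blast
qed

lemma laplacian_cmult:
  assumes "open S" "C2_on S u G Hs" "x \<in> S"
  shows "laplacian (\<lambda>x. c * u x) x = c * laplacian u x"
  using laplacian_C2_on[OF assms(1) C2_on_cmult[OF assms(2)] assms(3)] laplacian_C2_on[OF assms]
  by (simp add: sum_distrib_left)

lemma pos_part_scale: "c \<ge> 0 \<Longrightarrow> pos_part (c * t) = c * pos_part t"
  by (simp add: pos_part_def max_mult_distrib_left)

context plane_solution begin

text \<open>The condition \<open>s * R^2 = s powr p\<close> is the scaling invariance of the
  equation. A single \<open>g1\<close> serves all radii because it is read off from the gradient on
  the whole plane.\<close>

lemma rescaled_ode:
  assumes rad: "\<And>x y. norm x = norm y \<Longrightarrow> u (x + x0) = u (y + x0)"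
    and s: "s > 0" "R > 0" "s * R\<^sup>2 = s powr p"
  defines "V \<equiv> (\<lambda>x. s * u (R *\<^sub>R x + x0))"
  shows "\<exists>g1. \<forall>\<rho>>0. emden_ode p \<rho> (\<lambda>r. V (r *\<^sub>R axis 1 1)) g1"
proof -
  define A where "A x = R *\<^sub>R x" for x :: plane
  have A: "linear A" "A v \<bullet> w = v \<bullet> A w" "A (A v) = R\<^sup>2 *\<^sub>R v" for v w
    by (auto simp: A_def power2_eq_square linear_scaleR intro!: linearI simp: algebra_simps)
  obtain K where K: "C2_on UNIV (\<lambda>x. u (A x + x0)) (\<lambda>x. A (G (A x + x0))) K"
    "\<And>x. x \<in> UNIV \<Longrightarrow> laplacian (\<lambda>x. u (A x + x0)) x = R\<^sup>2 * laplacian u (A x + x0)"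
    by (rule laplacian_compose_affine[OF open_UNIV open_UNIV C2 A UNIV_I]) blast
  have C: "C2_on UNIV V (\<lambda>x. s *\<^sub>R A (G (A x + x0))) (\<lambda>e x. s *\<^sub>R K e x)"
    unfolding V_def A_def[symmetric] by (rule C2_on_cmult[OF K(1)])
  have pdeV: "- laplacian V x = pos_part (V x) powr p" for x
  proof -
    have "laplacian V x = s * (R\<^sup>2 * laplacian u (A x + x0))"
      unfolding V_def A_def[symmetric] using laplacian_cmult[OF open_UNIV K(1) UNIV_I] K(2) by simp
    moreover have "laplacian u (A x + x0) = - (pos_part (u (A x + x0)) powr p)"
      using pde[of "A x + x0"] by linarith
    ultimately have "- laplacian V x = s powr p * pos_part (u (A x + x0)) powr p"
      by (simp add: mult.assoc flip: s(3))
    also have "\<dots> = pos_part (V x) powr p"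
      using s by (simp add: V_def A_def pos_part_scale powr_mult)
    finally show ?thesis .
  qed
  have "V x = V y" if "norm x = norm y" for x y
    unfolding V_def using rad[of "R *\<^sub>R x" "R *\<^sub>R y"] that by simp
  then show ?thesis
    using radial_ode[OF C2_on_subset[OF C] _ _ pdeV] by blast
qed

end

text \<open>The radius is determined by matching the values at the centres: the rescaled solution
  \<open>V\<close> and \<open>\<phi>\<close> then solve the same initial value problem on the unit
  interval.\<close>

lemma emden_classification:
  fixes p :: real and u \<phi> :: "plane \<Rightarrow> real"
  assumes sol: "plane_solution u G Hs M p" and em: "emden_solution p \<phi>" 
    and m: "(LINT x|lborel. pos_part (u x) powr p) > 0"
  obtains R x0 where "R > 0"
    "(LINT x|lborel. pos_part (u x) powr p) = emden_mass p \<phi> / R powr (2 / (p - 1))"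
    "(LINT x|lborel. pos_part (u x) powr p) = - 2 * pi * radial_deriv1 \<phi> / R powr (2 / (p - 1))"
    "\<And>x y. norm x = norm y \<Longrightarrow> u (x + x0) = u (y + x0)"
    "\<And>x. u (x + x0) = emden_profile p \<phi> R x"
proof -
  interpret plane_solution u G Hs M p by (rule sol)
  have m': "(LINT x|lborel. f x) > 0" using m unfolding f_def[abs_def] .
  obtain x0 where rad: "\<And>x y. norm x = norm y \<Longrightarrow> u (x + x0) = u (y + x0)"
    by (rule radial_about_point[OF m']) blast
  define e :: plane where "e = axis 1 1"
  have e: "norm e = 1" by (simp add: e_def)
  have polar: "u (x + x0) = u (norm x *\<^sub>R e + x0)" for x by (rule rad) (simp add: e)
  \<comment> \<open>Radial solutions decrease away from the centre, so otherwise \<open>u\<close>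
    would be nonpositive everywhere and the mass zero.\<close>
  have a: "u x0 > 0"
  proof (rule ccontr)
    assume neg: "\<not> u x0 > 0"
    obtain g1 where g1: "\<And>\<rho>. \<rho> > 0 \<Longrightarrow> emden_ode p \<rho> (\<lambda>r. 1 * u (1 *\<^sub>R (r *\<^sub>R e) + x0)) g1"
      using rescaled_ode[OF rad, of 1 1] unfolding e_def by auto
    have "u y \<le> 0" for y
    proof -
      have "1 * u (1 *\<^sub>R (norm (y - x0) *\<^sub>R e) + x0) \<le> 1 * u (1 *\<^sub>R (0 *\<^sub>R e) + x0)"
        by (rule emden_ode_nonincreasing[OF g1[of "norm (y - x0) + 1"]]) (auto intro: add_nonneg_pos)
      then show ?thesis using polar[of "y - x0"] neg by simp
    qed
    then have "f = (\<lambda>x. 0)" using f_eq_0_iff by (intro ext) simp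
    then show False using m' by simp
  qed
  obtain G' Hs' where C2': "C2_on (ball 0 1) \<phi> G' Hs'"
    using Ck_on_2_imp_C2_on[OF open_ball] em unfolding emden_solution_def by blast
  have \<phi>pos: "\<phi> x > 0" if "norm x < 1" for x using em that by (simp add: emden_solution_def)
  have \<phi>0: "\<phi> x = 0" if "norm x = 1" for x using em that by (simp add: emden_solution_def)
  have c\<phi>: "continuous_on (cball 0 1) \<phi>" using em by (simp add: emden_solution_def)
  have rad\<phi>: "\<phi> x = \<phi> y" if "norm x = norm y" "norm x \<le> 1" for x y
    by (rule emden_radial[OF p em]) (use that in auto)
  have pde\<phi>: "- laplacian \<phi> x = pos_part (\<phi> x) powr p" if "norm x < 1" for x
    using em that \<phi>pos[OF that] by (simp add: emden_solution_def pos_part_def)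
  have ode\<phi>: "emden_ode p 1 (\<lambda>r. \<phi> (r *\<^sub>R e)) (\<lambda>r. G' (r *\<^sub>R e) \<bullet> e)"
    unfolding e_def by (rule radial_ode[OF C2' zero_less_one _ pde\<phi>]) (auto intro: rad\<phi>)
  have b: "\<phi> 0 > 0" using \<phi>pos[of 0] by simp
  \<comment> \<open>The solution of \<open>R powr (2 / (p - 1)) * u x0 = \<phi> 0\<close>.\<close>
  define R where "R = (\<phi> 0 / u x0) powr ((p - 1) / 2)"
  define s where "s = R powr (2 / (p - 1))"
  have R0: "R > 0" using a b by (simp add: R_def)
  have s0: "s > 0" using R0 by (simp add: s_def)
  have sb: "s * u x0 = \<phi> 0"
  proof -
    have "(p - 1) / 2 * (2 / (p - 1)) = 1" using p by simp
    then have "s = (\<phi> 0 / u x0) powr 1" unfolding s_def R_def powr_powr by (rule arg_cong)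
    then have "s = \<phi> 0 / u x0" using a b by simp
    then show ?thesis using a by simp
  qed
  have sR: "R\<^sup>2 = s powr (p - 1)"
  proof -
    have "2 / (p - 1) * (p - 1) = 2" using p by (simp add: field_simps)
    then have "s powr (p - 1) = R powr 2" unfolding s_def powr_powr by (rule arg_cong)
    then show ?thesis using R0 by simp
  qed
  have sp: "s * R\<^sup>2 = s powr p"
    using s0 powr_add[of s 1 "p - 1"] by (simp add: sR)
  define V where "V x = s * u (R *\<^sub>R x + x0)" for x
  obtain g1 where ode: "\<And>\<rho>. \<rho> > 0 \<Longrightarrow> emden_ode p \<rho> (\<lambda>r. V (r *\<^sub>R e)) g1"
    using rescaled_ode[OF rad s0 R0 sp] unfolding e_def V_def by blast
  have Vrad: "V x = V (norm x *\<^sub>R e)" for x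
    unfolding V_def using rad[of "R *\<^sub>R x" "R *\<^sub>R (norm x *\<^sub>R e)"] e R0 by simp
  have cV: "isCont (\<lambda>r. V (r *\<^sub>R e)) r" for r
    by (rule DERIV_isCont[OF emden_odeD(1)[OF ode[of "\<bar>r\<bar> + 1"]]]) auto
  have eq1: "V (r *\<^sub>R e) = \<phi> (r *\<^sub>R e)" if r: "0 \<le> r" "r < 1" for r
  proof -
    have "compact (\<phi> ` cball 0 1)" by (intro compact_continuous_image c\<phi>) auto
    then obtain B where B: "\<forall>y\<in>\<phi> ` cball 0 1. norm y \<le> B" using compact_imp_bounded bounded_iff by blast
    show ?thesis
    proof (rule emden_ode_unique[OF p ode[OF zero_less_one] ode\<phi> _ _ _ r, of "max B (s * M)"])
      show "V (0 *\<^sub>R e) = \<phi> (0 *\<^sub>R e)" using sb by (simp add: V_def)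
      show "V (r *\<^sub>R e) \<le> max B (s * M)" for r
        unfolding V_def using le_M s0 by (simp add: le_max_iff_disj)
      show "\<phi> (r *\<^sub>R e) \<le> max B (s * M)" if "0 \<le> r" "r < 1" for r
      proof -
        have "r *\<^sub>R e \<in> cball 0 1" using that e by simp
        then have "\<bar>\<phi> (r *\<^sub>R e)\<bar> \<le> B" using B by (metis imageI real_norm_def)
        then show ?thesis by simp
      qed
    qed
  qed
  \<comment> \<open>The equation for \<open>\<phi>\<close> holds only in the open disk, so the value
    at radius 1 comes from continuity of both sides.\<close>
  have eq2: "V (1 *\<^sub>R e) = \<phi> (1 *\<^sub>R e)"
  proof -
    have "((\<lambda>r. V (r *\<^sub>R e)) \<longlongrightarrow> V (1 *\<^sub>R e)) (at 1 within {0..<1})"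
      using cV[of 1] unfolding isCont_def by (rule tendsto_within_subset) simp
    moreover have "((\<lambda>r. \<phi> (r *\<^sub>R e)) \<longlongrightarrow> \<phi> (1 *\<^sub>R e)) (at 1 within {0..<1})"
    proof -
      have "continuous_on {0..1} (\<lambda>r. \<phi> (r *\<^sub>R e))"
        by (intro continuous_on_compose2[OF c\<phi>] continuous_on_scaleR continuous_on_id continuous_on_const) (auto simp: e)
      then have "((\<lambda>r. \<phi> (r *\<^sub>R e)) \<longlongrightarrow> \<phi> (1 *\<^sub>R e)) (at 1 within {0..1})"
        unfolding continuous_on_def by (rule bspec) simp
      then show ?thesis by (rule tendsto_within_subset) auto
    qed
    then have "((\<lambda>r. V (r *\<^sub>R e)) \<longlongrightarrow> \<phi> (1 *\<^sub>R e)) (at 1 within {0..<1})"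
      by (rule Lim_transform_eventually) (auto simp: eventually_at_filter eq1)
    moreover have "at (1::real) within {0..<1} \<noteq> bot"
      by (simp add: at_within_eq_bot_iff)
    ultimately show ?thesis using tendsto_unique by blast
  qed
  have V1: "V (1 *\<^sub>R e) = 0" using eq2 \<phi>0[of e] e by simp
  have eq: "V x = \<phi> x" if "norm x \<le> 1" for x
  proof -
    have "V x = V (norm x *\<^sub>R e)" by (rule Vrad)
    also have "\<dots> = \<phi> (norm x *\<^sub>R e)" using eq1[of "norm x"] eq2 that by (cases "norm x = 1") auto
    also have "\<dots> = \<phi> x" using that e by (intro rad\<phi>) auto
    finally show ?thesis .
  qed
  \<comment> \<open>\<open>V\<close> is differentiable across radius 1 and equals
    \<open>\<phi>\<close> up to it, so the one-sided derivative of \<open>\<phi>\<close> exists and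
    is that of \<open>V\<close>.\<close>
  have D: "radial_deriv1 \<phi> = g1 1"
    unfolding radial_deriv1_def e_def[symmetric]
  proof (rule vector_derivative_within_closed_interval)
    have "((\<lambda>r. V (r *\<^sub>R e)) has_vector_derivative g1 1) (at 1 within {0..1})"
      using emden_odeD(1)[OF ode[of 2], of 1] by (simp add: has_real_derivative_iff_has_vector_derivative has_vector_derivative_at_within)
    then show "((\<lambda>r. \<phi> (r *\<^sub>R e)) has_vector_derivative g1 1) (at 1 within {0..1})"
      by (rule has_vector_derivative_transform[rotated 2]) (use eq e in auto)
  qed auto
  have outside: "V x = g1 1 * ln (norm x)" if "norm x \<ge> 1" for x
    using emden_outside[OF ode V1 that] Vrad[of x] by simp
  have neg: "V x \<le> 0" if "norm x \<ge> 1" for x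
    using emden_ode_nonincreasing[OF ode[of "norm x + 1"], of 1 "norm x"] V1 Vrad[of x] that by simp
  have massV: "(LINT x|lborel. pos_part (V x) powr p) = - 2 * pi * g1 1"
    by (rule emden_flux_mass[OF p ode V1 Vrad])
  have cVV: "continuous_on UNIV V"
    unfolding V_def by (intro continuous_on_mult continuous_on_const continuous_on_compose2[OF cont_u] continuous_intros) auto
  have mass\<phi>: "emden_mass p \<phi> = (LINT x|lborel. pos_part (V x) powr p)"
  proof -
    have "emden_mass p \<phi> = (LINT x|lebesgue. pos_part (V x) powr p)"
      unfolding emden_mass_def set_lebesgue_integral_def
    proof (rule Bochner_Integration.integral_cong[OF refl])
      fix x
      show "indicat_real (ball 0 1) x *\<^sub>R \<phi> x powr p = pos_part (V x) powr p"
        using eq[of x] \<phi>pos[of x] neg[of x] by (cases "norm x < 1") (auto simp: pos_part_def)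
    qed
    also have "\<dots> = (LINT x|lborel. pos_part (V x) powr p)"
    proof (rule integral_completion)
      have [measurable]: "V \<in> borel_measurable borel" using cVV by (rule borel_measurable_continuous_onI)
      show "(\<lambda>x. pos_part (V x) powr p) \<in> borel_measurable lborel" unfolding pos_part_def by measurable
    qed
    finally show ?thesis .
  qed
  \<comment> \<open>The change of variables contributes \<open>1 / R^2\<close> and the nonlinearity
    \<open>s powr p\<close>; by the scaling relation their product is \<open>s\<close>.\<close>
  have massu: "(LINT x|lborel. pos_part (V x) powr p) = s * (LINT x|lborel. f x)"
  proof -
    have "(LINT x|lborel. f x) = R\<^sup>2 * (LINT x|lborel. f (x0 + R *\<^sub>R x))"
      by (rule integral_scale_plane[OF f_measurable R0])
    moreover have "pos_part (V x) powr p = s powr p * f (x0 + R *\<^sub>R x)" for x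
      using s0 by (simp add: V_def f_def pos_part_scale powr_mult add.commute)
    ultimately show ?thesis by (simp flip: sp)
  qed
  show ?thesis
  proof (rule that[of R x0])
    have "s \<noteq> 0" using s0 by simp
    show "(LINT x|lborel. pos_part (u x) powr p) = emden_mass p \<phi> / R powr (2 / (p - 1))"
      using mass\<phi> massu \<open>s \<noteq> 0\<close> unfolding s_def[symmetric] f_def[symmetric] by simp
    show "(LINT x|lborel. pos_part (u x) powr p) = - 2 * pi * radial_deriv1 \<phi> / R powr (2 / (p - 1))"
      using massV massu \<open>s \<noteq> 0\<close> unfolding s_def[symmetric] f_def[symmetric] D by (simp add: field_simps)
    show "u (x + x0) = emden_profile p \<phi> R x" for x
    proof -
      have "V (x /\<^sub>R R) = s * u (x + x0)" using R0 by (simp add: V_def)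
      then have u: "u (x + x0) = 1 / s * V (x /\<^sub>R R)" using \<open>s \<noteq> 0\<close> by simp
      have n: "norm (x /\<^sub>R R) = norm x / R" using R0 by (simp add: divide_inverse mult.commute)
      show ?thesis
      proof (cases "norm x \<le> R")
        case True
        then have "V (x /\<^sub>R R) = \<phi> (x /\<^sub>R R)" using R0 by (intro eq) (simp only: n, simp)
        then show ?thesis using u True by (simp add: emden_profile_def s_def)
      next
        case False
        then have "V (x /\<^sub>R R) = g1 1 * ln (norm x / R)" using outside[of "x /\<^sub>R R"] R0 unfolding n by simp
        then show ?thesis using u False by (simp add: emden_profile_def s_def D)
      qed
    qed
  qed (rule R0, rule rad)
qed

theorem proposition2p2:
  fixes p C\<^sub>0 :: real and w \<phi> :: "plane \<Rightarrow> real"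
  assumes "p > 1"
    and "emden_solution p \<phi>"
    and "locally_integrable w"
    and "distributional_solution p w"
    and "integrable lebesgue (\<lambda>x. pos_part (w x) powr p)"
    and "(LINT x|lebesgue. pos_part (w x) powr p) \<le> C\<^sub>0"
  shows "\<exists>u. (AE x in lebesgue. w x = u x) \<and> Ck_on 2 u UNIV \<and>
           essentially_bounded (\<lambda>x. pos_part (w x)) \<and>
           ((beta p w = 0 \<and> (\<exists>c\<le>0. \<forall>x. u x = c)) \<or>
            (beta p w > 0 \<and>
             (\<exists>R x\<^sub>0. R > 0 \<and>
                beta p w = 1 / (2 * pi) * (emden_mass p \<phi> / R powr (2 / (p - 1))) \<and>
                beta p w = - radial_deriv1 \<phi> / R powr (2 / (p - 1)) \<and>
                (\<forall>R'>0. beta p w = 1 / (2 * pi) * (emden_mass p \<phi> / R' powr (2 / (p - 1)))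
                         \<longrightarrow> R' = R) \<and>
                (\<forall>x y. norm x = norm y \<longrightarrow> u (x + x\<^sub>0) = u (y + x\<^sub>0)) \<and>
                (\<forall>x. u (x + x\<^sub>0) = emden_profile p \<phi> R x))))"
proof -
  note p = assms(1)
  have iw: "integrable lebesgue (\<lambda>x. indicator (cball 0 r) x * w x)" for r
    using assms(3)[unfolded locally_integrable_def set_integrable_def, rule_format, OF compact_cball] by simp
  \<comment> \<open>Integrability on compact sets gives measurability only of truncations, whose
    pointwise limit is \<open>w\<close>.\<close>
  have mw: "w \<in> borel_measurable lebesgue"
  proof (rule borel_measurable_LIMSEQ_metric)
    show "(\<lambda>x. indicator (cball 0 (real n)) x * w x) \<in> borel_measurable lebesgue" for n
      using iw by (rule borel_measurable_integrable)
    fix x :: plane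
    have "\<forall>\<^sub>F n in sequentially. w x = indicator (cball 0 (real n)) x * w x"
      using eventually_ge_at_top[of "nat \<lceil>norm x\<rceil>"]
    proof eventually_elim
      case (elim n)
      then have "norm x \<le> real n" by linarith
      then show ?case by simp
    qed
    then show "(\<lambda>n. indicator (cball 0 (real n)) x * w x) \<longlonglongrightarrow> w x"
      by (rule Lim_transform_eventually[OF tendsto_const])
  qed
  \<comment> \<open>The hypotheses speak of Lebesgue measurable functions, the convolution results
    of Borel ones; \<open>v\<close> is a Borel representative of \<open>w\<close>.\<close>
  obtain v where v[measurable]: "v \<in> borel_measurable borel" and "AE x in lborel. w x = v x"
    using completion_ex_borel_measurable_real[OF mw] by auto
  then have wv: "AE x in lebesgue. w x = v x" by (intro AE_completion)
  have [measurable]: "cball 0 r \<in> sets (borel :: plane measure)" for r by simp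
  have [measurable]: "(\<lambda>x. pos_part (v x) powr p) \<in> borel_measurable borel" unfolding pos_part_def by measurable
  have mwp: "(\<lambda>x. pos_part (w x) powr p) \<in> borel_measurable lebesgue" using assms(5) by (rule borel_measurable_integrable)
  have vm: "v \<in> borel_measurable lebesgue" by (rule measurable_completion) simp
  have lv: "loc_int v"
    unfolding loc_int_def
  proof (intro conjI allI)
    fix r
    have "integrable lebesgue (\<lambda>x. indicator (cball 0 r) x * v x)"
    proof (rule Bochner_Integration.integrable_cong_AE_imp[OF iw[of r]])
      show "(\<lambda>x. indicator (cball 0 r) x * v x) \<in> borel_measurable lebesgue"
        by (rule measurable_completion) simp
      show "AE x in lebesgue. indicator (cball 0 r) x * w x = indicator (cball 0 r) x * v x"
        using wv by eventually_elim simp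
    qed
    then show "integrable lborel (\<lambda>x. indicator (cball 0 r) x * v x)"
      by (subst (asm) integrable_completion) auto
  qed simp
  have iv: "integrable lborel (\<lambda>x. pos_part (v x) powr p)"
  proof -
    have "integrable lebesgue (\<lambda>x. pos_part (v x) powr p)"
    proof (rule Bochner_Integration.integrable_cong_AE_imp[OF assms(5)])
      show "(\<lambda>x. pos_part (v x) powr p) \<in> borel_measurable lebesgue" by (rule measurable_completion) simp
      show "AE x in lebesgue. pos_part (w x) powr p = pos_part (v x) powr p"
        using wv by eventually_elim simp
    qed
    then show ?thesis by (subst (asm) integrable_completion) auto
  qed
  \<comment> \<open>Used with the identity for \<open>h\<close> on the left of the weak equation and
    with the nonlinearity on the right.\<close>
  have leb: "(LINT x|lebesgue. h (w x) * \<psi> x) = (LINT x|lborel. h (v x) * \<psi> x)"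
    if h: "h \<in> borel_measurable borel" and "continuous_on UNIV \<psi>" for h :: "real \<Rightarrow> real" and \<psi>
  proof -
    have [measurable]: "\<psi> \<in> borel_measurable borel" using that(2) by (rule borel_measurable_continuous_onI)
    have b: "(\<lambda>x. h (v x) * \<psi> x) \<in> borel_measurable lborel" using h by simp
    have \<psi>l: "\<psi> \<in> borel_measurable lebesgue" by (rule measurable_completion) simp
    have "(LINT x|lebesgue. h (w x) * \<psi> x) = (LINT x|lebesgue. h (v x) * \<psi> x)"
    proof (rule integral_cong_AE)
      show "(\<lambda>x. h (w x) * \<psi> x) \<in> borel_measurable lebesgue"
        by (intro borel_measurable_times \<psi>l measurable_compose[OF mw h])
      show "(\<lambda>x. h (v x) * \<psi> x) \<in> borel_measurable lebesgue"
        using b by (rule measurable_completion)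
      show "AE x in lebesgue. h (w x) * \<psi> x = h (v x) * \<psi> x" using wv by eventually_elim simp
    qed
    also have "\<dots> = (LINT x|lborel. h (v x) * \<psi> x)" using b by (rule integral_completion)
    finally show ?thesis .
  qed
  have hp: "(\<lambda>t. pos_part t powr p) \<in> borel_measurable borel" unfolding pos_part_def by measurable
  have weak: "- (LINT x|lborel. v x * laplacian \<psi> x) = (LINT x|lborel. pos_part (v x) powr p * \<psi> x)" if t: "test_function \<psi>" for \<psi>
  proof -
    have sm: "smooth \<psi>" using t by (simp add: test_function_def)
    obtain G\<psi> H\<psi> where "C2_on UNIV \<psi> G\<psi> H\<psi>" using smooth_C2_on[OF sm] .
    then have "continuous_on UNIV (laplacian \<psi>)" by (rule continuous_laplacian)
    moreover have "continuous_on UNIV \<psi>" using spec[OF sm, of 0] by simp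
    ultimately have "(LINT x|lebesgue. pos_part (w x) powr p * \<psi> x) = (LINT x|lborel. pos_part (v x) powr p * \<psi> x)"
      "(LINT x|lebesgue. w x * laplacian \<psi> x) = (LINT x|lborel. v x * laplacian \<psi> x)"
      using leb[OF hp, of \<psi>] leb[of "\<lambda>t. t" "laplacian \<psi>"] by auto
    moreover have "- (LINT x|lebesgue. w x * laplacian \<psi> x) = (LINT x|lebesgue. pos_part (w x) powr p * \<psi> x)"
      using assms(4) t unfolding distributional_solution_def by blast
    ultimately show ?thesis by simp
  qed
  obtain u G Hs M where u: "AE x in lborel. v x = u x" "C2_on UNIV u G Hs"
    "\<And>x. - laplacian u x = pos_part (u x) powr p" "\<And>x. u x \<le> M"
    by (rule weak_solution_regular[OF p lv iv weak]) blast+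
  have wu: "AE x in lebesgue. w x = u x"
    using wv AE_completion[OF u(1)] by eventually_elim simp
  have cu: "continuous_on UNIV u" by (rule C1_on_continuous[OF C2_on_C1[OF u(2)]])
  then have [measurable]: "u \<in> borel_measurable borel" by (rule borel_measurable_continuous_onI)
  have [measurable]: "(\<lambda>x. pos_part (u x) powr p) \<in> borel_measurable borel" unfolding pos_part_def by measurable
  have vu: "AE x in lborel. pos_part (v x) powr p = pos_part (u x) powr p" using u(1) by eventually_elim simp
  have iu: "integrable lborel (\<lambda>x. pos_part (u x) powr p)"
    by (rule Bochner_Integration.integrable_cong_AE_imp[OF iv]) (use vu in \<open>auto elim!: eventually_mono\<close>)
  have sol: "plane_solution u G Hs M p"
    by unfold_locales (use p u iu in auto)
  define m where "m = (LINT x|lborel. pos_part (u x) powr p)"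
  have beta: "beta p w = 1 / (2 * pi) * m"
  proof -
    have "(LINT x|lebesgue. pos_part (w x) powr p) = (LINT x|lborel. pos_part (v x) powr p)"
      using leb[OF hp, of "\<lambda>_. 1"] by simp
    also have "\<dots> = m" unfolding m_def by (rule integral_cong_AE) (use vu in auto)
    finally show ?thesis by (simp add: beta_def)
  qed
  have bdd: "essentially_bounded (\<lambda>x. pos_part (w x))"
    unfolding essentially_bounded_def
  proof (intro conjI exI)
    show "(\<lambda>x. pos_part (w x)) \<in> borel_measurable lebesgue" unfolding pos_part_def using mw by measurable
    show "AE x in lebesgue. \<bar>pos_part (w x)\<bar> \<le> max M 0"
      using wu
    proof eventually_elim
      case (elim x)
      then show ?case using u(4)[of x] by (simp add: pos_part_def)
    qed
  qed
  have Ck: "Ck_on 2 u UNIV" by (rule C2_on_imp_Ck_on[OF open_UNIV u(2)])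
  interpret plane_solution u G Hs M p by (rule sol)
  have mf: "m = (LINT x|lborel. f x)" by (simp add: m_def f_def)
  have m0: "m \<ge> 0" unfolding mf by (rule integral_f_nonneg)
  show ?thesis
  proof (cases "m = 0")
    case True
    have "\<exists>c\<le>0. \<forall>x. u x = c"
      using constant_case[OF True[unfolded mf]] by blast
    then show ?thesis using wu Ck bdd beta True by (intro exI[of _ u]) simp
  next
    case False
    then have mpos: "m > 0" using m0 by simp
    obtain R x0 where R: "R > 0" "m = emden_mass p \<phi> / R powr (2 / (p - 1))" "m = - 2 * pi * radial_deriv1 \<phi> / R powr (2 / (p - 1))"
      "\<And>x y. norm x = norm y \<Longrightarrow> u (x + x0) = u (y + x0)" "\<And>x. u (x + x0) = emden_profile p \<phi> R x"
      unfolding m_def by (rule emden_classification[OF sol assms(2) mpos[unfolded m_def]]) blast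
    \<comment> \<open>As the mass is positive, equal quotients have equal denominators, and the
      exponent \<open>2 / (p - 1)\<close> is inverted by \<open>(p - 1) / 2\<close>.\<close>
    have uniq: "R' = R" if R': "R' > 0" "m = emden_mass p \<phi> / R' powr (2 / (p - 1))" for R'
    proof -
      have "R' powr (2 / (p - 1)) = R powr (2 / (p - 1))"
        using R(1,2) R' mpos by (auto simp: field_simps)
      then have "(R' powr (2 / (p - 1))) powr ((p - 1) / 2) = (R powr (2 / (p - 1))) powr ((p - 1) / 2)" by simp
      moreover have "2 / (p - 1) * ((p - 1) / 2) = 1" using p by simp
      ultimately have "R' powr 1 = R powr 1" unfolding powr_powr by metis
      then show ?thesis using R(1) R'(1) by simp
    qed
    have "beta p w > 0" using beta mpos by simp
    moreover have "beta p w = 1 / (2 * pi) * (emden_mass p \<phi> / R powr (2 / (p - 1)))" using beta R(2) by simp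
    moreover have "beta p w = - radial_deriv1 \<phi> / R powr (2 / (p - 1))"
      unfolding beta R(3) by simp
    moreover have "\<forall>R'>0. beta p w = 1 / (2 * pi) * (emden_mass p \<phi> / R' powr (2 / (p - 1))) \<longrightarrow> R' = R"
    proof (intro allI impI)
      fix R' :: real assume R': "R' > 0" "beta p w = 1 / (2 * pi) * (emden_mass p \<phi> / R' powr (2 / (p - 1)))"
      have "m = emden_mass p \<phi> / R' powr (2 / (p - 1))"
        using R'(2) unfolding beta by (subst (asm) mult_cancel_left) simp
      then show "R' = R" by (rule uniq[OF R'(1)])
    qed
    ultimately show ?thesis using wu Ck bdd R(1,4,5) by (intro exI[of _ u]) blast
  qed
qed

end
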